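(* Let $P_{Y_1,Y_2,Z|X_1,X_2}$ be a discrete memoryless two-way wiretap channel. For a joint distribution $P_{V_1,V_2,X_1,X_2}$, put $A_1:=I(Y_2;V_1|X_2)$, $A_2:=I(Y_1;V_2|X_1)$, $B_1:=I(Z;V_1)$, $B_2:=I(Z;V_2)$, $B_{12}:=I(V_1,V_2;Z)$, all computed under the joint distribution $P_{V_1,V_2,X_1,X_2}\,P_{Y_1,Y_2,Z|X_1,X_2}$, and define $$\mathcal R_{J,A}(P_{V_1,V_2,X_1,X_2}):=\left\{(R_1,R_2)\in\mathbb R_+^2 : R_1\le A_1,\ R_2\le A_2,\ R_1+R_2\le A_1+A_2-B_{12}\right\},$$ $$\mathcal R_{I,A}(P_{V_1,V_2,X_1,X_2}):=\left\{(R_1,R_2)\in\mathbb R_+^2 : \begin{array}{l} R_1\le A_1,\quad R_2\le A_2,\\ \max\{R_1,R_2\}\le A_1+A_2-B_{12},\\ R_1+R_2\le \min\{A_1-B_1,\ A_1+A_2-B_{12}\}+\min\{A_2-B_2,\ A_1+A_2-B_{12}\}\end{array}\right\}.$$ Let $\mathcal Q$ be the set of all joint distributions of the form $P_{V_1,V_2,X_1,X_2}(v_1,v_2,x_1,x_2)=\prod_{i\in\{1,2\}}P_{V_i}(v_i)P_{X_i|V_i}(x_i|v_i)$, and define $$\mathcal R_{J,A}:=\mathrm{cl.}\bigcup_{P\in\mathcal Q}\mathcal R_{J,A}(P),\qquad \mathcal R_{I,A}:=\mathrm{cl.}\bigcup_{P\in\mathcal Q}\mathcal R_{I,A}(P),$$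 where $\mathrm{cl.}$ denotes the closure of the convex hull. Then $\mathcal R_{J,A}$ is achievable by adaptive codes under strong joint secrecy, and $\mathcal R_{I,A}$ is achievable by adaptive codes under strong individual secrecy; that is, every rate pair in $\mathcal R_{J,A}$ (respectively $\mathcal R_{I,A}$) is achievable under the strong joint (respectively strong individual) secrecy constraint by adaptive codes.
   Context: Channel. User $i\in\{1,2\}$ has finite input alphabet $\mathcal X_i$ and finite output alphabet $\mathcal Y_i$; an external eavesdropper has finite output alphabet $\mathcal Z$. The channel is a transition probability $P_{Y_1,Y_2,Z|X_1,X_2}$, used $n$ times without memory: at time $t$ the users input $X_{1,t},X_{2,t}$, User $i$ receives $Y_{i,t}$, and the eavesdropper receives $Z_t$. Write $X_i^n=(X_{i,1},\dots,X_{i,n})$, $Y_i^n=(Y_{i,1},\dots,Y_{i,n})$, $Z^n=(Z_1,\dots,Z_n)$. The auxiliary variables $V_1,V_2$ take values in finite sets. $\mathbb R_+$ denotes the positive real numbers. Logarithms are natural. For $i\in\{1,2\}$, $i\oplus1$ denotes the index of the other user. Codes. The messages $M_1,M_2$ are independent, and $M_i$ is uniform on a set $\mathcal M_i$ of size $e^{nR_i}$. An adaptive encoder of User $i$ stochastically assigns the $t$-th input $X_{i,t}$ based on $M_i$ and the previous outputs $Y_{i,1},\dots,Y_{i,t-1}$, for $t=1,\dots,n$ (i.e. $X_{i,t}$ is a function of $M_i$, of $Y_{i,1},\dots,Y_{i,t-1}$, and of private local randomness of User $i$ that is independent of everything else and may be reused over time). The decoder of User $i$ is a map $\psi_i$ from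 $\mathcal M_i\times\mathcal X_i^n\times\mathcal Y_i^n$ to $\mathcal M_{i\oplus1}$, producing the estimate $\hat M_{i\oplus 1}$. An $(e^{nR_1},e^{nR_2},n)$ adaptive code $C_n$ consists of the two message sets, two adaptive encoders, and two decoders. Its average error probability is $$P_e^n(C_n)=\frac{1}{|\mathcal M_1||\mathcal M_2|}\sum_{m_1,m_2}\Pr\Big\{\bigcup_{i\in\{1,2\}}\{m_i\ne\hat m_i\}\ \Big|\ C_n\Big\}.$$ Achievability. A pair $(R_1,R_2)$ is achievable under the strong joint secrecy constraint by adaptive codes if there are $(e^{nR_{1,n}},e^{nR_{2,n}},n)$ adaptive codes $C_n$ with $R_{i,n}\to R_i$ for $i=1,2$, $P_e^n(C_n)\le\epsilon_n$ and $I(M_1,M_2;Z^n|C_n)\le\tau_n$, where $\epsilon_n\to0$ and $\tau_n\to0$ as $n\to\infty$. It is achievable under the strong individual secrecy constraint by adaptive codes if the same holds with the leakage condition replaced by $I(M_1;Z^n|C_n)\le\tau_n$ and $I(M_2;Z^n|C_n)\le\tau_n$. Here $I(\cdot;\cdot|C_n)$ denotes mutual information for the fixed code $C_n$. *)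

theory Defs
  imports "HOL-Probability.Probability"
begin

type_synonym ('x1, 'x2, 'y1, 'y2, 'z) channel = "'x1 \<Rightarrow> 'x2 \<Rightarrow> ('y1 \<times> 'y2 \<times> 'z) pmf"

(* The base exp 1 makes all logarithms natural.  The random variables below have countable
   range types, so the product of two counting spaces is again a counting space. *)
definition mutual_info :: "'w pmf \<Rightarrow> ('w \<Rightarrow> 'a) \<Rightarrow> ('w \<Rightarrow> 'b) \<Rightarrow> real" where
  "mutual_info p X Y =
     prob_space.mutual_information (measure_pmf p) (exp 1) (count_space UNIV) (count_space UNIV) X Y"

definition cond_mutual_info ::
  "'w pmf \<Rightarrow> ('w \<Rightarrow> 'a) \<Rightarrow> ('w \<Rightarrow> 'b) \<Rightarrow> ('w \<Rightarrow> 'c) \<Rightarrow> real" where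
  "cond_mutual_info p X Y Z =
     prob_space.conditional_mutual_information (measure_pmf p) (exp 1)
       (count_space UNIV) (count_space UNIV) (count_space UNIV) X Y Z"


section \<open>Adaptive codes\<close>

(* What one user contributes to a code: the message set, the law of the private randomness, the
   encoder (arguments: message, private randomness, past outputs; the time is 1 plus the number of
   past outputs) and the decoder (arguments: own message, inputs, outputs).
   The private randomness is drawn once and available at all times.  Taking it in nat loses no
   generality: for blocklength n it only matters through the map (message, past outputs) to input
   that it selects, and there are finitely many of these. *)
record ('x, 'y) terminal =
  msgs :: "nat set"
  seed :: "nat pmf"
  enc :: "nat \<Rightarrow> nat \<Rightarrow> 'y list \<Rightarrow> 'x"
  dec :: "nat \<Rightarrow> 'x list \<Rightarrow> 'y list \<Rightarrow> nat"

definition adaptive_code ::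
  "nat \<Rightarrow> real \<Rightarrow> real \<Rightarrow> ('x1, 'y1) terminal \<Rightarrow> ('x2, 'y2) terminal \<Rightarrow> bool" where
  "adaptive_code n R1 R2 T1 T2 \<longleftrightarrow>
     finite (msgs T1) \<and> real (card (msgs T1)) = exp (real n * R1) \<and>
     finite (msgs T2) \<and> real (card (msgs T2)) = exp (real n * R2) \<and>
     (\<forall>m xs ys. m \<in> msgs T1 \<and> length xs = n \<and> length ys = n \<longrightarrow> dec T1 m xs ys \<in> msgs T2) \<and>
     (\<forall>m xs ys. m \<in> msgs T2 \<and> length xs = n \<and> length ys = n \<longrightarrow> dec T2 m xs ys \<in> msgs T1)"

(* Law of the input and output sequences of the first t channel uses when both users apply
   deterministic feedback strategies. *)
primrec channel_run ::
  "('x1, 'x2, 'y1, 'y2, 'z) channel \<Rightarrow> ('y1 list \<Rightarrow> 'x1) \<Rightarrow> ('y2 list \<Rightarrow> 'x2) \<Rightarrow> nat \<Rightarrow>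
     ('x1 list \<times> 'x2 list \<times> 'y1 list \<times> 'y2 list \<times> 'z list) pmf" where
  "channel_run W f1 f2 0 = return_pmf ([], [], [], [], [])"
| "channel_run W f1 f2 (Suc t) =
     bind_pmf (channel_run W f1 f2 t) (\<lambda>(xs1, xs2, ys1, ys2, zs).
       map_pmf (\<lambda>(y1, y2, z).
           (xs1 @ [f1 ys1], xs2 @ [f2 ys2], ys1 @ [y1], ys2 @ [y2], zs @ [z]))
         (W (f1 ys1) (f2 ys2)))"

definition transmission ::
  "('x1, 'x2, 'y1, 'y2, 'z) channel \<Rightarrow> nat \<Rightarrow> ('x1, 'y1) terminal \<Rightarrow> ('x2, 'y2) terminal \<Rightarrow>
     nat \<Rightarrow> nat \<Rightarrow> ('x1 list \<times> 'x2 list \<times> 'y1 list \<times> 'y2 list \<times> 'z list) pmf" where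
  "transmission W n T1 T2 m1 m2 =
     bind_pmf (seed T1) (\<lambda>u1. bind_pmf (seed T2) (\<lambda>u2.
       channel_run W (enc T1 m1 u1) (enc T2 m2 u2) n))"

definition error_prob ::
  "('x1, 'x2, 'y1, 'y2, 'z) channel \<Rightarrow> nat \<Rightarrow> ('x1, 'y1) terminal \<Rightarrow> ('x2, 'y2) terminal \<Rightarrow> real"
where
  "error_prob W n T1 T2 =
     1 / (real (card (msgs T1)) * real (card (msgs T2))) *
     (\<Sum>m1\<in>msgs T1. \<Sum>m2\<in>msgs T2.
        measure_pmf.prob (transmission W n T1 T2 m1 m2)
          {(xs1, xs2, ys1, ys2, zs). m1 \<noteq> dec T2 m2 xs2 ys2 \<or> m2 \<noteq> dec T1 m1 xs1 ys1})"

(* Joint law of (M_1, M_2, Z^n). *)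
definition eavesdropper_law ::
  "('x1, 'x2, 'y1, 'y2, 'z) channel \<Rightarrow> nat \<Rightarrow> ('x1, 'y1) terminal \<Rightarrow> ('x2, 'y2) terminal \<Rightarrow>
     (nat \<times> nat \<times> 'z list) pmf" where
  "eavesdropper_law W n T1 T2 =
     bind_pmf (pmf_of_set (msgs T1)) (\<lambda>m1. bind_pmf (pmf_of_set (msgs T2)) (\<lambda>m2.
       map_pmf (\<lambda>(xs1, xs2, ys1, ys2, zs). (m1, m2, zs)) (transmission W n T1 T2 m1 m2)))"

definition achievable_joint ::
  "('x1, 'x2, 'y1, 'y2, 'z) channel \<Rightarrow> real \<Rightarrow> real \<Rightarrow> bool" where
  "achievable_joint W R1 R2 \<longleftrightarrow>
     (\<exists>r1 r2 T1 T2 \<epsilon> \<tau>.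
        r1 \<longlonglongrightarrow> R1 \<and> r2 \<longlonglongrightarrow> R2 \<and> \<epsilon> \<longlonglongrightarrow> 0 \<and> \<tau> \<longlonglongrightarrow> 0 \<and>
        (\<forall>n\<ge>1. adaptive_code n (r1 n) (r2 n) (T1 n) (T2 n) \<and>
          error_prob W n (T1 n) (T2 n) \<le> \<epsilon> n \<and>
          mutual_info (eavesdropper_law W n (T1 n) (T2 n))
            (\<lambda>(m1, m2, zs). (m1, m2)) (\<lambda>(m1, m2, zs). zs) \<le> \<tau> n))"

definition achievable_individual ::
  "('x1, 'x2, 'y1, 'y2, 'z) channel \<Rightarrow> real \<Rightarrow> real \<Rightarrow> bool" where
  "achievable_individual W R1 R2 \<longleftrightarrow>
     (\<exists>r1 r2 T1 T2 \<epsilon> \<tau>.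
        r1 \<longlonglongrightarrow> R1 \<and> r2 \<longlonglongrightarrow> R2 \<and> \<epsilon> \<longlonglongrightarrow> 0 \<and> \<tau> \<longlonglongrightarrow> 0 \<and>
        (\<forall>n\<ge>1. adaptive_code n (r1 n) (r2 n) (T1 n) (T2 n) \<and>
          error_prob W n (T1 n) (T2 n) \<le> \<epsilon> n \<and>
          mutual_info (eavesdropper_law W n (T1 n) (T2 n))
            (\<lambda>(m1, m2, zs). m1) (\<lambda>(m1, m2, zs). zs) \<le> \<tau> n \<and>
          mutual_info (eavesdropper_law W n (T1 n) (T2 n))
            (\<lambda>(m1, m2, zs). m2) (\<lambda>(m1, m2, zs). zs) \<le> \<tau> n))"


section \<open>Rate regions\<close>

(* The auxiliary variables range over arbitrary finite sets; up to relabelling these are the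
   finite subsets of nat, so V_1 and V_2 are nat-valued with finite support. *)
definition product_inputs :: "(nat \<times> nat \<times> 'x1 \<times> 'x2) pmf set" where
  "product_inputs =
     {P. \<exists>PV1 PV2 PX1 PX2. finite (set_pmf PV1) \<and> finite (set_pmf PV2) \<and>
        (\<forall>v1 v2 x1 x2. pmf P (v1, v2, x1, x2) =
           (pmf PV1 v1 * pmf (PX1 v1) x1) * (pmf PV2 v2 * pmf (PX2 v2) x2))}"

definition joint_law ::
  "('x1, 'x2, 'y1, 'y2, 'z) channel \<Rightarrow> (nat \<times> nat \<times> 'x1 \<times> 'x2) pmf \<Rightarrow>
     (nat \<times> nat \<times> 'x1 \<times> 'x2 \<times> 'y1 \<times> 'y2 \<times> 'z) pmf" where
  "joint_law W P =
     bind_pmf P (\<lambda>(v1, v2, x1, x2).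
       map_pmf (\<lambda>(y1, y2, z). (v1, v2, x1, x2, y1, y2, z)) (W x1 x2))"

definition A1 :: "('x1, 'x2, 'y1, 'y2, 'z) channel \<Rightarrow> (nat \<times> nat \<times> 'x1 \<times> 'x2) pmf \<Rightarrow> real" where
  "A1 W P = cond_mutual_info (joint_law W P)
     (\<lambda>(v1, v2, x1, x2, y1, y2, z). y2)
     (\<lambda>(v1, v2, x1, x2, y1, y2, z). v1)
     (\<lambda>(v1, v2, x1, x2, y1, y2, z). x2)"

definition A2 :: "('x1, 'x2, 'y1, 'y2, 'z) channel \<Rightarrow> (nat \<times> nat \<times> 'x1 \<times> 'x2) pmf \<Rightarrow> real" where
  "A2 W P = cond_mutual_info (joint_law W P)
     (\<lambda>(v1, v2, x1, x2, y1, y2, z). y1)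
     (\<lambda>(v1, v2, x1, x2, y1, y2, z). v2)
     (\<lambda>(v1, v2, x1, x2, y1, y2, z). x1)"

definition B1 :: "('x1, 'x2, 'y1, 'y2, 'z) channel \<Rightarrow> (nat \<times> nat \<times> 'x1 \<times> 'x2) pmf \<Rightarrow> real" where
  "B1 W P = mutual_info (joint_law W P)
     (\<lambda>(v1, v2, x1, x2, y1, y2, z). z)
     (\<lambda>(v1, v2, x1, x2, y1, y2, z). v1)"

definition B2 :: "('x1, 'x2, 'y1, 'y2, 'z) channel \<Rightarrow> (nat \<times> nat \<times> 'x1 \<times> 'x2) pmf \<Rightarrow> real" where
  "B2 W P = mutual_info (joint_law W P)
     (\<lambda>(v1, v2, x1, x2, y1, y2, z). z)
     (\<lambda>(v1, v2, x1, x2, y1, y2, z). v2)"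

definition B12 :: "('x1, 'x2, 'y1, 'y2, 'z) channel \<Rightarrow> (nat \<times> nat \<times> 'x1 \<times> 'x2) pmf \<Rightarrow> real" where
  "B12 W P = mutual_info (joint_law W P)
     (\<lambda>(v1, v2, x1, x2, y1, y2, z). (v1, v2))
     (\<lambda>(v1, v2, x1, x2, y1, y2, z). z)"

definition region_JA_of ::
  "('x1, 'x2, 'y1, 'y2, 'z) channel \<Rightarrow> (nat \<times> nat \<times> 'x1 \<times> 'x2) pmf \<Rightarrow> (real \<times> real) set" where
  "region_JA_of W P =
     {(R1, R2). 0 < R1 \<and> 0 < R2 \<and> R1 \<le> A1 W P \<and> R2 \<le> A2 W P \<and>
        R1 + R2 \<le> A1 W P + A2 W P - B12 W P}"

definition region_IA_of ::
  "('x1, 'x2, 'y1, 'y2, 'z) channel \<Rightarrow> (nat \<times> nat \<times> 'x1 \<times> 'x2) pmf \<Rightarrow> (real \<times> real) set" where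
  "region_IA_of W P =
     {(R1, R2). 0 < R1 \<and> 0 < R2 \<and> R1 \<le> A1 W P \<and> R2 \<le> A2 W P \<and>
        max R1 R2 \<le> A1 W P + A2 W P - B12 W P \<and>
        R1 + R2 \<le> min (A1 W P - B1 W P) (A1 W P + A2 W P - B12 W P)
                 + min (A2 W P - B2 W P) (A1 W P + A2 W P - B12 W P)}"

definition region_JA :: "('x1, 'x2, 'y1, 'y2, 'z) channel \<Rightarrow> (real \<times> real) set" where
  "region_JA W = closure (convex hull (\<Union>P\<in>product_inputs. region_JA_of W P))"

definition region_IA :: "('x1, 'x2, 'y1, 'y2, 'z) channel \<Rightarrow> (real \<times> real) set" where
  "region_IA W = closure (convex hull (\<Union>P\<in>product_inputs. region_IA_of W P))"

end

theory Submission
  imports Defs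
begin

text \<open>
  Closure and convexity of the achievable set (time sharing) reduce the theorem to the interior of the regions
  of a single input law, and exchanging the users leaves one asymmetric scheme, a block Markov code over
  independent random codebooks.  In each block user 2 sends, besides its message, a fresh key that stays
  hidden from the eavesdropper.  In the next block user 1 uses it as a one-time pad for a part of its message.
  The ciphertext is uniform and independent of everything else, so it also serves as randomness that protects
  the rest of user 1's message; this moves rate from user 2 to user 1 along the face of constant sum rate.

  Secrecy of a block is soft covering for the multiple access channel from the codewords to the
  eavesdropper: once the randomness rates exceed \<open>B1\<close>, \<open>B2\<close> and their sum exceeds \<open>B12\<close>, the output law
  is exponentially close to the one of independent inputs.  If \<open>A1 \<le> B1\<close>, no randomness rate below \<open>A1\<close>
  suffices for user 1; then its whole index is ciphertext, and its codeword may be treated as known to the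
  eavesdropper.
\<close>

section \<open>Closeness of distributions\<close>

text \<open>Everything passes through one composition theorem, \<open>scode_seq\<close>, for codes
  with an open input (the slot) and an extra output (the key). Block Markov coding, time sharing and
  padding to the exact length are instances of it, so secrecy over many blocks is never analysed as
  a whole. The price is a factor 3 in the error for each block; it is harmless because the number of
  blocks stays fixed while the error of a block decays exponentially in its length. The rate
  balance: a key of rate \<open>k\<close> takes \<open>k\<close> away from user 2's local randomness
  and adds \<open>k\<close> to the randomness of user 1. Hence \<open>k\<close> cancels in the
  covering condition against \<open>B12\<close>, and only the conditions against \<open>B1\<close>
  and \<open>B2\<close> confine it to an interval; its two ends are in the right order because
  \<open>R1 + R2 < A1 + A2 - B1 - B2\<close>. Under individual secrecy the message of the other user
  counts as randomness too, which is what enlarges the region. Codebooks of the two users are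
  independent and unconditioned: as V1 is independent of X2, \<open>A1\<close> equals the
  information between V1 and the pair (X2, Y2), so a decoder treats its own inputs as part of its
  observation.\<close>

definition close :: "real \<Rightarrow> 'a pmf \<Rightarrow> 'a pmf \<Rightarrow> bool" where
  "close \<epsilon> p q \<longleftrightarrow> (\<forall>f :: 'a \<Rightarrow> real. (\<forall>x. 0 \<le> f x \<and> f x \<le> 1) \<longrightarrow>
     measure_pmf.expectation p f \<le> measure_pmf.expectation q f + \<epsilon>)"

lemma integrable_bounded_pmf:
  fixes f :: "'a \<Rightarrow> real"
  assumes "\<And>x. \<bar>f x\<bar> \<le> B"
  shows "integrable (measure_pmf p) f"
  by (rule measure_pmf.integrable_const_bound[where B = B]) (auto simp: assms)

lemma expectation_bind_bounded:
  fixes f :: "'a \<Rightarrow> real"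
  assumes "\<And>x. \<bar>f x\<bar> \<le> B"
  shows "measure_pmf.expectation (bind_pmf p g) f =
         measure_pmf.expectation p (\<lambda>x. measure_pmf.expectation (g x) f)"
  unfolding measure_pmf_bind
  by (subst integral_bind[where K = "count_space UNIV" and B' = 1 and B = B])
     (auto simp: assms measure_pmf.emeasure_space_1 measure_pmf_in_subprob_space)

lemma expectation_unit_interval:
  fixes f :: "'a \<Rightarrow> real"
  assumes "\<And>x. 0 \<le> f x" "\<And>x. f x \<le> 1"
  shows "0 \<le> measure_pmf.expectation p f" "measure_pmf.expectation p f \<le> 1"
proof -
  show "0 \<le> measure_pmf.expectation p f" using assms by simp
  have "measure_pmf.expectation p f \<le> measure_pmf.expectation p (\<lambda>_. 1)"
    by (intro integral_mono integrable_bounded_pmf[where B=1]) (simp_all add: assms abs_of_nonneg)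
  then show "measure_pmf.expectation p f \<le> 1" by simp
qed

lemma closeI:
  assumes "\<And>f :: 'a \<Rightarrow> real. (\<And>x. 0 \<le> f x) \<Longrightarrow> (\<And>x. f x \<le> 1) \<Longrightarrow>
     measure_pmf.expectation p f \<le> measure_pmf.expectation q f + \<epsilon>"
  shows "close \<epsilon> p q"
  using assms unfolding close_def by blast

lemma closeD:
  assumes "close \<epsilon> p q" "\<And>x. 0 \<le> f x" "\<And>x. f x \<le> 1"
  shows "measure_pmf.expectation p f \<le> measure_pmf.expectation q f + \<epsilon>"
  using assms unfolding close_def by blast

lemma close_refl: "0 \<le> \<epsilon> \<Longrightarrow> close \<epsilon> p p"
  by (rule closeI) simp

lemma close_trans:
  assumes "close \<epsilon> p q" "close \<delta> q r"
  shows "close (\<epsilon> + \<delta>) p r"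
proof (rule closeI)
  fix f :: "'a \<Rightarrow> real" assume f: "\<And>x. 0 \<le> f x" "\<And>x. f x \<le> 1"
  show "measure_pmf.expectation p f \<le> measure_pmf.expectation r f + (\<epsilon> + \<delta>)"
    using closeD[where f=f, OF assms(1) f] closeD[where f=f, OF assms(2) f] by simp
qed

lemma close_mono:
  assumes "close \<epsilon> p q" "\<epsilon> \<le> \<delta>"
  shows "close \<delta> p q"
proof (rule closeI)
  fix f :: "'a \<Rightarrow> real" assume f: "\<And>x. 0 \<le> f x" "\<And>x. f x \<le> 1"
  show "measure_pmf.expectation p f \<le> measure_pmf.expectation q f + \<delta>"
    using closeD[where f=f, OF assms(1) f] assms(2) by simp
qed

text \<open>Passing from a test \<open>f\<close> to \<open>1 - f\<close> reverses the one-sided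
  inequality. The relation is thus total variation distance at most \<epsilon>; tests with values in
  the unit interval make it stable under maps and kernels without densities or finite
  supports.\<close>

lemma close_sym:
  assumes "close \<epsilon> p q"
  shows "close \<epsilon> q p"
proof (rule closeI)
  fix f :: "'a \<Rightarrow> real" assume f: "\<And>x. 0 \<le> f x" "\<And>x. f x \<le> 1"
  have b: "\<bar>f x\<bar> \<le> 1" for x using f[of x] by simp
  have "measure_pmf.expectation p (\<lambda>x. 1 - f x) \<le> measure_pmf.expectation q (\<lambda>x. 1 - f x) + \<epsilon>"
    by (rule closeD[OF assms]) (use f in auto)
  then show "measure_pmf.expectation q f \<le> measure_pmf.expectation p f + \<epsilon>"
    by (simp add: integrable_bounded_pmf[OF b])
qed

lemma close_map: "close \<epsilon> p q \<Longrightarrow> close \<epsilon> (map_pmf g p) (map_pmf g q)"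
  by (rule closeI) (simp add: closeD)

lemma close_bind:
  assumes "close \<epsilon> p q"
  shows "close \<epsilon> (bind_pmf p g) (bind_pmf q g)"
proof (rule closeI)
  fix f :: "'b \<Rightarrow> real" assume f: "\<And>x. 0 \<le> f x" "\<And>x. f x \<le> 1"
  have b: "\<bar>f x\<bar> \<le> 1" for x using f[of x] by simp
  show "measure_pmf.expectation (bind_pmf p g) f \<le> measure_pmf.expectation (bind_pmf q g) f + \<epsilon>"
    unfolding expectation_bind_bounded[OF b]
    by (rule closeD[OF assms]) (use expectation_unit_interval f in auto)
qed

text \<open>The error may depend on the mixing variable, and only its mean counts. This is why a
  codebook that is good on average over the messages, rather than for each of them, will be
  enough.\<close>

lemma close_bind_avg:
  assumes "\<And>x. x \<in> set_pmf p \<Longrightarrow> close (e x) (g x) (h x)" "integrable (measure_pmf p) e"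
  shows "close (measure_pmf.expectation p e) (bind_pmf p g) (bind_pmf p h)"
proof (rule closeI)
  fix f :: "'b \<Rightarrow> real" assume f: "\<And>x. 0 \<le> f x" "\<And>x. f x \<le> 1"
  have b: "\<bar>f x\<bar> \<le> 1" for x using f[of x] by simp
  have b2: "\<bar>measure_pmf.expectation (g x) f\<bar> \<le> 1" for g :: "'a \<Rightarrow> 'b pmf" and x
    using expectation_unit_interval[of f "g x"] f by auto
  have "measure_pmf.expectation p (\<lambda>x. measure_pmf.expectation (g x) f) \<le>
        measure_pmf.expectation p (\<lambda>x. measure_pmf.expectation (h x) f + e x)"
    by (intro integral_mono_AE integrable_bounded_pmf[OF b2] Bochner_Integration.integrable_add assms(2))
       (use closeD[where f=f, OF assms(1) f] in \<open>auto simp: AE_measure_pmf_iff\<close>)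
  also have "\<dots> = measure_pmf.expectation p (\<lambda>x. measure_pmf.expectation (h x) f) +
        measure_pmf.expectation p e"
    by (intro Bochner_Integration.integral_add integrable_bounded_pmf[OF b2] assms(2))
  finally show "measure_pmf.expectation (bind_pmf p g) f \<le>
      measure_pmf.expectation (bind_pmf p h) f + measure_pmf.expectation p e"
    unfolding expectation_bind_bounded[OF b] .
qed

lemma close_bind_cong:
  assumes "\<And>x. x \<in> set_pmf p \<Longrightarrow> close \<epsilon> (g x) (h x)"
  shows "close \<epsilon> (bind_pmf p g) (bind_pmf p h)"
  using close_bind_avg[of p "\<lambda>_. \<epsilon>" g h] assms by simp

lemma close_one: "close 1 p q"
proof (rule closeI)
  fix f :: "'a \<Rightarrow> real" assume f: "\<And>x. 0 \<le> f x" "\<And>x. f x \<le> 1"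
  show "measure_pmf.expectation p f \<le> measure_pmf.expectation q f + 1"
    using expectation_unit_interval[where f=f and p=p, OF f] expectation_unit_interval[where f=f and p=q, OF f] by simp
qed

text \<open>Inside the bad event the trivial bound \<open>close_one\<close> is used, outside it the
  two continuations coincide. It serves to replace a decoded key by the true one.\<close>

lemma close_bind_off:
  assumes "\<And>x. x \<in> set_pmf p \<Longrightarrow> x \<notin> A \<Longrightarrow> g x = h x" "measure_pmf.prob p A \<le> \<epsilon>"
  shows "close \<epsilon> (bind_pmf p g) (bind_pmf p h)"
proof -
  have "close (measure_pmf.expectation p (indicator A)) (bind_pmf p g) (bind_pmf p h)"
  proof (rule close_bind_avg)
    show "integrable (measure_pmf p) (indicator A :: 'a \<Rightarrow> real)"
      by (rule integrable_bounded_pmf[where B=1]) (auto simp: indicator_def)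
    show "close (indicator A x) (g x) (h x)" if "x \<in> set_pmf p" for x
      using assms(1)[OF that] by (cases "x \<in> A") (auto simp: close_one intro: close_refl)
  qed
  then show ?thesis using assms(2) by (auto intro: close_mono)
qed

lemma close_prob:
  assumes "close \<epsilon> p q"
  shows "measure_pmf.prob p A \<le> measure_pmf.prob q A + \<epsilon>"
  using closeD[OF assms, of "indicator A"] by (simp add: indicator_def)

lemma prob_bind_pmf:
  "measure_pmf.prob (bind_pmf p g) A = measure_pmf.expectation p (\<lambda>x. measure_pmf.prob (g x) A)"
  using expectation_bind_bounded[of "indicator A :: _ \<Rightarrow> real" 1 p g] by (simp add: indicator_def)

section \<open>Runs of the channel\<close>

text \<open>A strategy sees past outputs only, so its own past inputs are recomputed from them. A
  decoder that also reads inputs can then be run inside the strategy of a later block.\<close>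

definition inputs :: "('y list \<Rightarrow> 'x) \<Rightarrow> 'y list \<Rightarrow> 'x list" where
  "inputs f ys = map (\<lambda>i. f (take i ys)) [0..<length ys]"

lemma inputs_snoc: "inputs f (ys @ [y]) = inputs f ys @ [f ys]"
  by (simp add: inputs_def)

lemma channel_run_support:
  assumes "(xs1, xs2, ys1, ys2, zs) \<in> set_pmf (channel_run W f1 f2 n)"
  shows "length ys1 = n \<and> length ys2 = n \<and> length zs = n \<and> xs1 = inputs f1 ys1 \<and> xs2 = inputs f2 ys2"
  using assms
proof (induction n arbitrary: xs1 xs2 ys1 ys2 zs)
  case 0
  then show ?case by (simp add: inputs_def)
next
  case (Suc n)
  then show ?case by (fastforce simp: inputs_snoc)
qed

lemma channel_run_cong:
  assumes "\<And>ys. length ys < n \<Longrightarrow> f1 ys = g1 ys" "\<And>ys. length ys < n \<Longrightarrow> f2 ys = g2 ys"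
  shows "channel_run W f1 f2 n = channel_run W g1 g2 n"
  using assms
proof (induction n)
  case (Suc n)
  have "channel_run W f1 f2 n = channel_run W g1 g2 n" by (rule Suc.IH) (use Suc.prems in auto)
  moreover have "f1 ys1 = g1 ys1 \<and> f2 ys2 = g2 ys2"
    if "(xs1, xs2, ys1, ys2, zs) \<in> set_pmf (channel_run W g1 g2 n)" for xs1 xs2 ys1 ys2 zs
    using channel_run_support[OF that] Suc.prems by simp
  ultimately show ?case by (auto intro!: bind_pmf_cong)
qed simp

type_synonym ('x1, 'x2, 'y1, 'y2, 'z) transcript =
  "'x1 list \<times> 'x2 list \<times> 'y1 list \<times> 'y2 list \<times> 'z list"

definition tappend :: "('x1,'x2,'y1,'y2,'z) transcript \<Rightarrow> ('x1,'x2,'y1,'y2,'z) transcript \<Rightarrow>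
   ('x1,'x2,'y1,'y2,'z) transcript" where
  "tappend = (\<lambda>(xs1, xs2, ys1, ys2, zs) (xs1', xs2', ys1', ys2', zs').
     (xs1 @ xs1', xs2 @ xs2', ys1 @ ys1', ys2 @ ys2', zs @ zs'))"

lemma channel_run_add:
  "channel_run W f1 f2 (n + m) = bind_pmf (channel_run W f1 f2 n) (\<lambda>(xs1, xs2, ys1, ys2, zs).
     map_pmf (tappend (xs1, xs2, ys1, ys2, zs))
       (channel_run W (\<lambda>ys. f1 (ys1 @ ys)) (\<lambda>ys. f2 (ys2 @ ys)) m))"
proof (induction m)
  case 0
  have "tappend x ([], [], [], [], []) = x" for x :: "('a, 'b, 'c, 'd, 'e) transcript"
    by (cases x) (simp add: tappend_def)
  then show ?case by (simp add: case_prod_unfold bind_return_pmf')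
next
  case (Suc m)
  show ?case
    unfolding add_Suc_right channel_run.simps Suc bind_assoc_pmf
    by (intro bind_pmf_cong refl)
       (auto simp: map_bind_pmf bind_map_pmf tappend_def case_prod_unfold map_pmf_comp intro!: bind_pmf_cong map_pmf_cong)
qed

text \<open>The second strategy starts afresh after \<open>n\<close> outputs but may depend on all
  of them. This is where a decoded key enters; inside a single block of the random code inputs
  ignore the outputs, so all feedback of the final codes arises here.\<close>

definition strategy_seq :: "nat \<Rightarrow> ('y list \<Rightarrow> 'x) \<Rightarrow> ('y list \<Rightarrow> 'y list \<Rightarrow> 'x) \<Rightarrow> 'y list \<Rightarrow> 'x" where
  "strategy_seq n f g ys = (if length ys < n then f ys else g (take n ys) (drop n ys))"

lemma channel_run_seq:
  "channel_run W (strategy_seq n f1 g1) (strategy_seq n f2 g2) (n + m) =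
   bind_pmf (channel_run W f1 f2 n) (\<lambda>(xs1, xs2, ys1, ys2, zs).
     map_pmf (tappend (xs1, xs2, ys1, ys2, zs)) (channel_run W (g1 ys1) (g2 ys2) m))"
proof -
  have *: "channel_run W (strategy_seq n f1 g1) (strategy_seq n f2 g2) n = channel_run W f1 f2 n"
    by (rule channel_run_cong) (auto simp: strategy_seq_def)
  show ?thesis
    unfolding channel_run_add *
  proof (intro bind_pmf_cong refl, clarify)
    fix xs1 xs2 ys1 ys2 zs
    assume "(xs1, xs2, ys1, ys2, zs) \<in> set_pmf (channel_run W f1 f2 n)"
    from channel_run_support[OF this]
    show "map_pmf (tappend (xs1, xs2, ys1, ys2, zs))
            (channel_run W (\<lambda>ys. strategy_seq n f1 g1 (ys1 @ ys)) (\<lambda>ys. strategy_seq n f2 g2 (ys2 @ ys)) m) =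
          map_pmf (tappend (xs1, xs2, ys1, ys2, zs)) (channel_run W (g1 ys1) (g2 ys2) m)"
      by (intro arg_cong[where f="map_pmf _"] channel_run_cong) (auto simp: strategy_seq_def)
  qed
qed

section \<open>Codes with an incoming public slot and an outgoing key\<close>

fun in1 :: "('x1,'x2,'y1,'y2,'z) transcript \<Rightarrow> 'x1 list" where "in1 (xs1, xs2, ys1, ys2, zs) = xs1"
fun in2 :: "('x1,'x2,'y1,'y2,'z) transcript \<Rightarrow> 'x2 list" where "in2 (xs1, xs2, ys1, ys2, zs) = xs2"
fun out1 :: "('x1,'x2,'y1,'y2,'z) transcript \<Rightarrow> 'y1 list" where "out1 (xs1, xs2, ys1, ys2, zs) = ys1"
fun out2 :: "('x1,'x2,'y1,'y2,'z) transcript \<Rightarrow> 'y2 list" where "out2 (xs1, xs2, ys1, ys2, zs) = ys2"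
fun eve :: "('x1,'x2,'y1,'y2,'z) transcript \<Rightarrow> 'z list" where "eve (xs1, xs2, ys1, ys2, zs) = zs"

text \<open>A sender is the joint law of a message and a strategy.  The strategy of user 1 depends on a slot value \<open>e\<close>
  that is filled in from outside (the ciphertext); user 2 also draws a key.  The tuples \<open>(s, e, t, k, r)\<close>
  below consist of the message of user 1, the slot, the message and the key of user 2, and the transcript.\<close>

type_synonym ('x, 'y) sender1 = "(nat \<times> (nat \<Rightarrow> 'y list \<Rightarrow> 'x)) pmf"
type_synonym ('x, 'y) sender2 = "(nat \<times> nat \<times> ('y list \<Rightarrow> 'x)) pmf"

definition slot_law :: "('x1,'x2,'y1,'y2,'z) channel \<Rightarrow> nat \<Rightarrow> ('x1,'y1) sender1 \<Rightarrow> nat \<Rightarrow>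
    ('x2,'y2) sender2 \<Rightarrow> (nat \<times> nat \<times> nat \<times> ('x1,'x2,'y1,'y2,'z) transcript) pmf" where
  "slot_law W n \<rho>1 e \<rho>2 = bind_pmf \<rho>1 (\<lambda>a. bind_pmf \<rho>2 (\<lambda>b.
     map_pmf (\<lambda>r. (fst a, fst b, fst (snd b), r)) (channel_run W (snd a e) (snd (snd b)) n)))"

text \<open>The slot is drawn uniformly because the ciphertext that will fill it is uniform.\<close>

definition run_law :: "('x1,'x2,'y1,'y2,'z) channel \<Rightarrow> nat \<Rightarrow> ('x1,'y1) sender1 \<Rightarrow> nat \<Rightarrow>
    ('x2,'y2) sender2 \<Rightarrow> (nat \<times> nat \<times> nat \<times> nat \<times> ('x1,'x2,'y1,'y2,'z) transcript) pmf" where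
  "run_law W n \<rho>1 E \<rho>2 = bind_pmf (pmf_of_set {..<E}) (\<lambda>e.
     map_pmf (\<lambda>(s, t, k, r). (s, e, t, k, r)) (slot_law W n \<rho>1 e \<rho>2))"

definition correct :: "('x1 list \<Rightarrow> 'y1 list \<Rightarrow> nat \<times> nat) \<Rightarrow> ('x2 list \<Rightarrow> 'y2 list \<Rightarrow> nat \<times> nat \<times> nat) \<Rightarrow>
    (nat \<times> nat \<times> nat \<times> nat \<times> ('x1,'x2,'y1,'y2,'z) transcript) set" where
  "correct d1 d2 = {(s, e, t, k, r). d1 (in1 r) (out1 r) = (t, k) \<and> d2 (in2 r) (out2 r) = (s, e, k)}"

text \<open>Replacing an unprotected message by 0, instead of dropping it, gives joint and
  individual secrecy views of the same type.\<close>

definition hide :: "bool \<Rightarrow> nat \<Rightarrow> nat" where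
  "hide b t = (if b then t else 0)"

text \<open>The key stands beside the message because it has to be secret as well in order to serve
  as a pad in the next block. The slot is left out; being uniform, it acts as local randomness of
  user 1.\<close>

definition key_view :: "bool \<Rightarrow> nat \<times> nat \<times> nat \<times> nat \<times> ('x1,'x2,'y1,'y2,'z) transcript \<Rightarrow>
    nat \<times> nat \<times> nat \<times> 'z list" where
  "key_view b = (\<lambda>(s, e, t, k, r). (s, hide b t, k, eve r))"

definition msg_view :: "nat \<times> nat \<times> nat \<times> nat \<times> ('x1,'x2,'y1,'y2,'z) transcript \<Rightarrow> nat \<times> 'z list" where
  "msg_view = (\<lambda>(s, e, t, k, r). (t, eve r))"

text \<open>The slot of the second code carries a part \<open>u\<close> of user 1's message, encrypted by the key
  that user 1 decoded from the first block.\<close>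

definition pad_sender1 :: "nat \<Rightarrow> ('x1 list \<Rightarrow> 'y1 list \<Rightarrow> nat \<times> nat) \<Rightarrow> nat \<Rightarrow>
    ('x1,'y1) sender1 \<Rightarrow> ('x1,'y1) sender1 \<Rightarrow> ('x1,'y1) sender1" where
  "pad_sender1 n d1 K \<rho>1 \<rho>1' = bind_pmf \<rho>1 (\<lambda>a. bind_pmf \<rho>1' (\<lambda>a'. map_pmf (\<lambda>u.
     (prod_encode (fst a, prod_encode (fst a', u)),
      \<lambda>e. strategy_seq n (snd a e)
        (\<lambda>ys. snd a' ((u + snd (d1 (inputs (snd a e) ys) ys)) mod K)))) (pmf_of_set {..<K})))"

definition seq_sender2 :: "nat \<Rightarrow> ('x2,'y2) sender2 \<Rightarrow> ('x2,'y2) sender2 \<Rightarrow> ('x2,'y2) sender2" where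
  "seq_sender2 n \<rho>2 \<rho>2' = bind_pmf \<rho>2 (\<lambda>b. map_pmf (\<lambda>b'.
     (prod_encode (fst b, fst b'), fst (snd b'), strategy_seq n (snd (snd b)) (\<lambda>_. snd (snd b')))) \<rho>2')"

text \<open>The draws of the senders are independent of the channel noise, so those of the second
  block can be postponed until the first block is over. What remains is a run of the first code
  followed by a run of the second, whose slot is \<open>u\<close> plus the decoded key modulo
  \<open>K\<close>.\<close>

lemma run_law_pad:
  "run_law W (n + n') (pad_sender1 n d1 K \<rho>1 \<rho>1') E (seq_sender2 n \<rho>2 \<rho>2') =
   bind_pmf (run_law W n \<rho>1 E \<rho>2) (\<lambda>(s, e, t, k, r). bind_pmf (pmf_of_set {..<K}) (\<lambda>u.
     map_pmf (\<lambda>(s', t', k', r'). (prod_encode (s, prod_encode (s', u)), e, prod_encode (t, t'), k', tappend r r'))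
       (slot_law W n' \<rho>1' ((u + snd (d1 (in1 r) (out1 r))) mod K) \<rho>2')))"
proof -
  define U where "U = pmf_of_set {..<K}"
  define R where "R a e b = channel_run W (snd a e) (snd (snd b)) n" for a :: "nat \<times> (nat \<Rightarrow> _)" and e and b :: "nat \<times> nat \<times> _"
  have "slot_law W (n + n') (pad_sender1 n d1 K \<rho>1 \<rho>1') e (seq_sender2 n \<rho>2 \<rho>2') =
    bind_pmf \<rho>1 (\<lambda>a. bind_pmf \<rho>1' (\<lambda>a'. bind_pmf U (\<lambda>u. bind_pmf \<rho>2 (\<lambda>b. bind_pmf \<rho>2' (\<lambda>b'.
      bind_pmf (R a e b) (\<lambda>r. map_pmf (\<lambda>r'. (prod_encode (fst a, prod_encode (fst a', u)),
           prod_encode (fst b, fst b'), fst (snd b'), tappend r r'))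
       (channel_run W (snd a' ((u + snd (d1 (in1 r) (out1 r))) mod K)) (snd (snd b')) n')))))))" for e
    unfolding slot_law_def pad_sender1_def seq_sender2_def bind_assoc_pmf bind_map_pmf fst_conv snd_conv
      channel_run_seq U_def R_def map_bind_pmf
    by (intro bind_pmf_cong refl) (auto dest: channel_run_support simp: map_pmf_comp)
  also have "\<dots> e = bind_pmf \<rho>1 (\<lambda>a. bind_pmf \<rho>2 (\<lambda>b. bind_pmf (R a e b) (\<lambda>r. bind_pmf U (\<lambda>u.
      bind_pmf \<rho>1' (\<lambda>a'. bind_pmf \<rho>2' (\<lambda>b'. map_pmf (\<lambda>r'. (prod_encode (fst a, prod_encode (fst a', u)),
           prod_encode (fst b, fst b'), fst (snd b'), tappend r r'))
       (channel_run W (snd a' ((u + snd (d1 (in1 r) (out1 r))) mod K)) (snd (snd b')) n')))))))" for e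
    by (simp only: bind_commute_pmf[of \<rho>1' U] bind_commute_pmf[of \<rho>1' \<rho>2] bind_commute_pmf[of U \<rho>2]
        bind_commute_pmf[of \<rho>2' "R a e b" for a b] bind_commute_pmf[of \<rho>1' "R a e b" for a b]
        bind_commute_pmf[of U "R a e b" for a b])
  finally show ?thesis
    unfolding run_law_def slot_law_def[of W n] slot_law_def[of W n'] U_def R_def
    by (simp add: bind_assoc_pmf bind_map_pmf map_bind_pmf map_pmf_comp)
qed


text \<open>\<open>N1\<close>, \<open>E\<close>, \<open>N2\<close>, \<open>K\<close> are the numbers of values of \<open>s\<close>, \<open>e\<close>, \<open>t\<close>, \<open>k\<close>.  The eavesdropper learns nothing about
  \<open>t\<close>, and nothing about \<open>(s, t, k)\<close> if \<open>b\<close> holds (joint secrecy), but only nothing about \<open>(s, k)\<close> otherwise.\<close>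

definition scode :: "bool \<Rightarrow> ('x1,'x2,'y1,'y2,'z) channel \<Rightarrow> nat \<Rightarrow> nat \<Rightarrow> nat \<Rightarrow> nat \<Rightarrow> nat \<Rightarrow> real \<Rightarrow> bool" where
  "scode b W n N1 E N2 K \<epsilon> \<longleftrightarrow> (\<exists>\<rho>1 \<rho>2 M1 M2 d1 d2 Q1 Q2.
     finite M1 \<and> card M1 = N1 \<and> M1 \<noteq> {} \<and> finite M2 \<and> card M2 = N2 \<and> M2 \<noteq> {} \<and> 0 < E \<and> 0 < K \<and>
     map_pmf fst \<rho>1 = pmf_of_set M1 \<and>
     map_pmf (\<lambda>b. (fst b, fst (snd b))) \<rho>2 = pair_pmf (pmf_of_set M2) (pmf_of_set {..<K}) \<and>
     measure_pmf.prob (run_law W n \<rho>1 E \<rho>2) (- correct d1 d2) \<le> \<epsilon> \<and>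
     close \<epsilon> (map_pmf (key_view b) (run_law W n \<rho>1 E \<rho>2))
       (pair_pmf (pmf_of_set M1) (pair_pmf (map_pmf (hide b) (pmf_of_set M2)) (pair_pmf (pmf_of_set {..<K}) Q1))) \<and>
     close \<epsilon> (map_pmf msg_view (run_law W n \<rho>1 E \<rho>2)) (pair_pmf (pmf_of_set M2) Q2))"

section \<open>Sequential composition of codes by a one-time pad\<close>

lemma add_mod_cancel:
  fixes K :: nat assumes "u < K"
  shows "((u + c) mod K + (K - c mod K)) mod K = u" "((u + (K - c mod K)) mod K + c) mod K = u"
proof -
  have "c = K * (c div K) + c mod K" "c mod K < K" using assms by simp_all
  then have *: "u + c + (K - c mod K) = u + K * (c div K + 1)" unfolding distrib_left mult_1_right by linarith
  have "((u + c) mod K + (K - c mod K)) mod K = (u + c + (K - c mod K)) mod K" by (rule mod_add_left_eq)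
  then show "((u + c) mod K + (K - c mod K)) mod K = u" unfolding * using assms by (simp only: mod_mult_self2 mod_less)
  have "((u + (K - c mod K)) mod K + c) mod K = (u + c + (K - c mod K)) mod K"
    unfolding mod_add_left_eq by (simp only: ac_simps)
  then show "((u + (K - c mod K)) mod K + c) mod K = u" unfolding * using assms by (simp only: mod_mult_self2 mod_less)
qed

text \<open>The principle of the one-time pad: adding a constant modulo \<open>K\<close> permutes
  the residues, so a uniform residue stays uniform.\<close>

lemma bind_pmf_of_set_shift:
  fixes K :: nat assumes "0 < K"
  shows "bind_pmf (pmf_of_set {..<K}) (\<lambda>u. F ((u + c) mod K)) = bind_pmf (pmf_of_set {..<K}) F"
proof -
  have "bij_betw (\<lambda>u. (u + c) mod K) {..<K} {..<K}"
    by (rule bij_betwI[where g = "\<lambda>v. (v + (K - c mod K)) mod K"]) (use assms add_mod_cancel in auto)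
  then have "map_pmf (\<lambda>u. (u + c) mod K) (pmf_of_set {..<K}) = pmf_of_set {..<K}"
    by (rule map_pmf_of_set_bij_betw) (use assms in auto)
  then have "bind_pmf (pmf_of_set {..<K}) F = bind_pmf (map_pmf (\<lambda>u. (u + c) mod K) (pmf_of_set {..<K})) F"
    by simp
  then show ?thesis by (simp add: bind_map_pmf)
qed

lemma pair_pmf_of_set:
  assumes "finite A" "A \<noteq> {}" "finite B" "B \<noteq> {}"
  shows "pair_pmf (pmf_of_set A) (pmf_of_set B) = pmf_of_set (A \<times> B)"
proof (rule pmf_eqI)
  fix x :: "'a \<times> 'b"
  have "A \<times> B \<noteq> {}" "finite (A \<times> B)" using assms by auto
  then show "pmf (pair_pmf (pmf_of_set A) (pmf_of_set B)) x = pmf (pmf_of_set (A \<times> B)) x"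
    using pmf_of_set[OF assms(2,1)] pmf_of_set[OF assms(4,3)] pmf_of_set[of "A \<times> B"]
    by (cases x) (simp add: pmf_pair card_cartesian_product indicator_def)
qed

lemma map_prod_encode_pmf_of_set:
  assumes "finite A" "A \<noteq> {}" "finite B" "B \<noteq> {}"
  shows "map_pmf prod_encode (pair_pmf (pmf_of_set A) (pmf_of_set B)) = pmf_of_set (prod_encode ` (A \<times> B))"
  using assms by (simp add: pair_pmf_of_set map_pmf_of_set_inj inj_prod_encode)

lemma card_prod_encode_image: "card (prod_encode ` (A \<times> B)) = card A * card B"
  by (simp add: card_image inj_prod_encode card_cartesian_product)

lemma hide_prod_encode: "hide b (prod_encode (hide b t, hide b t')) = hide b (prod_encode (t, t'))"
  by (simp add: hide_def)

lemma eve_tappend: "eve (tappend r r') = eve r @ eve r'"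
  by (cases r; cases r') (simp add: tappend_def)

lemma run_law_lengths:
  assumes "(s, e, t, k, r) \<in> set_pmf (run_law W n \<rho>1 E \<rho>2)" "0 < E"
  shows "length (in1 r) = n" "length (in2 r) = n" "length (out1 r) = n" "length (out2 r) = n" "e < E"
  using assms by (auto simp: run_law_def slot_law_def inputs_def lessThan_empty_iff dest!: channel_run_support)

lemma slot_law_lengths:
  assumes "(s, t, k, r) \<in> set_pmf (slot_law W n \<rho>1 e \<rho>2)"
  shows "length (in1 r) = n" "length (in2 r) = n" "length (out1 r) = n" "length (out2 r) = n"
  using assms by (auto simp: slot_law_def inputs_def dest!: channel_run_support)

lemma tappend_sel:
  "in1 (tappend r r') = in1 r @ in1 r'" "in2 (tappend r r') = in2 r @ in2 r'"
  "out1 (tappend r r') = out1 r @ out1 r'" "out2 (tappend r r') = out2 r @ out2 r'"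
  by (cases r; cases r'; simp add: tappend_def)+

text \<open>The slot of the second code is filled with the encryption of \<open>u\<close>, so
  \<open>u\<close> joins user 1's message; the composite keeps the slot of the first code and the
  key of the second. The first error counts twice in the secrecy bound: once for replacing the
  decoded key by the true one, once for replacing the view of the first block by its ideal
  law.\<close>

theorem scode_seq:
  assumes "scode b W n N1 E N2 K \<epsilon>" "scode b W n' N1' K N2' K' \<epsilon>'"
  shows "scode b W (n + n') (N1 * (N1' * K)) E (N2 * N2') K' (2 * \<epsilon> + \<epsilon>')"
proof -
  from assms(1) obtain \<rho>1 \<rho>2 M1 M2 d1 d2 Q1 Q2 where A:
     "finite M1" "card M1 = N1" "M1 \<noteq> {}" "finite M2" "card M2 = N2" "M2 \<noteq> {}" "0 < E" "0 < K"
     "map_pmf fst \<rho>1 = pmf_of_set M1"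
     "map_pmf (\<lambda>b. (fst b, fst (snd b))) \<rho>2 = pair_pmf (pmf_of_set M2) (pmf_of_set {..<K})"
     "measure_pmf.prob (run_law W n \<rho>1 E \<rho>2) (- correct d1 d2) \<le> \<epsilon>"
     "close \<epsilon> (map_pmf (key_view b) (run_law W n \<rho>1 E \<rho>2))
       (pair_pmf (pmf_of_set M1) (pair_pmf (map_pmf (hide b) (pmf_of_set M2)) (pair_pmf (pmf_of_set {..<K}) Q1)))"
     "close \<epsilon> (map_pmf msg_view (run_law W n \<rho>1 E \<rho>2)) (pair_pmf (pmf_of_set M2) Q2)"
    unfolding scode_def by blast
  from assms(2) obtain \<rho>1' \<rho>2' M1' M2' d1' d2' Q1' Q2' where B:
     "finite M1'" "card M1' = N1'" "M1' \<noteq> {}" "finite M2'" "card M2' = N2'" "M2' \<noteq> {}" "0 < K" "0 < K'"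
     "map_pmf fst \<rho>1' = pmf_of_set M1'"
     "map_pmf (\<lambda>b. (fst b, fst (snd b))) \<rho>2' = pair_pmf (pmf_of_set M2') (pmf_of_set {..<K'})"
     "measure_pmf.prob (run_law W n' \<rho>1' K \<rho>2') (- correct d1' d2') \<le> \<epsilon>'"
     "close \<epsilon>' (map_pmf (key_view b) (run_law W n' \<rho>1' K \<rho>2'))
       (pair_pmf (pmf_of_set M1') (pair_pmf (map_pmf (hide b) (pmf_of_set M2')) (pair_pmf (pmf_of_set {..<K'}) Q1')))"
     "close \<epsilon>' (map_pmf msg_view (run_law W n' \<rho>1' K \<rho>2')) (pair_pmf (pmf_of_set M2') Q2')"
    unfolding scode_def by blast
  define U where "U = pmf_of_set {..<K}"
  define L where "L = run_law W n \<rho>1 E \<rho>2"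
  define R where "R e = slot_law W n' \<rho>1' e \<rho>2'" for e
  define L' where "L' = run_law W n' \<rho>1' K \<rho>2'"
  have L': "L' = bind_pmf U (\<lambda>e. map_pmf (\<lambda>(s, t, k, r). (s, e, t, k, r)) (R e))"
    unfolding L'_def run_law_def U_def R_def ..
  define \<rho>1c where "\<rho>1c = pad_sender1 n d1 K \<rho>1 \<rho>1'"
  define \<rho>2c where "\<rho>2c = seq_sender2 n \<rho>2 \<rho>2'"
  \<comment> \<open>User 1's estimate of the key. The pad has to use it, since user 1 never sees the
    true key.\<close>
  define kh where "kh r = snd (d1 (in1 r) (out1 r))" for r :: "('a,'b,'c,'d,'e) transcript"
  define Lc where "Lc = run_law W (n + n') \<rho>1c E \<rho>2c"
  have Lc: "Lc = bind_pmf L (\<lambda>(s, e, t, k, r). bind_pmf U (\<lambda>u.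
     map_pmf (\<lambda>(s', t', k', r'). (prod_encode (s, prod_encode (s', u)), e, prod_encode (t, t'), k', tappend r r'))
       (R ((u + kh r) mod K))))"
    unfolding Lc_def \<rho>1c_def \<rho>2c_def run_law_pad L_def U_def R_def kh_def ..
  define M1c where "M1c = prod_encode ` (M1 \<times> prod_encode ` (M1' \<times> {..<K}))"
  define M2c where "M2c = prod_encode ` (M2 \<times> M2')"
  have K0: "{..<K} \<noteq> {}" "{..<K'} \<noteq> {}" using A B by (auto simp: lessThan_empty_iff)
  have M1c: "pmf_of_set M1c = map_pmf prod_encode (pair_pmf (pmf_of_set M1)
      (map_pmf prod_encode (pair_pmf (pmf_of_set M1') U)))"
    unfolding M1c_def U_def
    by (subst map_prod_encode_pmf_of_set, (use A B K0 in simp_all)[4])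
       (subst map_prod_encode_pmf_of_set, use A B K0 in simp_all)
  have M2c: "pmf_of_set M2c = map_pmf prod_encode (pair_pmf (pmf_of_set M2) (pmf_of_set M2'))"
    unfolding M2c_def by (subst map_prod_encode_pmf_of_set) (use A B in simp_all)
  have eps0: "0 \<le> \<epsilon>" "0 \<le> \<epsilon>'"
    using A(11) B(11) by (meson measure_nonneg order_trans)+

  define d1c where "d1c xs ys = (prod_encode (fst (d1 (take n xs) (take n ys)), fst (d1' (drop n xs) (drop n ys))),
      snd (d1' (drop n xs) (drop n ys)))" for xs ys
  \<comment> \<open>User 2 undoes the pad with its own key. Its decoder is given inputs and outputs
    only, so the key is taken from the output of \<open>d2\<close>.\<close>
  define d2c where "d2c xs ys = (case d2 (take n xs) (take n ys) of (s, e, k) \<Rightarrow>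
      case d2' (drop n xs) (drop n ys) of (s', e', k') \<Rightarrow>
        (prod_encode (s, prod_encode (s', THE u. u < K \<and> (u + k) mod K = e')), e, k'))" for xs ys
  have pad_inj: "(THE v. v < K \<and> (v + k) mod K = (u + k) mod K) = u" if "u < K" for u k
  proof (rule the_equality)
    fix v assume "v < K \<and> (v + k) mod K = (u + k) mod K"
    then show "v = u" using that by (metis add_mod_cancel(1))
  qed (use that in simp)

  \<comment> \<open>If the first block is decoded correctly, the slot is \<open>u\<close> plus the
    true key, which is uniform because \<open>u\<close> is. The second block then fails with its
    average probability.\<close>
  have err: "measure_pmf.prob Lc (- correct d1c d2c) \<le> \<epsilon> + \<epsilon>'"
  proof -
    have "measure_pmf.prob Lc (- correct d1c d2c) \<le>
        measure_pmf.prob L (- correct d1 d2) + measure_pmf.prob L' (- correct d1' d2')"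
    proof -
      define g where "g x = (case x of (s, e, t, k, r) \<Rightarrow> bind_pmf U (\<lambda>u.
         map_pmf (\<lambda>(s', t', k', r'). (prod_encode (s, prod_encode (s', u)), e, prod_encode (t, t'), k', tappend r r'))
           (R ((u + kh r) mod K))))"
        for x :: "nat \<times> nat \<times> nat \<times> nat \<times> ('a,'b,'c,'d,'e) transcript"
      have g: "measure_pmf.prob (g x) (- correct d1c d2c) \<le> indicator (- correct d1 d2) x + measure_pmf.prob L' (- correct d1' d2')"
        if x: "x \<in> set_pmf L" for x
      proof (cases "x \<in> correct d1 d2")
        case False
        then show ?thesis by (simp add: add_increasing2)
      next
        case True
        obtain s e t k r where [simp]: "x = (s, e, t, k, r)" by (cases x)
        from True have r: "d1 (in1 r) (out1 r) = (t, k)" "d2 (in2 r) (out2 r) = (s, e, k)" by (auto simp: correct_def)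
        have len: "length (in1 r) = n" "length (in2 r) = n" "length (out1 r) = n" "length (out2 r) = n"
          using run_law_lengths x A(7) unfolding L_def by simp_all
        have "measure_pmf.prob (g x) (- correct d1c d2c) =
           measure_pmf.expectation U (\<lambda>u. measure_pmf.prob (R ((u + k) mod K))
             {(s', t', k', r'). (prod_encode (s, prod_encode (s', u)), e, prod_encode (t, t'), k', tappend r r') \<notin> correct d1c d2c})"
          by (simp add: g_def prob_bind_pmf kh_def r vimage_def case_prod_unfold Compl_eq)
        also have "\<dots> \<le> measure_pmf.expectation U (\<lambda>u. measure_pmf.prob (R ((u + k) mod K))
             {(s', t', k', r'). (s', (u + k) mod K, t', k', r') \<notin> correct d1' d2'})"
        proof (intro integral_mono_AE integrable_bounded_pmf[where B=1] AE_pmfI)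
          fix u assume "u \<in> set_pmf U"
          then have u: "u < K" unfolding U_def using K0 by simp
          have "(prod_encode (s, prod_encode (s', u)), e, prod_encode (t, t'), k', tappend r r') \<in> correct d1c d2c"
            if "(s', t', k', r') \<in> set_pmf (R ((u + k) mod K))" "(s', (u + k) mod K, t', k', r') \<in> correct d1' d2'" for s' t' k' r'
            using that slot_law_lengths[of s' t' k' r' W n'] len u
            by (auto simp: correct_def d1c_def d2c_def tappend_sel r R_def pad_inj)
          then show "measure_pmf.prob (R ((u + k) mod K))
             {(s', t', k', r'). (prod_encode (s, prod_encode (s', u)), e, prod_encode (t, t'), k', tappend r r') \<notin> correct d1c d2c}
            \<le> measure_pmf.prob (R ((u + k) mod K)) {(s', t', k', r'). (s', (u + k) mod K, t', k', r') \<notin> correct d1' d2'}"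
            by (intro measure_pmf.finite_measure_mono_AE) (auto simp: AE_measure_pmf_iff)
        qed auto
        also have "\<dots> = measure_pmf.prob (bind_pmf U (\<lambda>u. map_pmf (\<lambda>(s', t', k', r'). (s', (u + k) mod K, t', k', r')) (R ((u + k) mod K)))) (- correct d1' d2')"
          by (simp add: prob_bind_pmf vimage_def case_prod_unfold Compl_eq)
        also have "\<dots> = measure_pmf.prob L' (- correct d1' d2')"
          unfolding L' U_def using A(8)
          by (subst bind_pmf_of_set_shift[where F="\<lambda>e. map_pmf (\<lambda>(s', t', k', r'). (s', e, t', k', r')) (R e)"]) auto
        finally show ?thesis by (rule order_trans) simp
      qed
      have "measure_pmf.prob Lc (- correct d1c d2c) = measure_pmf.expectation L (\<lambda>x. measure_pmf.prob (g x) (- correct d1c d2c))"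
        unfolding Lc g_def by (rule prob_bind_pmf)
      also have "\<dots> \<le> measure_pmf.expectation L (\<lambda>x. indicator (- correct d1 d2) x + measure_pmf.prob L' (- correct d1' d2'))"
      proof (rule integral_mono_AE)
        have "measure_pmf.prob L' A \<le> 1" "0 \<le> measure_pmf.prob L' A" for A by simp_all
        then show "integrable (measure_pmf L) (\<lambda>x. indicator (- correct d1 d2) x + measure_pmf.prob L' (- correct d1' d2'))"
          by (intro integrable_bounded_pmf[where B=2]) (auto simp: indicator_def abs_le_iff intro: order_trans)
        show "AE x in measure_pmf L. measure_pmf.prob (g x) (- correct d1c d2c) \<le>
          indicator (- correct d1 d2) x + measure_pmf.prob L' (- correct d1' d2')"
          by (rule AE_pmfI) (rule g)
      qed (auto intro!: integrable_bounded_pmf[where B=1])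
      also have "\<dots> = measure_pmf.prob L (- correct d1 d2) + measure_pmf.prob L' (- correct d1' d2')"
        by (subst Bochner_Integration.integral_add) (auto intro: integrable_bounded_pmf[where B=1] simp: indicator_def)
      finally show ?thesis .
    qed
    then show ?thesis using A(11) B(11) unfolding L_def L'_def by linarith
  qed

  \<comment> \<open>In this view \<open>u\<close> does not appear. For every fixed first block the
    fresh uniform \<open>u\<close> makes the slot uniform, whatever the key estimate is, so the two
    blocks become independent.\<close>
  have msg: "close (\<epsilon> + \<epsilon>') (map_pmf msg_view Lc) (pair_pmf (pmf_of_set M2c) (map_pmf (\<lambda>(z, z'). z @ z') (pair_pmf Q2 Q2')))"
  proof -
    define c where "c = (\<lambda>(t, z) (t', z'). (prod_encode (t, t'), z @ z' :: 'e list))"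
    have "map_pmf msg_view Lc = bind_pmf L (\<lambda>(s, e, t, k, r). bind_pmf U (\<lambda>u.
       map_pmf (\<lambda>(s', t', k', r'). c (t, eve r) (t', eve r')) (R ((u + kh r) mod K))))"
      unfolding Lc by (simp add: map_bind_pmf case_prod_unfold map_pmf_comp msg_view_def eve_tappend c_def)
    also have "\<dots> = bind_pmf L (\<lambda>(s, e, t, k, r). bind_pmf U (\<lambda>u.
       map_pmf (\<lambda>(s', t', k', r'). c (t, eve r) (t', eve r')) (R u)))"
      using bind_pmf_of_set_shift[OF A(8)] unfolding U_def by (intro bind_pmf_cong refl) auto
    also have "\<dots> = bind_pmf (map_pmf msg_view L) (\<lambda>x. map_pmf (c x) (map_pmf msg_view L'))"
      unfolding L' by (simp add: bind_map_pmf map_bind_pmf msg_view_def case_prod_unfold map_pmf_comp)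
    finally have 1: "map_pmf msg_view Lc = bind_pmf (map_pmf msg_view L) (\<lambda>x. map_pmf (c x) (map_pmf msg_view L'))" .
    have "close (\<epsilon> + \<epsilon>') (bind_pmf (map_pmf msg_view L) (\<lambda>x. map_pmf (c x) (map_pmf msg_view L')))
       (bind_pmf (pair_pmf (pmf_of_set M2) Q2) (\<lambda>x. map_pmf (c x) (pair_pmf (pmf_of_set M2') Q2')))"
      by (rule close_trans[OF close_bind[OF A(13)[folded L_def]] close_bind_cong]) (rule close_map[OF B(13)[folded L'_def]])
    moreover have "bind_pmf (pair_pmf (pmf_of_set M2) Q2) (\<lambda>x. map_pmf (c x) (pair_pmf (pmf_of_set M2') Q2')) =
       pair_pmf (pmf_of_set M2c) (map_pmf (\<lambda>(z, z'). z @ z') (pair_pmf Q2 Q2'))"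
      unfolding M2c
      by (simp add: pair_pmf_def map_bind_pmf bind_map_pmf bind_assoc_pmf bind_return_pmf c_def bind_commute_pmf[of Q2 "pmf_of_set M2'"])
    ultimately show ?thesis unfolding 1 by simp
  qed
  \<comment> \<open>Here \<open>u\<close> is part of the view and cannot mask the slot; the secret
    key of the first block has to do it.\<close>
  have key: "close (2 * \<epsilon> + \<epsilon>') (map_pmf (key_view b) Lc) (pair_pmf (pmf_of_set M1c) (pair_pmf (map_pmf (hide b) (pmf_of_set M2c))
     (pair_pmf (pmf_of_set {..<K'}) (map_pmf (\<lambda>(z, z'). z @ z') (pair_pmf Q1 Q1')))))"
  proof -
    define c where "c = (\<lambda>(s, t, z) u (s', t', k', z'). (prod_encode (s, prod_encode (s', u)), hide b (prod_encode (t, t')), k' :: nat, z @ z' :: 'e list))"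
    define v where "v = (\<lambda>(s :: nat, t, k :: nat, r). (s, hide b t, k, eve (r :: ('a,'b,'c,'d,'e) transcript)))"
    define g where "g s t z a = bind_pmf U (\<lambda>u. map_pmf (\<lambda>x. c (s, t, z) u (v x)) (R ((u + a) mod K)))" for s t z a
    have 0: "map_pmf (key_view b) Lc = bind_pmf L (\<lambda>(s, e, t, k, r). g s (hide b t) (eve r) (kh r))"
      unfolding Lc by (simp add: map_bind_pmf case_prod_unfold map_pmf_comp key_view_def eve_tappend c_def g_def v_def hide_prod_encode)
    have 1: "close \<epsilon> (map_pmf (key_view b) Lc) (bind_pmf L (\<lambda>(s, e, t, k, r). g s (hide b t) (eve r) k))"
      unfolding 0
    proof (rule close_bind_off[where A="- correct d1 d2"])
      show "measure_pmf.prob L (- correct d1 d2) \<le> \<epsilon>" using A(11) unfolding L_def .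
      fix x :: "nat \<times> nat \<times> nat \<times> nat \<times> ('a,'b,'c,'d,'e) transcript"
      assume "x \<notin> - correct d1 d2"
      then show "(case x of (s, e, t, k, r) \<Rightarrow> g s (hide b t) (eve r) (kh r)) =
          (case x of (s, e, t, k, r) \<Rightarrow> g s (hide b t) (eve r) k)"
        by (cases x) (simp add: correct_def kh_def)
    qed
    have 2: "bind_pmf L (\<lambda>(s, e, t, k, r). g s (hide b t) (eve r) k) =
       bind_pmf (map_pmf (key_view b) L) (\<lambda>(s, t, k, z). g s t z k)"
      by (simp add: bind_map_pmf key_view_def case_prod_unfold)
    have 3: "close \<epsilon> (bind_pmf (map_pmf (key_view b) L) (\<lambda>(s, t, k, z). g s t z k))
       (bind_pmf (pair_pmf (pmf_of_set M1) (pair_pmf (map_pmf (hide b) (pmf_of_set M2)) (pair_pmf U Q1))) (\<lambda>(s, t, k, z). g s t z k))"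
      unfolding U_def by (rule close_bind[OF A(12)[folded L_def]])
    \<comment> \<open>For a given \<open>u\<close>, the uniform key makes the slot uniform and
      independent of \<open>u\<close>. After exchanging the two draws the second block is a plain
      run of its code, independent of \<open>u\<close>.\<close>
    have gU: "bind_pmf U (g s t z) = bind_pmf U (\<lambda>u. map_pmf (\<lambda>x. c (s, t, z) u x) (map_pmf (key_view b) L'))" for s t z
    proof -
      have "bind_pmf U (g s t z) = bind_pmf U (\<lambda>u. bind_pmf U (\<lambda>a. map_pmf (\<lambda>x. c (s, t, z) u (v x)) (R ((a + u) mod K))))"
        unfolding g_def by (subst bind_commute_pmf) (simp add: add.commute)
      also have "\<dots> = bind_pmf U (\<lambda>u. bind_pmf U (\<lambda>a. map_pmf (\<lambda>x. c (s, t, z) u (v x)) (R a)))"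
        unfolding U_def by (rule bind_pmf_cong[OF refl]) (rule bind_pmf_of_set_shift[OF A(8)])
      also have "\<dots> = bind_pmf U (\<lambda>u. map_pmf (\<lambda>x. c (s, t, z) u x) (map_pmf (key_view b) L'))"
        unfolding L' by (simp add: map_bind_pmf map_pmf_comp key_view_def v_def case_prod_unfold)
      finally show ?thesis .
    qed
    define T where "T = pair_pmf (pmf_of_set M1') (pair_pmf (map_pmf (hide b) (pmf_of_set M2')) (pair_pmf (pmf_of_set {..<K'}) Q1'))"
    have 4: "bind_pmf (pair_pmf (pmf_of_set M1) (pair_pmf (map_pmf (hide b) (pmf_of_set M2)) (pair_pmf U Q1))) (\<lambda>(s, t, k, z). g s t z k) =
      bind_pmf (pmf_of_set M1) (\<lambda>s. bind_pmf (map_pmf (hide b) (pmf_of_set M2)) (\<lambda>t. bind_pmf Q1 (\<lambda>z. bind_pmf U (g s t z))))"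
      unfolding pair_pmf_def by (simp add: bind_assoc_pmf bind_return_pmf bind_commute_pmf[of Q1 U])
    have 5: "close \<epsilon>' (bind_pmf (pmf_of_set M1) (\<lambda>s. bind_pmf (map_pmf (hide b) (pmf_of_set M2)) (\<lambda>t. bind_pmf Q1 (\<lambda>z. bind_pmf U (g s t z))))) (bind_pmf (pmf_of_set M1) (\<lambda>s. bind_pmf (map_pmf (hide b) (pmf_of_set M2)) (\<lambda>t.
        bind_pmf Q1 (\<lambda>z. bind_pmf U (\<lambda>u. map_pmf (\<lambda>x. c (s, t, z) u x) T)))))"
      unfolding gU T_def by (intro close_bind_cong close_map B(12)[folded L'_def])
    have 6: "bind_pmf (pmf_of_set M1) (\<lambda>s. bind_pmf (map_pmf (hide b) (pmf_of_set M2)) (\<lambda>t.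
        bind_pmf Q1 (\<lambda>z. bind_pmf U (\<lambda>u. map_pmf (\<lambda>x. c (s, t, z) u x) T)))) =
      pair_pmf (pmf_of_set M1c) (pair_pmf (map_pmf (hide b) (pmf_of_set M2c))
     (pair_pmf (pmf_of_set {..<K'}) (map_pmf (\<lambda>(z, z'). z @ z') (pair_pmf Q1 Q1'))))"
    proof -
      have "bind_pmf (pmf_of_set M1) (\<lambda>s. bind_pmf (map_pmf (hide b) (pmf_of_set M2)) (\<lambda>t.
        bind_pmf Q1 (\<lambda>z. bind_pmf U (\<lambda>u. map_pmf (\<lambda>x. c (s, t, z) u x) T)))) =
        bind_pmf (pmf_of_set M1) (\<lambda>s. bind_pmf (pmf_of_set M2) (\<lambda>t. bind_pmf Q1 (\<lambda>z. bind_pmf U (\<lambda>u.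
          bind_pmf (pmf_of_set M1') (\<lambda>s'. bind_pmf (pmf_of_set M2') (\<lambda>t'. bind_pmf (pmf_of_set {..<K'}) (\<lambda>k'.
            bind_pmf Q1' (\<lambda>z'. return_pmf (prod_encode (s, prod_encode (s', u)), hide b (prod_encode (t, t')), k', z @ z')))))))))"
        by (simp add: T_def pair_pmf_def map_bind_pmf bind_map_pmf bind_assoc_pmf bind_return_pmf c_def hide_prod_encode)
      also have "\<dots> = bind_pmf (pmf_of_set M1) (\<lambda>s. bind_pmf (pmf_of_set M1') (\<lambda>s'. bind_pmf U (\<lambda>u.
          bind_pmf (pmf_of_set M2) (\<lambda>t. bind_pmf (pmf_of_set M2') (\<lambda>t'. bind_pmf (pmf_of_set {..<K'}) (\<lambda>k'. bind_pmf Q1 (\<lambda>z.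
            bind_pmf Q1' (\<lambda>z'. return_pmf (prod_encode (s, prod_encode (s', u)), hide b (prod_encode (t, t')), k', z @ z')))))))))"
        by (simp only: bind_commute_pmf[of Q1 U] bind_commute_pmf[of Q1 "pmf_of_set M1'"] bind_commute_pmf[of Q1 "pmf_of_set M2'"]
             bind_commute_pmf[of Q1 "pmf_of_set {..<K'}"] bind_commute_pmf[of U "pmf_of_set M1'"]
             bind_commute_pmf[of "pmf_of_set M2" U] bind_commute_pmf[of "pmf_of_set M2" "pmf_of_set M1'"])
      also have "\<dots> = pair_pmf (pmf_of_set M1c) (pair_pmf (map_pmf (hide b) (pmf_of_set M2c))
           (pair_pmf (pmf_of_set {..<K'}) (map_pmf (\<lambda>(z, z'). z @ z') (pair_pmf Q1 Q1'))))"
        unfolding M1c M2c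
        by (simp add: pair_pmf_def map_bind_pmf bind_map_pmf bind_assoc_pmf bind_return_pmf)
      finally show ?thesis .
    qed
    show ?thesis
      using close_trans[OF close_trans[OF 1[unfolded 2] 3] 5[folded 4, unfolded 6]] unfolding mult_2 .
  qed
  have m1: "map_pmf fst \<rho>1c = pmf_of_set M1c"
    unfolding M1c A(9)[symmetric] B(9)[symmetric] \<rho>1c_def pad_sender1_def U_def[symmetric]
    unfolding pair_pmf_def map_pmf_def bind_assoc_pmf bind_return_pmf by simp
  have m2: "map_pmf (\<lambda>b. (fst b, fst (snd b))) \<rho>2c = pair_pmf (pmf_of_set M2c) (pmf_of_set {..<K'})"
  proof -
    have "map_pmf (\<lambda>b. (fst b, fst (snd b))) \<rho>2c = bind_pmf (map_pmf fst (map_pmf (\<lambda>b. (fst b, fst (snd b))) \<rho>2))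
        (\<lambda>t. map_pmf (\<lambda>(t', k'). (prod_encode (t, t'), k')) (map_pmf (\<lambda>b. (fst b, fst (snd b))) \<rho>2'))"
      unfolding \<rho>2c_def seq_sender2_def
      by (simp add: map_bind_pmf bind_map_pmf map_pmf_comp)
    also have "\<dots> = pair_pmf (pmf_of_set M2c) (pmf_of_set {..<K'})"
      unfolding A(10) B(10) map_fst_pair_pmf M2c
      by (simp add: pair_pmf_def map_bind_pmf bind_map_pmf bind_assoc_pmf bind_return_pmf)
    finally show ?thesis .
  qed
  show ?thesis unfolding scode_def
  proof (rule exI[of _ \<rho>1c], rule exI[of _ \<rho>2c], rule exI[of _ M1c], rule exI[of _ M2c], rule exI[of _ d1c],
      rule exI[of _ d2c], rule exI[of _ "map_pmf (\<lambda>(z, z'). z @ z') (pair_pmf Q1 Q1')"],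
      rule exI[of _ "map_pmf (\<lambda>(z, z'). z @ z') (pair_pmf Q2 Q2')"], intro conjI)
    show "finite M1c" "card M1c = N1 * (N1' * K)" "M1c \<noteq> {}"
      using A(1-3) B(1-3) K0 by (simp_all add: M1c_def card_prod_encode_image)
    show "finite M2c" "card M2c = N2 * N2'" "M2c \<noteq> {}"
      using A(4-6) B(4-6) by (simp_all add: M2c_def card_prod_encode_image)
    show "0 < E" "0 < K'" by fact+
    show "measure_pmf.prob (run_law W (n + n') \<rho>1c E \<rho>2c) (- correct d1c d2c) \<le> 2 * \<epsilon> + \<epsilon>'"
      using err eps0 unfolding Lc_def by simp
    show "close (2 * \<epsilon> + \<epsilon>') (map_pmf msg_view (run_law W (n + n') \<rho>1c E \<rho>2c))
       (pair_pmf (pmf_of_set M2c) (map_pmf (\<lambda>(z, z'). z @ z') (pair_pmf Q2 Q2')))"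
      by (rule close_mono[OF msg[unfolded Lc_def]]) (use eps0 in simp)
  qed (fact m1 m2 key[unfolded Lc_def])+
qed

section \<open>Closing slots, dropping keys, exchanging users and iterating\<close>

lemma scode_mono: "scode b W n N1 E N2 K \<epsilon> \<Longrightarrow> \<epsilon> \<le> \<delta> \<Longrightarrow> scode b W n N1 E N2 K \<delta>"
  unfolding scode_def by (elim ex_forward) (auto intro: close_mono order_trans)

lemma scode_positive:
  assumes "scode b W n N1 E N2 K \<epsilon>" shows "0 < N1" "0 < N2" "0 < E" "0 < K"
  using assms unfolding scode_def by (auto simp: card_gt_0_iff)

lemma pmf_of_set_lessThan_1: "pmf_of_set {..<Suc 0} = return_pmf 0"
  by (simp add: pmf_of_set_singleton lessThan_Suc)

text \<open>Filler for channel uses that carry no information; it also provides some code at every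
  length.\<close>

lemma scode_trivial: "scode b W n 1 1 1 1 0"
proof -
  define \<rho>1 where "\<rho>1 = return_pmf (0 :: nat, \<lambda>_ :: nat. \<lambda>_ :: 'c list. undefined :: 'a)"
  define \<rho>2 where "\<rho>2 = return_pmf (0 :: nat, 0 :: nat, \<lambda>_ :: 'd list. undefined :: 'b)"
  define C where "C = channel_run W (\<lambda>_. undefined) (\<lambda>_. undefined) n"
  have L: "run_law W n \<rho>1 1 \<rho>2 = map_pmf (\<lambda>r. (0, 0, 0, 0, r)) C"
    by (simp add: run_law_def slot_law_def \<rho>1_def \<rho>2_def C_def bind_return_pmf pmf_of_set_lessThan_1 map_pmf_comp)
  have P: "measure_pmf.prob (run_law W n \<rho>1 1 \<rho>2) (- correct (\<lambda>_ _. (0, 0)) (\<lambda>_ _. (0, 0, 0))) = 0"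
    unfolding L by (subst measure_pmf_zero_iff) (auto simp: correct_def)
  have key: "map_pmf (key_view b) (run_law W n \<rho>1 1 \<rho>2) =
     pair_pmf (return_pmf 0) (pair_pmf (return_pmf 0) (pair_pmf (return_pmf 0) (map_pmf eve C)))"
    unfolding L by (simp add: map_pmf_comp key_view_def hide_def pair_return_pmf1)
  have msg: "map_pmf msg_view (run_law W n \<rho>1 1 \<rho>2) = pair_pmf (return_pmf 0) (map_pmf eve C)"
    unfolding L by (simp add: map_pmf_comp msg_view_def pair_return_pmf1)
  show ?thesis
    unfolding scode_def
    apply (rule exI[of _ \<rho>1], rule exI[of _ \<rho>2], rule exI[of _ "{0}"], rule exI[of _ "{0}"],
       rule exI[of _ "\<lambda>_ _. (0, 0)"], rule exI[of _ "\<lambda>_ _. (0, 0, 0)"], rule exI[of _ "map_pmf eve C"], rule exI[of _ "map_pmf eve C"])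
    using P key msg
    by (simp add: close_refl pmf_of_set_singleton pmf_of_set_lessThan_1 hide_def \<rho>1_def[symmetric] \<rho>2_def[symmetric])
       (simp add: \<rho>1_def \<rho>2_def)
qed

text \<open>A slot can be filled with local randomness of user 1, because neither view contains it.
  This is used for the first block, where no key has arrived yet.\<close>

lemma scode_close_slot:
  assumes "scode b W n N1 E N2 K \<epsilon>"
  shows "scode b W n N1 1 N2 K \<epsilon>"
proof -
  from assms obtain \<rho>1 \<rho>2 M1 M2 d1 d2 Q1 Q2 where A:
     "finite M1" "card M1 = N1" "M1 \<noteq> {}" "finite M2" "card M2 = N2" "M2 \<noteq> {}" "0 < E" "0 < K"
     "map_pmf fst \<rho>1 = pmf_of_set M1"
     "map_pmf (\<lambda>b. (fst b, fst (snd b))) \<rho>2 = pair_pmf (pmf_of_set M2) (pmf_of_set {..<K})"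
     "measure_pmf.prob (run_law W n \<rho>1 E \<rho>2) (- correct d1 d2) \<le> \<epsilon>"
     "close \<epsilon> (map_pmf (key_view b) (run_law W n \<rho>1 E \<rho>2))
       (pair_pmf (pmf_of_set M1) (pair_pmf (map_pmf (hide b) (pmf_of_set M2)) (pair_pmf (pmf_of_set {..<K}) Q1)))"
     "close \<epsilon> (map_pmf msg_view (run_law W n \<rho>1 E \<rho>2)) (pair_pmf (pmf_of_set M2) Q2)"
    unfolding scode_def by blast
  define \<rho> where "\<rho> = bind_pmf (pmf_of_set {..<E}) (\<lambda>e. map_pmf (\<lambda>a. (fst a, \<lambda>_ :: nat. snd a e)) \<rho>1)"
  define h where "h = (\<lambda>(s :: nat, e :: nat, t :: nat, k :: nat, r :: ('a,'b,'c,'d,'e) transcript). (s, 0 :: nat, t, k, r))"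
  have L: "run_law W n \<rho> 1 \<rho>2 = map_pmf h (run_law W n \<rho>1 E \<rho>2)"
    by (simp add: run_law_def slot_law_def \<rho>_def bind_return_pmf pmf_of_set_lessThan_1 map_pmf_comp
        map_bind_pmf bind_map_pmf bind_assoc_pmf h_def)
  have key: "key_view b \<circ> h = key_view b" and msg: "msg_view \<circ> h = msg_view"
    by (auto simp: fun_eq_iff key_view_def msg_view_def h_def)
  have fst: "map_pmf fst \<rho> = pmf_of_set M1"
    unfolding A(9)[symmetric] by (simp add: \<rho>_def map_bind_pmf map_pmf_comp)
  define d where "d xs ys = (case d2 xs ys of (s, e, k) \<Rightarrow> (s, 0 :: nat, k))" for xs ys
  have "measure_pmf.prob (run_law W n \<rho> 1 \<rho>2) (- correct d1 d) \<le> measure_pmf.prob (run_law W n \<rho>1 E \<rho>2) (- correct d1 d2)"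
    unfolding L measure_map_pmf by (rule measure_pmf.finite_measure_mono) (auto simp: correct_def h_def d_def)
  then have P: "measure_pmf.prob (run_law W n \<rho> 1 \<rho>2) (- correct d1 d) \<le> \<epsilon>" using A(11) by linarith
  show ?thesis unfolding scode_def
    apply (rule exI[of _ \<rho>], rule exI[of _ \<rho>2], rule exI[of _ M1], rule exI[of _ M2],
       rule exI[of _ d1], rule exI[of _ d], rule exI[of _ Q1], rule exI[of _ Q2])
    using A(1-6,8,10,12,13) P fst unfolding L pmf.map_comp key msg by simp
qed

text \<open>The key sent in the last block encrypts nothing. It is turned into local randomness of
  user 2, and the eavesdropper's view is replaced by its marginal without the key.\<close>

lemma scode_drop_key:
  assumes "scode b W n N1 E N2 K \<epsilon>"
  shows "scode b W n N1 E N2 1 \<epsilon>"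
proof -
  from assms obtain \<rho>1 \<rho>2 M1 M2 d1 d2 Q1 Q2 where A:
     "finite M1" "card M1 = N1" "M1 \<noteq> {}" "finite M2" "card M2 = N2" "M2 \<noteq> {}" "0 < E" "0 < K"
     "map_pmf fst \<rho>1 = pmf_of_set M1"
     "map_pmf (\<lambda>b. (fst b, fst (snd b))) \<rho>2 = pair_pmf (pmf_of_set M2) (pmf_of_set {..<K})"
     "measure_pmf.prob (run_law W n \<rho>1 E \<rho>2) (- correct d1 d2) \<le> \<epsilon>"
     "close \<epsilon> (map_pmf (key_view b) (run_law W n \<rho>1 E \<rho>2))
       (pair_pmf (pmf_of_set M1) (pair_pmf (map_pmf (hide b) (pmf_of_set M2)) (pair_pmf (pmf_of_set {..<K}) Q1)))"
     "close \<epsilon> (map_pmf msg_view (run_law W n \<rho>1 E \<rho>2)) (pair_pmf (pmf_of_set M2) Q2)"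
    unfolding scode_def by blast
  define \<rho> where "\<rho> = map_pmf (\<lambda>c. (fst c, 0 :: nat, snd (snd c))) \<rho>2"
  define h where "h = (\<lambda>(s :: nat, e :: nat, t :: nat, k :: nat, r :: ('a,'b,'c,'d,'e) transcript). (s, e, t, 0 :: nat, r))"
  have L: "run_law W n \<rho>1 E \<rho> = map_pmf h (run_law W n \<rho>1 E \<rho>2)"
    by (simp add: run_law_def slot_law_def \<rho>_def map_pmf_comp map_bind_pmf bind_map_pmf h_def)
  define g where "g = (\<lambda>(s :: nat, t :: nat, k :: nat, z :: 'e list). (s, t, 0 :: nat, z))"
  have key: "key_view b \<circ> h = g \<circ> key_view b" and msg: "msg_view \<circ> h = msg_view"
    by (auto simp: fun_eq_iff key_view_def msg_view_def h_def g_def)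
  have g: "map_pmf g (pair_pmf p (pair_pmf q (pair_pmf (pmf_of_set {..<K}) Q1))) =
     pair_pmf p (pair_pmf q (pair_pmf (pmf_of_set {..<1}) Q1))" for p q
    by (simp add: pmf_of_set_lessThan_1 pair_pmf_def map_bind_pmf bind_assoc_pmf bind_return_pmf g_def)
  have key2: "close \<epsilon> (map_pmf (key_view b) (run_law W n \<rho>1 E \<rho>))
     (pair_pmf (pmf_of_set M1) (pair_pmf (map_pmf (hide b) (pmf_of_set M2)) (pair_pmf (pmf_of_set {..<1}) Q1)))"
    using close_map[OF A(12), of g] unfolding g L pmf.map_comp key .
  have snd: "map_pmf (\<lambda>b. (fst b, fst (snd b))) \<rho> = pair_pmf (pmf_of_set M2) (pmf_of_set {..<1})"
  proof -
    have "map_pmf (\<lambda>b. (fst b, fst (snd b))) \<rho> = map_pmf (\<lambda>t. (t, 0)) (map_pmf fst (map_pmf (\<lambda>b. (fst b, fst (snd b))) \<rho>2))"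
      by (simp add: \<rho>_def map_pmf_comp)
    then show ?thesis unfolding A(10) map_fst_pair_pmf by (simp add: pmf_of_set_lessThan_1 pair_return_pmf2)
  qed
  define d where "d xs ys = (case d2 xs ys of (s, e, k) \<Rightarrow> (s, e, 0 :: nat))" for xs ys
  define d' where "d' xs ys = (fst (d1 xs ys), 0 :: nat)" for xs ys
  have "measure_pmf.prob (run_law W n \<rho>1 E \<rho>) (- correct d' d) \<le> measure_pmf.prob (run_law W n \<rho>1 E \<rho>2) (- correct d1 d2)"
    unfolding L measure_map_pmf by (rule measure_pmf.finite_measure_mono) (auto simp: correct_def h_def d_def d'_def)
  then have P: "measure_pmf.prob (run_law W n \<rho>1 E \<rho>) (- correct d' d) \<le> \<epsilon>" using A(11) by linarith
  have msg2: "close \<epsilon> (map_pmf msg_view (run_law W n \<rho>1 E \<rho>)) (pair_pmf (pmf_of_set M2) Q2)"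
    using A(13) unfolding L pmf.map_comp msg .
  show ?thesis unfolding scode_def
    apply (rule exI[of _ \<rho>1], rule exI[of _ \<rho>], rule exI[of _ M1], rule exI[of _ M2],
       rule exI[of _ d'], rule exI[of _ d], rule exI[of _ Q1], rule exI[of _ Q2])
    using A(1-7,9) P snd key2 msg2 by simp
qed

lemma scode_individual:
  assumes "scode True W n N1 E N2 K \<epsilon>"
  shows "scode False W n N1 E N2 K \<epsilon>"
proof -
  define g where "g = (\<lambda>(s :: nat, t :: nat, k :: nat, z :: 'e list). (s, 0 :: nat, k, z))"
  have key: "key_view False = g \<circ> key_view True"
    by (auto simp: fun_eq_iff key_view_def g_def hide_def)
  have g: "map_pmf g (pair_pmf p (pair_pmf (map_pmf (hide True) q) (pair_pmf r Q1))) =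
     pair_pmf p (pair_pmf (map_pmf (hide False) q) (pair_pmf r Q1))" for p q r Q1
    by (simp add: pair_pmf_def map_bind_pmf bind_map_pmf bind_assoc_pmf bind_return_pmf g_def hide_def)
  show ?thesis
    using assms unfolding scode_def key g[symmetric] pmf.map_comp[symmetric]
    by (elim ex_forward) (auto intro: close_map)
qed

definition swap_channel :: "('x1,'x2,'y1,'y2,'z) channel \<Rightarrow> ('x2,'x1,'y2,'y1,'z) channel" where
  "swap_channel W x2 x1 = map_pmf (\<lambda>(y1, y2, z). (y2, y1, z)) (W x1 x2)"

definition swap_transcript :: "('x1,'x2,'y1,'y2,'z) transcript \<Rightarrow> ('x2,'x1,'y2,'y1,'z) transcript" where
  "swap_transcript = (\<lambda>(xs1, xs2, ys1, ys2, zs). (xs2, xs1, ys2, ys1, zs))"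

lemma channel_run_swap:
  "channel_run (swap_channel W) f2 f1 n = map_pmf swap_transcript (channel_run W f1 f2 n)"
  by (induction n) (simp_all add: swap_transcript_def swap_channel_def map_bind_pmf bind_map_pmf
      case_prod_unfold map_pmf_comp)

lemma swap_transcript_sel:
  "in1 (swap_transcript r) = in2 r" "in2 (swap_transcript r) = in1 r"
  "out1 (swap_transcript r) = out2 r" "out2 (swap_transcript r) = out1 r" "eve (swap_transcript r) = eve r"
  by (cases r; simp add: swap_transcript_def)+

text \<open>With trivial slot and key the notion is symmetric. Under joint secrecy the key view
  contains both messages; under individual secrecy the key view and the message view exchange their
  roles.\<close>

lemma scode_swap:
  assumes "scode b W n N1 1 N2 1 \<epsilon>"
  shows "scode b (swap_channel W) n N2 1 N1 1 \<epsilon>"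
proof -
  have U1: "pmf_of_set {..<1} = return_pmf (0 :: nat)" using pmf_of_set_lessThan_1 by simp
  from assms obtain \<rho>1 \<rho>2 M1 M2 d1 d2 Q1 Q2 where A:
     "finite M1" "card M1 = N1" "M1 \<noteq> {}" "finite M2" "card M2 = N2" "M2 \<noteq> {}"
     "map_pmf fst \<rho>1 = pmf_of_set M1"
     "map_pmf (\<lambda>b. (fst b, fst (snd b))) \<rho>2 = pair_pmf (pmf_of_set M2) (return_pmf 0)"
     "measure_pmf.prob (run_law W n \<rho>1 1 \<rho>2) (- correct d1 d2) \<le> \<epsilon>"
     "close \<epsilon> (map_pmf (key_view b) (run_law W n \<rho>1 1 \<rho>2))
       (pair_pmf (pmf_of_set M1) (pair_pmf (map_pmf (hide b) (pmf_of_set M2)) (pair_pmf (return_pmf 0) Q1)))"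
     "close \<epsilon> (map_pmf msg_view (run_law W n \<rho>1 1 \<rho>2)) (pair_pmf (pmf_of_set M2) Q2)"
    unfolding scode_def U1 by blast
  define \<rho> where "\<rho> = map_pmf (\<lambda>c. (fst c, \<lambda>_ :: nat. snd (snd c))) \<rho>2"
  define \<rho>' where "\<rho>' = map_pmf (\<lambda>a. (fst a, 0 :: nat, snd a 0)) \<rho>1"
  define h where "h = (\<lambda>(s :: nat, e :: nat, t :: nat, k :: nat, r :: ('a,'b,'c,'d,'e) transcript). (t, 0 :: nat, s, 0 :: nat, swap_transcript r))"
  have L: "run_law (swap_channel W) n \<rho> 1 \<rho>' = map_pmf h (run_law W n \<rho>1 1 \<rho>2)"
    by (simp add: run_law_def slot_law_def \<rho>_def \<rho>'_def map_pmf_comp map_bind_pmf bind_map_pmf h_def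
        pmf_of_set_lessThan_1 bind_return_pmf channel_run_swap bind_commute_pmf[of \<rho>2 \<rho>1])
  define g where "g = (\<lambda>(s :: nat, t :: nat, k :: nat, z :: 'e list). (s, z))"
  have msg: "msg_view \<circ> h = g \<circ> key_view b"
    by (auto simp: fun_eq_iff key_view_def msg_view_def h_def g_def swap_transcript_sel)
  have "map_pmf g (pair_pmf p (pair_pmf q (pair_pmf r Q1))) = pair_pmf p Q1" for p q r
    by (simp add: pair_pmf_def map_bind_pmf bind_map_pmf bind_assoc_pmf bind_return_pmf g_def)
  then have msg2: "close \<epsilon> (map_pmf msg_view (run_law (swap_channel W) n \<rho> 1 \<rho>')) (pair_pmf (pmf_of_set M1) Q1)"
    using close_map[OF A(10), of g] unfolding L pmf.map_comp msg by simp
  have key2: "\<exists>Q. close \<epsilon> (map_pmf (key_view b) (run_law (swap_channel W) n \<rho> 1 \<rho>'))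
     (pair_pmf (pmf_of_set M2) (pair_pmf (map_pmf (hide b) (pmf_of_set M1)) (pair_pmf (return_pmf 0) Q)))"
  proof (cases b)
    case True
    define f where "f = (\<lambda>(s :: nat, t :: nat, k :: nat, z :: 'e list). (t, s, 0 :: nat, z))"
    have 1: "key_view b \<circ> h = f \<circ> key_view b"
      using True by (auto simp: fun_eq_iff key_view_def h_def f_def swap_transcript_sel hide_def)
    have "map_pmf f (pair_pmf p (pair_pmf (map_pmf (hide b) q) (pair_pmf r Q1))) =
        pair_pmf q (pair_pmf (map_pmf (hide b) p) (pair_pmf (return_pmf 0) Q1))" for p q r
      using True by (simp add: pair_pmf_def map_bind_pmf bind_map_pmf bind_assoc_pmf bind_return_pmf f_def hide_def
          bind_commute_pmf[of p q])
    then show ?thesis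
      using close_map[OF A(10), of f] unfolding L pmf.map_comp 1 by auto
  next
    case False
    define f where "f = (\<lambda>(t :: nat, z :: 'e list). (t, 0 :: nat, 0 :: nat, z))"
    have 1: "key_view b \<circ> h = f \<circ> msg_view"
      using False by (auto simp: fun_eq_iff key_view_def msg_view_def h_def f_def swap_transcript_sel hide_def)
    have "map_pmf f (pair_pmf q Q) = pair_pmf q (pair_pmf (map_pmf (hide b) p) (pair_pmf (return_pmf 0) Q))" for p q Q
      using False by (simp add: pair_pmf_def map_bind_pmf bind_map_pmf bind_assoc_pmf bind_return_pmf f_def hide_def)
    then show ?thesis
      using close_map[OF A(11), of f] unfolding L pmf.map_comp 1 by metis
  qed
  have fst: "map_pmf fst \<rho> = pmf_of_set M2"
  proof -
    have "map_pmf fst \<rho> = map_pmf fst (map_pmf (\<lambda>b. (fst b, fst (snd b))) \<rho>2)"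
      by (simp add: \<rho>_def map_pmf_comp)
    then show ?thesis unfolding A(8) map_fst_pair_pmf .
  qed
  have snd: "map_pmf (\<lambda>b. (fst b, fst (snd b))) \<rho>' = pair_pmf (pmf_of_set M1) (return_pmf 0)"
    unfolding A(7)[symmetric] \<rho>'_def by (simp add: map_pmf_comp pair_return_pmf2)
  define d where "d xs ys = (fst (d2 xs ys), 0 :: nat)" for xs ys
  define d' where "d' xs ys = (fst (d1 xs ys), 0 :: nat, 0 :: nat)" for xs ys
  have "measure_pmf.prob (run_law (swap_channel W) n \<rho> 1 \<rho>') (- correct d d') \<le> measure_pmf.prob (run_law W n \<rho>1 1 \<rho>2) (- correct d1 d2)"
    unfolding L measure_map_pmf
  proof (rule measure_pmf.finite_measure_mono, rule subsetI)
    fix x assume x: "x \<in> h -` (- correct d d')"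
    obtain s e t k r where "x = (s, e, t, k, r)" by (cases x)
    then show "x \<in> - correct d1 d2"
      using x by (simp add: correct_def h_def d_def d'_def swap_transcript_sel) force
  qed simp
  then have P: "measure_pmf.prob (run_law (swap_channel W) n \<rho> 1 \<rho>') (- correct d d') \<le> \<epsilon>" using A(9) by linarith
  from key2 obtain Q where Q: "close \<epsilon> (map_pmf (key_view b) (run_law (swap_channel W) n \<rho> 1 \<rho>'))
     (pair_pmf (pmf_of_set M2) (pair_pmf (map_pmf (hide b) (pmf_of_set M1)) (pair_pmf (return_pmf 0) Q)))" by blast
  show ?thesis unfolding scode_def U1
    apply (rule exI[of _ \<rho>], rule exI[of _ \<rho>'], rule exI[of _ M2], rule exI[of _ M1],
       rule exI[of _ d], rule exI[of _ d'], rule exI[of _ Q], rule exI[of _ Q1])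
    using A(1-6) P Q snd msg2 fst by simp
qed

text \<open>The first block has no incoming key, so its slot is closed and it contributes no factor
  \<open>K\<close>. The recursion of \<open>scode_seq\<close>, from an error e to 2 e + \<epsilon>,
  stays below a factor 3 for each step since e is at least \<epsilon>.\<close>

lemma scode_power:
  assumes "scode b W n S1 K S2 K \<epsilon>"
  shows "scode b W (Suc m * n) (S1 * (S1 * K) ^ m) 1 (S2 ^ Suc m) K (3 ^ m * \<epsilon>)"
proof (induction m)
  case 0
  then show ?case using scode_close_slot[OF assms] by simp
next
  case (Suc m)
  have "0 \<le> \<epsilon>" using assms unfolding scode_def by (meson measure_nonneg order_trans)
  then have "2 * (3 ^ m * \<epsilon>) + \<epsilon> \<le> 3 ^ Suc m * \<epsilon>"
    using mult_right_mono[of 1 "3 ^ m" \<epsilon>] unfolding power_Suc mult.assoc by (simp add: mult.commute[of \<epsilon>])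
  then have "scode b W (Suc m * n + n) (S1 * (S1 * K) ^ m * (S1 * K)) 1 (S2 ^ Suc m * S2) K (3 ^ Suc m * \<epsilon>)"
    by (rule scode_mono[OF scode_seq[OF Suc assms]])
  moreover have "Suc m * n + n = Suc (Suc m) * n" "S1 * (S1 * K) ^ m * (S1 * K) = S1 * (S1 * K) ^ Suc m"
    "S2 ^ Suc m * S2 = S2 ^ Suc (Suc m)" by simp_all
  ultimately show ?case by (simp only:)
qed

text \<open>One seed serves all messages: a whole table with one entry for each message is drawn at
  once. The support of a distribution is countable, so the table can be coded by a natural number
  even when the type of strategies is uncountable.\<close>

lemma seed_representation:
  fixes \<sigma> :: "nat \<Rightarrow> 'a pmf"
  assumes "finite M"
  obtains s :: "nat pmf" and F where "\<And>m. m \<in> M \<Longrightarrow> map_pmf (F m) s = \<sigma> m"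
proof
  define P where "P = Pi_pmf M undefined \<sigma>"
  fix m assume m: "m \<in> M"
  have "map_pmf (\<lambda>u. from_nat_into (set_pmf P) u m) (map_pmf (to_nat_on (set_pmf P)) P) = map_pmf (\<lambda>f. f m) P"
    unfolding pmf.map_comp by (intro map_pmf_cong refl) simp
  also have "\<dots> = \<sigma> m" unfolding P_def Pi_pmf_component[OF assms] using m by simp
  finally show "map_pmf (\<lambda>u. from_nat_into (set_pmf P) u m) (map_pmf (to_nat_on (set_pmf P)) P) = \<sigma> m" .
qed


section \<open>From codes to terminals\<close>

lemma disintegrate_pmf_of_set:
  assumes "finite M" "M \<noteq> {}" "map_pmf f \<rho> = pmf_of_set M"
  shows "\<rho> = bind_pmf (pmf_of_set M) (\<lambda>m. cond_pmf \<rho> {a. f a = m})"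
proof -
  have "set_pmf (map_pmf f \<rho>) = M" unfolding assms(3) using assms by simp
  then have "bind_pmf (map_pmf f \<rho>) (\<lambda>m. cond_pmf \<rho> {a. m = f a}) = \<rho>"
    by (intro bind_cond_pmf_cancel) (auto simp: measure_map_pmf vimage_def eq_commute)
  then show ?thesis unfolding assms(3) by (simp add: eq_commute)
qed

lemma expectation_pmf_of_set:
  "finite A \<Longrightarrow> A \<noteq> {} \<Longrightarrow> measure_pmf.expectation (pmf_of_set A) f = sum f A / real (card A)"
  for f :: "'a \<Rightarrow> real"
  by (rule integral_pmf_of_set)

text \<open>Conditioning the joint law of message and strategy on the message turns a sender into a
  stochastic encoder. The rate is chosen as the logarithm of the number of messages over
  \<open>n\<close>, so the required cardinality exp(n R) holds exactly.\<close>

lemma scode_terminals: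
  fixes W :: "('x1,'x2,'y1,'y2,'z) channel"
  assumes "scode b W n N1 1 N2 1 \<epsilon>" "1 \<le> n"
  obtains T1 :: "('x1,'y1) terminal" and T2 :: "('x2,'y2) terminal" and M1 M2 Q1 Q2
  where "finite M1" "card M1 = N1" "M1 \<noteq> {}" "finite M2" "card M2 = N2" "M2 \<noteq> {}"
    "msgs T1 = M1" "msgs T2 = M2"
    "adaptive_code n (ln (real N1) / real n) (ln (real N2) / real n) T1 T2"
    "error_prob W n T1 T2 \<le> \<epsilon>"
    "close \<epsilon> (map_pmf (\<lambda>(m1, m2, z). (m1, hide b m2, z)) (eavesdropper_law W n T1 T2))
       (pair_pmf (pmf_of_set M1) (pair_pmf (map_pmf (hide b) (pmf_of_set M2)) Q1))"
    "close \<epsilon> (map_pmf (\<lambda>(m1, m2, z). (m2, z)) (eavesdropper_law W n T1 T2)) (pair_pmf (pmf_of_set M2) Q2)"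
proof -
  have U1: "pmf_of_set {..<1} = return_pmf (0 :: nat)" using pmf_of_set_lessThan_1 by simp
  from assms(1) obtain \<rho>1 \<rho>2 M1 M2 d1 d2 Q1 Q2 where A:
     "finite M1" "card M1 = N1" "M1 \<noteq> {}" "finite M2" "card M2 = N2" "M2 \<noteq> {}"
     "map_pmf fst \<rho>1 = pmf_of_set M1"
     "map_pmf (\<lambda>b. (fst b, fst (snd b))) \<rho>2 = pair_pmf (pmf_of_set M2) (return_pmf 0)"
     "measure_pmf.prob (run_law W n \<rho>1 1 \<rho>2) (- correct d1 d2) \<le> \<epsilon>"
     "close \<epsilon> (map_pmf (key_view b) (run_law W n \<rho>1 1 \<rho>2))
       (pair_pmf (pmf_of_set M1) (pair_pmf (map_pmf (hide b) (pmf_of_set M2)) (pair_pmf (return_pmf 0) Q1)))"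
     "close \<epsilon> (map_pmf msg_view (run_law W n \<rho>1 1 \<rho>2)) (pair_pmf (pmf_of_set M2) Q2)"
    unfolding scode_def U1 by blast
  have fst2: "map_pmf fst \<rho>2 = pmf_of_set M2"
  proof -
    have "map_pmf fst \<rho>2 = map_pmf fst (map_pmf (\<lambda>b. (fst b, fst (snd b))) \<rho>2)"
      by (simp add: map_pmf_comp)
    then show ?thesis unfolding A(8) map_fst_pair_pmf .
  qed
  have key0: "fst (snd c) = 0" if "c \<in> set_pmf \<rho>2" for c
  proof -
    have "(fst c, fst (snd c)) \<in> set_pmf (map_pmf (\<lambda>b. (fst b, fst (snd b))) \<rho>2)" using that by auto
    then show ?thesis unfolding A(8) by simp
  qed
  define \<sigma>1 where "\<sigma>1 m = map_pmf (\<lambda>a. snd a 0) (cond_pmf \<rho>1 {a. fst a = m})" for m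
  define \<sigma>2 where "\<sigma>2 m = map_pmf (\<lambda>a. snd (snd a)) (cond_pmf \<rho>2 {a. fst a = m})" for m
  obtain s1 :: "nat pmf" and F1 where s1: "\<And>m. m \<in> M1 \<Longrightarrow> map_pmf (F1 m) s1 = \<sigma>1 m"
    using seed_representation[OF A(1)] by blast
  obtain s2 :: "nat pmf" and F2 where s2: "\<And>m. m \<in> M2 \<Longrightarrow> map_pmf (F2 m) s2 = \<sigma>2 m"
    using seed_representation[OF A(4)] by blast
  have ne1: "set_pmf \<rho>1 \<inter> {a. fst a = m} \<noteq> {}" if "m \<in> M1" for m
  proof -
    have "m \<in> set_pmf (map_pmf fst \<rho>1)" unfolding A(7) using that A by simp
    then show ?thesis by auto
  qed
  have ne2: "set_pmf \<rho>2 \<inter> {a. fst a = m} \<noteq> {}" if "m \<in> M2" for m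
  proof -
    have "m \<in> set_pmf (map_pmf fst \<rho>2)" unfolding fst2 using that A by simp
    then show ?thesis by auto
  qed
  \<comment> \<open>The decoder of a terminal must always return an element of the other message
    set, so an invalid estimate is replaced by an arbitrary message. Correct estimates are
    unaffected, hence the error does not grow.\<close>
  define dflt1 where "dflt1 m = (if m \<in> M2 then m else SOME m. m \<in> M2)" for m
  define dflt2 where "dflt2 m = (if m \<in> M1 then m else SOME m. m \<in> M1)" for m
  have dflt: "dflt1 m \<in> M2" "dflt2 m \<in> M1" for m
    using A(3,6) by (auto simp: dflt1_def dflt2_def some_in_eq)
  define T1 :: "('x1,'y1) terminal" where
    "T1 = \<lparr>msgs = M1, seed = s1, enc = F1, dec = (\<lambda>m xs ys. dflt1 (fst (d1 xs ys)))\<rparr>"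
  define T2 :: "('x2,'y2) terminal" where
    "T2 = \<lparr>msgs = M2, seed = s2, enc = F2, dec = (\<lambda>m xs ys. dflt2 (fst (d2 xs ys)))\<rparr>"
  have trans: "transmission W n T1 T2 m1 m2 = bind_pmf (\<sigma>1 m1) (\<lambda>f1. bind_pmf (\<sigma>2 m2) (\<lambda>f2. channel_run W f1 f2 n))"
    if "m1 \<in> M1" "m2 \<in> M2" for m1 m2
    unfolding s1[OF that(1), symmetric] s2[OF that(2), symmetric]
    by (simp add: transmission_def T1_def T2_def bind_map_pmf)
  define G where "G = bind_pmf (pmf_of_set M1) (\<lambda>m1. bind_pmf (pmf_of_set M2) (\<lambda>m2.
     map_pmf (\<lambda>r. (m1, 0 :: nat, m2, 0 :: nat, r)) (transmission W n T1 T2 m1 m2)))"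
  have L: "run_law W n \<rho>1 1 \<rho>2 = G"
  proof -
    have "run_law W n \<rho>1 1 \<rho>2 = bind_pmf \<rho>1 (\<lambda>a. bind_pmf \<rho>2 (\<lambda>b.
        map_pmf (\<lambda>r. (fst a, 0, fst b, fst (snd b), r)) (channel_run W (snd a 0) (snd (snd b)) n)))"
      by (simp add: run_law_def slot_law_def pmf_of_set_lessThan_1 bind_return_pmf map_bind_pmf map_pmf_comp)
    also have "\<dots> = bind_pmf \<rho>1 (\<lambda>a. bind_pmf \<rho>2 (\<lambda>b.
        map_pmf (\<lambda>r. (fst a, 0, fst b, 0, r)) (channel_run W (snd a 0) (snd (snd b)) n)))"
      by (intro bind_pmf_cong refl) (simp add: key0)
    also have "\<dots> = bind_pmf (pmf_of_set M1) (\<lambda>m1. bind_pmf (cond_pmf \<rho>1 {a. fst a = m1}) (\<lambda>a.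
        bind_pmf (pmf_of_set M2) (\<lambda>m2. bind_pmf (cond_pmf \<rho>2 {a. fst a = m2}) (\<lambda>b.
        map_pmf (\<lambda>r. (fst a, 0, fst b, 0, r)) (channel_run W (snd a 0) (snd (snd b)) n)))))"
      by (subst disintegrate_pmf_of_set[OF A(1,3,7)], subst disintegrate_pmf_of_set[OF A(4,6) fst2])
         (simp only: bind_assoc_pmf)
    also have "\<dots> = bind_pmf (pmf_of_set M1) (\<lambda>m1. bind_pmf (cond_pmf \<rho>1 {a. fst a = m1}) (\<lambda>a.
        bind_pmf (pmf_of_set M2) (\<lambda>m2. bind_pmf (cond_pmf \<rho>2 {a. fst a = m2}) (\<lambda>b.
        map_pmf (\<lambda>r. (m1, 0, m2, 0, r)) (channel_run W (snd a 0) (snd (snd b)) n)))))"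
      using A ne1 ne2 by (intro bind_pmf_cong refl) (auto simp: set_cond_pmf)
    also have "\<dots> = bind_pmf (pmf_of_set M1) (\<lambda>m1. bind_pmf (pmf_of_set M2) (\<lambda>m2.
        bind_pmf (cond_pmf \<rho>1 {a. fst a = m1}) (\<lambda>a. bind_pmf (cond_pmf \<rho>2 {a. fst a = m2}) (\<lambda>b.
        map_pmf (\<lambda>r. (m1, 0, m2, 0, r)) (channel_run W (snd a 0) (snd (snd b)) n)))))"
      by (intro bind_pmf_cong refl) (rule bind_commute_pmf)
    also have "\<dots> = G"
      unfolding G_def using A trans by (intro bind_pmf_cong refl) (simp add: \<sigma>1_def \<sigma>2_def bind_map_pmf map_bind_pmf)
    finally show ?thesis .
  qed
  have eav: "eavesdropper_law W n T1 T2 = map_pmf (\<lambda>(s, e, t, k, r). (s, t, eve r)) G"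
    unfolding eavesdropper_law_def G_def
    by (simp add: T1_def T2_def map_bind_pmf map_pmf_comp)
       (intro bind_pmf_cong map_pmf_cong refl, auto)
  have "error_prob W n T1 T2 = measure_pmf.prob G
     {(s, e, t, k, r). s \<noteq> dec T2 t (in2 r) (out2 r) \<or> t \<noteq> dec T1 s (in1 r) (out1 r)}"
  proof -
    have msgs: "msgs T1 = M1" "msgs T2 = M2" by (simp_all add: T1_def T2_def)
    have set_eq: "{(xs1, xs2, ys1, ys2, zs). m1 \<noteq> dec T2 m2 xs2 ys2 \<or> m2 \<noteq> dec T1 m1 xs1 ys1} =
       {r. m1 \<noteq> dec T2 m2 (in2 r) (out2 r) \<or> m2 \<noteq> dec T1 m1 (in1 r) (out1 r)}" for m1 m2 :: nat
      by (auto simp only: mem_Collect_eq prod.case in1.simps in2.simps out1.simps out2.simps split: prod.splits)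
    define S where "S m1 m2 = {r :: ('x1,'x2,'y1,'y2,'z) transcript. m1 \<noteq> dec T2 m2 (in2 r) (out2 r) \<or> m2 \<noteq> dec T1 m1 (in1 r) (out1 r)}" for m1 m2
    have "error_prob W n T1 T2 = 1 / (real N1 * real N2) *
        (\<Sum>m1\<in>M1. \<Sum>m2\<in>M2. measure_pmf.prob (transmission W n T1 T2 m1 m2) (S m1 m2))"
      unfolding error_prob_def msgs set_eq A(2,5) S_def ..
    also have "\<dots> = measure_pmf.prob G {(s, e, t, k, r). r \<in> S s t}"
      unfolding G_def prob_bind_pmf using A(1-6)
      by (simp add: expectation_pmf_of_set vimage_def sum_divide_distrib[symmetric] mult.commute)
    finally show ?thesis unfolding S_def by simp
  qed
  also have "\<dots> \<le> measure_pmf.prob G (- correct d1 d2)"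
  proof (rule measure_pmf.finite_measure_mono_AE)
    have "s \<in> M1 \<and> t \<in> M2" if "(s, e, t, k, r) \<in> set_pmf G" for s e t k r
      using that A unfolding G_def by auto
    then show "AE x in measure_pmf G. x \<in> {(s, e, t, k, r). s \<noteq> dec T2 t (in2 r) (out2 r) \<or> t \<noteq> dec T1 s (in1 r) (out1 r)} \<longrightarrow>
        x \<in> - correct d1 d2"
      unfolding AE_measure_pmf_iff by (clarsimp simp: correct_def T1_def T2_def dflt1_def dflt2_def)
  qed simp
  finally have err: "error_prob W n T1 T2 \<le> \<epsilon>" using A(9) unfolding L by linarith
  have code: "adaptive_code n (ln (real N1) / real n) (ln (real N2) / real n) T1 T2"
    using A dflt assms(2) scode_positive[OF assms(1)] by (simp add: adaptive_code_def T1_def T2_def)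
  have v1: "(\<lambda>(m1, m2, z). (m1, hide b m2, z)) \<circ> (\<lambda>(s, e, t, k, r). (s, t, eve r)) =
      (\<lambda>(s, t, k, z). (s, t, z)) \<circ> key_view b"
    by (auto simp: fun_eq_iff key_view_def)
  have v2: "(\<lambda>(m1, m2, z). (m2, z)) \<circ> (\<lambda>(s, e, t, k, r). (s, t, eve r)) = msg_view"
    by (auto simp: fun_eq_iff msg_view_def)
  have "map_pmf (\<lambda>(s, t, k, z). (s, t, z)) (pair_pmf p (pair_pmf q (pair_pmf (return_pmf (0 :: nat)) Q1))) = pair_pmf p (pair_pmf q Q1)" for p q :: "nat pmf"
    by (simp add: pair_pmf_def map_bind_pmf bind_assoc_pmf bind_return_pmf)
  then have "close \<epsilon> (map_pmf (\<lambda>(m1, m2, z). (m1, hide b m2, z)) (eavesdropper_law W n T1 T2))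
       (pair_pmf (pmf_of_set M1) (pair_pmf (map_pmf (hide b) (pmf_of_set M2)) Q1))"
    using close_map[OF A(10), of "\<lambda>(s, t, k, z). (s, t, z)"] unfolding eav pmf.map_comp v1 L[symmetric] by simp
  moreover have "close \<epsilon> (map_pmf (\<lambda>(m1, m2, z). (m2, z)) (eavesdropper_law W n T1 T2)) (pair_pmf (pmf_of_set M2) Q2)"
    using A(11) unfolding eav pmf.map_comp v2 L[symmetric] .
  ultimately show ?thesis
    using that[of M1 M2 T1 T2] A err code by (simp add: T1_def T2_def)
qed

section \<open>Information densities\<close>

text \<open>The likelihood ratio of the joint law against the product of the marginals. Its
  logarithm is the information density, whose mean is the mutual information.\<close>

definition dens :: "'w pmf \<Rightarrow> ('w \<Rightarrow> 'a) \<Rightarrow> ('w \<Rightarrow> 'b) \<Rightarrow> 'w \<Rightarrow> real" where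
  "dens p X Y w = pmf (map_pmf (\<lambda>w. (X w, Y w)) p) (X w, Y w) /
     (pmf (map_pmf X p) (X w) * pmf (map_pmf Y p) (Y w))"

lemma mutual_info_dens:
  fixes X :: "'w \<Rightarrow> 'a::countable" and Y :: "'w \<Rightarrow> 'b::countable"
  shows "mutual_info p X Y = measure_pmf.expectation p (\<lambda>w. ln (dens p X Y w))"
proof -
  interpret information_space "measure_pmf p" "exp 1"
    by unfold_locales simp
  have distr: "distributed (measure_pmf p) (count_space UNIV) V (\<lambda>x. ennreal (pmf (map_pmf V p) x))" for V :: "'w \<Rightarrow> 'c"
    unfolding distributed_def map_pmf_rep_eq[symmetric] by (simp add: measure_pmf_eq_density[symmetric] map_pmf_rep_eq)
  have CC: "count_space (UNIV :: 'a set) \<Otimes>\<^sub>M count_space (UNIV :: 'b set) = count_space UNIV"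
    by (subst pair_measure_countable) auto
  have "mutual_info p X Y = (\<integral>x. (case x of (x, y) \<Rightarrow> pmf (map_pmf (\<lambda>w. (X w, Y w)) p) (x, y) *
       log (exp 1) (pmf (map_pmf (\<lambda>w. (X w, Y w)) p) (x, y) / (pmf (map_pmf X p) x * pmf (map_pmf Y p) y)))
      \<partial>(count_space UNIV \<Otimes>\<^sub>M count_space UNIV))"
    unfolding mutual_info_def
    by (subst mutual_information_distr[where Px="pmf (map_pmf X p)" and Py="pmf (map_pmf Y p)"
          and Pxy="pmf (map_pmf (\<lambda>w. (X w, Y w)) p)"])
       (auto intro!: sigma_finite_measure_count_space_countable distr simp: CC case_prod_unfold)
  also have "\<dots> = (\<integral>x. pmf (map_pmf (\<lambda>w. (X w, Y w)) p) x *\<^sub>R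
       ln (pmf (map_pmf (\<lambda>w. (X w, Y w)) p) x / (pmf (map_pmf X p) (fst x) * pmf (map_pmf Y p) (snd x))) \<partial>count_space UNIV)"
    unfolding CC by (intro Bochner_Integration.integral_cong refl) (auto simp: log_def)
  also have "\<dots> = measure_pmf.expectation (map_pmf (\<lambda>w. (X w, Y w)) p)
      (\<lambda>x. ln (pmf (map_pmf (\<lambda>w. (X w, Y w)) p) x / (pmf (map_pmf X p) (fst x) * pmf (map_pmf Y p) (snd x))))"
    unfolding measure_pmf_eq_density[of "map_pmf (\<lambda>w. (X w, Y w)) p"] by (subst integral_density) auto
  finally show ?thesis by (simp add: dens_def)
qed

lemma cond_mutual_info_dens:
  fixes X :: "'w \<Rightarrow> 'a::countable" and Y :: "'w \<Rightarrow> 'b::countable" and Z :: "'w \<Rightarrow> 'c::countable"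
  shows "cond_mutual_info p X Y Z = measure_pmf.expectation p (\<lambda>w. ln (dens p X (\<lambda>w. (Y w, Z w)) w)) -
     measure_pmf.expectation p (\<lambda>w. ln (dens p X Z w))"
proof -
  interpret information_space "measure_pmf p" "exp 1"
    by unfold_locales simp
  have CC: "count_space (UNIV :: 'b set) \<Otimes>\<^sub>M count_space (UNIV :: 'c set) = count_space UNIV"
    by (subst pair_measure_countable) auto
  show ?thesis
    unfolding cond_mutual_info_def prob_space.conditional_mutual_information_def[OF measure_pmf.prob_space_axioms] CC
      mutual_info_def[symmetric] mutual_info_dens ..
qed

lemma dens_pos: "w \<in> set_pmf p \<Longrightarrow> 0 < dens p X Y w"
  unfolding dens_def by (intro divide_pos_pos mult_pos_pos pmf_positive) auto

lemma dens_nonneg: "0 \<le> dens p X Y w"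
  unfolding dens_def by simp

lemma dens_commute: "dens p X Y w = dens p Y X w"
proof -
  have "map_pmf (\<lambda>w. (X w, Y w)) p = map_pmf prod.swap (map_pmf (\<lambda>w. (Y w, X w)) p)"
    by (simp add: map_pmf_comp)
  then have "pmf (map_pmf (\<lambda>w. (X w, Y w)) p) (X w, Y w) = pmf (map_pmf (\<lambda>w. (Y w, X w)) p) (Y w, X w)"
    using pmf_map_inj'[of prod.swap "map_pmf (\<lambda>w. (Y w, X w)) p" "(Y w, X w)"] by simp
  then show ?thesis by (simp add: dens_def mult.commute)
qed

lemma dens_map_pmf: "dens (map_pmf h p) X Y (h w) = dens p (X \<circ> h) (Y \<circ> h) w"
  by (simp add: dens_def map_pmf_comp o_def)

lemma dens_inj_right:
  assumes "inj \<iota>"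
  shows "dens p X (\<lambda>w. \<iota> (Y w)) w = dens p X Y w"
proof -
  have "map_pmf (\<lambda>w. (X w, \<iota> (Y w))) p = map_pmf (map_prod id \<iota>) (map_pmf (\<lambda>w. (X w, Y w)) p)"
    by (simp add: map_pmf_comp)
  then have 1: "pmf (map_pmf (\<lambda>w. (X w, \<iota> (Y w))) p) (X w, \<iota> (Y w)) = pmf (map_pmf (\<lambda>w. (X w, Y w)) p) (X w, Y w)"
    using pmf_map_inj'[of "map_prod id \<iota>" "map_pmf (\<lambda>w. (X w, Y w)) p" "(X w, Y w)"] assms
    by (simp add: prod.inj_map)
  have "map_pmf (\<lambda>w. \<iota> (Y w)) p = map_pmf \<iota> (map_pmf Y p)" by (simp add: map_pmf_comp)
  then have 2: "pmf (map_pmf (\<lambda>w. \<iota> (Y w)) p) (\<iota> (Y w)) = pmf (map_pmf Y p) (Y w)"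
    using pmf_map_inj'[OF assms] by metis
  show ?thesis unfolding dens_def 1 2 ..
qed

lemma dens_inj_left: "inj \<iota> \<Longrightarrow> dens p (\<lambda>w. \<iota> (X w)) Y w = dens p X Y w"
  by (metis dens_commute dens_inj_right)

lemma pmf_replicate: "pmf (replicate_pmf n p) xs = (if length xs = n then prod_list (map (pmf p) xs) else 0)"
proof (induction n arbitrary: xs)
  case 0
  then show ?case by (auto simp: indicator_def)
next
  case (Suc n)
  have 1: "replicate_pmf (Suc n) p = map_pmf (\<lambda>(x, xs). x # xs) (pair_pmf p (replicate_pmf n p))"
    by (simp add: pair_pmf_def map_bind_pmf)
  show ?case
  proof (cases xs)
    case Nil
    then show ?thesis by (simp add: 1 pmf_eq_0_set_pmf del: replicate_pmf.simps) auto
  next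
    case (Cons y ys)
    have "inj (\<lambda>(x :: 'a, xs). x # xs)" by (auto simp: inj_def)
    from pmf_map_inj'[OF this, of _ "(y, ys)"] show ?thesis
      by (simp add: 1 Cons pmf_pair Suc del: replicate_pmf.simps)
  qed
qed

lemma map_replicate_pmf: "map_pmf (map f) (replicate_pmf n p) = replicate_pmf n (map_pmf f p)"
proof (induction n)
  case (Suc n)
  show ?case by (simp add: map_bind_pmf bind_map_pmf Suc[symmetric])
qed simp

lemma inj_unzip: "inj (\<lambda>l. (map fst l, map snd l))"
  by (rule injI) (metis Pair_inject zip_map_fst_snd)

lemma prod_list_divide:
  fixes f g :: "'a \<Rightarrow> 'b::field"
  shows "prod_list (map (\<lambda>x. f x / g x) xs) = prod_list (map f xs) / prod_list (map g xs)"
  by (induction xs) auto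

lemma prod_list_mult:
  fixes f g :: "'a \<Rightarrow> 'b::comm_monoid_mult"
  shows "prod_list (map (\<lambda>x. f x * g x) xs) = prod_list (map f xs) * prod_list (map g xs)"
  by (induction xs) (auto simp: ac_simps)

lemma dens_replicate:
  assumes "length ws = n"
  shows "dens (replicate_pmf n p) (map X) (map Y) ws = prod_list (map (dens p X Y) ws)"
proof -
  have "map_pmf (\<lambda>ws. (map X ws, map Y ws)) (replicate_pmf n p) =
      map_pmf (\<lambda>l. (map fst l, map snd l)) (replicate_pmf n (map_pmf (\<lambda>w. (X w, Y w)) p))"
    by (simp add: map_replicate_pmf[symmetric] map_pmf_comp o_def)
  then have "pmf (map_pmf (\<lambda>ws. (map X ws, map Y ws)) (replicate_pmf n p)) (map X ws, map Y ws) =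
      pmf (replicate_pmf n (map_pmf (\<lambda>w. (X w, Y w)) p)) (map (\<lambda>w. (X w, Y w)) ws)"
    using pmf_map_inj'[OF inj_unzip, of "replicate_pmf n (map_pmf (\<lambda>w. (X w, Y w)) p)" "map (\<lambda>w. (X w, Y w)) ws"]
    by (simp add: o_def)
  then show ?thesis
    using assms unfolding dens_def map_replicate_pmf prod_list_divide prod_list_mult
    by (simp add: pmf_replicate o_def)
qed

lemma finite_set_replicate_pmf: "finite (set_pmf p) \<Longrightarrow> finite (set_pmf (replicate_pmf n p))"
  unfolding set_replicate_pmf using finite_lists_length_eq[of "set_pmf p" n]
  by (simp add: lists_eq_set)

lemma expectation_bind_finite:
  fixes f :: "'a \<Rightarrow> real"
  assumes "finite (set_pmf p)" "\<And>x. x \<in> set_pmf p \<Longrightarrow> finite (set_pmf (g x))"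
  shows "measure_pmf.expectation (bind_pmf p g) f = measure_pmf.expectation p (\<lambda>x. measure_pmf.expectation (g x) f)"
proof -
  have "measure_pmf.expectation p (\<lambda>x. measure_pmf.expectation (g x) f) =
     (\<Sum>x\<in>set_pmf p. pmf p x *\<^sub>R measure_pmf.expectation (g x) f)"
    by (rule integral_measure_pmf) (use assms in auto)
  then show ?thesis using pmf_expectation_bind[of "set_pmf p" g p f] assms by simp
qed

section \<open>Exponential bounds for products of densities\<close>

lemma expectation_replicate_prod:
  fixes g :: "'a \<Rightarrow> real"
  assumes "finite (set_pmf p)"
  shows "measure_pmf.expectation (replicate_pmf n p) (\<lambda>ws. prod_list (map g ws)) = measure_pmf.expectation p g ^ n"
proof (induction n)
  case (Suc n)
  have "measure_pmf.expectation (replicate_pmf (Suc n) p) (\<lambda>ws. prod_list (map g ws)) =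
     measure_pmf.expectation p (\<lambda>x. measure_pmf.expectation (replicate_pmf n p) (\<lambda>ws. g x * prod_list (map g ws)))"
    unfolding replicate_pmf.simps
    by (subst expectation_bind_finite; (simp add: assms finite_set_replicate_pmf)?)
       (subst expectation_bind_finite; simp add: assms finite_set_replicate_pmf)
  then show ?case by (simp add: Suc)
qed simp

text \<open>Chernoff bound: \<open>E r\<^sup>s \<le> exp (s I + s\<^sup>2 C\<^sup>2)\<close> when \<open>\<bar>ln r\<bar> \<le> C\<close> and \<open>I = E ln r\<close>.\<close>

lemma moment_exponent:
  fixes r :: "'a \<Rightarrow> real" and x :: real
  assumes fin: "finite (set_pmf p)" and pos: "\<And>w. w \<in> set_pmf p \<Longrightarrow> 0 < r w"
    and I: "measure_pmf.expectation p (\<lambda>w. ln (r w)) < x"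
  obtains s q where "0 < s" "s \<le> 1" "0 < q" "q < 1"
    "measure_pmf.expectation p (\<lambda>w. r w powr s) = exp (s * x) * q"
proof -
  define I where "I = measure_pmf.expectation p (\<lambda>w. ln (r w))"
  define C where "C = 1 + (\<Sum>w\<in>set_pmf p. \<bar>ln (r w)\<bar>)"
  have C: "\<bar>ln (r w)\<bar> \<le> C" if "w \<in> set_pmf p" for w
    using member_le_sum[of w "set_pmf p" "\<lambda>w. \<bar>ln (r w)\<bar>"] fin that unfolding C_def by auto
  have C1: "1 \<le> C" unfolding C_def by (simp add: sum_nonneg)
  \<comment> \<open>The bound 1 / C keeps the exponent s ln r in the range where exp y is at most 1
    + y + y squared. The other bound makes the quadratic term at most half of s (x - I).\<close>
  define s where "s = min (1 / C) ((x - I) / (2 * C\<^sup>2))"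
  have s: "0 < s" "s \<le> 1 / C" "s \<le> (x - I) / (2 * C\<^sup>2)" using I C1 unfolding s_def I_def by auto
  have "1 / C \<le> 1" using C1 by simp
  with s have s1: "s \<le> 1" by linarith
  have int: "integrable (measure_pmf p) f" for f :: "'a \<Rightarrow> real" by (rule integrable_measure_pmf_finite[OF fin])
  have "measure_pmf.expectation p (\<lambda>w. r w powr s) \<le> measure_pmf.expectation p (\<lambda>w. 1 + s * ln (r w) + (s * C)\<^sup>2)"
  proof (intro integral_mono_AE int AE_pmfI)
    fix w assume w: "w \<in> set_pmf p"
    have "\<bar>s * ln (r w)\<bar> \<le> s * C" using C[OF w] s by (simp add: abs_mult)
    moreover have "s * C \<le> 1" using s(2) C1 by (simp add: field_simps)
    ultimately have le: "\<bar>s * ln (r w)\<bar> \<le> 1" "(s * ln (r w))\<^sup>2 \<le> (s * C)\<^sup>2"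
      by (auto simp: abs_le_square_iff[symmetric] intro: order_trans)
    have "exp y \<le> 1 + y + y\<^sup>2" if "\<bar>y\<bar> \<le> 1" for y :: real
    proof (cases "0 \<le> y")
      case True then show ?thesis using exp_bound[of y] that by simp
    next
      case False
      have "exp y * (1 - y) \<le> exp y * exp (- y)" using exp_ge_add_one_self[of "-y"] by (intro mult_left_mono) auto
      then have "exp y \<le> 1 / (1 - y)" using False by (simp add: field_simps exp_minus)
      also have "\<dots> \<le> 1 + y + y\<^sup>2"
      proof -
        have "(1 + y + y\<^sup>2) * (1 - y) = 1 - y ^ 3" by (simp add: algebra_simps power2_eq_square power3_eq_cube)
        moreover have "y ^ 3 \<le> 0" using False by (simp add: power_le_zero_eq)
        ultimately show ?thesis using False by (simp add: divide_le_eq)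
      qed
      finally show ?thesis .
    qed
    from this[OF le(1)] le(2) pos[OF w] show "r w powr s \<le> 1 + s * ln (r w) + (s * C)\<^sup>2"
      by (simp add: powr_def)
  qed
  also have "\<dots> = 1 + s * I + (s * C)\<^sup>2" by (simp add: int I_def)
  also have "\<dots> \<le> exp (s * I + (s * C)\<^sup>2)" using exp_ge_add_one_self[of "s * I + (s * C)\<^sup>2"] by (simp only: add.assoc)
  also have "\<dots> < exp (s * x)"
  proof -
    have "s * C\<^sup>2 \<le> (x - I) / 2" using s(3) C1 by (simp add: field_simps)
    also have "\<dots> < x - I" using I unfolding I_def by simp
    finally have "s * (s * C\<^sup>2) < s * (x - I)" using s(1) by simp
    then show ?thesis by (simp add: algebra_simps power2_eq_square)
  qed
  finally have less: "measure_pmf.expectation p (\<lambda>w. r w powr s) < exp (s * x)" .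
  obtain w where w: "w \<in> set_pmf p" using set_pmf_not_empty[of p] by blast
  have "0 < measure_pmf.expectation p (\<lambda>w. r w powr s)"
    by (subst integral_measure_pmf_real[OF fin]) (use pos w fin in \<open>auto intro!: sum_pos2[of _ w] simp: pmf_positive less_imp_neq[symmetric]\<close>)
  then show ?thesis
    using less s(1) s1 by (intro that[of s "measure_pmf.expectation p (\<lambda>w. r w powr s) / exp (s * x)"]) auto
qed

lemma powr_prod_list:
  fixes r :: "'a \<Rightarrow> real"
  assumes "\<And>w. w \<in> set ws \<Longrightarrow> 0 < r w"
  shows "prod_list (map r ws) powr s = prod_list (map (\<lambda>w. r w powr s) ws)" "0 < prod_list (map r ws)"
  using assms by (induction ws) (auto simp: powr_mult less_imp_le)

text \<open>Lets a moment of small order control the expected logarithm in the covering bounds, so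
  that the Chernoff estimate \<open>moment_exponent\<close> applies to them.\<close>

lemma ln_add_one_le_powr:
  fixes x s :: real
  assumes "0 \<le> x" "0 < s" "s \<le> 1"
  shows "ln (1 + x) \<le> x powr s / s"
proof (cases "x \<le> 1")
  case True
  have "ln (1 + x) \<le> x" using assms by (simp add: ln_add_one_self_le_self)
  also have "\<dots> \<le> x powr s"
    using assms True powr_mono'[of s 1 x] by (cases "x = 0") auto
  also have "\<dots> \<le> x powr s / s" using assms by (simp add: le_divide_eq mult_left_le)
  finally show ?thesis .
next
  case False
  have "ln (1 + x) \<le> ln (2 * x)" using False by (intro ln_mono) auto
  also have "\<dots> = ln 2 + ln x" using False by (simp add: ln_mult)
  also have "\<dots> \<le> 1 / s + (x powr s - 1) / s"
  proof -
    have "ln x * s \<le> x powr s - 1"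
    proof -
      have "x powr s = exp (s * ln x)" using False by (simp add: powr_def)
      then show ?thesis using exp_ge_add_one_self[of "s * ln x"] unfolding mult.commute[of "ln x"] by linarith
    qed
    moreover have "ln 2 \<le> (1 :: real)" using ln_le_minus_one[of 2] by simp
    moreover have "1 \<le> 1 / s" using assms by simp
    ultimately show ?thesis using assms by (intro add_mono) (linarith, simp add: le_divide_eq)
  qed
  also have "\<dots> = x powr s / s" by (simp add: diff_divide_distrib)
  finally show ?thesis .
qed

text \<open>After \<open>ln_add_one_le_powr\<close> the moment of order \<open>s\<close> factorises
  over the letters, and its excess over exp(n s x) is \<open>q ^ n\<close>. The divisor 64 absorbs
  rounding: codebook sizes will be products of at most five integer parts, each of which loses at
  most a factor 2.\<close>

lemma covering_exponent:
  assumes fin: "finite (set_pmf p)" and I: "measure_pmf.expectation p (\<lambda>w. ln (dens p X Y w)) < x"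
  obtains C q where "0 \<le> C" "0 < q" "q < 1"
    "\<And>n L. exp (real n * x) / 64 \<le> L \<Longrightarrow>
       measure_pmf.expectation (replicate_pmf n p) (\<lambda>ws. ln (1 + dens (replicate_pmf n p) (map X) (map Y) ws / L)) \<le> C * q ^ n"
proof -
  obtain s q where s: "0 < s" "s \<le> 1" and q: "0 < q" "q < 1"
    and E: "measure_pmf.expectation p (\<lambda>w. dens p X Y w powr s) = exp (s * x) * q"
    using moment_exponent[OF fin dens_pos I] by metis
  show ?thesis
  proof (rule that[of "64 powr s / s" q])
    fix n :: nat and L :: real assume L: "exp (real n * x) / 64 \<le> L"
    have "0 < exp (real n * x) / 64" by simp
    with L have L0: "0 < L" by linarith
    let ?P = "replicate_pmf n p" and ?d = "dens (replicate_pmf n p) (map X) (map Y)"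
    have int: "integrable (measure_pmf ?P) f" for f :: "_ \<Rightarrow> real"
      by (rule integrable_measure_pmf_finite[OF finite_set_replicate_pmf[OF fin]])
    have len: "length ws = n" "set ws \<subseteq> set_pmf p" if "ws \<in> set_pmf ?P" for ws
      using that by (auto simp: set_replicate_pmf)
    have "measure_pmf.expectation ?P (\<lambda>ws. ln (1 + ?d ws / L)) \<le>
          measure_pmf.expectation ?P (\<lambda>ws. (1 / (L powr s * s)) * prod_list (map (\<lambda>w. dens p X Y w powr s) ws))"
    proof (intro integral_mono_AE int AE_pmfI)
      fix ws assume ws: "ws \<in> set_pmf ?P"
      have "ln (1 + ?d ws / L) \<le> (?d ws / L) powr s / s"
        using s L0 by (intro ln_add_one_le_powr) (auto simp: dens_nonneg)
      also have "\<dots> = (1 / (L powr s * s)) * (?d ws powr s)"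
        using L0 by (simp add: powr_divide dens_nonneg)
      also have "?d ws powr s = prod_list (map (\<lambda>w. dens p X Y w powr s) ws)"
        unfolding dens_replicate[OF len(1)[OF ws]] by (rule powr_prod_list) (meson len(2)[OF ws] dens_pos subsetD)
      finally show "ln (1 + ?d ws / L) \<le> (1 / (L powr s * s)) * prod_list (map (\<lambda>w. dens p X Y w powr s) ws)" .
    qed
    also have "\<dots> = (1 / (L powr s * s)) * (exp (s * x) * q) ^ n"
      using expectation_replicate_prod[OF fin, where n=n and g="\<lambda>w. dens p X Y w powr s"] by (simp add: E)
    also have "\<dots> \<le> (1 / ((exp (real n * x) / 64) powr s * s)) * (exp (s * x) * q) ^ n"
      using L L0 s q by (intro mult_right_mono divide_left_mono mult_right_mono powr_mono2) auto
    also have "(exp (real n * x) / 64) powr s = exp (s * x) ^ n / 64 powr s"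
      by (simp add: powr_divide exp_of_nat_mult[symmetric] powr_def[of "exp _"] ac_simps)
    also have "1 / (exp (s * x) ^ n / 64 powr s * s) * (exp (s * x) * q) ^ n = 64 powr s / s * q ^ n"
      by (simp add: power_mult_distrib)
    finally show "measure_pmf.expectation ?P (\<lambda>ws. ln (1 + ?d ws / L)) \<le> 64 powr s / s * q ^ n" .
  qed (use s q in auto)
qed

text \<open>The lower tail of the density is the upper tail of its reciprocal, whose mean logarithm
  lies below \<open>- g\<close>; so the same Chernoff estimate applies.\<close>

lemma packing_exponent:
  assumes fin: "finite (set_pmf p)" and I: "g < measure_pmf.expectation p (\<lambda>w. ln (dens p X Y w))"
  obtains q where "0 < q" "q < 1"
    "\<And>n. measure_pmf.prob (replicate_pmf n p) {ws. dens (replicate_pmf n p) (map X) (map Y) ws < exp (real n * g)} \<le> q ^ n"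
proof -
  have "measure_pmf.expectation p (\<lambda>w. ln (1 / dens p X Y w)) < - g"
  proof -
    have "measure_pmf.expectation p (\<lambda>w. ln (1 / dens p X Y w)) = measure_pmf.expectation p (\<lambda>w. - ln (dens p X Y w))"
      by (intro integral_cong_AE) (auto simp: AE_measure_pmf_iff ln_div dest: dens_pos[of _ _ X Y])
    then show ?thesis using I by simp
  qed
  from moment_exponent[OF fin _ this] dens_pos[of _ p X Y]
  obtain s q where s: "0 < s" "s \<le> 1" and q: "0 < q" "q < 1"
    and E: "measure_pmf.expectation p (\<lambda>w. (1 / dens p X Y w) powr s) = exp (s * (- g)) * q"
    by (metis zero_less_divide_1_iff)
  show ?thesis
  proof (rule that[OF q])
    fix n
    let ?P = "replicate_pmf n p" and ?d = "dens (replicate_pmf n p) (map X) (map Y)"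
    have int: "integrable (measure_pmf ?P) f" for f :: "_ \<Rightarrow> real"
      by (rule integrable_measure_pmf_finite[OF finite_set_replicate_pmf[OF fin]])
    have len: "length ws = n" "set ws \<subseteq> set_pmf p" if "ws \<in> set_pmf ?P" for ws
      using that by (auto simp: set_replicate_pmf)
    have "measure_pmf.prob ?P {ws. ?d ws < exp (real n * g)} = measure_pmf.expectation ?P (indicator {ws. ?d ws < exp (real n * g)})"
      by simp
    also have "\<dots> \<le> measure_pmf.expectation ?P (\<lambda>ws. exp (s * g) ^ n * prod_list (map (\<lambda>w. (1 / dens p X Y w) powr s) ws))"
    proof (intro integral_mono_AE int AE_pmfI)
      fix ws assume ws: "ws \<in> set_pmf ?P"
      have d: "?d ws = prod_list (map (dens p X Y) ws)" by (rule dens_replicate[OF len(1)[OF ws]])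
      have pos: "0 < prod_list (map (dens p X Y) ws)"
        by (rule powr_prod_list) (meson len(2)[OF ws] dens_pos subsetD)
      have "prod_list (map (\<lambda>w. (1 / dens p X Y w) powr s) ws) = prod_list (map (\<lambda>w. 1 / dens p X Y w) ws) powr s"
        by (rule powr_prod_list(1)[symmetric]) (metis len(2)[OF ws] dens_pos subsetD zero_less_divide_1_iff)
      also have "\<dots> = (1 / ?d ws) powr s" unfolding d prod_list_divide by (simp add: map_replicate_const)
      finally have "exp (s * g) ^ n * prod_list (map (\<lambda>w. (1 / dens p X Y w) powr s) ws) = (exp (real n * g) / ?d ws) powr s"
        using pos unfolding d by (simp add: powr_divide exp_of_nat_mult[symmetric] powr_def[of "exp _"] ac_simps)
      moreover have "1 \<le> (exp (real n * g) / ?d ws) powr s" if "?d ws < exp (real n * g)"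
        using that pos s unfolding d by (intro ge_one_powr_ge_zero) auto
      ultimately show "indicator {ws. ?d ws < exp (real n * g)} ws \<le> exp (s * g) ^ n * prod_list (map (\<lambda>w. (1 / dens p X Y w) powr s) ws)"
        by (auto simp: indicator_def)
    qed
    also have "\<dots> = exp (s * g) ^ n * (exp (s * (- g)) * q) ^ n"
      using expectation_replicate_prod[OF fin, where n=n and g="\<lambda>w. (1 / dens p X Y w) powr s"] by (simp add: E)
    also have "\<dots> = q ^ n" by (simp add: power_mult_distrib[symmetric] mult.assoc[symmetric] exp_add[symmetric])
    finally show "measure_pmf.prob ?P {ws. ?d ws < exp (real n * g)} \<le> q ^ n" .
  qed
qed

section \<open>Leakage of codes that are close to uniform\<close>

text \<open>Write p = (p - q) + q. On the first part ln (p / q) is at most ln N, on the second it is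
  at most p / q - 1.\<close>

lemma mult_ln_le:
  fixes p q N :: real
  assumes "0 < p" "0 < q" "p \<le> N * q" "1 \<le> N"
  shows "p * ln (p / q) \<le> (ln N + 1) * (if q < p then p - q else 0)"
proof (cases "q < p")
  case False
  then have "ln (p / q) \<le> 0" using assms by simp
  then have "p * ln (p / q) \<le> 0" using assms by (simp add: mult_nonneg_nonpos)
  with False show ?thesis by simp
next
  case True
  have "p * ln (p / q) = (p - q) * ln (p / q) + q * ln (p / q)" by (simp add: algebra_simps)
  also have "\<dots> \<le> (p - q) * ln N + q * (p / q - 1)"
  proof (rule add_mono; rule mult_left_mono)
    show "ln (p / q) \<le> ln N" using assms by (intro ln_mono) (auto simp: field_simps)
    show "ln (p / q) \<le> p / q - 1" using assms by (intro ln_le_minus_one) auto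
  qed (use True assms in auto)
  also have "\<dots> = (ln N + 1) * (p - q)" using assms by (simp add: algebra_simps)
  finally show ?thesis using True by simp
qed

text \<open>A joint probability is at most the marginal probability of the \<open>Y\<close> value,
  hence at most \<open>card M\<close> times the product probability, because \<open>X\<close> is
  uniform on \<open>M\<close>. With this bound on the ratio, \<open>mult_ln_le\<close> makes the
  leakage linear in the distance. The factor 2 pays for replacing \<open>Q\<close> by the true
  marginal of \<open>Y\<close>.\<close>

lemma mutual_info_le_of_close:
  fixes X :: "'w \<Rightarrow> 'a::countable" and Y :: "'w \<Rightarrow> 'b::countable"
  assumes fin: "finite (set_pmf p)" and M: "finite M" "M \<noteq> {}"
    and cl: "close \<epsilon> (map_pmf (\<lambda>w. (X w, Y w)) p) (pair_pmf (pmf_of_set M) Q)"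
    and X: "map_pmf X p = pmf_of_set M"
  shows "mutual_info p X Y \<le> 2 * \<epsilon> * (ln (real (card M)) + 1)"
proof -
  define N where "N = real (card M)"
  have N: "1 \<le> N" using M unfolding N_def by (simp add: Suc_le_eq card_gt_0_iff)
  define P where "P = map_pmf (\<lambda>w. (X w, Y w)) p"
  define R where "R = map_pmf Y p"
  define U where "U = pair_pmf (pmf_of_set M) R"
  have PR: "map_pmf snd P = R" and PM: "map_pmf fst P = pmf_of_set M"
    unfolding P_def R_def X[symmetric] by (simp_all add: map_pmf_comp)
  define S where "S = set_pmf P"
  have finS: "finite S" unfolding S_def P_def using fin by simp
  define A where "A = {x. pmf U x < pmf P x}"
  have le: "pmf P x \<le> pmf R (snd x)" for x
  proof -
    have "pmf R (snd x) = measure_pmf.prob P (snd -` {snd x})" unfolding PR[symmetric] by (simp add: pmf_map)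
    moreover have "measure_pmf.prob P {x} \<le> measure_pmf.prob P (snd -` {snd x})"
      by (rule measure_pmf.finite_measure_mono) auto
    ultimately show ?thesis by (simp add: measure_pmf_single)
  qed
  have U: "pmf U x = pmf R (snd x) / N" if "x \<in> S" for x
  proof -
    have "fst x \<in> set_pmf (map_pmf fst P)" using that unfolding S_def by simp
    then have "fst x \<in> M" unfolding PM using M by simp
    then show ?thesis unfolding U_def N_def using M by (cases x) (simp add: pmf_pair)
  qed
  have mi: "mutual_info p X Y = (\<Sum>x\<in>S. pmf P x * ln (pmf P x / pmf U x))"
  proof -
    have "mutual_info p X Y = measure_pmf.expectation P (\<lambda>x. ln (pmf P x / pmf U x))"
      unfolding mutual_info_dens dens_def P_def U_def R_def X by (simp add: pmf_pair)
    also have "\<dots> = (\<Sum>x\<in>S. pmf P x *\<^sub>R ln (pmf P x / pmf U x))"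
      by (rule integral_measure_pmf) (use finS in \<open>auto simp: S_def\<close>)
    finally show ?thesis by simp
  qed
  also have "\<dots> \<le> (\<Sum>x\<in>S. (ln N + 1) * (if pmf U x < pmf P x then pmf P x - pmf U x else 0))"
  proof (rule sum_mono)
    fix x assume x: "x \<in> S"
    have p: "0 < pmf P x" using x unfolding S_def by (simp add: pmf_positive)
    then have "0 < pmf R (snd x)" using le[of x] by linarith
    then show "pmf P x * ln (pmf P x / pmf U x) \<le> (ln N + 1) * (if pmf U x < pmf P x then pmf P x - pmf U x else 0)"
      using p le[of x] N U[OF x] by (intro mult_ln_le) auto
  qed
  also have "\<dots> = (ln N + 1) * (\<Sum>x\<in>S \<inter> A. pmf P x - pmf U x)"
    unfolding A_def sum_distrib_left[symmetric] by (simp add: sum.If_cases finS Int_def)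
  finally have main: "mutual_info p X Y \<le> (ln N + 1) * (\<Sum>x\<in>S \<inter> A. pmf P x - pmf U x)" .
  have "(\<Sum>x\<in>S \<inter> A. pmf P x - pmf U x) = measure_pmf.prob P (S \<inter> A) - measure_pmf.prob U (S \<inter> A)"
    using finS by (simp add: sum_subtractf measure_measure_pmf_finite)
  also have "\<dots> \<le> 2 * \<epsilon>"
  proof -
    have "close \<epsilon> R Q"
      using close_map[OF cl, of snd] unfolding P_def[symmetric] PR map_snd_pair_pmf .
    then have "close \<epsilon> (pair_pmf (pmf_of_set M) Q) U"
      unfolding U_def pair_pmf_def by (rule close_bind_cong[OF close_bind[OF close_sym]])
    then have "close (\<epsilon> + \<epsilon>) P U" using cl unfolding P_def[symmetric] by (rule close_trans[rotated])
    from close_prob[OF this, of "S \<inter> A"] show ?thesis by simp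
  qed
  finally have "(\<Sum>x\<in>S \<inter> A. pmf P x - pmf U x) \<le> 2 * \<epsilon>" .
  then have "(ln N + 1) * (\<Sum>x\<in>S \<inter> A. pmf P x - pmf U x) \<le> (ln N + 1) * (2 * \<epsilon>)"
    using N by (intro mult_left_mono) auto
  with main show ?thesis unfolding N_def by (simp only: mult.commute)
qed

lemma finite_channel_run:
  fixes W :: "('x1, 'x2, 'y1::finite, 'y2::finite, 'z::finite) channel"
  shows "finite (set_pmf (channel_run W f1 f2 n))"
  by (induction n) (auto simp: case_prod_unfold)

lemma map_eavesdropper_law:
  "map_pmf (\<lambda>(m1, m2, zs). (m1, m2)) (eavesdropper_law W n T1 T2) = pair_pmf (pmf_of_set (msgs T1)) (pmf_of_set (msgs T2))"
  unfolding eavesdropper_law_def pair_pmf_def map_bind_pmf map_pmf_comp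
  by (simp add: case_prod_unfold)

lemma finite_eavesdropper_law:
  fixes W :: "('x1, 'x2, 'y1, 'y2, 'z::finite) channel"
  assumes "finite (msgs T1)" "msgs T1 \<noteq> {}" "finite (msgs T2)" "msgs T2 \<noteq> {}"
  shows "finite (set_pmf (eavesdropper_law W n T1 T2))"
proof (rule finite_subset)
  show "set_pmf (eavesdropper_law W n T1 T2) \<subseteq> msgs T1 \<times> msgs T2 \<times> {zs. set zs \<subseteq> UNIV \<and> length zs = n}"
    using assms by (auto simp: eavesdropper_law_def transmission_def dest!: channel_run_support)
  show "finite (msgs T1 \<times> msgs T2 \<times> {zs :: 'z list. set zs \<subseteq> UNIV \<and> length zs = n})"
    using assms by (intro finite_cartesian_product finite_lists_length_eq) auto
qed

definition leak :: "bool \<Rightarrow> ('x1, 'x2, 'y1, 'y2, 'z) channel \<Rightarrow> nat \<Rightarrow> ('x1, 'y1) terminal \<Rightarrow> ('x2, 'y2) terminal \<Rightarrow> real" where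
  "leak b W n T1 T2 = (if b
     then mutual_info (eavesdropper_law W n T1 T2) (\<lambda>(m1, m2, zs). (m1, m2)) (\<lambda>(m1, m2, zs). zs)
     else max (mutual_info (eavesdropper_law W n T1 T2) (\<lambda>(m1, m2, zs). m1) (\<lambda>(m1, m2, zs). zs))
              (mutual_info (eavesdropper_law W n T1 T2) (\<lambda>(m1, m2, zs). m2) (\<lambda>(m1, m2, zs). zs)))"

lemma scode_leak:
  fixes W :: "('x1, 'x2, 'y1, 'y2, 'z::finite) channel"
  assumes "scode b W n N1 1 N2 1 \<epsilon>" "1 \<le> n"
  obtains T1 T2 where
    "adaptive_code n (ln (real N1) / real n) (ln (real N2) / real n) T1 T2"
    "error_prob W n T1 T2 \<le> \<epsilon>"
    "leak b W n T1 T2 \<le> 2 * \<epsilon> * (ln (real N1) + ln (real N2) + 1)"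
proof -
  have N: "0 < N1" "0 < N2" using scode_positive[OF assms(1)] by auto
  have eps: "0 \<le> \<epsilon>" using assms(1) unfolding scode_def by (meson measure_nonneg order_trans)
  obtain T1 :: "('x1,'y1) terminal" and T2 :: "('x2,'y2) terminal" and M1 M2 Q1 Q2
  where T: "finite M1" "card M1 = N1" "M1 \<noteq> {}" "finite M2" "card M2 = N2" "M2 \<noteq> {}"
    "msgs T1 = M1" "msgs T2 = M2"
    "adaptive_code n (ln (real N1) / real n) (ln (real N2) / real n) T1 T2"
    "error_prob W n T1 T2 \<le> \<epsilon>"
    "close \<epsilon> (map_pmf (\<lambda>(m1, m2, z). (m1, hide b m2, z)) (eavesdropper_law W n T1 T2))
       (pair_pmf (pmf_of_set M1) (pair_pmf (map_pmf (hide b) (pmf_of_set M2)) Q1))"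
    "close \<epsilon> (map_pmf (\<lambda>(m1, m2, z). (m2, z)) (eavesdropper_law W n T1 T2)) (pair_pmf (pmf_of_set M2) Q2)"
    using scode_terminals[OF assms] by metis
  let ?p = "eavesdropper_law W n T1 T2"
  have fin: "finite (set_pmf ?p)" by (rule finite_eavesdropper_law) (use T in auto)
  have M12: "map_pmf (\<lambda>(m1, m2, zs). (m1, m2)) ?p = pmf_of_set (M1 \<times> M2)"
    using map_eavesdropper_law[of W n T1 T2] T by (simp add: pair_pmf_of_set)
  have M1: "map_pmf (\<lambda>(m1, m2, zs). m1) ?p = pmf_of_set M1"
  proof -
    have "map_pmf (\<lambda>(m1, m2, zs). m1) ?p = map_pmf fst (map_pmf (\<lambda>(m1, m2, zs). (m1, m2)) ?p)"
      by (simp add: map_pmf_comp case_prod_unfold)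
    then show ?thesis unfolding map_eavesdropper_law map_fst_pair_pmf T(7) .
  qed
  have M2: "map_pmf (\<lambda>(m1, m2, zs). m2) ?p = pmf_of_set M2"
  proof -
    have "map_pmf (\<lambda>(m1, m2, zs). m2) ?p = map_pmf snd (map_pmf (\<lambda>(m1, m2, zs). (m1, m2)) ?p)"
      by (simp add: map_pmf_comp case_prod_unfold)
    then show ?thesis unfolding map_eavesdropper_law map_snd_pair_pmf T(8) .
  qed
  have "leak b W n T1 T2 \<le> 2 * \<epsilon> * (ln (real N1) + ln (real N2) + 1)"
  proof (cases b)
    case True
    have hide: "hide b = id" using True by (auto simp: fun_eq_iff hide_def)
    then have "close \<epsilon> (map_pmf (\<lambda>w. ((\<lambda>(m1, m2, zs). (m1, m2)) w, (\<lambda>(m1, m2, zs). zs) w)) ?p) (pair_pmf (pmf_of_set (M1 \<times> M2)) Q1)"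
      using close_map[OF T(11), of "\<lambda>(m1, m2, z). ((m1, m2), z)"] True T
      by (simp add: map_pmf_comp case_prod_unfold hide pair_pmf_of_set[symmetric] pair_pair_pmf pmf.map_id)
    from mutual_info_le_of_close[OF fin _ _ this M12] T
    have "leak b W n T1 T2 \<le> 2 * \<epsilon> * (ln (real (N1 * N2)) + 1)"
      using True by (simp add: leak_def card_cartesian_product)
    then show ?thesis using N by (simp add: ln_mult)
  next
    case False
    have "close \<epsilon> (map_pmf (\<lambda>w. ((\<lambda>(m1, m2, zs). m1) w, (\<lambda>(m1, m2, zs). zs) w)) ?p) (pair_pmf (pmf_of_set M1) Q1)"
    proof -
      have "map_pmf (\<lambda>(m1, m2, z). (m1, z)) (pair_pmf p (pair_pmf q r)) = pair_pmf p r"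
        for p :: "nat pmf" and q :: "nat pmf" and r :: "'z list pmf"
        by (simp add: pair_pmf_def map_bind_pmf bind_assoc_pmf bind_return_pmf)
      then show ?thesis
        using close_map[OF T(11), of "\<lambda>(m1, m2, z). (m1, z)"] by (simp add: map_pmf_comp case_prod_unfold)
    qed
    from mutual_info_le_of_close[OF fin T(1,3) this M1]
    have 1: "mutual_info ?p (\<lambda>(m1, m2, zs). m1) (\<lambda>(m1, m2, zs). zs) \<le> 2 * \<epsilon> * (ln (real N1) + 1)" using T by simp
    have "close \<epsilon> (map_pmf (\<lambda>w. ((\<lambda>(m1, m2, zs). m2) w, (\<lambda>(m1, m2, zs). zs) w)) ?p) (pair_pmf (pmf_of_set M2) Q2)"
      using T(12) by (simp add: case_prod_unfold)
    from mutual_info_le_of_close[OF fin T(4,6) this M2]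
    have 2: "mutual_info ?p (\<lambda>(m1, m2, zs). m2) (\<lambda>(m1, m2, zs). zs) \<le> 2 * \<epsilon> * (ln (real N2) + 1)" using T by simp
    have "2 * \<epsilon> * (ln (real N1) + 1) \<le> 2 * \<epsilon> * (ln (real N1) + ln (real N2) + 1)"
      "2 * \<epsilon> * (ln (real N2) + 1) \<le> 2 * \<epsilon> * (ln (real N1) + ln (real N2) + 1)"
      using eps N by (intro mult_left_mono; simp)+
    with 1 2 False show ?thesis by (simp add: leak_def)
  qed
  with T(9,10) show ?thesis by (rule that)
qed

section \<open>Asymptotic achievability\<close>

text \<open>The error is \<open>o(1/n)\<close> because the leakage is at most the error times the logarithm of the number of messages.\<close>

definition ach :: "bool \<Rightarrow> ('x1,'x2,'y1,'y2,'z) channel \<Rightarrow> real \<Rightarrow> real \<Rightarrow> bool" where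
  "ach b W R1 R2 \<longleftrightarrow> (\<forall>\<delta>>0. \<forall>\<^sub>F n in sequentially. \<exists>N1 N2. scode b W n N1 1 N2 1 (\<delta> / real n) \<and>
     \<bar>ln (real N1) / real n - R1\<bar> \<le> \<delta> \<and> \<bar>ln (real N2) / real n - R2\<bar> \<le> \<delta>)"

text \<open>At each \<open>n\<close> a candidate within 1 / (n + 1) of the infimum is chosen. The
  infima tend to 0 by assumption, so one sequence serves all tolerances at once.\<close>

lemma exists_choice_tendsto_zero:
  fixes g :: "nat \<Rightarrow> 'c \<Rightarrow> real"
  assumes "\<And>\<delta>. 0 < \<delta> \<Longrightarrow> \<forall>\<^sub>F n in sequentially. \<exists>c. V n c \<and> g n c \<le> \<delta>"
    and V: "\<And>n. \<exists>c. V n c" and nonneg: "\<And>n c. V n c \<Longrightarrow> 0 \<le> g n c"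
  obtains c where "\<And>n. V n (c n)" "(\<lambda>n. g n (c n)) \<longlonglongrightarrow> 0"
proof -
  define h where "h n = Inf (g n ` {c. V n c})" for n
  have bdd: "bdd_below (g n ` {c. V n c})" for n using nonneg by (intro bdd_belowI[of _ 0]) auto
  have "\<exists>c. V n c \<and> g n c < h n + 1 / real (Suc n)" for n
    using V[of n] cInf_lessD[of "g n ` {c. V n c}" "h n + 1 / real (Suc n)"] unfolding h_def by auto
  then obtain c where c: "\<And>n. V n (c n)" "\<And>n. g n (c n) < h n + 1 / real (Suc n)" by metis
  have h: "\<forall>\<^sub>F n in sequentially. h n \<le> \<delta>" if "0 < \<delta>" for \<delta>
    using assms(1)[OF that]
  proof eventually_elim
    case (elim n)
    then obtain c where "V n c" "g n c \<le> \<delta>" by blast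
    then show ?case unfolding h_def by (intro cInf_lower2[OF _ _ bdd]) auto
  qed
  have "(\<lambda>n. g n (c n)) \<longlonglongrightarrow> 0"
  proof (rule LIMSEQ_I)
    fix r :: real assume "0 < r"
    have "\<forall>\<^sub>F n in sequentially. 1 / real (Suc n) < r / 2"
      using LIMSEQ_inverse_real_of_nat \<open>0 < r\<close> by (intro order_tendstoD(2)[of _ 0]) (auto simp: inverse_eq_divide)
    then have "\<forall>\<^sub>F n in sequentially. norm (g n (c n) - 0) < r"
      using h[OF half_gt_zero[OF \<open>0 < r\<close>]]
    proof eventually_elim
      case (elim n)
      then show ?case using c(2)[of n] nonneg[OF c(1)[of n]] by simp
    qed
    then show "\<exists>no. \<forall>n\<ge>no. norm (g n (c n) - 0) < r" by (simp add: eventually_sequentially)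
  qed
  with c(1) show ?thesis by (rule that)
qed

lemma ach_terminals:
  fixes W :: "('x1, 'x2, 'y1, 'y2, 'z::finite) channel"
  assumes "ach b W R1 R2"
  obtains r1 r2 T1 T2 \<epsilon> where "r1 \<longlonglongrightarrow> R1" "r2 \<longlonglongrightarrow> R2" "\<epsilon> \<longlonglongrightarrow> 0"
    "\<And>n. 1 \<le> n \<Longrightarrow> adaptive_code n (r1 n) (r2 n) (T1 n) (T2 n) \<and> error_prob W n (T1 n) (T2 n) \<le> \<epsilon> n \<and> leak b W n (T1 n) (T2 n) \<le> \<epsilon> n"
proof -
  define V where "V n = (\<lambda>(r1, r2, T1 :: ('x1,'y1) terminal, T2 :: ('x2,'y2) terminal). 1 \<le> n \<longrightarrow> adaptive_code n r1 r2 T1 T2)"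
    for n :: nat
  \<comment> \<open>Truncating error and leakage at 0 makes all four terms nonnegative; the infimum
    then exists, and each term tends to 0 when the sum does.\<close>
  define g where "g n = (\<lambda>(r1, r2, T1, T2). \<bar>r1 - R1\<bar> + \<bar>r2 - R2\<bar> + max 0 (error_prob W n T1 T2) + max 0 (leak b W n T1 T2))" for n
  have ex: "\<exists>c. V n c" for n
  proof (cases "1 \<le> n")
    case True
    obtain T1 :: "('x1,'y1) terminal" and T2 :: "('x2,'y2) terminal"
      where "adaptive_code n (ln (real 1) / real n) (ln (real 1) / real n) T1 T2"
      by (rule scode_leak[OF scode_trivial[of b W n] True]) blast
    then show ?thesis unfolding V_def by auto
  qed (auto simp: V_def)
  have g0: "0 \<le> g n c" for n c unfolding g_def by (auto split: prod.splits)
  have small: "\<forall>\<^sub>F n in sequentially. \<exists>c. V n c \<and> g n c \<le> \<delta>" if "0 < \<delta>" for \<delta>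
  proof -
    \<comment> \<open>The denominator collects the bounds below: \<eta> once each for the two rates
      and the error, and 2 \<eta> (|R1| + |R2| + 3) for the leakage, where each normalised
      log-cardinality is at most its limit plus 1 and 1 / n is at most 1.\<close>
    define \<eta> where "\<eta> = min 1 (\<delta> / (2 * (\<bar>R1\<bar> + \<bar>R2\<bar> + 3) + 3))"
    have den: "0 < 2 * (\<bar>R1\<bar> + \<bar>R2\<bar> + 3) + 3" by (intro add_pos_pos mult_pos_pos add_nonneg_pos) auto
    have \<eta>: "0 < \<eta>" "\<eta> \<le> 1" using that den unfolding \<eta>_def by auto
    have "\<eta> \<le> \<delta> / (2 * (\<bar>R1\<bar> + \<bar>R2\<bar> + 3) + 3)" unfolding \<eta>_def by simp
    then have \<eta>': "\<eta> * (2 * (\<bar>R1\<bar> + \<bar>R2\<bar> + 3) + 3) \<le> \<delta>" using den by (simp add: pos_le_divide_eq)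
    have "\<forall>\<^sub>F n in sequentially. \<exists>N1 N2. scode b W n N1 1 N2 1 (\<eta> / real n) \<and>
     \<bar>ln (real N1) / real n - R1\<bar> \<le> \<eta> \<and> \<bar>ln (real N2) / real n - R2\<bar> \<le> \<eta>"
      using assms \<eta>(1) unfolding ach_def by blast
    then show ?thesis using eventually_ge_at_top[of 1]
    proof eventually_elim
      case (elim n)
      then obtain N1 N2 where N: "scode b W n N1 1 N2 1 (\<eta> / real n)"
        "\<bar>ln (real N1) / real n - R1\<bar> \<le> \<eta>" "\<bar>ln (real N2) / real n - R2\<bar> \<le> \<eta>" by blast
      obtain T1 :: "('x1,'y1) terminal" and T2 :: "('x2,'y2) terminal" where
        T: "adaptive_code n (ln (real N1) / real n) (ln (real N2) / real n) T1 T2"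
          "error_prob W n T1 T2 \<le> \<eta> / real n"
          "leak b W n T1 T2 \<le> 2 * (\<eta> / real n) * (ln (real N1) + ln (real N2) + 1)"
        by (rule scode_leak[OF N(1) elim(2)]) blast
      have n: "0 < real n" "1 \<le> real n" using elim(2) by auto
      have e: "\<eta> / real n \<le> \<eta>" using n \<eta> by (simp add: divide_le_eq)
      have "2 * (\<eta> / real n) * (ln (real N1) + ln (real N2) + 1) =
          2 * \<eta> * (ln (real N1) / real n + ln (real N2) / real n + 1 / real n)" using n by (simp add: field_simps)
      also have "\<dots> \<le> 2 * \<eta> * (\<bar>R1\<bar> + \<bar>R2\<bar> + 3)"
      proof -
        have "1 / real n \<le> 1" using n by simp
        then show ?thesis using N(2,3) \<eta> by (intro mult_left_mono) auto
      qed
      finally have l: "leak b W n T1 T2 \<le> 2 * \<eta> * (\<bar>R1\<bar> + \<bar>R2\<bar> + 3)" using T(3) by linarith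
      have l0: "0 \<le> 2 * \<eta> * (\<bar>R1\<bar> + \<bar>R2\<bar> + 3)" using \<eta> by simp
      have "max 0 (error_prob W n T1 T2) \<le> \<eta>" "max 0 (leak b W n T1 T2) \<le> 2 * \<eta> * (\<bar>R1\<bar> + \<bar>R2\<bar> + 3)"
        using T(2) e l l0 \<eta> by auto
      then have "g n (ln (real N1) / real n, ln (real N2) / real n, T1, T2) \<le> \<eta> + \<eta> + \<eta> + 2 * \<eta> * (\<bar>R1\<bar> + \<bar>R2\<bar> + 3)"
        using N(2,3) unfolding g_def prod.case by linarith
      also have "\<dots> \<le> \<delta>" using \<eta>' by (simp add: algebra_simps)
      finally show ?case using T(1) by (intro exI[of _ "(ln (real N1) / real n, ln (real N2) / real n, T1, T2)"]) (simp add: V_def)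
    qed
  qed
  obtain c where c: "\<And>n. V n (c n)" "(\<lambda>n. g n (c n)) \<longlonglongrightarrow> 0"
    by (rule exists_choice_tendsto_zero[OF small ex g0]) (assumption, rule that)
  define r1 where "r1 n = fst (c n)" for n
  define r2 where "r2 n = fst (snd (c n))" for n
  define T1 where "T1 n = fst (snd (snd (c n)))" for n
  define T2 where "T2 n = snd (snd (snd (c n)))" for n
  have c': "c n = (r1 n, r2 n, T1 n, T2 n)" for n by (simp add: r1_def r2_def T1_def T2_def)
  have g: "\<bar>r1 n - R1\<bar> + \<bar>r2 n - R2\<bar> + max 0 (error_prob W n (T1 n) (T2 n)) + max 0 (leak b W n (T1 n) (T2 n)) = g n (c n)" for n
    by (simp add: g_def c')
  have "(\<lambda>n. r1 n - R1) \<longlonglongrightarrow> 0" "(\<lambda>n. r2 n - R2) \<longlonglongrightarrow> 0"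
    unfolding g[symmetric] by (rule Lim_null_comparison[OF always_eventually c(2)[unfolded g[symmetric]]]; simp add: add_nonneg_nonneg)+
  then have lim: "r1 \<longlonglongrightarrow> R1" "r2 \<longlonglongrightarrow> R2" by (simp_all add: LIM_zero_iff)
  have "adaptive_code n (r1 n) (r2 n) (T1 n) (T2 n) \<and> error_prob W n (T1 n) (T2 n) \<le> g n (c n) \<and> leak b W n (T1 n) (T2 n) \<le> g n (c n)"
    if "1 \<le> n" for n
  proof (intro conjI)
    show "adaptive_code n (r1 n) (r2 n) (T1 n) (T2 n)" using c(1)[of n] that by (simp add: V_def c')
    show "error_prob W n (T1 n) (T2 n) \<le> g n (c n)" "leak b W n (T1 n) (T2 n) \<le> g n (c n)"
      unfolding g[symmetric] by simp_all
  qed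
  with lim c(2) show ?thesis by (rule that)
qed

lemma ach_achievable_joint:
  fixes W :: "('x1, 'x2, 'y1, 'y2, 'z::finite) channel"
  assumes "ach True W R1 R2" shows "achievable_joint W R1 R2"
proof -
  obtain r1 r2 and T1 :: "nat \<Rightarrow> ('x1,'y1) terminal" and T2 :: "nat \<Rightarrow> ('x2,'y2) terminal" and \<epsilon>
    where "r1 \<longlonglongrightarrow> R1" "r2 \<longlonglongrightarrow> R2" "\<epsilon> \<longlonglongrightarrow> 0"
      "\<And>n. 1 \<le> n \<Longrightarrow> adaptive_code n (r1 n) (r2 n) (T1 n) (T2 n) \<and> error_prob W n (T1 n) (T2 n) \<le> \<epsilon> n \<and> leak True W n (T1 n) (T2 n) \<le> \<epsilon> n"
    by (rule ach_terminals[OF assms]) (rule that)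
  then show ?thesis
    unfolding achievable_joint_def leak_def
    by (intro exI[of _ r1] exI[of _ r2] exI[of _ T1] exI[of _ T2] exI[of _ \<epsilon>]) simp
qed

lemma ach_achievable_individual:
  fixes W :: "('x1, 'x2, 'y1, 'y2, 'z::finite) channel"
  assumes "ach False W R1 R2" shows "achievable_individual W R1 R2"
proof -
  obtain r1 r2 and T1 :: "nat \<Rightarrow> ('x1,'y1) terminal" and T2 :: "nat \<Rightarrow> ('x2,'y2) terminal" and \<epsilon>
    where "r1 \<longlonglongrightarrow> R1" "r2 \<longlonglongrightarrow> R2" "\<epsilon> \<longlonglongrightarrow> 0"
      "\<And>n. 1 \<le> n \<Longrightarrow> adaptive_code n (r1 n) (r2 n) (T1 n) (T2 n) \<and> error_prob W n (T1 n) (T2 n) \<le> \<epsilon> n \<and> leak False W n (T1 n) (T2 n) \<le> \<epsilon> n"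
    by (rule ach_terminals[OF assms]) (rule that)
  then show ?thesis
    unfolding achievable_individual_def leak_def
    by (intro exI[of _ r1] exI[of _ r2] exI[of _ T1] exI[of _ T2] exI[of _ \<epsilon>]) simp
qed

section \<open>One-shot random coding\<close>

abbreviation E :: "'a pmf \<Rightarrow> ('a \<Rightarrow> real) \<Rightarrow> real" where
  "E p f \<equiv> measure_pmf.expectation p f"

lemma E_mono:
  assumes "finite (set_pmf p)" "\<And>x. x \<in> set_pmf p \<Longrightarrow> f x \<le> g x"
  shows "E p f \<le> E p g"
  using assms by (intro integral_mono_AE integrable_measure_pmf_finite) (auto simp: AE_measure_pmf_iff)

lemma E_cong:
  assumes "\<And>x. x \<in> set_pmf p \<Longrightarrow> f x = g x"
  shows "E p f = E p g"
  using assms by (intro integral_cong_AE) (auto simp: AE_measure_pmf_iff)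

lemma E_add: "finite (set_pmf p) \<Longrightarrow> E p (\<lambda>x. f x + g x) = E p f + E p g"
  by (intro Bochner_Integration.integral_add integrable_measure_pmf_finite)

lemma E_diff: "finite (set_pmf p) \<Longrightarrow> E p (\<lambda>x. f x - g x) = E p f - E p g"
  by (intro Bochner_Integration.integral_diff integrable_measure_pmf_finite)

lemma E_sum: "finite (set_pmf p) \<Longrightarrow> E p (\<lambda>x. \<Sum>i\<in>I. f i x) = (\<Sum>i\<in>I. E p (f i))"
  by (intro Bochner_Integration.integral_sum integrable_measure_pmf_finite)

lemma E_swap:
  assumes "finite (set_pmf p)" "finite (set_pmf q)"
  shows "E p (\<lambda>x. E q (f x)) = E q (\<lambda>y. E p (\<lambda>x. f x y))"
  using assms by (simp add: integral_measure_pmf_real[of "set_pmf p"] integral_measure_pmf_real[of "set_pmf q"]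
      sum_distrib_left sum_distrib_right sum.swap[of _ "set_pmf p"] ac_simps)

lemma E_nonneg: "(\<And>x. x \<in> set_pmf p \<Longrightarrow> 0 \<le> f x) \<Longrightarrow> 0 \<le> E p f"
  by (intro integral_nonneg_AE) (auto simp: AE_measure_pmf_iff)

definition codebook :: "'j set \<Rightarrow> 'a pmf \<Rightarrow> ('j \<Rightarrow> 'a) pmf" where
  "codebook J p = Pi_pmf J undefined (\<lambda>_. p)"

lemma codebook_component: "finite J \<Longrightarrow> u \<in> J \<Longrightarrow> map_pmf (\<lambda>c. c u) (codebook J p) = p"
  unfolding codebook_def by (simp add: Pi_pmf_component)

lemma codebook_pair:
  assumes "finite J" "u \<in> J" "u' \<in> J" "u \<noteq> u'"
  shows "map_pmf (\<lambda>c. (c u, c u')) (codebook J p) = pair_pmf p p"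
proof -
  have J: "J = insert u (J - {u})" using assms by auto
  have "codebook J p = map_pmf (\<lambda>(y, f). f(u := y)) (pair_pmf p (codebook (J - {u}) p))"
    unfolding codebook_def by (subst J, subst Pi_pmf_insert) (use assms in auto)
  then have "map_pmf (\<lambda>c. (c u, c u')) (codebook J p) = map_pmf (\<lambda>(y, f). (y, f u')) (pair_pmf p (codebook (J - {u}) p))"
    using assms by (simp add: map_pmf_comp case_prod_unfold)
  also have "\<dots> = pair_pmf p (map_pmf (\<lambda>f. f u') (codebook (J - {u}) p))"
    by (simp add: map_pair[of "\<lambda>x. x", simplified])
  also have "\<dots> = pair_pmf p p" using assms by (simp add: codebook_component)
  finally show ?thesis .
qed

lemma codebook_mem: "finite J \<Longrightarrow> c \<in> set_pmf (codebook J p) \<Longrightarrow> u \<in> J \<Longrightarrow> c u \<in> set_pmf p"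
  unfolding codebook_def by (auto simp: set_Pi_pmf PiE_dflt_def)

lemma finite_codebook: "finite J \<Longrightarrow> finite (set_pmf p) \<Longrightarrow> finite (set_pmf (codebook J p))"
  unfolding codebook_def by (auto simp: set_Pi_pmf intro!: finite_PiE_dflt)

lemma E_codebook: "finite J \<Longrightarrow> u \<in> J \<Longrightarrow> E (codebook J p) (\<lambda>c. h (c u)) = E p h"
  using integral_map_pmf[of "\<lambda>c. c u" "codebook J p" h] by (simp add: codebook_component)

text \<open>On the diagonal the same codeword occurs twice; every other pair of codewords is
  independent. The number of off-diagonal terms is enlarged from \<open>card U - 1\<close> to
  \<open>card U\<close>, which is allowed since \<open>F\<close> is nonnegative and keeps later
  products simple.\<close>

lemma E_codebook_sum_le:
  assumes J: "finite J" "U \<subseteq> J" "u \<in> U" and fin: "finite (set_pmf p)"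
    and nonneg: "\<And>a a'. a \<in> set_pmf p \<Longrightarrow> a' \<in> set_pmf p \<Longrightarrow> 0 \<le> F a a'"
  shows "E (codebook J p) (\<lambda>c. \<Sum>u'\<in>U. F (c u) (c u')) \<le>
     E p (\<lambda>a. F a a) + real (card U) * E p (\<lambda>a. E p (F a))"
proof -
  have finU: "finite U" using J finite_subset by blast
  have pair: "E (codebook J p) (\<lambda>c. F (c u) (c u')) = E p (\<lambda>a. E p (F a))" if "u' \<in> U - {u}" for u'
  proof -
    have "E (codebook J p) (\<lambda>c. F (c u) (c u')) = E (map_pmf (\<lambda>c. (c u, c u')) (codebook J p)) (\<lambda>(a, a'). F a a')"
      by simp
    also have "\<dots> = E (pair_pmf p p) (\<lambda>(a, a'). F a a')"
      by (subst codebook_pair) (use J that in auto)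
    also have "\<dots> = E p (\<lambda>a. E p (F a))"
      unfolding pair_pmf_def by (subst expectation_bind_finite, (simp add: fin)+)
         (subst expectation_bind_finite, simp_all add: fin)
    finally show ?thesis .
  qed
  have nn: "0 \<le> E p (\<lambda>a. E p (F a))" by (intro E_nonneg nonneg)
  have "E (codebook J p) (\<lambda>c. \<Sum>u'\<in>U. F (c u) (c u')) = (\<Sum>u'\<in>U. E (codebook J p) (\<lambda>c. F (c u) (c u')))"
    by (rule E_sum) (use J fin finite_codebook in auto)
  also have "\<dots> = E (codebook J p) (\<lambda>c. F (c u) (c u)) + (\<Sum>u'\<in>U - {u}. E (codebook J p) (\<lambda>c. F (c u) (c u')))"
    by (rule sum.remove) (use J finU in auto)
  also have "(\<Sum>u'\<in>U - {u}. E (codebook J p) (\<lambda>c. F (c u) (c u'))) = (\<Sum>u'\<in>U - {u}. E p (\<lambda>a. E p (F a)))"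
    by (rule sum.cong) (auto intro: pair)
  also have "\<dots> = real (card (U - {u})) * E p (\<lambda>a. E p (F a))" by simp
  also have "\<dots> \<le> real (card U) * E p (\<lambda>a. E p (F a))"
    using nn finU by (intro mult_right_mono) (auto intro: card_mono)
  also have "E (codebook J p) (\<lambda>c. F (c u) (c u)) = E p (\<lambda>a. F a a)"
    by (rule E_codebook) (use J in auto)
  finally show ?thesis by simp
qed

text \<open>A pointwise form of Pinsker's inequality: the difference factors through the square
  roots, the squared difference of the roots is below the divergence term, and the product is split
  by the arithmetic-geometric mean inequality. Being linear in the divergence, the bound can be
  averaged over codebooks directly; \<open>t\<close> is tuned afterwards.\<close>

lemma abs_diff_le_divergence:
  fixes p q t :: real
  assumes "0 \<le> p" "0 < q" "0 < t"
  shows "\<bar>p - q\<bar> \<le> (p * ln (p / q) - p + q) / (2 * t) + t * (p + q)"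
proof -
  define a where "a = sqrt p" define b where "b = sqrt q"
  have ab: "p = a\<^sup>2" "q = b\<^sup>2" "0 \<le> a" "0 < b" using assms by (auto simp: a_def b_def)
  have div: "(a - b)\<^sup>2 \<le> p * ln (p / q) - p + q"
  proof (cases "a = 0")
    case True then show ?thesis using ab by simp
  next
    case False
    then have a: "0 < a" using ab by simp
    have "ln (b / a) \<le> b / a - 1" using a ab by (intro ln_le_minus_one) auto
    then have "2 * p * ln (b / a) \<le> 2 * p * (b / a - 1)" using assms by (intro mult_left_mono) auto
    moreover have "2 * p * (b / a - 1) = 2 * a * b - 2 * p" using a ab by (simp add: field_simps power2_eq_square)
    moreover have "2 * p * ln (b / a) = - (p * ln (p / q))"
      using a ab by (simp add: ln_div ln_realpow algebra_simps)
    ultimately show ?thesis using ab by (simp add: power2_diff)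
  qed
  have "\<bar>p - q\<bar> = \<bar>a - b\<bar> * (a + b)"
    using ab by (simp add: power2_eq_square square_diff_square_factored abs_mult ac_simps)
  also have "\<dots> \<le> (a - b)\<^sup>2 / (2 * t) + t * (a + b)\<^sup>2 / 2"
  proof -
    have "(\<bar>a - b\<bar> - t * (a + b))\<^sup>2 = (a - b)\<^sup>2 + t\<^sup>2 * (a + b)\<^sup>2 - 2 * t * (\<bar>a - b\<bar> * (a + b))"
      unfolding power2_diff[of "\<bar>a - b\<bar>"] power_mult_distrib power2_abs by simp
    then have "2 * t * (\<bar>a - b\<bar> * (a + b)) \<le> (a - b)\<^sup>2 + t\<^sup>2 * (a + b)\<^sup>2"
      using zero_le_power2[of "\<bar>a - b\<bar> - t * (a + b)"] by linarith
    then have "\<bar>a - b\<bar> * (a + b) \<le> ((a - b)\<^sup>2 + t\<^sup>2 * (a + b)\<^sup>2) / (2 * t)"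
      using assms by (simp add: pos_le_divide_eq ac_simps)
    then show ?thesis using assms by (simp add: add_divide_distrib power2_eq_square)
  qed
  also have "\<dots> \<le> (p * ln (p / q) - p + q) / (2 * t) + t * (p + q)"
  proof (rule add_mono)
    show "(a - b)\<^sup>2 / (2 * t) \<le> (p * ln (p / q) - p + q) / (2 * t)" using div assms by (intro divide_right_mono) auto
    have "(a + b)\<^sup>2 \<le> 2 * (p + q)"
      using zero_le_power2[of "a - b"] ab by (simp add: power2_sum power2_diff)
    then show "t * (a + b)\<^sup>2 / 2 \<le> t * (p + q)" using assms by simp
  qed
  finally show ?thesis .
qed

definition l1_dist :: "'z set \<Rightarrow> 'z pmf \<Rightarrow> 'z pmf \<Rightarrow> real" where
  "l1_dist S p q = (\<Sum>z\<in>S. \<bar>pmf p z - pmf q z\<bar>)"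

lemma close_l1_dist:
  assumes "finite S" "set_pmf p \<subseteq> S" "set_pmf q \<subseteq> S"
  shows "close (l1_dist S p q) p q"
proof (rule closeI)
  fix f :: "'a \<Rightarrow> real" assume f: "\<And>x. 0 \<le> f x" "\<And>x. f x \<le> 1"
  have "E p f = (\<Sum>z\<in>S. pmf p z * f z)"
    using assms by (subst integral_measure_pmf_real[of S]) (auto simp: ac_simps)
  also have "\<dots> \<le> (\<Sum>z\<in>S. pmf q z * f z + \<bar>pmf p z - pmf q z\<bar>)"
  proof (rule sum_mono)
    fix z
    have "(pmf p z - pmf q z) * f z \<le> \<bar>pmf p z - pmf q z\<bar> * 1"
      using f by (intro mult_mono) auto
    then show "pmf p z * f z \<le> pmf q z * f z + \<bar>pmf p z - pmf q z\<bar>" by (simp add: algebra_simps)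
  qed
  also have "\<dots> = E q f + l1_dist S p q"
    using assms by (subst integral_measure_pmf_real[of S]) (auto simp: ac_simps sum.distrib l1_dist_def)
  finally show "E p f \<le> E q f + l1_dist S p q" .
qed

lemma pmf_bind_E: "pmf (bind_pmf p f) z = E p (\<lambda>x. pmf (f x) z)"
  by (rule pmf_bind)

text \<open>The tangent of the logarithm at the conditional mean \<open>\<mu>\<close> of the induced output probability
  replaces Jensen's inequality, so that only pairwise independence of codewords is used.\<close>

lemma soft_covering:
  fixes p1 :: "'a pmf" and p2 :: "'b pmf" and \<omega> :: "'a \<Rightarrow> 'b \<Rightarrow> 'z pmf"
  assumes fin: "finite (set_pmf p1)" "finite (set_pmf p2)"
      "\<And>a b. a \<in> set_pmf p1 \<Longrightarrow> b \<in> set_pmf p2 \<Longrightarrow> finite (set_pmf (\<omega> a b))"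
    and J: "finite J1" "finite J2" "U1 \<subseteq> J1" "U1 \<noteq> {}" "U2 \<subseteq> J2" "U2 \<noteq> {}" and t: "0 < t"
  defines "Q \<equiv> bind_pmf p1 (\<lambda>a. bind_pmf p2 (\<omega> a))"
    and "L1 \<equiv> real (card U1)" and "L2 \<equiv> real (card U2)"
    and "\<mu> \<equiv> \<lambda>a b z. pmf (\<omega> a b) z / (real (card U1) * real (card U2)) + pmf (bind_pmf p2 (\<omega> a)) z / real (card U1) +
       pmf (bind_pmf p1 (\<lambda>a. \<omega> a b)) z / real (card U2) + pmf (bind_pmf p1 (\<lambda>a. bind_pmf p2 (\<omega> a))) z"
  shows "E (codebook J1 p1) (\<lambda>c1. E (codebook J2 p2) (\<lambda>c2. l1_dist (set_pmf Q)
      (bind_pmf (pmf_of_set U1) (\<lambda>u1. bind_pmf (pmf_of_set U2) (\<lambda>u2. \<omega> (c1 u1) (c2 u2)))) Q)) \<le>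
    E p1 (\<lambda>a. E p2 (\<lambda>b. E (\<omega> a b) (\<lambda>z. ln (\<mu> a b z / pmf Q z)))) / (2 * t) + 2 * t"
proof -
  define C1 where "C1 = codebook J1 p1"
  define C2 where "C2 = codebook J2 p2"
  define P where "P c1 c2 = bind_pmf (pmf_of_set U1) (\<lambda>u1. bind_pmf (pmf_of_set U2) (\<lambda>u2. \<omega> (c1 u1) (c2 u2)))" for c1 c2
  define w where "w a b z = pmf (\<omega> a b) z" for a b z
  define w1 where "w1 a z = E p2 (\<lambda>b. w a b z)" for a z
  define w2 where "w2 b z = E p1 (\<lambda>a. w a b z)" for b z
  define q where "q z = pmf Q z" for z
  define S where "S = set_pmf Q"
  have finU: "finite U1" "finite U2" using J finite_subset by blast+
  have L: "1 \<le> L1" "1 \<le> L2" unfolding L1_def L2_def using finU J by (auto simp: Suc_le_eq card_gt_0_iff)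
  have finC: "finite (set_pmf C1)" "finite (set_pmf C2)" unfolding C1_def C2_def using finite_codebook[OF J(1) fin(1)] finite_codebook[OF J(2) fin(2)] by auto
  have q1: "q z = E p1 (\<lambda>a. w1 a z)" and q2: "q z = E p2 (\<lambda>b. w2 b z)" for z
  proof -
    show "q z = E p1 (\<lambda>a. w1 a z)" unfolding q_def Q_def w1_def w_def pmf_bind_E ..
    then show "q z = E p2 (\<lambda>b. w2 b z)" unfolding w1_def w2_def by (subst E_swap[OF fin(2,1)]) simp
  qed
  have \<mu>: "\<mu> a b z = w a b z / (L1 * L2) + w1 a z / L1 + w2 b z / L2 + q z" for a b z
    unfolding \<mu>_def w_def w1_def w2_def q_def Q_def L1_def L2_def pmf_bind_E ..
  have w0: "0 \<le> w a b z" "0 \<le> w1 a z" "0 \<le> w2 b z" "0 \<le> q z" for a b z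
    unfolding w_def w1_def w2_def q_def by (auto intro: E_nonneg)
  have qpos: "0 < q z" if "z \<in> S" for z using that unfolding q_def S_def by (simp add: pmf_positive)
  have \<mu>pos: "0 < \<mu> a b z" if "z \<in> S" for a b z
    unfolding \<mu> using w0 qpos[OF that] L by (intro add_nonneg_pos add_nonneg_nonneg divide_nonneg_nonneg) auto
  have finS: "finite S" unfolding S_def Q_def using fin by auto
  have P: "pmf (P c1 c2) z = (\<Sum>u1\<in>U1. \<Sum>u2\<in>U2. w (c1 u1) (c2 u2) z) / (L1 * L2)" for c1 c2 z
    unfolding P_def pmf_bind_E w_def L1_def L2_def using finU J
    by (simp add: expectation_pmf_of_set sum_divide_distrib[symmetric] mult.commute)
  have subS: "set_pmf (\<omega> a b) \<subseteq> S" if "a \<in> set_pmf p1" "b \<in> set_pmf p2" for a b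
    using that unfolding S_def Q_def by auto
  have mem: "c1 u1 \<in> set_pmf p1" "c2 u2 \<in> set_pmf p2"
    if "c1 \<in> set_pmf C1" "c2 \<in> set_pmf C2" "u1 \<in> U1" "u2 \<in> U2" for c1 c2 u1 u2
    using codebook_mem[OF J(1) that(1)[unfolded C1_def] subsetD[OF J(3) that(3)]]
      codebook_mem[OF J(2) that(2)[unfolded C2_def] subsetD[OF J(5) that(4)]] by auto
  have sumS: "(\<Sum>z\<in>S. pmf (P c1 c2) z) = 1" if "c1 \<in> set_pmf C1" "c2 \<in> set_pmf C2" for c1 c2
  proof (rule sum_pmf_eq_1[OF finS])
    show "set_pmf (P c1 c2) \<subseteq> S"
      unfolding P_def set_bind_pmf set_pmf_of_set[OF J(4) finU(1)] set_pmf_of_set[OF J(6) finU(2)]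
      by (intro UN_least subS mem(1)[OF that] mem(2)[OF that])
  qed
  have sumQ: "(\<Sum>z\<in>S. q z) = 1" unfolding q_def S_def by (rule sum_pmf_eq_1) (use finS S_def in auto)
  define KL where "KL c1 c2 = (\<Sum>z\<in>S. pmf (P c1 c2) z * ln (pmf (P c1 c2) z / q z))" for c1 c2
  define D where "D = E p1 (\<lambda>a. E p2 (\<lambda>b. \<Sum>z\<in>S. w a b z * ln (\<mu> a b z / q z)))"

  \<comment> \<open>Given the codewords at \<open>u1\<close> and \<open>u2\<close>, the mean of the
    induced output probability is at most \<mu>: its four terms come from index pairs that agree
    with (u1, u2) in both, the first, the second or no component. Weighting by w / \<mu> then leaves
    the mean of w, which is \<open>q z\<close>.\<close>
  have key: "E C1 (\<lambda>c1. E C2 (\<lambda>c2. w (c1 u1) (c2 u2) z / \<mu> (c1 u1) (c2 u2) z * pmf (P c1 c2) z)) \<le> q z"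
    if u: "u1 \<in> U1" "u2 \<in> U2" and z: "z \<in> S" for u1 u2 z
  proof -
    define \<phi> where "\<phi> a b = w a b z / \<mu> a b z" for a b
    have \<phi>0: "0 \<le> \<phi> a b" for a b unfolding \<phi>_def using w0 \<mu>pos[OF z] by (simp add: less_imp_le)
    define H where "H a a' = E p2 (\<lambda>b. \<phi> a b * w a' b z) + L2 * E p2 (\<lambda>b. \<phi> a b * w1 a' z)" for a a'
    have inner: "E C2 (\<lambda>c2. \<Sum>u2'\<in>U2. \<phi> a (c2 u2) * w a' (c2 u2') z) \<le> H a a'" for a a'
    proof -
      have "E C2 (\<lambda>c2. \<Sum>u2'\<in>U2. \<phi> a (c2 u2) * w a' (c2 u2') z) \<le>
          E p2 (\<lambda>b. \<phi> a b * w a' b z) + real (card U2) * E p2 (\<lambda>b. E p2 (\<lambda>b'. \<phi> a b * w a' b' z))"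
        unfolding C2_def by (rule E_codebook_sum_le) (use J u fin \<phi>0 w0 in auto)
      then show ?thesis unfolding H_def L2_def by (simp add: w1_def)
    qed
    have EH: "E p1 (H a) = E p2 (\<lambda>b. \<phi> a b * w2 b z) + L2 * E p2 (\<lambda>b. \<phi> a b * q z)" for a
      unfolding H_def by (simp add: E_add[OF fin(1)] E_swap[OF fin(1,2)] w2_def q1)
    have "E C1 (\<lambda>c1. E C2 (\<lambda>c2. \<phi> (c1 u1) (c2 u2) * (L1 * L2 * pmf (P c1 c2) z))) =
        E C1 (\<lambda>c1. \<Sum>u1'\<in>U1. E C2 (\<lambda>c2. \<Sum>u2'\<in>U2. \<phi> (c1 u1) (c2 u2) * w (c1 u1') (c2 u2') z))"
    proof -
      have "L1 * L2 * pmf (P c1 c2) z = (\<Sum>u1\<in>U1. \<Sum>u2\<in>U2. w (c1 u1) (c2 u2) z)" for c1 c2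
        unfolding P using L by simp
      then show ?thesis by (simp only: sum_distrib_left E_sum[OF finC(2)])
    qed
    also have "\<dots> \<le> E C1 (\<lambda>c1. \<Sum>u1'\<in>U1. H (c1 u1) (c1 u1'))"
      by (intro E_mono finC sum_mono inner)
    also have "\<dots> \<le> E p1 (\<lambda>a. H a a) + real (card U1) * E p1 (\<lambda>a. E p1 (H a))"
      unfolding C1_def by (rule E_codebook_sum_le)
        (use J u fin \<phi>0 w0 L in \<open>auto simp: H_def intro!: add_nonneg_nonneg mult_nonneg_nonneg E_nonneg\<close>)
    also have "\<dots> =
        E p1 (\<lambda>a. E p2 (\<lambda>b. \<phi> a b * (L1 * L2 * \<mu> a b z)))"
    proof -
      have "L1 * L2 * \<mu> a b z = w a b z + L2 * w1 a z + L1 * w2 b z + L1 * L2 * q z" for a b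
        unfolding \<mu> using L by (simp add: field_simps)
      then have "E p1 (\<lambda>a. E p2 (\<lambda>b. \<phi> a b * (L1 * L2 * \<mu> a b z))) =
          E p1 (\<lambda>a. E p2 (\<lambda>b. \<phi> a b * w a b z + L2 * (\<phi> a b * w1 a z) + L1 * (\<phi> a b * w2 b z) + L1 * L2 * (\<phi> a b * q z)))"
        by (simp add: algebra_simps)
      also have "\<dots> = E p1 (\<lambda>a. E p2 (\<lambda>b. \<phi> a b * w a b z) + L2 * E p2 (\<lambda>b. \<phi> a b * w1 a z) + L1 * E p2 (\<lambda>b. \<phi> a b * w2 b z)
            + L1 * L2 * E p2 (\<lambda>b. \<phi> a b * q z))"
        by (simp only: E_add[OF fin(2)] integral_mult_right_zero)
      finally show ?thesis
        unfolding EH unfolding H_def L1_def[symmetric] by (simp only: E_add[OF fin(1)] integral_mult_right_zero) (simp add: algebra_simps)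
    qed
    also have "\<dots> = E p1 (\<lambda>a. E p2 (\<lambda>b. L1 * L2 * w a b z))"
      unfolding \<phi>_def using \<mu>pos[OF z] by (simp add: less_imp_neq[symmetric])
    also have "\<dots> = L1 * L2 * q z" by (simp add: q1 w1_def)
    finally have "L1 * L2 * E C1 (\<lambda>c1. E C2 (\<lambda>c2. \<phi> (c1 u1) (c2 u2) * pmf (P c1 c2) z)) \<le> L1 * L2 * q z"
      by (simp add: mult.left_commute[of _ "L1 * L2"])
    then show ?thesis using L unfolding \<phi>_def by simp
  qed

  \<comment> \<open>The tangent inequality at \<mu>. Its correction is linear in the random
    probability \<open>pmf (P c1 c2) z\<close>, and \<open>key\<close> shows that it is nonpositive
    on average.\<close>
  have pointwise: "w a b z * ln (pmf (P c1 c2) z / q z) \<le> w a b z * ln (\<mu> a b z / q z) + w a b z / \<mu> a b z * pmf (P c1 c2) z - w a b z"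
    if "z \<in> S" "w a b z > 0 \<longrightarrow> pmf (P c1 c2) z > 0" for a b z c1 c2
  proof (cases "w a b z = 0")
    case False
    then have pos: "0 < w a b z" "0 < pmf (P c1 c2) z" using w0(1)[of a b z] that(2) by linarith+
    have m: "0 < \<mu> a b z" and "0 < q z" using \<mu>pos qpos that by auto
    have "ln (pmf (P c1 c2) z / q z) = ln (\<mu> a b z / q z) + ln (pmf (P c1 c2) z / \<mu> a b z)"
      using pos m \<open>0 < q z\<close> by (simp add: ln_div)
    also have "\<dots> \<le> ln (\<mu> a b z / q z) + (pmf (P c1 c2) z / \<mu> a b z - 1)"
      using pos m by (intro add_left_mono ln_le_minus_one) auto
    finally have "w a b z * ln (pmf (P c1 c2) z / q z) \<le> w a b z * (ln (\<mu> a b z / q z) + (pmf (P c1 c2) z / \<mu> a b z - 1))"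
      using pos by (intro mult_left_mono) auto
    then show ?thesis by (simp add: algebra_simps)
  qed simp

  have KL: "E C1 (\<lambda>c1. E C2 (KL c1)) \<le> D"
  proof -
    define T where "T u1 u2 z c1 c2 = w (c1 u1) (c2 u2) z * ln (\<mu> (c1 u1) (c2 u2) z / q z) +
        w (c1 u1) (c2 u2) z / \<mu> (c1 u1) (c2 u2) z * pmf (P c1 c2) z - w (c1 u1) (c2 u2) z" for u1 u2 z c1 c2
    have "KL c1 c2 \<le> (\<Sum>u1\<in>U1. \<Sum>u2\<in>U2. \<Sum>z\<in>S. T u1 u2 z c1 c2) / (L1 * L2)"
      if c: "c1 \<in> set_pmf C1" "c2 \<in> set_pmf C2" for c1 c2
    proof -
      have "KL c1 c2 = (\<Sum>z\<in>S. \<Sum>u1\<in>U1. \<Sum>u2\<in>U2. w (c1 u1) (c2 u2) z * ln (pmf (P c1 c2) z / q z)) / (L1 * L2)"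
        unfolding KL_def by (subst (1) P) (simp add: sum_distrib_right sum_divide_distrib)
      also have "(\<Sum>z\<in>S. \<Sum>u1\<in>U1. \<Sum>u2\<in>U2. w (c1 u1) (c2 u2) z * ln (pmf (P c1 c2) z / q z)) \<le>
          (\<Sum>z\<in>S. \<Sum>u1\<in>U1. \<Sum>u2\<in>U2. T u1 u2 z c1 c2)"
      proof (intro sum_mono)
        fix z u1 u2 assume z: "z \<in> S" and u: "u1 \<in> U1" "u2 \<in> U2"
        have "pmf (P c1 c2) z > 0" if "w (c1 u1) (c2 u2) z > 0"
        proof -
          have "w (c1 u1) (c2 u2) z \<le> (\<Sum>u1\<in>U1. \<Sum>u2\<in>U2. w (c1 u1) (c2 u2) z)"
            using member_le_sum[OF u(2), of "\<lambda>u2. w (c1 u1) (c2 u2) z"]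
              member_le_sum[OF u(1), of "\<lambda>u1. \<Sum>u2\<in>U2. w (c1 u1) (c2 u2) z"] w0 finU
            by (smt (verit, best) sum_nonneg)
          then show ?thesis unfolding P using that L by (intro divide_pos_pos) auto
        qed
        then show "w (c1 u1) (c2 u2) z * ln (pmf (P c1 c2) z / q z) \<le> T u1 u2 z c1 c2"
          unfolding T_def by (intro pointwise z) auto
      qed
      also have "(\<Sum>z\<in>S. \<Sum>u1\<in>U1. \<Sum>u2\<in>U2. T u1 u2 z c1 c2) = (\<Sum>u1\<in>U1. \<Sum>u2\<in>U2. \<Sum>z\<in>S. T u1 u2 z c1 c2)"
        by (subst sum.swap, intro sum.cong refl, subst sum.swap) simp
      finally show ?thesis using L by (simp add: divide_right_mono)
    qed
    then have "E C1 (\<lambda>c1. E C2 (KL c1)) \<le> E C1 (\<lambda>c1. E C2 (\<lambda>c2. (\<Sum>u1\<in>U1. \<Sum>u2\<in>U2. \<Sum>z\<in>S. T u1 u2 z c1 c2) / (L1 * L2)))"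
      by (intro E_mono finC)
    also have "\<dots> = (\<Sum>u1\<in>U1. \<Sum>u2\<in>U2. \<Sum>z\<in>S. E C1 (\<lambda>c1. E C2 (T u1 u2 z c1))) / (L1 * L2)"
      by (simp add: E_sum finC)
    also have "\<dots> \<le> (\<Sum>u1\<in>U1. \<Sum>u2\<in>U2. D) / (L1 * L2)"
    proof (intro divide_right_mono sum_mono)
      fix u1 u2 assume u: "u1 \<in> U1" "u2 \<in> U2"
      have uJ: "u1 \<in> J1" "u2 \<in> J2" using u J by auto
      have EE: "E C1 (\<lambda>c1. E C2 (\<lambda>c2. h (c1 u1) (c2 u2))) = E p1 (\<lambda>a. E p2 (h a))" for h
        unfolding C1_def C2_def by (simp add: E_codebook[OF J(2) uJ(2)] E_codebook[OF J(1) uJ(1), of _ "\<lambda>a. E p2 (h a)"])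
      have "(\<Sum>z\<in>S. E C1 (\<lambda>c1. E C2 (T u1 u2 z c1))) = (\<Sum>z\<in>S. E p1 (\<lambda>a. E p2 (\<lambda>b. w a b z * ln (\<mu> a b z / q z)))
          + E C1 (\<lambda>c1. E C2 (\<lambda>c2. w (c1 u1) (c2 u2) z / \<mu> (c1 u1) (c2 u2) z * pmf (P c1 c2) z)) - q z)"
        unfolding T_def
        by (simp only: E_add[OF finC(1)] E_add[OF finC(2)] E_diff[OF finC(1)] E_diff[OF finC(2)] q1 w1_def
            EE[symmetric, of "\<lambda>a b. w a b _"] EE[symmetric, of "\<lambda>a b. w a b _ * ln (\<mu> a b _ / _)"])
      also have "\<dots> \<le> (\<Sum>z\<in>S. E p1 (\<lambda>a. E p2 (\<lambda>b. w a b z * ln (\<mu> a b z / q z))))"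
        using key[OF u] by (intro sum_mono) simp
      also have "\<dots> = D" unfolding D_def by (simp add: E_sum fin)
      finally show "(\<Sum>z\<in>S. E C1 (\<lambda>c1. E C2 (T u1 u2 z c1))) \<le> D" .
    qed (use L in auto)
    also have "\<dots> = D" using L unfolding L1_def L2_def by simp
    finally show ?thesis .
  qed

  have "E C1 (\<lambda>c1. E C2 (\<lambda>c2. l1_dist S (P c1 c2) Q)) \<le> E C1 (\<lambda>c1. E C2 (\<lambda>c2. KL c1 c2 / (2 * t) + 2 * t))"
  proof (intro E_mono finC)
    fix c1 c2 assume c: "c1 \<in> set_pmf C1" "c2 \<in> set_pmf C2"
    have "l1_dist S (P c1 c2) Q \<le> (\<Sum>z\<in>S. (pmf (P c1 c2) z * ln (pmf (P c1 c2) z / q z) - pmf (P c1 c2) z + q z) / (2 * t)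
        + t * (pmf (P c1 c2) z + q z))"
      unfolding l1_dist_def q_def[symmetric] using qpos t by (intro sum_mono abs_diff_le_divergence) auto
    also have "\<dots> = KL c1 c2 / (2 * t) + 2 * t"
      unfolding sum.distrib sum_divide_distrib[symmetric] sum_distrib_left[symmetric] sum_subtractf sumS[OF c] sumQ KL_def by simp
    finally show "l1_dist S (P c1 c2) Q \<le> KL c1 c2 / (2 * t) + 2 * t" .
  qed
  also have "\<dots> = E C1 (\<lambda>c1. E C2 (KL c1)) / (2 * t) + 2 * t"
    by (simp add: E_add finC)
  also have "\<dots> \<le> D / (2 * t) + 2 * t" using KL t by (intro add_right_mono divide_right_mono) auto
  also have "D = E p1 (\<lambda>a. E p2 (\<lambda>b. E (\<omega> a b) (\<lambda>z. ln (\<mu> a b z / pmf Q z))))"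
    unfolding D_def
  proof (intro E_cong)
    fix a b assume "a \<in> set_pmf p1" "b \<in> set_pmf p2"
    then show "(\<Sum>z\<in>S. w a b z * ln (\<mu> a b z / q z)) = E (\<omega> a b) (\<lambda>z. ln (\<mu> a b z / pmf Q z))"
      using subS[of a b] finS by (subst integral_measure_pmf_real[of S]) (auto simp: w_def q_def ac_simps)
  qed
  finally show ?thesis unfolding C1_def C2_def P_def S_def .
qed

definition joint :: "'a pmf \<Rightarrow> 'b pmf \<Rightarrow> ('a \<Rightarrow> 'b \<Rightarrow> 'r pmf) \<Rightarrow> ('a \<times> 'b \<times> 'r) pmf" where
  "joint p1 p2 \<kappa> = bind_pmf p1 (\<lambda>a. bind_pmf p2 (\<lambda>b. map_pmf (\<lambda>r. (a, b, r)) (\<kappa> a b)))"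

lemma E_bind_finite:
  assumes "finite (set_pmf p)" "\<And>x. x \<in> set_pmf p \<Longrightarrow> finite (set_pmf (g x))"
  shows "E (bind_pmf p g) f = E p (\<lambda>x. E (g x) f)"
  by (rule expectation_bind_finite[OF assms])

lemma E_joint:
  assumes "finite (set_pmf p1)" "finite (set_pmf p2)"
    "\<And>a b. a \<in> set_pmf p1 \<Longrightarrow> b \<in> set_pmf p2 \<Longrightarrow> finite (set_pmf (\<kappa> a b))"
  shows "E (joint p1 p2 \<kappa>) (\<lambda>(a, b, r). f a b r) = E p1 (\<lambda>a. E p2 (\<lambda>b. E (\<kappa> a b) (f a b)))"
  unfolding joint_def
  by (subst E_bind_finite, (use assms in auto)[2], rule E_cong, subst E_bind_finite) (use assms in auto)

lemma finite_joint:
  assumes "finite (set_pmf p1)" "finite (set_pmf p2)"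
    "\<And>a b. a \<in> set_pmf p1 \<Longrightarrow> b \<in> set_pmf p2 \<Longrightarrow> finite (set_pmf (\<kappa> a b))"
  shows "finite (set_pmf (joint p1 p2 \<kappa>))"
  using assms unfolding joint_def by auto

lemma map_joint_fst: "map_pmf (\<lambda>(a, b, r). a) (joint p1 p2 \<kappa>) = p1"
  unfolding joint_def by (simp add: map_bind_pmf map_pmf_comp bind_return_pmf')

lemma joint_swap: "joint p2 p1 (\<lambda>b a. \<kappa> a b) = map_pmf (\<lambda>(a, b, r). (b, a, r)) (joint p1 p2 \<kappa>)"
  unfolding joint_def by (subst bind_commute_pmf) (simp add: map_bind_pmf map_pmf_comp)

lemma pmf_bind_Pair: "pmf (bind_pmf p (\<lambda>x. map_pmf (Pair x) (f x))) (x, y) = pmf p x * pmf (f x) y"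
proof -
  have "pmf (map_pmf (Pair x') (f x')) (x, y) = indicator {x} x' * pmf (f x) y" for x'
  proof (cases "x' = x")
    case True
    then show ?thesis using pmf_map_inj'[of "Pair x" "f x" y] by (simp add: inj_def)
  next
    case False
    then show ?thesis by (auto simp: pmf_eq_0_set_pmf)
  qed
  then show ?thesis by (simp add: pmf_bind measure_pmf_single)
qed

subsection \<open>Threshold decoding\<close>

text \<open>The density as a function of two values instead of a sample point, since a decoder
  evaluates it at codewords that were not sent.\<close>

definition ratio :: "('a \<times> 'y) pmf \<Rightarrow> 'a \<Rightarrow> 'y \<Rightarrow> real" where
  "ratio P a y = pmf P (a, y) / (pmf (map_pmf fst P) a * pmf (map_pmf snd P) y)"

lemma dens_ratio: "dens p X Y w = ratio (map_pmf (\<lambda>w. (X w, Y w)) p) (X w) (Y w)"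
  by (simp add: dens_def ratio_def map_pmf_comp)

definition decodable :: "('a \<times> 'y) pmf \<Rightarrow> real \<Rightarrow> 'j set \<Rightarrow> ('j \<Rightarrow> 'a) \<Rightarrow> 'j \<Rightarrow> 'y \<Rightarrow> bool" where
  "decodable P \<gamma> J c j y \<longleftrightarrow> \<gamma> \<le> ratio P (c j) y \<and> (\<forall>j'\<in>J. j' \<noteq> j \<longrightarrow> ratio P (c j') y < \<gamma>)"

definition decode :: "('a \<times> 'y) pmf \<Rightarrow> real \<Rightarrow> 'j set \<Rightarrow> ('j \<Rightarrow> 'a) \<Rightarrow> 'y \<Rightarrow> 'j" where
  "decode P \<gamma> J c y = (SOME j. j \<in> J \<and> \<gamma> \<le> ratio P (c j) y)"

lemma decode_eq: "decodable P \<gamma> J c j y \<Longrightarrow> j \<in> J \<Longrightarrow> decode P \<gamma> J c y = j"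
  unfolding decode_def decodable_def by (rule some_equality) (auto simp: not_less[symmetric])

text \<open>A change of measure: on this event each product probability is at most 1 / \<gamma>
  times the joint probability, and the joint probabilities sum to at most 1.\<close>

lemma prob_ratio_le:
  assumes fin: "finite (set_pmf P)" and \<gamma>: "0 < \<gamma>"
  shows "measure_pmf.prob (pair_pmf (map_pmf fst P) (map_pmf snd P)) {(a, y). \<gamma> \<le> ratio P a y} \<le> 1 / \<gamma>"
proof -
  let ?R = "pair_pmf (map_pmf fst P) (map_pmf snd P)"
  define T where "T = set_pmf ?R \<inter> {(a, y). \<gamma> \<le> ratio P a y}"
  have finT: "finite T" unfolding T_def using fin by auto
  have "measure_pmf.prob ?R {(a, y). \<gamma> \<le> ratio P a y} = measure_pmf.prob ?R T"
    unfolding T_def by (rule measure_pmf.finite_measure_eq_AE) (auto simp: AE_measure_pmf_iff)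
  also have "\<dots> = (\<Sum>x\<in>T. pmf ?R x)" by (rule measure_measure_pmf_finite[OF finT])
  also have "\<dots> \<le> (\<Sum>x\<in>T. pmf P x / \<gamma>)"
  proof (rule sum_mono)
    fix x assume x: "x \<in> T"
    obtain a y where [simp]: "x = (a, y)" by (cases x)
    have "0 < pmf ?R x" using x unfolding T_def by (intro pmf_positive) auto
    moreover have "\<gamma> \<le> pmf P x / pmf ?R x" using x unfolding T_def ratio_def by (simp add: pmf_pair)
    ultimately show "pmf ?R x \<le> pmf P x / \<gamma>" using \<gamma> by (simp add: field_simps)
  qed
  also have "\<dots> = measure_pmf.prob P T / \<gamma>"
    by (simp add: measure_measure_pmf_finite[OF finT] sum_divide_distrib)
  also have "\<dots> \<le> 1 / \<gamma>" using \<gamma> by (intro divide_right_mono) auto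
  finally show ?thesis .
qed

text \<open>Decoding fails only if the sent codeword falls below the threshold or another one
  reaches it. A codeword that was not sent is independent of the observation, so by the change of
  measure it costs 1 / \<gamma>; the other user's codebook merely acts as channel noise.\<close>

lemma threshold_decoding:
  fixes p1 :: "'a pmf" and p2 :: "'b pmf" and \<kappa> :: "'a \<Rightarrow> 'b \<Rightarrow> 'r pmf" and Y :: "'r \<Rightarrow> 'y"
  assumes fin: "finite (set_pmf p1)" "finite (set_pmf p2)"
      "\<And>a b. a \<in> set_pmf p1 \<Longrightarrow> b \<in> set_pmf p2 \<Longrightarrow> finite (set_pmf (\<kappa> a b))"
    and J: "finite J1" "finite J2" "j1 \<in> J1" "j2 \<in> J2" and \<gamma>: "0 < \<gamma>"
  defines "P \<equiv> map_pmf (\<lambda>(a, b, r). (a, Y r)) (joint p1 p2 \<kappa>)"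
  shows "E (codebook J1 p1) (\<lambda>c1. E (codebook J2 p2) (\<lambda>c2.
      measure_pmf.prob (\<kappa> (c1 j1) (c2 j2)) {r. \<not> decodable P \<gamma> J1 c1 j1 (Y r)})) \<le>
    measure_pmf.prob (joint p1 p2 \<kappa>) {w. dens (joint p1 p2 \<kappa>) (\<lambda>(a, b, r). a) (\<lambda>(a, b, r). Y r) w < \<gamma>} + real (card J1) / \<gamma>"
proof -
  define T where "T = bind_pmf (codebook J1 p1) (\<lambda>c1. bind_pmf (codebook J2 p2) (\<lambda>c2.
     map_pmf (\<lambda>r. (c1, r)) (\<kappa> (c1 j1) (c2 j2))))"
  have "E (codebook J1 p1) (\<lambda>c1. E (codebook J2 p2) (\<lambda>c2.
      measure_pmf.prob (\<kappa> (c1 j1) (c2 j2)) {r. \<not> decodable P \<gamma> J1 c1 j1 (Y r)})) =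
      measure_pmf.prob T {(c1, r). \<not> decodable P \<gamma> J1 c1 j1 (Y r)}"
    unfolding T_def prob_bind_pmf by (simp add: vimage_def)
  also have "\<dots> \<le> measure_pmf.prob T ({(c1, r). ratio P (c1 j1) (Y r) < \<gamma>} \<union>
       (\<Union>j'\<in>J1 - {j1}. {(c1, r). \<gamma> \<le> ratio P (c1 j') (Y r)}))"
    by (rule measure_pmf.finite_measure_mono) (auto simp: decodable_def not_less not_le)
  also have "\<dots> \<le> measure_pmf.prob T {(c1, r). ratio P (c1 j1) (Y r) < \<gamma>} +
       measure_pmf.prob T (\<Union>j'\<in>J1 - {j1}. {(c1, r). \<gamma> \<le> ratio P (c1 j') (Y r)})"
    by (rule measure_Un_le) auto
  also have "measure_pmf.prob T (\<Union>j'\<in>J1 - {j1}. {(c1, r). \<gamma> \<le> ratio P (c1 j') (Y r)}) \<le>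
      (\<Sum>j'\<in>J1 - {j1}. measure_pmf.prob T {(c1, r). \<gamma> \<le> ratio P (c1 j') (Y r)})"
    by (rule measure_pmf.finite_measure_subadditive_finite) (use J in auto)
  also have "\<dots> \<le> (\<Sum>j'\<in>J1 - {j1}. 1 / \<gamma>)"
  proof (rule sum_mono)
    fix j' assume j': "j' \<in> J1 - {j1}"
    have "map_pmf (\<lambda>(c1, r). (c1 j', Y r)) T = bind_pmf (codebook J1 p1) (\<lambda>c1. bind_pmf (codebook J2 p2) (\<lambda>c2.
       map_pmf (\<lambda>r. (c1 j', Y r)) (\<kappa> (c1 j1) (c2 j2))))"
      unfolding T_def by (simp add: map_bind_pmf map_pmf_comp)
    also have "\<dots> = bind_pmf (map_pmf (\<lambda>c. (c j', c j1)) (codebook J1 p1)) (\<lambda>(a', a). bind_pmf (map_pmf (\<lambda>c. c j2) (codebook J2 p2)) (\<lambda>b.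
       map_pmf (\<lambda>r. (a', Y r)) (\<kappa> a b)))"
      by (simp add: bind_map_pmf)
    also have "\<dots> = pair_pmf p1 (map_pmf (\<lambda>(a, b, r). Y r) (joint p1 p2 \<kappa>))"
      using J j' by (simp add: codebook_pair codebook_component joint_def pair_pmf_def map_bind_pmf bind_map_pmf
          bind_assoc_pmf bind_return_pmf map_pmf_comp) (simp add: map_pmf_def bind_assoc_pmf bind_return_pmf)
    also have "\<dots> = pair_pmf (map_pmf fst P) (map_pmf snd P)"
      unfolding P_def using map_joint_fst[of p1 p2 \<kappa>] by (simp add: map_pmf_comp case_prod_unfold)
    finally have eq: "map_pmf (\<lambda>(c1, r). (c1 j', Y r)) T = pair_pmf (map_pmf fst P) (map_pmf snd P)" .
    have "measure_pmf.prob T {(c1, r). \<gamma> \<le> ratio P (c1 j') (Y r)} =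
        measure_pmf.prob (map_pmf (\<lambda>(c1, r). (c1 j', Y r)) T) {(a, y). \<gamma> \<le> ratio P a y}"
      by (simp add: vimage_def case_prod_unfold)
    also have "\<dots> \<le> 1 / \<gamma>" unfolding eq
      by (rule prob_ratio_le[OF _ \<gamma>]) (simp add: P_def finite_joint[OF fin])
    finally show "measure_pmf.prob T {(c1, r). \<gamma> \<le> ratio P (c1 j') (Y r)} \<le> 1 / \<gamma>" .
  qed
  also have "(\<Sum>j'\<in>J1 - {j1}. 1 / \<gamma>) \<le> real (card J1) / \<gamma>"
    using \<gamma> card_Diff1_le[of J1 j1] by (simp add: divide_right_mono)
  also have "measure_pmf.prob T {(c1, r). ratio P (c1 j1) (Y r) < \<gamma>} =
     measure_pmf.prob (joint p1 p2 \<kappa>) {w. dens (joint p1 p2 \<kappa>) (\<lambda>(a, b, r). a) (\<lambda>(a, b, r). Y r) w < \<gamma>}"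
  proof -
    have "map_pmf (\<lambda>(c1, r). (c1 j1, r)) T = bind_pmf (map_pmf (\<lambda>c. c j1) (codebook J1 p1)) (\<lambda>a. bind_pmf (map_pmf (\<lambda>c. c j2) (codebook J2 p2)) (\<lambda>b.
       map_pmf (\<lambda>r. (a, r)) (\<kappa> a b)))"
      unfolding T_def by (simp add: map_bind_pmf bind_map_pmf map_pmf_comp)
    also have "\<dots> = map_pmf (\<lambda>(a, b, r). (a, r)) (joint p1 p2 \<kappa>)"
      using J by (simp add: codebook_component joint_def map_bind_pmf map_pmf_comp)
    finally have eq: "map_pmf (\<lambda>(c1, r). (c1 j1, r)) T = map_pmf (\<lambda>(a, b, r). (a, r)) (joint p1 p2 \<kappa>)" .
    have "measure_pmf.prob T {(c1, r). ratio P (c1 j1) (Y r) < \<gamma>} =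
        measure_pmf.prob (map_pmf (\<lambda>(c1, r). (c1 j1, r)) T) {(a, r). ratio P a (Y r) < \<gamma>}"
      by (simp add: vimage_def case_prod_unfold)
    then show ?thesis unfolding eq dens_ratio P_def by (simp add: vimage_def case_prod_unfold)
  qed
  finally show ?thesis by simp
qed

subsection \<open>Soft covering in terms of information densities\<close>

lemma E_joint_snd:
  assumes "finite (set_pmf p1)" "finite (set_pmf p2)"
    "\<And>a b. a \<in> set_pmf p1 \<Longrightarrow> b \<in> set_pmf p2 \<Longrightarrow> finite (set_pmf (\<kappa> a b))"
  shows "E p1 (\<lambda>a. E p2 (\<lambda>b. E (map_pmf Z (\<kappa> a b)) (f a b))) = E (joint p1 p2 \<kappa>) (\<lambda>(a, b, r). f a b (Z r))"
  by (subst E_joint[OF assms]) simp_all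

text \<open>As the two codewords are independent, the input probabilities cancel and the densities
  become ratios of output probabilities. This is the form in which the terms of the covering bound
  arise.\<close>

lemma dens_joint:
  fixes p1 :: "'a pmf" and p2 :: "'b pmf" and \<kappa> :: "'a \<Rightarrow> 'b \<Rightarrow> 'r pmf" and Z :: "'r \<Rightarrow> 'z"
  assumes w: "(a, b, r) \<in> set_pmf (joint p1 p2 \<kappa>)"
  defines "\<omega> \<equiv> \<lambda>a b. map_pmf Z (\<kappa> a b)"
  defines "Q \<equiv> bind_pmf p1 (\<lambda>a. bind_pmf p2 (\<omega> a))"
  shows "dens (joint p1 p2 \<kappa>) (\<lambda>(a, b, r). (a, b)) (\<lambda>(a, b, r). Z r) (a, b, r) = pmf (\<omega> a b) (Z r) / pmf Q (Z r)"
    "dens (joint p1 p2 \<kappa>) (\<lambda>(a, b, r). a) (\<lambda>(a, b, r). Z r) (a, b, r) = pmf (bind_pmf p2 (\<omega> a)) (Z r) / pmf Q (Z r)"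
    "dens (joint p1 p2 \<kappa>) (\<lambda>(a, b, r). b) (\<lambda>(a, b, r). Z r) (a, b, r) = pmf (bind_pmf p1 (\<lambda>a. \<omega> a b)) (Z r) / pmf Q (Z r)"
    "dens (joint p1 p2 \<kappa>) (\<lambda>(a, b, r). b) (\<lambda>(a, b, r). (a, Z r)) (a, b, r) = pmf (\<omega> a b) (Z r) / pmf (bind_pmf p2 (\<omega> a)) (Z r)"
proof -
  have ab: "a \<in> set_pmf p1" "b \<in> set_pmf p2" using w by (auto simp: joint_def)
  have pos: "0 < pmf p1 a" "0 < pmf p2 b" using ab by (auto simp: pmf_positive)
  have Z: "map_pmf (\<lambda>(a, b, r). Z r) (joint p1 p2 \<kappa>) = Q"
    unfolding joint_def Q_def \<omega>_def by (simp add: map_bind_pmf map_pmf_comp)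
  have AB: "map_pmf (\<lambda>(a, b, r). (a, b)) (joint p1 p2 \<kappa>) = pair_pmf p1 p2"
    unfolding joint_def pair_pmf_def by (simp add: map_bind_pmf map_pmf_comp)
  have B: "map_pmf (\<lambda>(a, b, r). b) (joint p1 p2 \<kappa>) = p2"
    unfolding joint_def by (simp add: map_bind_pmf map_pmf_comp bind_return_pmf')
  have "map_pmf (\<lambda>(a, b, r). ((a, b), Z r)) (joint p1 p2 \<kappa>) = bind_pmf (pair_pmf p1 p2) (\<lambda>x. map_pmf (Pair x) (\<omega> (fst x) (snd x)))"
    unfolding joint_def pair_pmf_def \<omega>_def by (simp add: map_bind_pmf bind_assoc_pmf bind_return_pmf map_pmf_comp)
  then have ABZ: "pmf (map_pmf (\<lambda>(a, b, r). ((a, b), Z r)) (joint p1 p2 \<kappa>)) ((a, b), z) = pmf p1 a * pmf p2 b * pmf (\<omega> a b) z" for z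
    by (simp add: pmf_bind_Pair pmf_pair)
  have "map_pmf (\<lambda>(a, b, r). (a, Z r)) (joint p1 p2 \<kappa>) = bind_pmf p1 (\<lambda>a. map_pmf (Pair a) (bind_pmf p2 (\<omega> a)))"
    unfolding joint_def \<omega>_def by (simp add: map_bind_pmf map_pmf_comp)
  then have AZ: "pmf (map_pmf (\<lambda>(a, b, r). (a, Z r)) (joint p1 p2 \<kappa>)) (a, z) = pmf p1 a * pmf (bind_pmf p2 (\<omega> a)) z" for z
    by (simp add: pmf_bind_Pair)
  have "map_pmf (\<lambda>(a, b, r). (b, Z r)) (joint p1 p2 \<kappa>) = bind_pmf p2 (\<lambda>b. map_pmf (Pair b) (bind_pmf p1 (\<lambda>a. \<omega> a b)))"
    unfolding joint_def \<omega>_def by (simp add: map_bind_pmf map_pmf_comp bind_commute_pmf[of p2 p1])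
  then have BZ: "pmf (map_pmf (\<lambda>(a, b, r). (b, Z r)) (joint p1 p2 \<kappa>)) (b, z) = pmf p2 b * pmf (bind_pmf p1 (\<lambda>a. \<omega> a b)) z" for z
    by (simp add: pmf_bind_Pair)
  have BAZ: "pmf (map_pmf (\<lambda>(a, b, r). (b, (a, Z r))) (joint p1 p2 \<kappa>)) (b, (a, z)) = pmf p1 a * pmf p2 b * pmf (\<omega> a b) z" for z
  proof -
    have "inj (\<lambda>((a, b), z). (b, (a, z)))" by (auto simp: inj_def)
    from pmf_map_inj'[OF this, of "map_pmf (\<lambda>(a, b, r). ((a, b), Z r)) (joint p1 p2 \<kappa>)" "((a, b), z)"]
    show ?thesis unfolding ABZ by (simp add: map_pmf_comp case_prod_unfold)
  qed
  note A = map_joint_fst[of p1 p2 \<kappa>]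
  show "dens (joint p1 p2 \<kappa>) (\<lambda>(a, b, r). (a, b)) (\<lambda>(a, b, r). Z r) (a, b, r) = pmf (\<omega> a b) (Z r) / pmf Q (Z r)"
    using ABZ Z AB pos by (simp add: dens_def case_prod_unfold pmf_pair)
  show "dens (joint p1 p2 \<kappa>) (\<lambda>(a, b, r). a) (\<lambda>(a, b, r). Z r) (a, b, r) = pmf (bind_pmf p2 (\<omega> a)) (Z r) / pmf Q (Z r)"
    using AZ Z A pos by (simp add: dens_def case_prod_unfold)
  show "dens (joint p1 p2 \<kappa>) (\<lambda>(a, b, r). b) (\<lambda>(a, b, r). Z r) (a, b, r) = pmf (bind_pmf p1 (\<lambda>a. \<omega> a b)) (Z r) / pmf Q (Z r)"
    using BZ Z B pos by (simp add: dens_def case_prod_unfold)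
  show "dens (joint p1 p2 \<kappa>) (\<lambda>(a, b, r). b) (\<lambda>(a, b, r). (a, Z r)) (a, b, r) = pmf (\<omega> a b) (Z r) / pmf (bind_pmf p2 (\<omega> a)) (Z r)"
    using BAZ AZ B pos by (simp add: dens_def case_prod_unfold)
qed

text \<open>Separates the three rate conditions of the multiple access channel, one logarithm for
  each.\<close>

lemma ln_sum_le:
  fixes x y z :: real
  assumes "0 \<le> x" "0 \<le> y" "0 \<le> z"
  shows "ln (1 + (x + y + z)) \<le> ln (1 + x) + ln (1 + y) + ln (1 + z)"
proof -
  have "(1 + x) * (1 + y) * (1 + z) = 1 + (x * y + x + y + z) + (x * z + y * z + x * y * z)" by (simp add: algebra_simps)
  moreover have "0 \<le> x * z" "0 \<le> y * z" "0 \<le> x * y * z" "0 \<le> x * y" using assms by simp_all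
  ultimately have "1 + (x + y + z) \<le> (1 + x) * (1 + y) * (1 + z)" by linarith
  then have "ln (1 + (x + y + z)) \<le> ln ((1 + x) * (1 + y) * (1 + z))" using assms by (intro ln_mono) auto
  then show ?thesis using assms by (simp add: ln_mult)
qed

lemma soft_covering_mac:
  fixes p1 :: "'a pmf" and p2 :: "'b pmf" and \<kappa> :: "'a \<Rightarrow> 'b \<Rightarrow> 'r pmf" and Z :: "'r \<Rightarrow> 'z"
  assumes fin: "finite (set_pmf p1)" "finite (set_pmf p2)"
      "\<And>a b. a \<in> set_pmf p1 \<Longrightarrow> b \<in> set_pmf p2 \<Longrightarrow> finite (set_pmf (\<kappa> a b))"
    and J: "finite J1" "finite J2" "U1 \<subseteq> J1" "U1 \<noteq> {}" "U2 \<subseteq> J2" "U2 \<noteq> {}" and t: "0 < t"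
  defines "G \<equiv> joint p1 p2 \<kappa>" and "Q \<equiv> map_pmf (\<lambda>(a, b, r). Z r) (joint p1 p2 \<kappa>)"
  shows "E (codebook J1 p1) (\<lambda>c1. E (codebook J2 p2) (\<lambda>c2. l1_dist (set_pmf Q)
      (bind_pmf (pmf_of_set U1) (\<lambda>u1. bind_pmf (pmf_of_set U2) (\<lambda>u2. map_pmf Z (\<kappa> (c1 u1) (c2 u2))))) Q)) \<le>
    (E G (\<lambda>w. ln (1 + dens G (\<lambda>(a, b, r). (a, b)) (\<lambda>(a, b, r). Z r) w / (real (card U1) * real (card U2))))
     + E G (\<lambda>w. ln (1 + dens G (\<lambda>(a, b, r). a) (\<lambda>(a, b, r). Z r) w / real (card U1)))
     + E G (\<lambda>w. ln (1 + dens G (\<lambda>(a, b, r). b) (\<lambda>(a, b, r). Z r) w / real (card U2)))) / (2 * t) + 2 * t"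
proof -
  define \<omega> where "\<omega> a b = map_pmf Z (\<kappa> a b)" for a b
  define Q' where "Q' = bind_pmf p1 (\<lambda>a. bind_pmf p2 (\<omega> a))"
  have Q: "Q = Q'" unfolding Q_def Q'_def joint_def \<omega>_def by (simp add: map_bind_pmf map_pmf_comp)
  define L1 where "L1 = real (card U1)" define L2 where "L2 = real (card U2)"
  have finU: "finite U1" "finite U2" using J finite_subset by blast+
  have L: "1 \<le> L1" "1 \<le> L2" unfolding L1_def L2_def using finU J by (auto simp: Suc_le_eq card_gt_0_iff)
  define \<mu> where "\<mu> a b z = pmf (\<omega> a b) z / (L1 * L2) + pmf (bind_pmf p2 (\<omega> a)) z / L1 +
       pmf (bind_pmf p1 (\<lambda>a. \<omega> a b)) z / L2 + pmf Q' z" for a b z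
  have finG: "finite (set_pmf G)" unfolding G_def by (rule finite_joint[OF fin])
  have "E (codebook J1 p1) (\<lambda>c1. E (codebook J2 p2) (\<lambda>c2. l1_dist (set_pmf Q')
      (bind_pmf (pmf_of_set U1) (\<lambda>u1. bind_pmf (pmf_of_set U2) (\<lambda>u2. \<omega> (c1 u1) (c2 u2)))) Q')) \<le>
    E p1 (\<lambda>a. E p2 (\<lambda>b. E (\<omega> a b) (\<lambda>z. ln (\<mu> a b z / pmf Q' z)))) / (2 * t) + 2 * t"
    unfolding \<mu>_def L1_def L2_def Q'_def
    by (rule soft_covering) (use fin J t in \<open>auto simp: \<omega>_def\<close>)
  also have "E p1 (\<lambda>a. E p2 (\<lambda>b. E (\<omega> a b) (\<lambda>z. ln (\<mu> a b z / pmf Q' z)))) = E G (\<lambda>(a, b, r). ln (\<mu> a b (Z r) / pmf Q' (Z r)))"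
    unfolding G_def \<omega>_def by (rule E_joint_snd[OF fin])
  also have "\<dots> \<le> E G (\<lambda>w. ln (1 + dens G (\<lambda>(a, b, r). (a, b)) (\<lambda>(a, b, r). Z r) w / (L1 * L2))
     + ln (1 + dens G (\<lambda>(a, b, r). a) (\<lambda>(a, b, r). Z r) w / L1)
     + ln (1 + dens G (\<lambda>(a, b, r). b) (\<lambda>(a, b, r). Z r) w / L2))"
  proof (intro E_mono finG)
    fix w assume w: "w \<in> set_pmf G"
    obtain a b r where [simp]: "w = (a, b, r)" by (cases w)
    have d: "dens G (\<lambda>(a, b, r). (a, b)) (\<lambda>(a, b, r). Z r) w = pmf (\<omega> a b) (Z r) / pmf Q' (Z r)"
      "dens G (\<lambda>(a, b, r). a) (\<lambda>(a, b, r). Z r) w = pmf (bind_pmf p2 (\<omega> a)) (Z r) / pmf Q' (Z r)"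
      "dens G (\<lambda>(a, b, r). b) (\<lambda>(a, b, r). Z r) w = pmf (bind_pmf p1 (\<lambda>a. \<omega> a b)) (Z r) / pmf Q' (Z r)"
      using w dens_joint[of a b r p1 p2 \<kappa> Z] unfolding G_def Q'_def \<omega>_def by simp_all
    have "Z r \<in> set_pmf Q" unfolding Q_def using w unfolding G_def by force
    then have q: "0 < pmf Q' (Z r)" unfolding Q by (rule pmf_positive)
    have "\<mu> a b (Z r) / pmf Q' (Z r) = 1 + (dens G (\<lambda>(a, b, r). (a, b)) (\<lambda>(a, b, r). Z r) w / (L1 * L2)
       + dens G (\<lambda>(a, b, r). a) (\<lambda>(a, b, r). Z r) w / L1 + dens G (\<lambda>(a, b, r). b) (\<lambda>(a, b, r). Z r) w / L2)"
      unfolding d \<mu>_def using q L by (simp add: add_divide_distrib mult.commute)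
    then show "(case w of (a, b, r) \<Rightarrow> ln (\<mu> a b (Z r) / pmf Q' (Z r))) \<le> ln (1 + dens G (\<lambda>(a, b, r). (a, b)) (\<lambda>(a, b, r). Z r) w / (L1 * L2))
     + ln (1 + dens G (\<lambda>(a, b, r). a) (\<lambda>(a, b, r). Z r) w / L1)
     + ln (1 + dens G (\<lambda>(a, b, r). b) (\<lambda>(a, b, r). Z r) w / L2)"
      (is "_ \<le> ln (1 + ?x) + ln (1 + ?y) + ln (1 + ?z)")
    proof -
      have nn: "0 \<le> ?x" "0 \<le> ?y" "0 \<le> ?z" using L by (auto intro!: divide_nonneg_nonneg dens_nonneg)
      have "ln (1 + (?x + ?y + ?z)) \<le> ln (1 + ?x) + ln (1 + ?y) + ln (1 + ?z)"
        using nn by (rule ln_sum_le)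
      then show ?thesis using \<open>\<mu> a b (Z r) / pmf Q' (Z r) = _\<close> by simp
    qed
  qed
  also have "\<dots> = E G (\<lambda>w. ln (1 + dens G (\<lambda>(a, b, r). (a, b)) (\<lambda>(a, b, r). Z r) w / (L1 * L2)))
     + E G (\<lambda>w. ln (1 + dens G (\<lambda>(a, b, r). a) (\<lambda>(a, b, r). Z r) w / L1))
     + E G (\<lambda>w. ln (1 + dens G (\<lambda>(a, b, r). b) (\<lambda>(a, b, r). Z r) w / L2))"
    by (simp only: E_add[OF finG])
  finally show ?thesis unfolding Q \<omega>_def L1_def L2_def using t by (simp add: divide_right_mono)
qed

text \<open>One codebook against a fixed codeword \<open>a\<close> of the other user: the two-codebook bound for the point mass
  at \<open>a\<close> and \<open>M\<close> copies of \<open>a\<close>, with \<open>M \<longrightarrow> \<infinity>\<close>.\<close>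

lemma soft_covering_fixed:
  fixes p2 :: "'b pmf" and \<omega> :: "'b \<Rightarrow> 'z pmf"
  assumes fin: "finite (set_pmf p2)" "\<And>b. b \<in> set_pmf p2 \<Longrightarrow> finite (set_pmf (\<omega> b))"
    and J: "finite J2" "U2 \<subseteq> J2" "U2 \<noteq> {}" and t: "0 < t"
  defines "Q \<equiv> bind_pmf p2 \<omega>"
  shows "E (codebook J2 p2) (\<lambda>c2. l1_dist (set_pmf Q) (bind_pmf (pmf_of_set U2) (\<lambda>u2. \<omega> (c2 u2))) Q) \<le>
    E p2 (\<lambda>b. E (\<omega> b) (\<lambda>z. ln (1 + pmf (\<omega> b) z / pmf Q z / real (card U2)))) / (2 * t) + 2 * t"
proof -
  define L2 where "L2 = real (card U2)"
  have finU: "finite U2" using J finite_subset by blast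
  have L: "1 \<le> L2" unfolding L2_def using finU J by (auto simp: Suc_le_eq card_gt_0_iff)
  define X where "X = E (codebook J2 p2) (\<lambda>c2. l1_dist (set_pmf Q) (bind_pmf (pmf_of_set U2) (\<lambda>u2. \<omega> (c2 u2))) Q)"
  define D where "D = E p2 (\<lambda>b. E (\<omega> b) (\<lambda>z. ln (1 + pmf (\<omega> b) z / pmf Q z / L2)))"
  have step: "X \<le> (D + 1 / real M) / (2 * t) + 2 * t" if M: "1 \<le> M" for M :: nat
  proof -
    define J1 where "J1 = {..<M}"
    have J1: "finite J1" "J1 \<noteq> {}" "card J1 = M" unfolding J1_def using M by (auto simp: lessThan_empty_iff)
    define \<mu> where "\<mu> b z = pmf (\<omega> b) z / (real M * L2) + pmf Q z / real M + pmf (\<omega> b) z / L2 + pmf Q z" for b z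
    have const: "bind_pmf (pmf_of_set J1) (\<lambda>u1. bind_pmf (pmf_of_set U2) (\<lambda>u2. \<omega> (c2 u2))) = bind_pmf (pmf_of_set U2) (\<lambda>u2. \<omega> (c2 u2))" for c2
      by simp
    have "E (codebook J1 (return_pmf ())) (\<lambda>c1. E (codebook J2 p2) (\<lambda>c2. l1_dist (set_pmf (bind_pmf (return_pmf ()) (\<lambda>a. bind_pmf p2 \<omega>)))
      (bind_pmf (pmf_of_set J1) (\<lambda>u1. bind_pmf (pmf_of_set U2) (\<lambda>u2. \<omega> (c2 u2)))) (bind_pmf (return_pmf ()) (\<lambda>a. bind_pmf p2 \<omega>)))) \<le>
      E (return_pmf ()) (\<lambda>a. E p2 (\<lambda>b. E (\<omega> b) (\<lambda>z. ln ((pmf (\<omega> b) z / (real (card J1) * real (card U2)) + pmf (bind_pmf p2 \<omega>) z / real (card J1) +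
       pmf (bind_pmf (return_pmf ()) (\<lambda>a. \<omega> b)) z / real (card U2) + pmf (bind_pmf (return_pmf ()) (\<lambda>a. bind_pmf p2 \<omega>)) z)
         / pmf (bind_pmf (return_pmf ()) (\<lambda>a. bind_pmf p2 \<omega>)) z)))) / (2 * t) + 2 * t"
      by (rule soft_covering) (use fin J J1 t in auto)
    then have "X \<le> E p2 (\<lambda>b. E (\<omega> b) (\<lambda>z. ln (\<mu> b z / pmf Q z))) / (2 * t) + 2 * t"
      unfolding X_def const bind_return_pmf J1(3) \<mu>_def L2_def Q_def by simp
    also have "E p2 (\<lambda>b. E (\<omega> b) (\<lambda>z. ln (\<mu> b z / pmf Q z))) \<le> E p2 (\<lambda>b. E (\<omega> b) (\<lambda>z. ln (1 + pmf (\<omega> b) z / pmf Q z / L2) + 1 / real M))"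
    proof (intro E_mono fin)
      fix b z assume b: "b \<in> set_pmf p2" and z: "z \<in> set_pmf (\<omega> b)"
      have q: "0 < pmf Q z" unfolding Q_def using b z by (intro pmf_positive) auto
      \<comment> \<open>With a constant input of the other user the four terms of \<mu> factor,
        which isolates the number \<open>M\<close> of copies in a vanishing summand.\<close>
      have "\<mu> b z / pmf Q z = (1 + pmf (\<omega> b) z / pmf Q z / L2) * (1 + 1 / real M)"
        unfolding \<mu>_def using q L M by (simp add: field_simps)
      then have "ln (\<mu> b z / pmf Q z) = ln (1 + pmf (\<omega> b) z / pmf Q z / L2) + ln (1 + 1 / real M)"
      proof -
        have "0 < 1 + pmf (\<omega> b) z / pmf Q z / L2" "0 < 1 + 1 / real M"
          using q L by (auto intro!: add_pos_nonneg divide_nonneg_nonneg)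
        then show ?thesis unfolding \<open>\<mu> b z / pmf Q z = _\<close> by (rule ln_mult_pos)
      qed
      also have "ln (1 + 1 / real M) \<le> 1 / real M" by (rule ln_add_one_self_le_self) simp
      finally show "ln (\<mu> b z / pmf Q z) \<le> ln (1 + pmf (\<omega> b) z / pmf Q z / L2) + 1 / real M" by simp
    qed
    also have "\<dots> = E p2 (\<lambda>b. E (\<omega> b) (\<lambda>z. ln (1 + pmf (\<omega> b) z / pmf Q z / L2)) + 1 / real M)"
      by (rule E_cong) (simp add: E_add fin)
    also have "\<dots> = D + 1 / real M" unfolding D_def by (simp add: E_add fin)
    finally show ?thesis using t by (simp add: divide_right_mono)
  qed
  have "(\<lambda>M. (D + 1 / real M) / (2 * t) + 2 * t) \<longlonglongrightarrow> (D + 0) / (2 * t) + 2 * t"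
    using t by (intro tendsto_intros lim_1_over_n) auto
  then have "X \<le> (D + 0) / (2 * t) + 2 * t"
    by (rule LIMSEQ_le_const) (use step in auto)
  then show ?thesis unfolding X_def D_def L2_def by simp
qed

text \<open>Only user 2's codebook is averaged for a given codeword of user 1. The relevant density
  is therefore the one between user 2's codeword and the pair of user 1's codeword and the
  eavesdropper's output.\<close>

lemma soft_covering_public:
  fixes p1 :: "'a pmf" and p2 :: "'b pmf" and \<kappa> :: "'a \<Rightarrow> 'b \<Rightarrow> 'r pmf" and Z :: "'r \<Rightarrow> 'z"
  assumes fin: "finite (set_pmf p1)" "finite (set_pmf p2)"
      "\<And>a b. a \<in> set_pmf p1 \<Longrightarrow> b \<in> set_pmf p2 \<Longrightarrow> finite (set_pmf (\<kappa> a b))"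
    and J: "finite J1" "finite J2" "u \<in> J1" "U2 \<subseteq> J2" "U2 \<noteq> {}" and t: "0 < t"
  defines "G \<equiv> joint p1 p2 \<kappa>" and "Q \<equiv> \<lambda>a. bind_pmf p2 (\<lambda>b. map_pmf Z (\<kappa> a b))"
  shows "E (codebook J1 p1) (\<lambda>c1. E (codebook J2 p2) (\<lambda>c2. l1_dist (set_pmf (Q (c1 u)))
      (bind_pmf (pmf_of_set U2) (\<lambda>u2. map_pmf Z (\<kappa> (c1 u) (c2 u2)))) (Q (c1 u)))) \<le>
    E G (\<lambda>w. ln (1 + dens G (\<lambda>(a, b, r). b) (\<lambda>(a, b, r). (a, Z r)) w / real (card U2))) / (2 * t) + 2 * t"
proof -
  define \<omega> where "\<omega> a b = map_pmf Z (\<kappa> a b)" for a b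
  have "E (codebook J1 p1) (\<lambda>c1. E (codebook J2 p2) (\<lambda>c2. l1_dist (set_pmf (Q (c1 u)))
      (bind_pmf (pmf_of_set U2) (\<lambda>u2. map_pmf Z (\<kappa> (c1 u) (c2 u2)))) (Q (c1 u)))) =
    E p1 (\<lambda>a. E (codebook J2 p2) (\<lambda>c2. l1_dist (set_pmf (Q a))
      (bind_pmf (pmf_of_set U2) (\<lambda>u2. map_pmf Z (\<kappa> a (c2 u2)))) (Q a)))"
    by (rule E_codebook[OF J(1,3)])
  also have "\<dots> \<le> E p1 (\<lambda>a. E p2 (\<lambda>b. E (\<omega> a b) (\<lambda>z. ln (1 + pmf (\<omega> a b) z / pmf (Q a) z / real (card U2)))) / (2 * t) + 2 * t)"
    unfolding Q_def \<omega>_def by (intro E_mono fin soft_covering_fixed) (use fin J t in auto)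
  also have "\<dots> = E p1 (\<lambda>a. E p2 (\<lambda>b. E (\<omega> a b) (\<lambda>z. ln (1 + pmf (\<omega> a b) z / pmf (Q a) z / real (card U2))))) / (2 * t) + 2 * t"
    by (simp add: E_add fin)
  also have "E p1 (\<lambda>a. E p2 (\<lambda>b. E (\<omega> a b) (\<lambda>z. ln (1 + pmf (\<omega> a b) z / pmf (Q a) z / real (card U2))))) =
     E G (\<lambda>(a, b, r). ln (1 + pmf (\<omega> a b) (Z r) / pmf (Q a) (Z r) / real (card U2)))"
    unfolding G_def \<omega>_def by (rule E_joint_snd[OF fin])
  also have "\<dots> = E G (\<lambda>w. ln (1 + dens G (\<lambda>(a, b, r). b) (\<lambda>(a, b, r). (a, Z r)) w / real (card U2)))"
  proof (rule E_cong)
    fix w assume w: "w \<in> set_pmf G"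
    obtain a b r where w': "w = (a, b, r)" by (cases w)
    have "dens G (\<lambda>(a, b, r). b) (\<lambda>(a, b, r). (a, Z r)) w = pmf (\<omega> a b) (Z r) / pmf (Q a) (Z r)"
      using dens_joint(4)[of a b r p1 p2 \<kappa> Z] w unfolding w' G_def Q_def \<omega>_def by simp
    then show "(case w of (a, b, r) \<Rightarrow> ln (1 + pmf (\<omega> a b) (Z r) / pmf (Q a) (Z r) / real (card U2))) =
      ln (1 + dens G (\<lambda>(a, b, r). b) (\<lambda>(a, b, r). (a, Z r)) w / real (card U2))" by (simp only: w' prod.case)
  qed
  finally show ?thesis .
qed

section \<open>Random codes\<close>

lemma pmf_of_set_times:
  assumes "finite A" "A \<noteq> {}" "finite B" "B \<noteq> {}"
  shows "pmf_of_set (A \<times> B) = bind_pmf (pmf_of_set A) (\<lambda>a. pmf_of_set ({a} \<times> B))"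
proof -
  have "pmf_of_set ({a} \<times> B) = map_pmf (Pair a) (pmf_of_set B)" for a :: 'a
  proof -
    have "{a} \<times> B = Pair a ` B" by auto
    then show ?thesis using assms map_pmf_of_set_inj[of "Pair a" B] by (simp add: inj_on_def)
  qed
  then show ?thesis
    unfolding pair_pmf_of_set[OF assms, symmetric] pair_pmf_def by (simp add: map_pmf_def)
qed

text \<open>Each index splits into a visible part, read off by \<open>f\<close> or \<open>g\<close>,
  and a rest that is uniform given it. It is enough to cover with the sub-codebooks
  \<open>U1 x\<close> and \<open>U2 y\<close> on average over the visible parts. The ideal output
  law may depend on \<open>x\<close>, which admits codewords treated as public.\<close>

lemma view_close:
  fixes \<omega> :: "'a \<Rightarrow> 'b \<Rightarrow> 'z pmf"
  assumes J1: "pmf_of_set J1 = bind_pmf \<alpha> (\<lambda>x. pmf_of_set (U1 x))" "\<And>x. x \<in> set_pmf \<alpha> \<Longrightarrow> finite (U1 x) \<and> U1 x \<noteq> {} \<and> U1 x \<subseteq> J1"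
    and J2: "pmf_of_set J2 = bind_pmf \<beta> (\<lambda>y. pmf_of_set (U2 y))" "\<And>y. y \<in> set_pmf \<beta> \<Longrightarrow> finite (U2 y) \<and> U2 y \<noteq> {} \<and> U2 y \<subseteq> J2"
    and f: "\<And>x j. x \<in> set_pmf \<alpha> \<Longrightarrow> j \<in> U1 x \<Longrightarrow> f j = x" and g: "\<And>y j. y \<in> set_pmf \<beta> \<Longrightarrow> j \<in> U2 y \<Longrightarrow> g j = y"
    and fin: "finite (set_pmf \<alpha>)" "finite (set_pmf \<beta>)" "\<And>x. x \<in> set_pmf \<alpha> \<Longrightarrow> finite (set_pmf (Q x))"
    and sub: "\<And>x j1 j2. x \<in> set_pmf \<alpha> \<Longrightarrow> j1 \<in> U1 x \<Longrightarrow> j2 \<in> J2 \<Longrightarrow> set_pmf (\<omega> (c1 j1) (c2 j2)) \<subseteq> set_pmf (Q x)"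
  shows "close (E \<alpha> (\<lambda>x. E \<beta> (\<lambda>y. l1_dist (set_pmf (Q x)) (bind_pmf (pmf_of_set (U1 x)) (\<lambda>u1. bind_pmf (pmf_of_set (U2 y)) (\<lambda>u2. \<omega> (c1 u1) (c2 u2)))) (Q x))))
     (bind_pmf (pmf_of_set J1) (\<lambda>j1. bind_pmf (pmf_of_set J2) (\<lambda>j2. map_pmf (\<lambda>z. (f j1, g j2, z)) (\<omega> (c1 j1) (c2 j2)))))
     (bind_pmf \<alpha> (\<lambda>x. bind_pmf \<beta> (\<lambda>y. map_pmf (\<lambda>z. (x, y, z)) (Q x))))"
proof -
  define mix where "mix x y = bind_pmf (pmf_of_set (U1 x)) (\<lambda>u1. bind_pmf (pmf_of_set (U2 y)) (\<lambda>u2. \<omega> (c1 u1) (c2 u2)))" for x y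
  have "bind_pmf (pmf_of_set J1) (\<lambda>j1. bind_pmf (pmf_of_set J2) (\<lambda>j2. map_pmf (\<lambda>z. (f j1, g j2, z)) (\<omega> (c1 j1) (c2 j2)))) =
     bind_pmf \<alpha> (\<lambda>x. bind_pmf (pmf_of_set (U1 x)) (\<lambda>j1. bind_pmf \<beta> (\<lambda>y. bind_pmf (pmf_of_set (U2 y)) (\<lambda>j2. map_pmf (\<lambda>z. (f j1, g j2, z)) (\<omega> (c1 j1) (c2 j2))))))"
    unfolding J1(1) J2(1) by (simp only: bind_assoc_pmf)
  also have "\<dots> = bind_pmf \<alpha> (\<lambda>x. bind_pmf (pmf_of_set (U1 x)) (\<lambda>j1. bind_pmf \<beta> (\<lambda>y. bind_pmf (pmf_of_set (U2 y)) (\<lambda>j2. map_pmf (\<lambda>z. (x, y, z)) (\<omega> (c1 j1) (c2 j2))))))"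
    using J1(2) J2(2) f g by (intro bind_pmf_cong refl) (simp add: set_pmf_of_set)
  also have "\<dots> = bind_pmf \<alpha> (\<lambda>x. bind_pmf \<beta> (\<lambda>y. map_pmf (\<lambda>z. (x, y, z)) (mix x y)))"
    unfolding mix_def map_bind_pmf by (intro bind_pmf_cong refl) (rule bind_commute_pmf)
  finally have law: "bind_pmf (pmf_of_set J1) (\<lambda>j1. bind_pmf (pmf_of_set J2) (\<lambda>j2. map_pmf (\<lambda>z. (f j1, g j2, z)) (\<omega> (c1 j1) (c2 j2)))) =
     bind_pmf \<alpha> (\<lambda>x. bind_pmf \<beta> (\<lambda>y. map_pmf (\<lambda>z. (x, y, z)) (mix x y)))" .
  have mixsub: "set_pmf (mix x y) \<subseteq> set_pmf (Q x)" if "x \<in> set_pmf \<alpha>" "y \<in> set_pmf \<beta>" for x y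
    unfolding mix_def set_bind_pmf using that J1(2)[OF that(1)] J2(2)[OF that(2)]
    by (intro UN_least sub[OF that(1)]) (auto simp: set_pmf_of_set)
  show ?thesis
    unfolding law mix_def[symmetric]
    by (intro close_bind_avg close_map close_l1_dist integrable_measure_pmf_finite fin mixsub subset_refl)
qed

definition nonadaptive :: "'x list \<Rightarrow> 'y list \<Rightarrow> 'x" where
  "nonadaptive xs ys = xs ! length ys"

text \<open>A codeword passes through a random prefix channel before transmission. With codewords
  made of auxiliary letters, the prefixes realise the conditional laws of the inputs given V1 and
  V2.\<close>

definition block_channel :: "('x1,'x2,'y1,'y2,'z) channel \<Rightarrow> nat \<Rightarrow> ('a \<Rightarrow> 'x1 list pmf) \<Rightarrow> ('b \<Rightarrow> 'x2 list pmf) \<Rightarrow>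
    'a \<Rightarrow> 'b \<Rightarrow> ('x1,'x2,'y1,'y2,'z) transcript pmf" where
  "block_channel W n X1 X2 a b = bind_pmf (X1 a) (\<lambda>xs1. bind_pmf (X2 b) (\<lambda>xs2.
     channel_run W (nonadaptive xs1) (nonadaptive xs2) n))"

text \<open>The index of a codeword consists of the message, the slot (user 1) or key (user 2), and
  local randomness, in this order.\<close>

definition indices :: "nat \<Rightarrow> nat \<Rightarrow> nat \<Rightarrow> (nat \<times> nat \<times> nat) set" where
  "indices S N D = {..<S} \<times> {..<N} \<times> {..<D}"

definition codebook_law :: "('a \<Rightarrow> 'b \<Rightarrow> 'r pmf) \<Rightarrow> (nat \<times> nat \<times> nat) set \<Rightarrow> (nat \<times> nat \<times> nat) set \<Rightarrow>
    (nat \<times> nat \<times> nat \<Rightarrow> 'a) \<Rightarrow> (nat \<times> nat \<times> nat \<Rightarrow> 'b) \<Rightarrow> (nat \<times> nat \<times> nat \<times> nat \<times> 'r) pmf" where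
  "codebook_law \<kappa> J1 J2 c1 c2 = bind_pmf (pmf_of_set J1) (\<lambda>j1. bind_pmf (pmf_of_set J2) (\<lambda>j2.
     map_pmf (\<lambda>r. (fst j1, fst (snd j1), fst j2, fst (snd j2), r)) (\<kappa> (c1 j1) (c2 j2))))"

lemma finite_indices: "finite (indices S N D)" and card_indices: "card (indices S N D) = S * (N * D)"
  by (simp_all add: indices_def card_cartesian_product)

lemma indices_nonempty: "0 < S \<Longrightarrow> 0 < N \<Longrightarrow> 0 < D \<Longrightarrow> indices S N D \<noteq> {}"
  by (auto simp: indices_def lessThan_empty_iff)

lemma pmf_of_set_indices:
  assumes "0 < S" "0 < N" "0 < D"
  shows "pmf_of_set (indices S N D) = bind_pmf (pmf_of_set {..<S}) (\<lambda>s. bind_pmf (pmf_of_set {..<N}) (\<lambda>e.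
    map_pmf (\<lambda>d. (s, e, d)) (pmf_of_set {..<D})))"
proof -
  have ne: "{..<S} \<noteq> {}" "{..<N} \<noteq> {}" "{..<D} \<noteq> {}" using assms by (auto simp: lessThan_empty_iff)
  have "pmf_of_set (indices S N D) = pair_pmf (pmf_of_set {..<S}) (pair_pmf (pmf_of_set {..<N}) (pmf_of_set {..<D}))"
    unfolding indices_def using ne by (simp add: pair_pmf_of_set)
  then show ?thesis by (simp add: pair_pmf_def map_pmf_def bind_assoc_pmf bind_return_pmf)
qed

lemma scode_codebook:
  fixes W :: "('x1,'x2,'y1,'y2,'z) channel" and d1 :: "'x1 list \<Rightarrow> 'y1 list \<Rightarrow> nat \<times> nat"
    and X1 :: "'a \<Rightarrow> 'x1 list pmf" and X2 :: "'b \<Rightarrow> 'x2 list pmf" and n c1 c2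
  assumes pos: "0 < S1" "0 < En" "0 < D1" "0 < S2" "0 < K" "0 < D2"
  defines "L \<equiv> codebook_law (block_channel W n X1 X2) (indices S1 En D1) (indices S2 K D2) c1 c2"
  assumes err: "measure_pmf.prob L (- correct d1 d2) \<le> \<epsilon>"
    and key: "close \<epsilon> (map_pmf (key_view b) L)
      (pair_pmf (pmf_of_set {..<S1}) (pair_pmf (map_pmf (hide b) (pmf_of_set {..<S2})) (pair_pmf (pmf_of_set {..<K}) Q1)))"
    and msg: "close \<epsilon> (map_pmf msg_view L) (pair_pmf (pmf_of_set {..<S2}) Q2)"
  shows "scode b W n S1 En S2 K \<epsilon>"
proof -
  have ne: "{..<S1} \<noteq> {}" "{..<S2} \<noteq> {}" "{..<En} \<noteq> {}" using pos by (auto simp: lessThan_empty_iff)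
  \<comment> \<open>A sender fixes its strategy for every slot value before the slot is known, so
    one input word is drawn for each \<open>e\<close>. Only the word at the actual slot is
    transmitted, and its marginal law is the required one.\<close>
  define \<rho>1 :: "('x1,'y1) sender1" where "\<rho>1 = bind_pmf (pmf_of_set {..<S1}) (\<lambda>s. bind_pmf (pmf_of_set {..<D1}) (\<lambda>d.
     map_pmf (\<lambda>F. (s, \<lambda>e. nonadaptive (F e))) (Pi_pmf {..<En} [] (\<lambda>e. X1 (c1 (s, e, d))))))"
  define \<rho>2 :: "('x2,'y2) sender2" where "\<rho>2 = bind_pmf (pmf_of_set {..<S2}) (\<lambda>t. bind_pmf (pmf_of_set {..<K}) (\<lambda>k.
     bind_pmf (pmf_of_set {..<D2}) (\<lambda>d. map_pmf (\<lambda>xs. (t, k, nonadaptive xs)) (X2 (c2 (t, k, d))))))"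
  have slot: "slot_law W n \<rho>1 e \<rho>2 = bind_pmf (pmf_of_set {..<S1}) (\<lambda>s. bind_pmf (pmf_of_set {..<D1}) (\<lambda>d.
      bind_pmf (pmf_of_set (indices S2 K D2)) (\<lambda>j2. map_pmf (\<lambda>r. (s, fst j2, fst (snd j2), r))
        (block_channel W n X1 X2 (c1 (s, e, d)) (c2 j2)))))" if "e < En" for e
  proof -
    have comp: "bind_pmf (Pi_pmf {..<En} [] (\<lambda>e. X1 (c1 (s, e, d)))) (\<lambda>F. H (F e)) = bind_pmf (X1 (c1 (s, e, d))) H" for s d H
    proof -
      have "map_pmf (\<lambda>F. F e) (Pi_pmf {..<En} [] (\<lambda>e. X1 (c1 (s, e, d)))) = X1 (c1 (s, e, d))"
        using that by (simp add: Pi_pmf_component)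
      then show ?thesis by (metis bind_map_pmf)
    qed
    have "slot_law W n \<rho>1 e \<rho>2 = bind_pmf (pmf_of_set {..<S1}) (\<lambda>s. bind_pmf (pmf_of_set {..<D1}) (\<lambda>d.
       bind_pmf (Pi_pmf {..<En} [] (\<lambda>e. X1 (c1 (s, e, d)))) (\<lambda>F. bind_pmf \<rho>2 (\<lambda>b.
         map_pmf (\<lambda>r. (s, fst b, fst (snd b), r)) (channel_run W (nonadaptive (F e)) (snd (snd b)) n)))))"
      unfolding slot_law_def \<rho>1_def by (simp add: bind_assoc_pmf bind_map_pmf)
    also have "\<dots> = bind_pmf (pmf_of_set {..<S1}) (\<lambda>s. bind_pmf (pmf_of_set {..<D1}) (\<lambda>d.
       bind_pmf (X1 (c1 (s, e, d))) (\<lambda>xs1. bind_pmf \<rho>2 (\<lambda>b.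
         map_pmf (\<lambda>r. (s, fst b, fst (snd b), r)) (channel_run W (nonadaptive xs1) (snd (snd b)) n)))))"
      by (intro bind_pmf_cong refl) (rule comp)
    also have "\<dots> = bind_pmf (pmf_of_set {..<S1}) (\<lambda>s. bind_pmf (pmf_of_set {..<D1}) (\<lambda>d.
       bind_pmf (X1 (c1 (s, e, d))) (\<lambda>xs1. bind_pmf (pmf_of_set (indices S2 K D2)) (\<lambda>j2. bind_pmf (X2 (c2 j2)) (\<lambda>xs2.
         map_pmf (\<lambda>r. (s, fst j2, fst (snd j2), r)) (channel_run W (nonadaptive xs1) (nonadaptive xs2) n))))))"
      unfolding \<rho>2_def pmf_of_set_indices[OF pos(4-6)] by (simp add: bind_assoc_pmf bind_map_pmf)
    also have "\<dots> = bind_pmf (pmf_of_set {..<S1}) (\<lambda>s. bind_pmf (pmf_of_set {..<D1}) (\<lambda>d.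
       bind_pmf (pmf_of_set (indices S2 K D2)) (\<lambda>j2. bind_pmf (X1 (c1 (s, e, d))) (\<lambda>xs1. bind_pmf (X2 (c2 j2)) (\<lambda>xs2.
         map_pmf (\<lambda>r. (s, fst j2, fst (snd j2), r)) (channel_run W (nonadaptive xs1) (nonadaptive xs2) n))))))"
      by (intro bind_pmf_cong refl) (rule bind_commute_pmf)
    finally show ?thesis unfolding block_channel_def map_bind_pmf .
  qed
  have run: "run_law W n \<rho>1 En \<rho>2 = L"
  proof -
    have "run_law W n \<rho>1 En \<rho>2 = bind_pmf (pmf_of_set {..<En}) (\<lambda>e. bind_pmf (pmf_of_set {..<S1}) (\<lambda>s. bind_pmf (pmf_of_set {..<D1}) (\<lambda>d.
      bind_pmf (pmf_of_set (indices S2 K D2)) (\<lambda>j2. map_pmf (\<lambda>r. (s, e, fst j2, fst (snd j2), r))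
        (block_channel W n X1 X2 (c1 (s, e, d)) (c2 j2))))))"
      unfolding run_law_def using ne(3)
      by (intro bind_pmf_cong refl) (simp add: slot set_pmf_of_set map_bind_pmf map_pmf_comp)
    also have "\<dots> = bind_pmf (pmf_of_set {..<S1}) (\<lambda>s. bind_pmf (pmf_of_set {..<En}) (\<lambda>e. bind_pmf (pmf_of_set {..<D1}) (\<lambda>d.
      bind_pmf (pmf_of_set (indices S2 K D2)) (\<lambda>j2. map_pmf (\<lambda>r. (s, e, fst j2, fst (snd j2), r))
        (block_channel W n X1 X2 (c1 (s, e, d)) (c2 j2))))))"
      by (rule bind_commute_pmf)
    also have "\<dots> = L"
      unfolding L_def codebook_law_def pmf_of_set_indices[OF pos(1-3)] by (simp add: bind_assoc_pmf bind_map_pmf)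
    finally show ?thesis .
  qed
  have m1: "map_pmf fst \<rho>1 = pmf_of_set {..<S1}"
    unfolding \<rho>1_def by (simp add: map_bind_pmf map_pmf_comp bind_return_pmf')
  have m2: "map_pmf (\<lambda>b. (fst b, fst (snd b))) \<rho>2 = pair_pmf (pmf_of_set {..<S2}) (pmf_of_set {..<K})"
    unfolding \<rho>2_def by (simp add: map_bind_pmf map_pmf_comp pair_pmf_def)
  show ?thesis unfolding scode_def
    apply (rule exI[of _ \<rho>1], rule exI[of _ \<rho>2], rule exI[of _ "{..<S1}"], rule exI[of _ "{..<S2}"],
       rule exI[of _ d1], rule exI[of _ d2], rule exI[of _ Q1], rule exI[of _ Q2])
    using pos m1 m2 err key msg ne unfolding run by simp
qed

lemma finite_block_channel:
  fixes W :: "('x1,'x2,'y1::finite,'y2::finite,'z::finite) channel"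
  assumes "finite (set_pmf (X1 a))" "finite (set_pmf (X2 b))"
  shows "finite (set_pmf (block_channel W n X1 X2 a b))"
  using assms finite_channel_run unfolding block_channel_def by auto

section \<open>Selection of codebooks and their decoding error\<close>

lemma E_greater:
  assumes fin: "finite (set_pmf r)" and less: "\<And>x. x \<in> set_pmf r \<Longrightarrow> \<beta> < h x"
  shows "\<beta> < E r h"
proof -
  obtain x where x: "x \<in> set_pmf r" using set_pmf_not_empty[of r] by blast
  have "E r (\<lambda>x. h x - \<beta>) = (\<Sum>x\<in>set_pmf r. (h x - \<beta>) * pmf r x)"
    by (rule integral_measure_pmf_real[OF fin])
  also have "\<dots> > 0"
    using x fin less by (intro sum_pos2[of _ x]) (auto simp: pmf_positive less_imp_le)
  finally show ?thesis using fin by (simp add: E_diff)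
qed

text \<open>The probabilistic method: a pair of codebooks that does at least as well as the average
  is fixed once and for all.\<close>

lemma exists_le_E:
  assumes "finite (set_pmf p)" "finite (set_pmf q)" "E p (\<lambda>x. E q (f x)) \<le> \<beta>"
  obtains x y where "x \<in> set_pmf p" "y \<in> set_pmf q" "f x y \<le> \<beta>"
proof -
  have "\<exists>x\<in>set_pmf p. \<exists>y\<in>set_pmf q. f x y \<le> \<beta>"
  proof (rule ccontr)
    assume "\<not> ?thesis"
    then have "\<beta> < f x y" if "x \<in> set_pmf p" "y \<in> set_pmf q" for x y using that by force
    then have "\<beta> < E p (\<lambda>x. E q (f x))" using assms(1,2) by (intro E_greater)
    then show False using assms(3) by simp
  qed
  then show ?thesis using that by blast
qed


abbreviation cw1 :: "'a \<times> 'b \<times> 'r \<Rightarrow> 'a" where "cw1 \<equiv> (\<lambda>(a, b, r). a)"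
abbreviation cw2 :: "'a \<times> 'b \<times> 'r \<Rightarrow> 'b" where "cw2 \<equiv> (\<lambda>(a, b, r). b)"

definition obs1 :: "('x1,'x2,'y1,'y2,'z) transcript \<Rightarrow> 'x1 list \<times> 'y1 list" where "obs1 r = (in1 r, out1 r)"
definition obs2 :: "('x1,'x2,'y1,'y2,'z) transcript \<Rightarrow> 'x2 list \<times> 'y2 list" where "obs2 r = (in2 r, out2 r)"

definition packing :: "'w pmf \<Rightarrow> ('w \<Rightarrow> 'a) \<Rightarrow> ('w \<Rightarrow> 'y) \<Rightarrow> real \<Rightarrow> nat \<Rightarrow> real" where
  "packing G X Y \<gamma> N = measure_pmf.prob G {w. dens G X Y w < \<gamma>} + real N / \<gamma>"

text \<open>The loss in soft covering with \<open>L\<close> codewords; it becomes small once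
  \<open>ln L\<close> exceeds the information density with high probability.\<close>

definition covering :: "'w pmf \<Rightarrow> ('w \<Rightarrow> 'a) \<Rightarrow> ('w \<Rightarrow> 'z) \<Rightarrow> real \<Rightarrow> real" where
  "covering G X Z L = E G (\<lambda>w. ln (1 + dens G X Z w / L))"

text \<open>User 2 recovers its own index as well: a decoder sees only inputs and outputs, and the key is needed later.\<close>

definition decoding_error :: "('a \<Rightarrow> 'b \<Rightarrow> ('x1,'x2,'y1,'y2,'z) transcript pmf) \<Rightarrow> ('a \<times> 'b \<times> ('x1,'x2,'y1,'y2,'z) transcript) pmf \<Rightarrow>
    real \<Rightarrow> real \<Rightarrow> real \<Rightarrow> (nat \<times> nat \<times> nat) set \<Rightarrow> (nat \<times> nat \<times> nat) set \<Rightarrow>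
    (nat \<times> nat \<times> nat \<Rightarrow> 'a) \<Rightarrow> (nat \<times> nat \<times> nat \<Rightarrow> 'b) \<Rightarrow> real" where
  "decoding_error \<kappa> G \<gamma>1 \<gamma>2 \<gamma>3 J1 J2 c1 c2 = E (pmf_of_set J1) (\<lambda>j1. E (pmf_of_set J2) (\<lambda>j2.
     measure_pmf.prob (\<kappa> (c1 j1) (c2 j2)) {r. \<not> decodable (map_pmf (\<lambda>(a, b, r). (a, obs2 r)) G) \<gamma>1 J1 c1 j1 (obs2 r)} +
     measure_pmf.prob (\<kappa> (c1 j1) (c2 j2)) {r. \<not> decodable (map_pmf (\<lambda>(a, b, r). (b, obs1 r)) G) \<gamma>2 J2 c2 j2 (obs1 r)} +
     measure_pmf.prob (\<kappa> (c1 j1) (c2 j2)) {r. \<not> decodable (map_pmf (\<lambda>(a, b, r). (b, obs2 r)) G) \<gamma>3 J2 c2 j2 (obs2 r)}))"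

text \<open>Exchanging the two users in the joint law reduces decoding of user 2's index to
  \<open>threshold_decoding\<close>. The observation is left arbitrary because both user 1 and user
  2 decode this index.\<close>

lemma threshold_decoding2:
  fixes p1 :: "'a pmf" and p2 :: "'b pmf" and \<kappa> :: "'a \<Rightarrow> 'b \<Rightarrow> 'r pmf" and Y :: "'r \<Rightarrow> 'y"
  assumes fin: "finite (set_pmf p1)" "finite (set_pmf p2)"
      "\<And>a b. a \<in> set_pmf p1 \<Longrightarrow> b \<in> set_pmf p2 \<Longrightarrow> finite (set_pmf (\<kappa> a b))"
    and J: "finite J1" "finite J2" "j1 \<in> J1" "j2 \<in> J2" and \<gamma>: "0 < \<gamma>"
  defines "G \<equiv> joint p1 p2 \<kappa>"
  shows "E (codebook J1 p1) (\<lambda>c1. E (codebook J2 p2) (\<lambda>c2.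
      measure_pmf.prob (\<kappa> (c1 j1) (c2 j2)) {r. \<not> decodable (map_pmf (\<lambda>(a, b, r). (b, Y r)) G) \<gamma> J2 c2 j2 (Y r)})) \<le>
    packing G cw2 (\<lambda>(a, b, r). Y r) \<gamma> (card J2)"
proof -
  define h where "h = (\<lambda>(a, b, r). (b, a, r) :: 'b \<times> 'a \<times> 'r)"
  have sw: "joint p2 p1 (\<lambda>b a. \<kappa> a b) = map_pmf h G"
    unfolding G_def h_def by (rule joint_swap)
  have finc: "finite (set_pmf (codebook J1 p1))" "finite (set_pmf (codebook J2 p2))"
    using J fin by (auto intro: finite_codebook)
  have 1: "map_pmf (\<lambda>(a, b, r). (a, Y r)) (map_pmf h G) = map_pmf (\<lambda>(a, b, r). (b, Y r)) G"
    by (simp add: map_pmf_comp h_def case_prod_unfold)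
  have 2: "measure_pmf.prob (map_pmf h G) {w. dens (map_pmf h G) cw1 (\<lambda>(a, b, r). Y r) w < \<gamma>} =
      measure_pmf.prob G {w. dens G cw2 (\<lambda>(a, b, r). Y r) w < \<gamma>}"
  proof -
    have "(\<lambda>(a, b, r). a) \<circ> h = cw2" "(\<lambda>(a, b, r). Y r) \<circ> h = (\<lambda>(a, b, r). Y r)"
      by (auto simp: h_def fun_eq_iff)
    then show ?thesis by (simp add: vimage_def dens_map_pmf)
  qed
  have "E (codebook J1 p1) (\<lambda>c1. E (codebook J2 p2) (\<lambda>c2.
      measure_pmf.prob (\<kappa> (c1 j1) (c2 j2)) {r. \<not> decodable (map_pmf (\<lambda>(a, b, r). (b, Y r)) G) \<gamma> J2 c2 j2 (Y r)})) =
    E (codebook J2 p2) (\<lambda>c2. E (codebook J1 p1) (\<lambda>c1.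
      measure_pmf.prob (\<kappa> (c1 j1) (c2 j2)) {r. \<not> decodable (map_pmf (\<lambda>(a, b, r). (b, Y r)) G) \<gamma> J2 c2 j2 (Y r)}))"
    by (rule E_swap[OF finc])
  also have "\<dots> \<le> packing G cw2 (\<lambda>(a, b, r). Y r) \<gamma> (card J2)"
    using threshold_decoding[OF fin(2,1), of "\<lambda>b a. \<kappa> a b" J2 J1 j2 j1 \<gamma> Y] fin(3) J \<gamma>
    unfolding sw 1 2 packing_def by simp
  finally show ?thesis .
qed

lemma E_decoding_error:
  fixes p1 :: "'a pmf" and p2 :: "'b pmf" and \<kappa> :: "'a \<Rightarrow> 'b \<Rightarrow> ('x1,'x2,'y1,'y2,'z) transcript pmf"
  assumes fin: "finite (set_pmf p1)" "finite (set_pmf p2)"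
      "\<And>a b. a \<in> set_pmf p1 \<Longrightarrow> b \<in> set_pmf p2 \<Longrightarrow> finite (set_pmf (\<kappa> a b))"
    and J: "finite J1" "finite J2" "J1 \<noteq> {}" "J2 \<noteq> {}" and \<gamma>: "0 < \<gamma>1" "0 < \<gamma>2" "0 < \<gamma>3"
  defines "G \<equiv> joint p1 p2 \<kappa>"
  shows "E (codebook J1 p1) (\<lambda>c1. E (codebook J2 p2) (decoding_error \<kappa> G \<gamma>1 \<gamma>2 \<gamma>3 J1 J2 c1)) \<le>
    packing G cw1 (\<lambda>(a, b, r). obs2 r) \<gamma>1 (card J1) + packing G cw2 (\<lambda>(a, b, r). obs1 r) \<gamma>2 (card J2) +
    packing G cw2 (\<lambda>(a, b, r). obs2 r) \<gamma>3 (card J2)" (is "_ \<le> ?B")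
proof -
  define C1 where "C1 = codebook J1 p1"
  define C2 where "C2 = codebook J2 p2"
  have finc: "finite (set_pmf C1)" "finite (set_pmf C2)" unfolding C1_def C2_def
    using J fin by (auto intro: finite_codebook)
  have finJ: "finite (set_pmf (pmf_of_set J1))" "finite (set_pmf (pmf_of_set J2))" using J by (auto simp: set_pmf_of_set)
  define T where "T j1 j2 c1 c2 =
     measure_pmf.prob (\<kappa> (c1 j1) (c2 j2)) {r. \<not> decodable (map_pmf (\<lambda>(a, b, r). (a, obs2 r)) G) \<gamma>1 J1 c1 j1 (obs2 r)} +
     measure_pmf.prob (\<kappa> (c1 j1) (c2 j2)) {r. \<not> decodable (map_pmf (\<lambda>(a, b, r). (b, obs1 r)) G) \<gamma>2 J2 c2 j2 (obs1 r)} +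
     measure_pmf.prob (\<kappa> (c1 j1) (c2 j2)) {r. \<not> decodable (map_pmf (\<lambda>(a, b, r). (b, obs2 r)) G) \<gamma>3 J2 c2 j2 (obs2 r)}"
     for j1 j2 c1 c2
  have "E C1 (\<lambda>c1. E C2 (decoding_error \<kappa> G \<gamma>1 \<gamma>2 \<gamma>3 J1 J2 c1)) =
      E C1 (\<lambda>c1. E C2 (\<lambda>c2. E (pmf_of_set J1) (\<lambda>j1. E (pmf_of_set J2) (\<lambda>j2. T j1 j2 c1 c2))))"
    unfolding decoding_error_def T_def ..
  also have "\<dots> = E (pmf_of_set J1) (\<lambda>j1. E (pmf_of_set J2) (\<lambda>j2. E C1 (\<lambda>c1. E C2 (T j1 j2 c1))))"
    by (simp only: E_swap[OF finc(2) finJ(1)] E_swap[OF finc(2) finJ(2)] E_swap[OF finc(1) finJ(1)] E_swap[OF finc(1) finJ(2)])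
  also have "\<dots> \<le> E (pmf_of_set J1) (\<lambda>j1. E (pmf_of_set J2) (\<lambda>j2. ?B))"
  proof (intro E_mono finJ)
    fix j1 j2 assume "j1 \<in> set_pmf (pmf_of_set J1)" "j2 \<in> set_pmf (pmf_of_set J2)"
    then have j: "j1 \<in> J1" "j2 \<in> J2" using J by (auto simp: set_pmf_of_set)
    have "E C1 (\<lambda>c1. E C2 (T j1 j2 c1)) =
       E C1 (\<lambda>c1. E C2 (\<lambda>c2. measure_pmf.prob (\<kappa> (c1 j1) (c2 j2)) {r. \<not> decodable (map_pmf (\<lambda>(a, b, r). (a, obs2 r)) G) \<gamma>1 J1 c1 j1 (obs2 r)})) +
       E C1 (\<lambda>c1. E C2 (\<lambda>c2. measure_pmf.prob (\<kappa> (c1 j1) (c2 j2)) {r. \<not> decodable (map_pmf (\<lambda>(a, b, r). (b, obs1 r)) G) \<gamma>2 J2 c2 j2 (obs1 r)})) +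
       E C1 (\<lambda>c1. E C2 (\<lambda>c2. measure_pmf.prob (\<kappa> (c1 j1) (c2 j2)) {r. \<not> decodable (map_pmf (\<lambda>(a, b, r). (b, obs2 r)) G) \<gamma>3 J2 c2 j2 (obs2 r)}))"
      unfolding T_def by (simp only: E_add[OF finc(1)] E_add[OF finc(2)])
    also have "\<dots> \<le> ?B"
      unfolding C1_def C2_def G_def
      by (intro add_mono threshold_decoding2 fin J j \<gamma>)
         (use threshold_decoding[where Y=obs2, OF fin J(1,2) j \<gamma>(1)] in \<open>simp add: packing_def\<close>)
    finally show "E C1 (\<lambda>c1. E C2 (T j1 j2 c1)) \<le> ?B" .
  qed
  also have "\<dots> = ?B" by simp
  finally show ?thesis unfolding C1_def C2_def .
qed

lemma decoding_error_nonneg: "0 \<le> decoding_error \<kappa> G \<gamma>1 \<gamma>2 \<gamma>3 J1 J2 c1 c2"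
  unfolding decoding_error_def by (intro E_nonneg add_nonneg_nonneg) auto

lemma decoders_exist:
  fixes \<kappa> :: "'a \<Rightarrow> 'b \<Rightarrow> ('x1,'x2,'y1,'y2,'z) transcript pmf"
  assumes J: "finite J1" "finite J2" "J1 \<noteq> {}" "J2 \<noteq> {}"
  obtains d1 d2 where "measure_pmf.prob (codebook_law \<kappa> J1 J2 c1 c2) (- correct d1 d2) \<le> decoding_error \<kappa> G \<gamma>1 \<gamma>2 \<gamma>3 J1 J2 c1 c2"
proof -
  define P1 where "P1 = map_pmf (\<lambda>(a, b, r :: ('x1,'x2,'y1,'y2,'z) transcript). (a, obs2 r)) G"
  define P2 where "P2 = map_pmf (\<lambda>(a, b, r :: ('x1,'x2,'y1,'y2,'z) transcript). (b, obs1 r)) G"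
  define P3 where "P3 = map_pmf (\<lambda>(a, b, r :: ('x1,'x2,'y1,'y2,'z) transcript). (b, obs2 r)) G"
  define d1 where "d1 xs ys = (case decode P2 \<gamma>2 J2 c2 (xs, ys) of (t, k, d) \<Rightarrow> (t, k))" for xs ys
  define d2 where "d2 xs ys = (case decode P1 \<gamma>1 J1 c1 (xs, ys) of (s, e, d) \<Rightarrow>
     case decode P3 \<gamma>3 J2 c2 (xs, ys) of (t, k, d) \<Rightarrow> (s, e, k))" for xs ys
  have sub: "(\<lambda>r. (fst j1, fst (snd j1), fst j2, fst (snd j2), r)) -` (- correct d1 d2) \<subseteq>
      ({r. \<not> decodable P1 \<gamma>1 J1 c1 j1 (obs2 r)} \<union> {r. \<not> decodable P2 \<gamma>2 J2 c2 j2 (obs1 r)}) \<union> {r. \<not> decodable P3 \<gamma>3 J2 c2 j2 (obs2 r)}"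
    if j: "j1 \<in> J1" "j2 \<in> J2" for j1 j2
  proof (rule subsetI, rule ccontr)
    fix r assume r: "r \<in> (\<lambda>r. (fst j1, fst (snd j1), fst j2, fst (snd j2), r)) -` (- correct d1 d2)"
      and "r \<notin> ({r. \<not> decodable P1 \<gamma>1 J1 c1 j1 (obs2 r)} \<union> {r. \<not> decodable P2 \<gamma>2 J2 c2 j2 (obs1 r)}) \<union> {r. \<not> decodable P3 \<gamma>3 J2 c2 j2 (obs2 r)}"
    then have "decodable P1 \<gamma>1 J1 c1 j1 (obs2 r)" "decodable P2 \<gamma>2 J2 c2 j2 (obs1 r)" "decodable P3 \<gamma>3 J2 c2 j2 (obs2 r)" by blast+
    then have "decode P1 \<gamma>1 J1 c1 (obs2 r) = j1" "decode P2 \<gamma>2 J2 c2 (obs1 r) = j2" "decode P3 \<gamma>3 J2 c2 (obs2 r) = j2"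
      using j by (auto intro: decode_eq)
    then have "d1 (in1 r) (out1 r) = (fst j2, fst (snd j2))" "d2 (in2 r) (out2 r) = (fst j1, fst (snd j1), fst (snd j2))"
      by (simp_all add: d1_def d2_def obs1_def obs2_def case_prod_unfold)
    then show False using r by (simp add: correct_def)
  qed
  have "measure_pmf.prob (codebook_law \<kappa> J1 J2 c1 c2) (- correct d1 d2) = E (pmf_of_set J1) (\<lambda>j1. E (pmf_of_set J2) (\<lambda>j2.
      measure_pmf.prob (\<kappa> (c1 j1) (c2 j2)) ((\<lambda>r. (fst j1, fst (snd j1), fst j2, fst (snd j2), r)) -` (- correct d1 d2))))"
    unfolding codebook_law_def prob_bind_pmf by simp
  also have "\<dots> \<le> decoding_error \<kappa> G \<gamma>1 \<gamma>2 \<gamma>3 J1 J2 c1 c2"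
    unfolding decoding_error_def P1_def[symmetric] P2_def[symmetric] P3_def[symmetric]
  proof (intro E_mono)
    fix j1 j2 assume "j1 \<in> set_pmf (pmf_of_set J1)" "j2 \<in> set_pmf (pmf_of_set J2)"
    then have j: "j1 \<in> J1" "j2 \<in> J2" using J by (auto simp: set_pmf_of_set)
    let ?p = "measure_pmf.prob (\<kappa> (c1 j1) (c2 j2))"
    have "?p ((\<lambda>r. (fst j1, fst (snd j1), fst j2, fst (snd j2), r)) -` (- correct d1 d2)) \<le> ?p (
      ({r. \<not> decodable P1 \<gamma>1 J1 c1 j1 (obs2 r)} \<union> {r. \<not> decodable P2 \<gamma>2 J2 c2 j2 (obs1 r)}) \<union> {r. \<not> decodable P3 \<gamma>3 J2 c2 j2 (obs2 r)})"
      by (rule measure_pmf.finite_measure_mono[OF sub[OF j]]) simp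
    also have "\<dots> \<le> ?p ({r. \<not> decodable P1 \<gamma>1 J1 c1 j1 (obs2 r)} \<union> {r. \<not> decodable P2 \<gamma>2 J2 c2 j2 (obs1 r)}) + ?p {r. \<not> decodable P3 \<gamma>3 J2 c2 j2 (obs2 r)}"
      by (rule measure_Un_le) auto
    also have "?p ({r. \<not> decodable P1 \<gamma>1 J1 c1 j1 (obs2 r)} \<union> {r. \<not> decodable P2 \<gamma>2 J2 c2 j2 (obs1 r)}) \<le>
       ?p {r. \<not> decodable P1 \<gamma>1 J1 c1 j1 (obs2 r)} + ?p {r. \<not> decodable P2 \<gamma>2 J2 c2 j2 (obs1 r)}"
      by (rule measure_Un_le) auto
    finally show "?p ((\<lambda>r. (fst j1, fst (snd j1), fst j2, fst (snd j2), r)) -` (- correct d1 d2)) \<le>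
       ?p {r. \<not> decodable P1 \<gamma>1 J1 c1 j1 (obs2 r)} + ?p {r. \<not> decodable P2 \<gamma>2 J2 c2 j2 (obs1 r)} + ?p {r. \<not> decodable P3 \<gamma>3 J2 c2 j2 (obs2 r)}" by simp
  qed (use J in \<open>auto simp: set_pmf_of_set\<close>)
  finally show ?thesis by (rule that)
qed

section \<open>One-shot existence of secret codes\<close>

lemma pmf_of_set_box:
  assumes "finite A" "A \<noteq> {}" "finite B" "B \<noteq> {}" "finite C" "C \<noteq> {}"
  shows "pmf_of_set (A \<times> B \<times> C) = pair_pmf (pmf_of_set A) (pair_pmf (pmf_of_set B) (pmf_of_set C))"
  using assms by (simp add: pair_pmf_of_set)

text \<open>A view is protected by the parts of the indices that it omits. The key view shows
  \<open>s\<close> and \<open>k\<close>; what remains is the slot and local randomness of user 1,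
  and the local randomness of user 2 together with its message when \<open>b\<close> is false. The
  message view shows only \<open>t\<close>, so the whole index of user 1 and the key of user 2 are
  available as well.\<close>

lemma random_code_mac:
  fixes W :: "('x1,'x2,'y1::finite,'y2::finite,'z::finite) channel"
    and X1 :: "'a \<Rightarrow> 'x1 list pmf" and X2 :: "'b \<Rightarrow> 'x2 list pmf" and n :: nat
  assumes fin: "finite (set_pmf p1)" "finite (set_pmf p2)" "\<And>a. a \<in> set_pmf p1 \<Longrightarrow> finite (set_pmf (X1 a))"
      "\<And>b. b \<in> set_pmf p2 \<Longrightarrow> finite (set_pmf (X2 b))"
    and pos: "0 < S1" "0 < N" "0 < D1" "0 < S2" "0 < K" "0 < D2" and t: "0 < t"
    and \<gamma>: "0 < \<gamma>1" "0 < \<gamma>2" "0 < \<gamma>3"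
  defines "G \<equiv> joint p1 p2 (block_channel W n X1 X2)"
  defines "\<sigma> \<equiv> \<lambda>l1 l2. (covering G (\<lambda>(a, b, r). (a, b)) (\<lambda>(a, b, r). eve r) (real l1 * real l2)
     + covering G cw1 (\<lambda>(a, b, r). eve r) (real l1) + covering G cw2 (\<lambda>(a, b, r). eve r) (real l2)) / (2 * t) + 2 * t"
  shows "scode b W n S1 N S2 K (packing G cw1 (\<lambda>(a, b, r). obs2 r) \<gamma>1 (S1 * (N * D1))
     + packing G cw2 (\<lambda>(a, b, r). obs1 r) \<gamma>2 (S2 * (K * D2)) + packing G cw2 (\<lambda>(a, b, r). obs2 r) \<gamma>3 (S2 * (K * D2))
     + \<sigma> (N * D1) ((if b then 1 else S2) * D2) + \<sigma> (S1 * (N * D1)) (K * D2))" (is "scode b W n S1 N S2 K (?e + ?k + ?m)")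
proof -
  define J1 where "J1 = indices S1 N D1"
  define J2 where "J2 = indices S2 K D2"
  define \<kappa> where "\<kappa> = block_channel W n X1 X2"
  define \<omega> where "\<omega> a b = map_pmf eve (\<kappa> a b)" for a b
  define Q where "Q = map_pmf (\<lambda>(a, b, r). eve r) G"
  define C1 where "C1 = codebook J1 p1"
  define C2 where "C2 = codebook J2 p2"
  have G: "G = joint p1 p2 \<kappa>" unfolding G_def \<kappa>_def ..
  have fin\<kappa>: "finite (set_pmf (\<kappa> a b))" if "a \<in> set_pmf p1" "b \<in> set_pmf p2" for a b
    unfolding \<kappa>_def using that fin by (intro finite_block_channel) auto
  have J: "finite J1" "finite J2" "J1 \<noteq> {}" "J2 \<noteq> {}" "card J1 = S1 * (N * D1)" "card J2 = S2 * (K * D2)"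
    unfolding J1_def J2_def using pos by (auto simp: finite_indices card_indices indices_nonempty)
  have finc: "finite (set_pmf C1)" "finite (set_pmf C2)"
    unfolding C1_def C2_def using J fin by (auto intro: finite_codebook)
  have ne: "{..<S1} \<noteq> {}" "{..<N} \<noteq> {}" "{..<D1} \<noteq> {}" "{..<S2} \<noteq> {}" "{..<K} \<noteq> {}" "{..<D2} \<noteq> {}"
    using pos by (auto simp: lessThan_empty_iff)
  have finQ: "finite (set_pmf Q)" unfolding Q_def G using finite_joint[OF fin(1,2) fin\<kappa>] by simp
  have sub: "set_pmf (\<omega> (c1 j1) (c2 j2)) \<subseteq> set_pmf Q"
    if "c1 \<in> set_pmf C1" "c2 \<in> set_pmf C2" "j1 \<in> J1" "j2 \<in> J2" for c1 c2 j1 j2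
  proof -
    have "c1 j1 \<in> set_pmf p1" "c2 j2 \<in> set_pmf p2"
      using codebook_mem[OF J(1) that(1)[unfolded C1_def] that(3)] codebook_mem[OF J(2) that(2)[unfolded C2_def] that(4)] by auto
    then show ?thesis unfolding \<omega>_def Q_def G joint_def by (force simp: set_map_pmf)
  qed
  define mix where "mix U1 U2 c1 c2 = bind_pmf (pmf_of_set U1) (\<lambda>u1. bind_pmf (pmf_of_set U2) (\<lambda>u2. \<omega> (c1 u1) (c2 u2)))"
    for U1 U2 :: "(nat \<times> nat \<times> nat) set" and c1 c2
  have cov: "E C1 (\<lambda>c1. E C2 (\<lambda>c2. l1_dist (set_pmf Q) (mix U1 U2 c1 c2) Q)) \<le> \<sigma> (card U1) (card U2)"
    if "U1 \<subseteq> J1" "U1 \<noteq> {}" "U2 \<subseteq> J2" "U2 \<noteq> {}" for U1 U2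
    using soft_covering_mac[where Z=eve, OF fin(1,2) fin\<kappa> J(1,2) that t]
    unfolding C1_def C2_def mix_def \<omega>_def Q_def G \<sigma>_def covering_def by simp

  define \<alpha> where "\<alpha> = pmf_of_set {..<S1}"
  define \<beta> where "\<beta> = pair_pmf (map_pmf (hide b) (pmf_of_set {..<S2})) (pmf_of_set {..<K})"
  define V1 where "V1 s = {s} \<times> {..<N} \<times> {..<D1}" for s :: nat
  define V2 where "V2 = (\<lambda>(t :: nat, k :: nat). (if b then {t} else {..<S2}) \<times> {k} \<times> {..<D2})"
  have fin\<alpha>\<beta>: "finite (set_pmf \<alpha>)" "finite (set_pmf \<beta>)" unfolding \<alpha>_def \<beta>_def using ne by (auto simp: set_pmf_of_set)
  have V1: "pmf_of_set J1 = bind_pmf \<alpha> (\<lambda>s. pmf_of_set (V1 s))"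
    unfolding J1_def \<alpha>_def V1_def indices_def using ne by (intro pmf_of_set_times) auto
  have V1': "V1 s \<subseteq> J1 \<and> finite (V1 s) \<and> V1 s \<noteq> {} \<and> card (V1 s) = N * D1" if "s \<in> set_pmf \<alpha>" for s
    using that ne unfolding V1_def J1_def indices_def \<alpha>_def by (auto simp: set_pmf_of_set card_cartesian_product)
  have V2: "pmf_of_set J2 = bind_pmf \<beta> (\<lambda>y. pmf_of_set (V2 y))"
  proof (cases b)
    case True
    have "hide b = id" using True by (auto simp: hide_def fun_eq_iff)
    then show ?thesis unfolding J2_def \<beta>_def V2_def indices_def using True ne
      by (simp add: pmf_of_set_box pair_pmf_def bind_assoc_pmf bind_return_pmf pmf_of_set_singleton pmf.map_id)
  next
    case False
    have "hide b = (\<lambda>_. 0)" using False by (auto simp: hide_def fun_eq_iff)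
    then have "map_pmf (hide b) (pmf_of_set {..<S2}) = return_pmf 0" by simp
    then show ?thesis unfolding J2_def \<beta>_def V2_def indices_def using False ne
      by (simp add: pmf_of_set_box pair_pmf_def bind_assoc_pmf bind_return_pmf pmf_of_set_singleton
           bind_commute_pmf[of "pmf_of_set {..<S2}" "pmf_of_set {..<K}"])
  qed
  have V2': "V2 y \<subseteq> J2 \<and> finite (V2 y) \<and> V2 y \<noteq> {} \<and> card (V2 y) = (if b then 1 else S2) * D2" if "y \<in> set_pmf \<beta>" for y
    using that ne unfolding V2_def J2_def indices_def \<beta>_def
    by (auto simp: set_pmf_of_set card_cartesian_product hide_def split: if_splits)
  define T2 where "T2 t = {t} \<times> {..<K} \<times> {..<D2}" for t :: nat
  define \<tau> where "\<tau> = pmf_of_set {..<S2}"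
  have fin\<tau>: "finite (set_pmf \<tau>)" unfolding \<tau>_def using ne by (auto simp: set_pmf_of_set)
  have T2: "pmf_of_set J2 = bind_pmf \<tau> (\<lambda>s. pmf_of_set (T2 s))"
    unfolding J2_def \<tau>_def T2_def indices_def using ne by (intro pmf_of_set_times) auto
  have T2': "T2 s \<subseteq> J2 \<and> finite (T2 s) \<and> T2 s \<noteq> {} \<and> card (T2 s) = K * D2" if "s \<in> set_pmf \<tau>" for s
    using that ne unfolding T2_def J2_def indices_def \<tau>_def by (auto simp: set_pmf_of_set card_cartesian_product)

  define F where "F = decoding_error \<kappa> G \<gamma>1 \<gamma>2 \<gamma>3 J1 J2"
  define Fk where "Fk c1 c2 = E \<alpha> (\<lambda>s. E \<beta> (\<lambda>y. l1_dist (set_pmf Q) (mix (V1 s) (V2 y) c1 c2) Q))" for c1 c2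
  define Fm where "Fm c1 c2 = E \<tau> (\<lambda>t. l1_dist (set_pmf Q) (mix J1 (T2 t) c1 c2) Q)" for c1 c2
  have l1: "0 \<le> l1_dist S p q" for S :: "'z list set" and p q unfolding l1_dist_def by (simp add: sum_nonneg)
  have nn: "0 \<le> F c1 c2" "0 \<le> Fk c1 c2" "0 \<le> Fm c1 c2" for c1 c2
    unfolding F_def Fk_def Fm_def by (auto intro!: E_nonneg l1 decoding_error_nonneg)
  have "E C1 (\<lambda>c1. E C2 (\<lambda>c2. F c1 c2)) \<le> ?e"
    using E_decoding_error[OF fin(1,2) fin\<kappa> J(1-4) \<gamma>] unfolding F_def C1_def C2_def G J(5,6) .
  moreover have "E C1 (\<lambda>c1. E C2 (\<lambda>c2. Fk c1 c2)) \<le> ?k"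
  proof -
    have "E C1 (\<lambda>c1. E C2 (\<lambda>c2. Fk c1 c2)) = E \<alpha> (\<lambda>s. E \<beta> (\<lambda>y. E C1 (\<lambda>c1. E C2 (\<lambda>c2. l1_dist (set_pmf Q) (mix (V1 s) (V2 y) c1 c2) Q))))"
      unfolding Fk_def by (simp only: E_swap[OF finc(2) fin\<alpha>\<beta>(1)] E_swap[OF finc(2) fin\<alpha>\<beta>(2)] E_swap[OF finc(1) fin\<alpha>\<beta>(1)] E_swap[OF finc(1) fin\<alpha>\<beta>(2)])
    also have "\<dots> \<le> E \<alpha> (\<lambda>s. E \<beta> (\<lambda>y. ?k))"
    proof (intro E_mono fin\<alpha>\<beta>)
      fix s y assume "s \<in> set_pmf \<alpha>" "y \<in> set_pmf \<beta>"
      then show "E C1 (\<lambda>c1. E C2 (\<lambda>c2. l1_dist (set_pmf Q) (mix (V1 s) (V2 y) c1 c2) Q)) \<le> ?k"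
        using V1'[of s] V2'[of y] cov[of "V1 s" "V2 y"] by simp
    qed
    finally show ?thesis by simp
  qed
  moreover have "E C1 (\<lambda>c1. E C2 (\<lambda>c2. Fm c1 c2)) \<le> ?m"
  proof -
    have "E C1 (\<lambda>c1. E C2 (\<lambda>c2. Fm c1 c2)) = E \<tau> (\<lambda>y. E C1 (\<lambda>c1. E C2 (\<lambda>c2. l1_dist (set_pmf Q) (mix J1 (T2 y) c1 c2) Q)))"
      unfolding Fm_def by (simp only: E_swap[OF finc(2) fin\<tau>] E_swap[OF finc(1) fin\<tau>])
    also have "\<dots> \<le> E \<tau> (\<lambda>y. ?m)"
    proof (intro E_mono fin\<tau>)
      fix y assume "y \<in> set_pmf \<tau>"
      then show "E C1 (\<lambda>c1. E C2 (\<lambda>c2. l1_dist (set_pmf Q) (mix J1 (T2 y) c1 c2) Q)) \<le> ?m"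
        using T2'[of y] cov[of J1 "T2 y"] J by simp
    qed
    finally show ?thesis by simp
  qed
  \<comment> \<open>Decoding error and the two secrecy gaps are nonnegative, so one pair of
    codebooks with a small sum makes each of them small.\<close>
  ultimately have "E C1 (\<lambda>c1. E C2 (\<lambda>c2. F c1 c2 + Fk c1 c2 + Fm c1 c2)) \<le> ?e + ?k + ?m"
    by (simp add: E_add finc)
  from exists_le_E[OF finc this] obtain c1 c2 where c: "c1 \<in> set_pmf C1" "c2 \<in> set_pmf C2"
    and le: "F c1 c2 + Fk c1 c2 + Fm c1 c2 \<le> ?e + ?k + ?m" by blast
  define L where "L = codebook_law \<kappa> J1 J2 c1 c2"
  obtain d1 d2 where d: "measure_pmf.prob L (- correct d1 d2) \<le> F c1 c2"
    unfolding L_def F_def by (rule decoders_exist[OF J(1-4)])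
  have key: "close (Fk c1 c2) (map_pmf (key_view b) L)
      (pair_pmf (pmf_of_set {..<S1}) (pair_pmf (map_pmf (hide b) (pmf_of_set {..<S2})) (pair_pmf (pmf_of_set {..<K}) Q)))"
  proof -
    have "close (Fk c1 c2)
     (bind_pmf (pmf_of_set J1) (\<lambda>j1. bind_pmf (pmf_of_set J2) (\<lambda>j2. map_pmf (\<lambda>z. (fst j1, (hide b (fst j2), fst (snd j2)), z)) (\<omega> (c1 j1) (c2 j2)))))
     (bind_pmf \<alpha> (\<lambda>x. bind_pmf \<beta> (\<lambda>y. map_pmf (\<lambda>z. (x, y, z)) Q)))"
      unfolding Fk_def mix_def
    proof (rule view_close[OF V1 _ V2])
      show "fst j = x" if "j \<in> V1 x" for x j using that by (auto simp: V1_def)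
      show "(hide b (fst j), fst (snd j)) = y" if "y \<in> set_pmf \<beta>" "j \<in> V2 y" for y j
        using that by (cases y) (auto simp: V2_def \<beta>_def hide_def split: if_splits)
      show "set_pmf (\<omega> (c1 j1) (c2 j2)) \<subseteq> set_pmf Q" if "x \<in> set_pmf \<alpha>" "j1 \<in> V1 x" "j2 \<in> J2" for x j1 j2
        using sub[OF c _ that(3)] V1'[OF that(1)] that(2) by blast
    qed (use V1' V2' fin\<alpha>\<beta> finQ in blast)+
    from close_map[OF this, of "\<lambda>(s, (t, k), z). (s, t, k, z)"]
    show ?thesis unfolding L_def codebook_law_def \<alpha>_def \<beta>_def \<omega>_def pair_pmf_def
      by (simp add: map_bind_pmf bind_map_pmf bind_assoc_pmf bind_return_pmf map_pmf_comp key_view_def)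
         (simp add: map_pmf_def bind_assoc_pmf bind_return_pmf)
  qed
  have msg: "close (Fm c1 c2) (map_pmf msg_view L) (pair_pmf (pmf_of_set {..<S2}) Q)"
  proof -
    \<comment> \<open>Nothing of user 1's index is visible here, so its visible part is a single
      point and its whole codebook covers.\<close>
    have "close (E (return_pmf ()) (\<lambda>x. Fm c1 c2))
     (bind_pmf (pmf_of_set J1) (\<lambda>j1. bind_pmf (pmf_of_set J2) (\<lambda>j2. map_pmf (\<lambda>z. ((), fst j2, z)) (\<omega> (c1 j1) (c2 j2)))))
     (bind_pmf (return_pmf ()) (\<lambda>x. bind_pmf \<tau> (\<lambda>y. map_pmf (\<lambda>z. (x, y, z)) Q)))"
      unfolding Fm_def mix_def
      by (rule view_close[where ?U1.0="\<lambda>_. J1", OF _ _ T2])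
         (use T2' fin\<tau> finQ sub[OF c] J in \<open>auto simp: T2_def bind_return_pmf\<close>)
    from close_map[OF this, of "\<lambda>(x, t, z). (t, z)"]
    show ?thesis unfolding L_def codebook_law_def \<tau>_def \<omega>_def pair_pmf_def
      by (simp add: map_bind_pmf bind_map_pmf bind_assoc_pmf bind_return_pmf map_pmf_comp msg_view_def)
         (simp add: map_pmf_def bind_assoc_pmf bind_return_pmf)
  qed
  have err': "measure_pmf.prob L (- correct d1 d2) \<le> ?e + ?k + ?m" using d le nn[of c1 c2] by linarith
  have key': "close (?e + ?k + ?m) (map_pmf (key_view b) L)
      (pair_pmf (pmf_of_set {..<S1}) (pair_pmf (map_pmf (hide b) (pmf_of_set {..<S2})) (pair_pmf (pmf_of_set {..<K}) Q)))"
    by (rule close_mono[OF key]) (use le nn[of c1 c2] in linarith)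
  have msg': "close (?e + ?k + ?m) (map_pmf msg_view L) (pair_pmf (pmf_of_set {..<S2}) Q)"
    by (rule close_mono[OF msg]) (use le nn[of c1 c2] in linarith)
  show ?thesis
    by (rule scode_codebook[OF pos err'[unfolded L_def \<kappa>_def J1_def J2_def]
        key'[unfolded L_def \<kappa>_def J1_def J2_def] msg'[unfolded L_def \<kappa>_def J1_def J2_def]])
qed

text \<open>User 1 has no private message here, and \<open>t\<close> belongs to the key view. The
  message view is then a marginal of the key view, so one covering bound, with the local randomness
  of user 2 alone, settles both.\<close>

lemma random_code_public:
  fixes W :: "('x1,'x2,'y1::finite,'y2::finite,'z::finite) channel"
    and X1 :: "'a \<Rightarrow> 'x1 list pmf" and X2 :: "'b \<Rightarrow> 'x2 list pmf" and n :: nat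
  assumes fin: "finite (set_pmf p1)" "finite (set_pmf p2)" "\<And>a. a \<in> set_pmf p1 \<Longrightarrow> finite (set_pmf (X1 a))"
      "\<And>b. b \<in> set_pmf p2 \<Longrightarrow> finite (set_pmf (X2 b))"
    and pos: "0 < N" "0 < S2" "0 < K" "0 < D2" and t: "0 < t"
    and \<gamma>: "0 < \<gamma>1" "0 < \<gamma>2" "0 < \<gamma>3"
  defines "G \<equiv> joint p1 p2 (block_channel W n X1 X2)"
  shows "scode True W n 1 N S2 K (packing G cw1 (\<lambda>(a, b, r). obs2 r) \<gamma>1 (1 * (N * 1))
     + packing G cw2 (\<lambda>(a, b, r). obs1 r) \<gamma>2 (S2 * (K * D2)) + packing G cw2 (\<lambda>(a, b, r). obs2 r) \<gamma>3 (S2 * (K * D2))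
     + (covering G cw2 (\<lambda>(a, b, r). (a, eve r)) (real D2) / (2 * t) + 2 * t))" (is "scode True W n 1 N S2 K (?e + ?k)")
proof -
  define J1 where "J1 = indices 1 N 1"
  define J2 where "J2 = indices S2 K D2"
  define \<kappa> where "\<kappa> = block_channel W n X1 X2"
  define \<omega> where "\<omega> a b = map_pmf eve (\<kappa> a b)" for a b
  define Q where "Q a = bind_pmf p2 (\<omega> a)" for a
  define C1 where "C1 = codebook J1 p1"
  define C2 where "C2 = codebook J2 p2"
  have G: "G = joint p1 p2 \<kappa>" unfolding G_def \<kappa>_def ..
  have fin\<kappa>: "finite (set_pmf (\<kappa> a b))" if "a \<in> set_pmf p1" "b \<in> set_pmf p2" for a b
    unfolding \<kappa>_def using that fin by (intro finite_block_channel) auto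
  have J: "finite J1" "finite J2" "J1 \<noteq> {}" "J2 \<noteq> {}" "card J1 = 1 * (N * 1)" "card J2 = S2 * (K * D2)"
    unfolding J1_def J2_def using pos by (auto simp: finite_indices card_indices indices_nonempty)
  have finc: "finite (set_pmf C1)" "finite (set_pmf C2)"
    unfolding C1_def C2_def using J fin by (auto intro: finite_codebook)
  have ne: "{..<N} \<noteq> {}" "{..<S2} \<noteq> {}" "{..<K} \<noteq> {}" "{..<D2} \<noteq> {}"
    using pos by (auto simp: lessThan_empty_iff)
  define \<alpha> where "\<alpha> = pmf_of_set {..<N}"
  define \<beta> where "\<beta> = pair_pmf (pmf_of_set {..<S2}) (pmf_of_set {..<K})"
  define j where "j e = (0 :: nat, e :: nat, 0 :: nat)" for e
  define V2 where "V2 = (\<lambda>(t :: nat, k :: nat). {t} \<times> {k} \<times> {..<D2})"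
  have fin\<alpha>\<beta>: "finite (set_pmf \<alpha>)" "finite (set_pmf \<beta>)" unfolding \<alpha>_def \<beta>_def using ne by (auto simp: set_pmf_of_set)
  have jJ: "j e \<in> J1" if "e \<in> set_pmf \<alpha>" for e
    using that ne unfolding j_def J1_def indices_def \<alpha>_def by (auto simp: set_pmf_of_set)
  have V1: "pmf_of_set J1 = bind_pmf \<alpha> (\<lambda>e. pmf_of_set {j e})"
    unfolding J1_def \<alpha>_def j_def pmf_of_set_indices[OF zero_less_one pos(1) zero_less_one]
    by (simp add: pmf_of_set_lessThan_1 bind_return_pmf pmf_of_set_singleton)
  have V2: "pmf_of_set J2 = bind_pmf \<beta> (\<lambda>y. pmf_of_set (V2 y))"
    unfolding J2_def \<beta>_def V2_def indices_def using ne
    by (simp add: pmf_of_set_box pair_pmf_def bind_assoc_pmf bind_return_pmf pmf_of_set_singleton)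
  have V2': "V2 y \<subseteq> J2 \<and> finite (V2 y) \<and> V2 y \<noteq> {} \<and> card (V2 y) = D2" if "y \<in> set_pmf \<beta>" for y
    using that ne unfolding V2_def J2_def indices_def \<beta>_def
    by (auto simp: set_pmf_of_set card_cartesian_product)
  have mem: "c1 (j e) \<in> set_pmf p1" if "c1 \<in> set_pmf C1" "e \<in> set_pmf \<alpha>" for c1 e
    using codebook_mem[OF J(1) that(1)[unfolded C1_def] jJ[OF that(2)]] .
  have finQ: "finite (set_pmf (Q a))" if "a \<in> set_pmf p1" for a
    unfolding Q_def \<omega>_def using that fin fin\<kappa> by auto
  have sub: "set_pmf (\<omega> a (c2 j2)) \<subseteq> set_pmf (Q a)" if "c2 \<in> set_pmf C2" "j2 \<in> J2" for a c2 j2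
    using codebook_mem[OF J(2) that(1)[unfolded C2_def] that(2)] unfolding Q_def by auto
  define F where "F = decoding_error \<kappa> G \<gamma>1 \<gamma>2 \<gamma>3 J1 J2"
  define Fk where "Fk c1 c2 = E \<alpha> (\<lambda>e. E \<beta> (\<lambda>y. l1_dist (set_pmf (Q (c1 (j e))))
      (bind_pmf (pmf_of_set (V2 y)) (\<lambda>u2. \<omega> (c1 (j e)) (c2 u2))) (Q (c1 (j e)))))" for c1 c2
  have l1: "0 \<le> l1_dist S p q" for S :: "'z list set" and p q unfolding l1_dist_def by (simp add: sum_nonneg)
  have nn: "0 \<le> F c1 c2" "0 \<le> Fk c1 c2" for c1 c2
    unfolding F_def Fk_def by (auto intro!: E_nonneg l1 decoding_error_nonneg)
  have "E C1 (\<lambda>c1. E C2 (\<lambda>c2. F c1 c2)) \<le> ?e"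
    using E_decoding_error[OF fin(1,2) fin\<kappa> J(1-4) \<gamma>] unfolding F_def C1_def C2_def G J(5,6) .
  moreover have "E C1 (\<lambda>c1. E C2 (\<lambda>c2. Fk c1 c2)) \<le> ?k"
  proof -
    have "E C1 (\<lambda>c1. E C2 (\<lambda>c2. Fk c1 c2)) = E \<alpha> (\<lambda>e. E \<beta> (\<lambda>y. E C1 (\<lambda>c1. E C2 (\<lambda>c2. l1_dist (set_pmf (Q (c1 (j e))))
      (bind_pmf (pmf_of_set (V2 y)) (\<lambda>u2. \<omega> (c1 (j e)) (c2 u2))) (Q (c1 (j e)))))))"
      unfolding Fk_def by (simp only: E_swap[OF finc(2) fin\<alpha>\<beta>(1)] E_swap[OF finc(2) fin\<alpha>\<beta>(2)] E_swap[OF finc(1) fin\<alpha>\<beta>(1)] E_swap[OF finc(1) fin\<alpha>\<beta>(2)])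
    also have "\<dots> \<le> E \<alpha> (\<lambda>s. E \<beta> (\<lambda>y. ?k))"
    proof (intro E_mono fin\<alpha>\<beta>)
      fix e y assume ey: "e \<in> set_pmf \<alpha>" "y \<in> set_pmf \<beta>"
      then show "E C1 (\<lambda>c1. E C2 (\<lambda>c2. l1_dist (set_pmf (Q (c1 (j e))))
        (bind_pmf (pmf_of_set (V2 y)) (\<lambda>u2. \<omega> (c1 (j e)) (c2 u2))) (Q (c1 (j e))))) \<le> ?k"
        using soft_covering_public[where Z=eve and ?U2.0="V2 y" and t=t, OF fin(1,2) fin\<kappa> J(1,2) jJ[OF ey(1)]] V2'[of y] t
        unfolding C1_def C2_def \<omega>_def Q_def G covering_def by simp
    qed
    finally show ?thesis by simp
  qed
  ultimately have "E C1 (\<lambda>c1. E C2 (\<lambda>c2. F c1 c2 + Fk c1 c2)) \<le> ?e + ?k"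
    by (simp add: E_add finc)
  from exists_le_E[OF finc this] obtain c1 c2 where c: "c1 \<in> set_pmf C1" "c2 \<in> set_pmf C2"
    and le: "F c1 c2 + Fk c1 c2 \<le> ?e + ?k" by blast
  define L where "L = codebook_law \<kappa> J1 J2 c1 c2"
  obtain d1 d2 where d: "measure_pmf.prob L (- correct d1 d2) \<le> F c1 c2"
    unfolding L_def F_def by (rule decoders_exist[OF J(1-4)])
  define Qe where "Qe = bind_pmf \<alpha> (\<lambda>e. Q (c1 (j e)))"
  have hide: "hide True = id" by (auto simp: hide_def fun_eq_iff)
  have key: "close (Fk c1 c2) (map_pmf (key_view True) L)
      (pair_pmf (pmf_of_set {..<1}) (pair_pmf (map_pmf (hide True) (pmf_of_set {..<S2})) (pair_pmf (pmf_of_set {..<K}) Qe)))"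
  proof -
    have "close (E \<alpha> (\<lambda>e. E \<beta> (\<lambda>y. l1_dist (set_pmf (Q (c1 (j e))))
      (bind_pmf (pmf_of_set {j e}) (\<lambda>u1. bind_pmf (pmf_of_set (V2 y)) (\<lambda>u2. \<omega> (c1 u1) (c2 u2)))) (Q (c1 (j e))))))
     (bind_pmf (pmf_of_set J1) (\<lambda>j1. bind_pmf (pmf_of_set J2) (\<lambda>j2. map_pmf (\<lambda>z. (fst (snd j1), (fst j2, fst (snd j2)), z)) (\<omega> (c1 j1) (c2 j2)))))
     (bind_pmf \<alpha> (\<lambda>x. bind_pmf \<beta> (\<lambda>y. map_pmf (\<lambda>z. (x, y, z)) (Q (c1 (j x))))))"
      by (rule view_close[OF V1 _ V2])
         (use jJ V2' fin\<alpha>\<beta> finQ[OF mem[OF c(1)]] sub[OF c(2)] in \<open>auto simp: j_def V2_def\<close>)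
    then have "close (Fk c1 c2)
     (bind_pmf (pmf_of_set J1) (\<lambda>j1. bind_pmf (pmf_of_set J2) (\<lambda>j2. map_pmf (\<lambda>z. (fst (snd j1), (fst j2, fst (snd j2)), z)) (\<omega> (c1 j1) (c2 j2)))))
     (bind_pmf \<alpha> (\<lambda>x. bind_pmf \<beta> (\<lambda>y. map_pmf (\<lambda>z. (x, y, z)) (Q (c1 (j x))))))"
      unfolding Fk_def by (simp add: pmf_of_set_singleton bind_return_pmf)
    \<comment> \<open>The slot was shown for the comparison and is now forgotten; this averages the
      ideal output law over the slot values.\<close>
    from close_map[OF this, of "\<lambda>(e, (t, k), z). (0 :: nat, t, k, z)"]
    have "close (Fk c1 c2)
     (bind_pmf (pmf_of_set J1) (\<lambda>j1. bind_pmf (pmf_of_set J2) (\<lambda>j2. map_pmf (\<lambda>z. (0 :: nat, fst j2, fst (snd j2), z)) (\<omega> (c1 j1) (c2 j2)))))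
     (bind_pmf \<alpha> (\<lambda>x. bind_pmf \<beta> (\<lambda>y. map_pmf (\<lambda>z. (0 :: nat, fst y, snd y, z)) (Q (c1 (j x))))))"
      by (simp add: map_bind_pmf map_pmf_comp case_prod_unfold)
    moreover have "bind_pmf (pmf_of_set J1) (\<lambda>j1. bind_pmf (pmf_of_set J2) (\<lambda>j2. map_pmf (\<lambda>z. (0 :: nat, fst j2, fst (snd j2), z)) (\<omega> (c1 j1) (c2 j2)))) =
       map_pmf (key_view True) L"
      unfolding L_def codebook_law_def \<omega>_def map_bind_pmf map_pmf_comp using J
      by (intro bind_pmf_cong refl) (auto simp: key_view_def hide set_pmf_of_set J1_def indices_def)
    moreover have "bind_pmf \<alpha> (\<lambda>x. bind_pmf \<beta> (\<lambda>y. map_pmf (\<lambda>z. (0 :: nat, fst y, snd y, z)) (Q (c1 (j x))))) =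
       pair_pmf (pmf_of_set {..<1}) (pair_pmf (map_pmf (hide True) (pmf_of_set {..<S2})) (pair_pmf (pmf_of_set {..<K}) Qe))"
      unfolding Qe_def \<beta>_def hide
      by (simp add: pmf_of_set_lessThan_1 pmf_of_set_lessThan_1[folded One_nat_def] pair_pmf_def map_pmf_def bind_assoc_pmf bind_return_pmf
          bind_commute_pmf[of \<alpha> "pmf_of_set {..<S2}"] bind_commute_pmf[of \<alpha> "pmf_of_set {..<K}"])
    ultimately show ?thesis by simp
  qed
  have msg: "close (Fk c1 c2) (map_pmf msg_view L) (pair_pmf (pmf_of_set {..<S2}) Qe)"
  proof -
    have "map_pmf (\<lambda>(s, t, k, z). (t, z)) (map_pmf (key_view True) L) = map_pmf msg_view L"
      by (simp add: map_pmf_comp key_view_def msg_view_def hide case_prod_unfold)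
    moreover have "map_pmf (\<lambda>(s, t, k, z). (t, z)) (pair_pmf (pmf_of_set {..<1 :: nat}) (pair_pmf (map_pmf (hide True) (pmf_of_set {..<S2})) (pair_pmf (pmf_of_set {..<K}) Qe)))
       = pair_pmf (pmf_of_set {..<S2}) Qe"
      unfolding hide by (simp add: pair_pmf_def map_bind_pmf bind_assoc_pmf bind_return_pmf)
    ultimately show ?thesis
      using close_map[OF key, of "\<lambda>(s, t, k, z). (t, z)"] by (simp only:)
  qed
  have err': "measure_pmf.prob L (- correct d1 d2) \<le> ?e + ?k" using d le nn[of c1 c2] by linarith
  have key': "close (?e + ?k) (map_pmf (key_view True) L)
      (pair_pmf (pmf_of_set {..<1}) (pair_pmf (map_pmf (hide True) (pmf_of_set {..<S2})) (pair_pmf (pmf_of_set {..<K}) Qe)))"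
    by (rule close_mono[OF key]) (use le nn[of c1 c2] in linarith)
  have msg': "close (?e + ?k) (map_pmf msg_view L) (pair_pmf (pmf_of_set {..<S2}) Qe)"
    by (rule close_mono[OF msg]) (use le nn[of c1 c2] in linarith)
  show ?thesis
    by (rule scode_codebook[OF zero_less_one pos(1) zero_less_one pos(2-4) err'[unfolded L_def \<kappa>_def J1_def J2_def]
        key'[unfolded L_def \<kappa>_def J1_def J2_def] msg'[unfolded L_def \<kappa>_def J1_def J2_def]])
qed

section \<open>Memoryless extension\<close>

primrec block_input :: "('v \<Rightarrow> 'x pmf) \<Rightarrow> 'v list \<Rightarrow> 'x list pmf" where
  "block_input \<kappa> [] = return_pmf []"
| "block_input \<kappa> (v # vs) = bind_pmf (\<kappa> v) (\<lambda>x. map_pmf ((#) x) (block_input \<kappa> vs))"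

lemma block_input_snoc:
  "block_input \<kappa> (vs @ [v]) = bind_pmf (block_input \<kappa> vs) (\<lambda>xs. map_pmf (\<lambda>x. xs @ [x]) (\<kappa> v))"
  by (induction vs) (simp_all add: bind_return_pmf bind_assoc_pmf bind_map_pmf map_bind_pmf map_pmf_comp map_pmf_def[of _ "\<kappa> v"])

lemma block_input_length: "xs \<in> set_pmf (block_input \<kappa> vs) \<Longrightarrow> length xs = length vs"
  by (induction vs arbitrary: xs) auto

lemma finite_block_input: "finite (set_pmf (block_input (\<kappa> :: 'v \<Rightarrow> 'x::finite pmf) vs))"
  by (induction vs) auto

text \<open>\<open>channel_run\<close> extends sequences at the end, so independent letters have to
  be peeled off there too.\<close>

lemma replicate_pmf_snoc: "replicate_pmf (Suc n) p = bind_pmf (replicate_pmf n p) (\<lambda>xs. map_pmf (\<lambda>x. xs @ [x]) p)"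
  using replicate_pmf_distrib[of n 1 p]
  unfolding replicate_pmf_1 bind_map_pmf map_pmf_def bind_assoc_pmf bind_return_pmf by (simp del: replicate_pmf.simps)

lemma block_channel_snoc:
  assumes "length as = n" "length bs = n"
  shows "block_channel W (Suc n) (block_input X1) (block_input X2) (as @ [a]) (bs @ [b]) =
    bind_pmf (block_channel W n (block_input X1) (block_input X2) as bs) (\<lambda>r. bind_pmf (X1 a) (\<lambda>x1. bind_pmf (X2 b) (\<lambda>x2.
      map_pmf (\<lambda>(y1, y2, z). tappend r ([x1], [x2], [y1], [y2], [z])) (W x1 x2))))"
proof -
  have "block_channel W (Suc n) (block_input X1) (block_input X2) (as @ [a]) (bs @ [b]) =
     bind_pmf (block_input X1 as) (\<lambda>xs1. bind_pmf (X1 a) (\<lambda>x1. bind_pmf (block_input X2 bs) (\<lambda>xs2. bind_pmf (X2 b) (\<lambda>x2.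
       channel_run W (nonadaptive (xs1 @ [x1])) (nonadaptive (xs2 @ [x2])) (Suc n)))))"
    unfolding block_channel_def block_input_snoc by (simp add: bind_assoc_pmf bind_map_pmf del: channel_run.simps)
  also have "\<dots> = bind_pmf (block_input X1 as) (\<lambda>xs1. bind_pmf (X1 a) (\<lambda>x1. bind_pmf (block_input X2 bs) (\<lambda>xs2. bind_pmf (X2 b) (\<lambda>x2.
       bind_pmf (channel_run W (nonadaptive xs1) (nonadaptive xs2) n) (\<lambda>r. map_pmf (\<lambda>(y1, y2, z). tappend r ([x1], [x2], [y1], [y2], [z])) (W x1 x2))))))"
  proof (intro bind_pmf_cong refl)
    fix xs1 x1 xs2 x2 assume "xs1 \<in> set_pmf (block_input X1 as)" "xs2 \<in> set_pmf (block_input X2 bs)"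
    then have len: "length xs1 = n" "length xs2 = n" using assms block_input_length by metis+
    have run: "channel_run W (nonadaptive (xs1 @ [x1])) (nonadaptive (xs2 @ [x2])) n = channel_run W (nonadaptive xs1) (nonadaptive xs2) n"
      by (rule channel_run_cong) (auto simp: nonadaptive_def nth_append len)
    show "channel_run W (nonadaptive (xs1 @ [x1])) (nonadaptive (xs2 @ [x2])) (Suc n) =
      bind_pmf (channel_run W (nonadaptive xs1) (nonadaptive xs2) n) (\<lambda>r. map_pmf (\<lambda>(y1, y2, z). tappend r ([x1], [x2], [y1], [y2], [z])) (W x1 x2))"
      unfolding channel_run.simps run
    proof (intro bind_pmf_cong refl)
      fix r assume "r \<in> set_pmf (channel_run W (nonadaptive xs1) (nonadaptive xs2) n)"
      then obtain us1 us2 ys1 ys2 zs where r: "r = (us1, us2, ys1, ys2, zs)" "length ys1 = n" "length ys2 = n"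
        using channel_run_support by (metis prod_cases5)
      then show "(case r of (xs1a, xs2a, ys1, ys2, zs) \<Rightarrow> map_pmf (\<lambda>(y1, y2, z). (xs1a @ [nonadaptive (xs1 @ [x1]) ys1],
            xs2a @ [nonadaptive (xs2 @ [x2]) ys2], ys1 @ [y1], ys2 @ [y2], zs @ [z]))
          (W (nonadaptive (xs1 @ [x1]) ys1) (nonadaptive (xs2 @ [x2]) ys2))) =
        map_pmf (\<lambda>(y1, y2, z). tappend r ([x1], [x2], [y1], [y2], [z])) (W x1 x2)"
        using len by (simp add: nonadaptive_def nth_append tappend_def)
    qed
  qed
  also have "\<dots> = bind_pmf (block_input X1 as) (\<lambda>xs1. bind_pmf (block_input X2 bs) (\<lambda>xs2.
       bind_pmf (channel_run W (nonadaptive xs1) (nonadaptive xs2) n) (\<lambda>r. bind_pmf (X1 a) (\<lambda>x1. bind_pmf (X2 b) (\<lambda>x2.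
         map_pmf (\<lambda>(y1, y2, z). tappend r ([x1], [x2], [y1], [y2], [z])) (W x1 x2))))))"
    by (simp only: bind_commute_pmf[of "X1 a" "block_input X2 bs"]
        bind_commute_pmf[of "X2 b" "channel_run W (nonadaptive xs1) (nonadaptive xs2) n" for xs1 xs2]
        bind_commute_pmf[of "X1 a" "channel_run W (nonadaptive xs1) (nonadaptive xs2) n" for xs1 xs2])
  finally show ?thesis unfolding block_channel_def bind_assoc_pmf .
qed

definition letter_law :: "nat pmf \<Rightarrow> nat pmf \<Rightarrow> (nat \<Rightarrow> 'x1 pmf) \<Rightarrow> (nat \<Rightarrow> 'x2 pmf) \<Rightarrow> ('x1,'x2,'y1,'y2,'z) channel \<Rightarrow>
    (nat \<times> nat \<times> 'x1 \<times> 'x2 \<times> 'y1 \<times> 'y2 \<times> 'z) pmf" where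
  "letter_law p1 p2 X1 X2 W = bind_pmf p1 (\<lambda>a. bind_pmf p2 (\<lambda>b. bind_pmf (X1 a) (\<lambda>x1. bind_pmf (X2 b) (\<lambda>x2.
     map_pmf (\<lambda>(y1, y2, z). (a, b, x1, x2, y1, y2, z)) (W x1 x2)))))"

definition unzip :: "(nat \<times> nat \<times> 'x1 \<times> 'x2 \<times> 'y1 \<times> 'y2 \<times> 'z) list \<Rightarrow> nat list \<times> nat list \<times> ('x1,'x2,'y1,'y2,'z) transcript" where
  "unzip ws = (map (\<lambda>(a, b, x1, x2, y1, y2, z). a) ws, map (\<lambda>(a, b, x1, x2, y1, y2, z). b) ws,
     map (\<lambda>(a, b, x1, x2, y1, y2, z). x1) ws, map (\<lambda>(a, b, x1, x2, y1, y2, z). x2) ws,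
     map (\<lambda>(a, b, x1, x2, y1, y2, z). y1) ws, map (\<lambda>(a, b, x1, x2, y1, y2, z). y2) ws,
     map (\<lambda>(a, b, x1, x2, y1, y2, z). z) ws)"

text \<open>Codeword letters, prefix channels and channel uses act letter by letter, so the law of a
  block is the independent power of the single-letter law up to the arrangement of coordinates.
  Densities of blocks thereby become products of single-letter densities.\<close>

lemma joint_block_channel:
  "joint (replicate_pmf n p1) (replicate_pmf n p2) (block_channel W n (block_input X1) (block_input X2)) =
   map_pmf unzip (replicate_pmf n (letter_law p1 p2 X1 X2 W))"
proof (induction n)
  case 0
  show ?case by (simp add: joint_def block_channel_def bind_return_pmf unzip_def)
next
  case (Suc n)
  define J where "J = letter_law p1 p2 X1 X2 W"
  define R where "R = block_channel W n (block_input X1) (block_input X2)"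
  define tail where "tail as bs r a b = bind_pmf (X1 a) (\<lambda>x1. bind_pmf (X2 b) (\<lambda>x2.
       map_pmf (\<lambda>(y1, y2, z). (as @ [a], bs @ [b], tappend r ([x1], [x2], [y1], [y2], [z]))) (W x1 x2)))"
     for as bs r a b
  have "joint (replicate_pmf (Suc n) p1) (replicate_pmf (Suc n) p2) (block_channel W (Suc n) (block_input X1) (block_input X2)) =
    bind_pmf (replicate_pmf n p1) (\<lambda>as. bind_pmf p1 (\<lambda>a. bind_pmf (replicate_pmf n p2) (\<lambda>bs. bind_pmf p2 (\<lambda>b.
      map_pmf (\<lambda>r. (as @ [a], bs @ [b], r)) (block_channel W (Suc n) (block_input X1) (block_input X2) (as @ [a]) (bs @ [b]))))))"
    unfolding joint_def replicate_pmf_snoc by (simp add: bind_assoc_pmf bind_map_pmf del: replicate_pmf.simps)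
  also have "\<dots> = bind_pmf (replicate_pmf n p1) (\<lambda>as. bind_pmf p1 (\<lambda>a. bind_pmf (replicate_pmf n p2) (\<lambda>bs. bind_pmf p2 (\<lambda>b.
      bind_pmf (R as bs) (\<lambda>r. tail as bs r a b)))))"
    unfolding R_def tail_def
    by (intro bind_pmf_cong refl) (simp add: block_channel_snoc set_replicate_pmf map_bind_pmf map_pmf_comp case_prod_unfold)
  also have "\<dots> = bind_pmf (replicate_pmf n p1) (\<lambda>as. bind_pmf (replicate_pmf n p2) (\<lambda>bs. bind_pmf (R as bs) (\<lambda>r.
      bind_pmf p1 (\<lambda>a. bind_pmf p2 (\<lambda>b. tail as bs r a b)))))"
    by (simp only: bind_commute_pmf[of p1 "replicate_pmf n p2"] bind_commute_pmf[of p2 "R as bs" for as bs]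
        bind_commute_pmf[of p1 "R as bs" for as bs])
  also have "\<dots> = bind_pmf (joint (replicate_pmf n p1) (replicate_pmf n p2) R) (\<lambda>(as, bs, r). bind_pmf p1 (\<lambda>a. bind_pmf p2 (\<lambda>b. tail as bs r a b)))"
    unfolding joint_def by (simp add: bind_assoc_pmf bind_map_pmf)
  also have "\<dots> = bind_pmf (replicate_pmf n J) (\<lambda>ws. case unzip ws of (as, bs, r) \<Rightarrow> bind_pmf p1 (\<lambda>a. bind_pmf p2 (\<lambda>b. tail as bs r a b)))"
    unfolding R_def Suc J_def by (simp add: bind_map_pmf)
  also have "\<dots> = bind_pmf (replicate_pmf n J) (\<lambda>ws. map_pmf (\<lambda>w. unzip (ws @ [w])) J)"
    unfolding J_def letter_law_def tail_def
    by (intro bind_pmf_cong refl) (simp add: map_bind_pmf map_pmf_comp unzip_def tappend_def case_prod_unfold)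
  also have "\<dots> = map_pmf unzip (replicate_pmf (Suc n) J)"
    unfolding replicate_pmf_snoc by (simp add: map_bind_pmf map_pmf_comp del: replicate_pmf.simps)
  finally show ?case unfolding J_def .
qed

section \<open>Exponential decay\<close>

definition decays :: "(nat \<Rightarrow> real) \<Rightarrow> bool" where
  "decays f \<longleftrightarrow> (\<exists>C q. 0 \<le> C \<and> 0 < q \<and> q < 1 \<and> (\<forall>n. f n \<le> C * q ^ n))"

lemma decaysI: "0 \<le> C \<Longrightarrow> 0 < q \<Longrightarrow> q < 1 \<Longrightarrow> (\<And>n. f n \<le> C * q ^ n) \<Longrightarrow> decays f"
  unfolding decays_def by blast

lemma decays_add:
  assumes "decays f" "decays g"
  shows "decays (\<lambda>n. f n + g n)"
proof -
  obtain C q where f: "0 \<le> C" "0 < q" "q < 1" "\<And>n. f n \<le> C * q ^ n" using assms(1) unfolding decays_def by blast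
  obtain D r where g: "0 \<le> D" "0 < r" "r < 1" "\<And>n. g n \<le> D * r ^ n" using assms(2) unfolding decays_def by blast
  show ?thesis
  proof (rule decaysI)
    fix n
    have "C * q ^ n \<le> C * max q r ^ n" "D * r ^ n \<le> D * max q r ^ n"
      using f g by (auto intro!: mult_left_mono power_mono)
    then show "f n + g n \<le> (C + D) * max q r ^ n" using f(4)[of n] g(4)[of n] by (simp add: algebra_simps)
  qed (use f g in auto)
qed

text \<open>The summands c / t and t are balanced by taking \<open>t\<close> of the order of the
  square root of the bound on \<open>c\<close>. The coefficient 4 collects the terms 2 t of two
  covering bounds.\<close>

lemma decays_balance:
  assumes "decays c"
  obtains t where "\<And>n. 0 < t n" "decays (\<lambda>n. c n / (2 * t n) + 4 * t n)"
proof -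
  obtain C q where c: "0 \<le> C" "0 < q" "q < 1" "\<And>n. c n \<le> C * q ^ n" using assms unfolding decays_def by blast
  define t where "t n = sqrt q ^ n" for n
  have t: "0 < t n" for n using c unfolding t_def by simp
  have "decays (\<lambda>n. c n / (2 * t n) + 4 * t n)"
  proof (rule decaysI)
    fix n
    have "q ^ n = t n * t n" using c unfolding t_def by (simp add: power_mult_distrib[symmetric])
    then have "c n / (2 * t n) \<le> C * (t n * t n) / (2 * t n)" using c(4)[of n] t[of n] by (intro divide_right_mono) auto
    also have "\<dots> = C / 2 * t n" using t[of n] by simp
    finally show "c n / (2 * t n) + 4 * t n \<le> (C / 2 + 4) * sqrt q ^ n" by (simp add: algebra_simps t_def)
  qed (use c in auto)
  with t show ?thesis by (rule that)
qed

text \<open>Exponential decay beats the factor \<open>n\<close> even after the length has been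
  divided by a fixed number of blocks, since \<open>n\<close> is at most \<open>k\<close> times (n
  div k + 1).\<close>

lemma decays_tendsto: "decays f \<Longrightarrow> 0 < \<delta> \<Longrightarrow> 0 < k \<Longrightarrow>
   \<forall>\<^sub>F n in sequentially. c * f (n div k) \<le> \<delta> / real n" if c: "0 \<le> c" for c :: real
proof -
  assume f: "decays f" and \<delta>: "0 < \<delta>" and k: "0 < k"
  obtain C q where C: "0 \<le> C" "0 < q" "q < 1" "\<And>n. f n \<le> C * q ^ n" using f unfolding decays_def by blast
  have "(\<lambda>j. real j * q ^ j) \<longlonglongrightarrow> 0" using powser_times_n_limit_0[of q] C by simp
  moreover have "(\<lambda>j. q ^ j) \<longlonglongrightarrow> 0" using C by (intro LIMSEQ_power_zero) auto
  ultimately have "(\<lambda>j. c * C * real k * (real j * q ^ j + q ^ j)) \<longlonglongrightarrow> c * C * real k * (0 + 0)"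
    by (intro tendsto_mult tendsto_add tendsto_const)
  then have "\<forall>\<^sub>F j in sequentially. c * C * real k * (real j * q ^ j + q ^ j) < \<delta>"
    using \<delta> by (intro order_tendstoD) auto
  moreover have "filterlim (\<lambda>n. n div k) at_top sequentially"
    unfolding filterlim_at_top
  proof
    fix Z show "\<forall>\<^sub>F n in sequentially. Z \<le> n div k"
      using eventually_ge_at_top[of "Z * k"] by eventually_elim (use k in \<open>simp add: less_eq_div_iff_mult_less_eq\<close>)
  qed
  ultimately have "\<forall>\<^sub>F n in sequentially. c * C * real k * (real (n div k) * q ^ (n div k) + q ^ (n div k)) < \<delta>"
    by (rule eventually_compose_filterlim)
  then show "\<forall>\<^sub>F n in sequentially. c * f (n div k) \<le> \<delta> / real n"
    using eventually_ge_at_top[of 1]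
  proof eventually_elim
    case (elim n)
    have "n < k * Suc (n div k)" using k by (metis dividend_less_div_times mult.commute mult_Suc_right add.commute)
    then have n: "real n \<le> real k * (real (n div k) + 1)"
      by (metis of_nat_Suc of_nat_le_iff of_nat_mult less_imp_le add.commute)
    have "c * f (n div k) \<le> c * C * q ^ (n div k)" using C(4)[of "n div k"] c by (simp add: mult_left_mono mult.assoc)
    then have "c * f (n div k) * real n \<le> c * C * q ^ (n div k) * real n" by (rule mult_right_mono) simp
    also have "\<dots> \<le> c * C * q ^ (n div k) * (real k * (real (n div k) + 1))" using n c C by (intro mult_left_mono) auto
    also have "\<dots> \<le> \<delta>" using elim(1) by (simp add: algebra_simps)
    finally show ?case using elim(2) by (simp add: pos_le_divide_eq)
  qed
qed

section \<open>Random codes at given rates\<close>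

definition fl :: "nat \<Rightarrow> real \<Rightarrow> nat" where
  "fl n x = nat \<lfloor>exp (real n * x)\<rfloor>"

lemma fl_bounds:
  assumes "0 \<le> x"
  shows "0 < fl n x" "real (fl n x) \<le> exp (real n * x)" "exp (real n * x) / 2 \<le> real (fl n x)"
proof -
  have 1: "1 \<le> exp (real n * x)" using assms by simp
  then have "1 \<le> \<lfloor>exp (real n * x)\<rfloor>" by simp
  then have eq: "real (fl n x) = of_int \<lfloor>exp (real n * x)\<rfloor>" and "0 < fl n x" unfolding fl_def by simp_all
  then show "0 < fl n x" "real (fl n x) \<le> exp (real n * x)" by simp_all
  show "exp (real n * x) / 2 \<le> real (fl n x)"
  proof -
    have "1 \<le> real_of_int \<lfloor>exp (real n * x)\<rfloor>" using \<open>1 \<le> \<lfloor>exp (real n * x)\<rfloor>\<close> by linarith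
    moreover have "exp (real n * x) < real_of_int \<lfloor>exp (real n * x)\<rfloor> + 1" by linarith
    ultimately show ?thesis unfolding eq by linarith
  qed
qed

lemma ln_fl_bounds:
  assumes "0 \<le> x"
  shows "ln (real (fl n x)) \<le> real n * x" "real n * x - 1 \<le> ln (real (fl n x))"
proof -
  have pos: "0 < real (fl n x)" using fl_bounds(1)[OF assms] by simp
  have "ln (real (fl n x)) \<le> ln (exp (real n * x))" using fl_bounds(2)[OF assms] pos by (intro ln_mono) auto
  then show "ln (real (fl n x)) \<le> real n * x" by simp
  have "ln (exp (real n * x) / 2) \<le> ln (real (fl n x))" using fl_bounds(3)[OF assms] by (intro ln_mono) auto
  moreover have "ln 2 \<le> (1 :: real)" using ln_le_minus_one[of 2] by simp
  ultimately show "real n * x - 1 \<le> ln (real (fl n x))" by (simp add: ln_div)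
qed

abbreviation lv1 where "lv1 \<equiv> (\<lambda>(v1, v2, x1, x2, y1, y2, z). v1)"
abbreviation lv2 where "lv2 \<equiv> (\<lambda>(v1, v2, x1, x2, y1, y2, z). v2)"
abbreviation lz where "lz \<equiv> (\<lambda>(v1, v2, x1, x2, y1, y2, z). z)"
abbreviation lv12 where "lv12 \<equiv> (\<lambda>(v1, v2, x1, x2, y1, y2, z). (v1, v2))"
abbreviation lv1z where "lv1z \<equiv> (\<lambda>(v1, v2, x1, x2, y1, y2, z). (v1, z))"
abbreviation lo1 where "lo1 \<equiv> (\<lambda>(v1, v2, x1, x2, y1, y2, z). (x1, y1))"
abbreviation lo2 where "lo2 \<equiv> (\<lambda>(v1, v2, x1, x2, y1, y2, z). (x2, y2))"

section \<open>From single-letter conditions to exponentially good codes\<close>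

definition mean_dens :: "'w pmf \<Rightarrow> ('w \<Rightarrow> 'a) \<Rightarrow> ('w \<Rightarrow> 'b) \<Rightarrow> real" where
  "mean_dens p X Y = E p (\<lambda>w. ln (dens p X Y w))"

lemma dens_map_inj:
  assumes "\<And>w. F (h w) = \<iota> (X w)" "inj \<iota>" "\<And>w. H (h w) = \<iota>' (Y w)" "inj \<iota>'"
  shows "dens (map_pmf h p) F H (h w) = dens p X Y w"
proof -
  have "F \<circ> h = (\<lambda>w. \<iota> (X w))" "H \<circ> h = (\<lambda>w. \<iota>' (Y w))" using assms by (auto simp: fun_eq_iff)
  then show ?thesis using assms by (simp add: dens_map_pmf dens_inj_left dens_inj_right)
qed

lemma covering_decays:
  assumes fin: "finite (set_pmf p)" and I: "mean_dens p X Y < x"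
    and F: "\<And>ws. F (h ws) = \<iota> (map X ws)" "inj \<iota>" and H: "\<And>ws. H (h ws) = \<iota>' (map Y ws)" "inj \<iota>'"
    and L: "\<And>n. exp (real n * x) / 64 \<le> L n"
  shows "decays (\<lambda>n. covering (map_pmf h (replicate_pmf n p)) F H (L n))"
proof -
  obtain C q where C: "0 \<le> C" "0 < q" "q < 1"
    "\<And>n L. exp (real n * x) / 64 \<le> L \<Longrightarrow>
       E (replicate_pmf n p) (\<lambda>ws. ln (1 + dens (replicate_pmf n p) (map X) (map Y) ws / L)) \<le> C * q ^ n"
    using covering_exponent[OF fin I[unfolded mean_dens_def]] by blast
  show ?thesis
  proof (rule decaysI[OF C(1-3)])
    fix n
    show "covering (map_pmf h (replicate_pmf n p)) F H (L n) \<le> C * q ^ n"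
      using C(4)[OF L] unfolding covering_def
      by (simp add: dens_map_inj[where F=F and h=h and \<iota>=\<iota> and X="map X" and H=H and \<iota>'=\<iota>' and Y="map Y", OF F H])
  qed
qed

lemma packing_decays:
  assumes fin: "finite (set_pmf p)" and r: "r < mean_dens p X Y"
    and F: "\<And>ws. F (h ws) = \<iota> (map X ws)" "inj \<iota>" and H: "\<And>ws. H (h ws) = \<iota>' (map Y ws)" "inj \<iota>'"
    and N: "\<And>n. real (N n) \<le> exp (real n * r)"
  shows "\<exists>\<gamma>. (\<forall>n. 0 < \<gamma> n) \<and> decays (\<lambda>n. packing (map_pmf h (replicate_pmf n p)) F H (\<gamma> n) (N n))"
proof -
  \<comment> \<open>The midpoint leaves room on both sides: below the mean density for the Chernoff
    bound, above the rate for the union bound over codewords.\<close>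
  define g where "g = (r + mean_dens p X Y) / 2"
  have g: "r < g" "g < mean_dens p X Y" using r unfolding g_def by auto
  obtain q where q: "0 < q" "q < 1"
    "\<And>n. measure_pmf.prob (replicate_pmf n p) {ws. dens (replicate_pmf n p) (map X) (map Y) ws < exp (real n * g)} \<le> q ^ n"
    using packing_exponent[OF fin g(2)[unfolded mean_dens_def]] by blast
  have 1: "decays (\<lambda>n. measure_pmf.prob (replicate_pmf n p) {ws. dens (replicate_pmf n p) (map X) (map Y) ws < exp (real n * g)})"
    by (rule decaysI[of 1 q]) (use q in auto)
  have 2: "decays (\<lambda>n. real (N n) / exp (real n * g))"
  proof (rule decaysI[of 1 "exp (r - g)"])
    fix n
    have "real (N n) / exp (real n * g) \<le> exp (real n * r) / exp (real n * g)" using N by (intro divide_right_mono) auto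
    then show "real (N n) / exp (real n * g) \<le> 1 * exp (r - g) ^ n"
      by (simp add: exp_diff[symmetric] exp_of_nat_mult[symmetric] algebra_simps)
  qed (use g in auto)
  have "decays (\<lambda>n. packing (map_pmf h (replicate_pmf n p)) F H (exp (real n * g)) (N n))"
    using decays_add[OF 1 2] unfolding packing_def
    by (simp add: vimage_def dens_map_inj[where F=F and h=h and \<iota>=\<iota> and X="map X" and H=H and \<iota>'=\<iota>' and Y="map Y", OF F H])
  then show ?thesis by (intro exI[of _ "\<lambda>n. exp (real n * g)"]) simp
qed

lemma finite_letter_law:
  assumes "finite (set_pmf p1)" "finite (set_pmf p2)"
  shows "finite (set_pmf (letter_law p1 p2 X1 X2 (W :: ('x1::finite,'x2::finite,'y1::finite,'y2::finite,'z::finite) channel)))"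
  using assms unfolding letter_law_def by auto

lemma unzip_sel:
  "cw1 (unzip ws) = id (map lv1 ws)" "cw2 (unzip ws) = id (map lv2 ws)"
  "(\<lambda>(a, b, r). (a, b)) (unzip ws) = (\<lambda>l. (map fst l, map snd l)) (map lv12 ws)"
  "(\<lambda>(a, b, r). eve r) (unzip ws) = id (map lz ws)"
  "(\<lambda>(a, b, r). (a, eve r)) (unzip ws) = (\<lambda>l. (map fst l, map snd l)) (map lv1z ws)"
  "(\<lambda>(a, b, r). obs1 r) (unzip ws) = (\<lambda>l. (map fst l, map snd l)) (map lo1 ws)"
  "(\<lambda>(a, b, r). obs2 r) (unzip ws) = (\<lambda>l. (map fst l, map snd l)) (map lo2 ws)"
  by (simp_all add: unzip_def obs1_def obs2_def o_def case_prod_unfold)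

text \<open>User 1's rate splits into private message \<open>s1\<close>, slot \<open>k\<close> and
  local randomness \<open>d1\<close>; user 2's into message \<open>s2\<close>, key \<open>k\<close>
  and local randomness \<open>d2\<close>. The first three covering conditions belong to the key
  view, where \<open>g\<close> is the rate of user 2 invisible in it. The last two belong to the
  message view; the condition on V1 alone for that view follows from the first one because
  \<open>s1\<close> is nonnegative.\<close>

lemma random_code_rates:
  fixes W :: "('x1::finite,'x2::finite,'y1::finite,'y2::finite,'z::finite) channel"
    and X1 :: "nat \<Rightarrow> 'x1 pmf" and X2 :: "nat \<Rightarrow> 'x2 pmf" and b :: bool
  assumes fin: "finite (set_pmf p1)" "finite (set_pmf p2)"
    and rates: "0 \<le> s1" "0 \<le> k" "0 \<le> d1" "0 \<le> s2" "0 \<le> d2"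
  defines "J \<equiv> letter_law p1 p2 X1 X2 W" and "g \<equiv> (if b then d2 else s2 + d2)"
  assumes packing: "s1 + k + d1 < mean_dens J lv1 lo2" "s2 + k + d2 < mean_dens J lv2 lo1" "s2 + k + d2 < mean_dens J lv2 lo2"
    and covering: "mean_dens J lv1 lz < k + d1" "mean_dens J lv2 lz < g" "mean_dens J lv12 lz < k + d1 + g"
      "mean_dens J lv2 lz < k + d2" "mean_dens J lv12 lz < s1 + k + d1 + k + d2"
  shows "\<exists>\<epsilon>. decays \<epsilon> \<and> (\<forall>n. scode b W n (fl n s1) (fl n k) (fl n s2) (fl n k) (\<epsilon> n))"
proof -
  have finJ: "finite (set_pmf J)" unfolding J_def by (rule finite_letter_law[OF fin])
  define G where "G n = map_pmf unzip (replicate_pmf n J)" for n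
  define N1 where "N1 n = fl n s1 * (fl n k * fl n d1)" for n
  define N2 where "N2 n = fl n s2 * (fl n k * fl n d2)" for n
  define L1 where "L1 n = fl n k * fl n d1" for n
  define L2 where "L2 n = (if b then 1 else fl n s2) * fl n d2" for n
  define L3 where "L3 n = fl n k * fl n d2" for n
  note fb = fl_bounds[OF rates(1)] fl_bounds[OF rates(2)] fl_bounds[OF rates(3)] fl_bounds[OF rates(4)] fl_bounds[OF rates(5)]
  have ub: "real a * real c \<le> exp (real n * (x + y))" if "real a \<le> exp (real n * x)" "real c \<le> exp (real n * y)" for a c n x y
    using mult_mono[OF that] by (simp add: exp_add[symmetric] algebra_simps)
  have lb: "exp (real n * (x + y)) / (c1 * c2) \<le> a * c" if "exp (real n * x) / c1 \<le> a" "exp (real n * y) / c2 \<le> c" "0 < c1" "0 < c2"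
    for a c c1 c2 x y :: real and n
  proof -
    have "0 \<le> a" using that(1,3) by (meson divide_nonneg_pos exp_ge_zero order_trans)
    then have "exp (real n * x) / c1 * (exp (real n * y) / c2) \<le> a * c" using that by (intro mult_mono) auto
    then show ?thesis by (simp add: exp_add[symmetric] algebra_simps)
  qed
  have N: "real (N1 n) \<le> exp (real n * (s1 + k + d1))" "real (N2 n) \<le> exp (real n * (s2 + k + d2))" for n
    using ub[OF fb(2) ub[OF fb(5) fb(8), folded of_nat_mult]] ub[OF fb(11) ub[OF fb(5) fb(14), folded of_nat_mult]]
    unfolding N1_def N2_def by (simp_all add: add.assoc)
  have L1: "exp (real n * (k + d1)) / 4 \<le> real (L1 n)" for n
    using lb[OF fb(6) fb(9)] unfolding L1_def by simp
  have L3: "exp (real n * (k + d2)) / 4 \<le> real (L3 n)" for n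
    using lb[OF fb(6) fb(15)] unfolding L3_def by simp
  have N1: "exp (real n * (s1 + (k + d1))) / 8 \<le> real (N1 n)" for n
    using lb[OF fb(3) L1[unfolded L1_def]] unfolding N1_def by simp
  have L2: "exp (real n * g) / 4 \<le> real (L2 n)" for n
  proof (cases b)
    case True
    have "exp (real n * d2) / 4 \<le> exp (real n * d2) / 2" by simp
    then show ?thesis using True fb(15)[of n] unfolding L2_def g_def by simp
  next
    case False
    then show ?thesis using lb[OF fb(12) fb(15)] unfolding L2_def g_def by simp
  qed
  have quarter: "exp y / 64 \<le> exp y / 4" "exp y / 64 \<le> exp y / 8" for y :: real by simp_all

  obtain \<gamma>1 where \<gamma>1: "\<And>n. 0 < \<gamma>1 n" "decays (\<lambda>n. packing (G n) cw1 (\<lambda>(a, b, r). obs2 r) (\<gamma>1 n) (N1 n))"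
    using packing_decays[where h=unzip and F="cw1" and \<iota>="id" and X="lv1" and H="\<lambda>(a, b, r). obs2 r" and \<iota>'="\<lambda>l. (map fst l, map snd l)" and Y="lo2",
      OF finJ packing(1) unzip_sel(1) inj_on_id unzip_sel(7) inj_unzip N(1)] unfolding G_def by blast
  obtain \<gamma>2 where \<gamma>2: "\<And>n. 0 < \<gamma>2 n" "decays (\<lambda>n. packing (G n) cw2 (\<lambda>(a, b, r). obs1 r) (\<gamma>2 n) (N2 n))"
    using packing_decays[where h=unzip and F="cw2" and \<iota>="id" and X="lv2" and H="\<lambda>(a, b, r). obs1 r" and \<iota>'="\<lambda>l. (map fst l, map snd l)" and Y="lo1",
      OF finJ packing(2) unzip_sel(2) inj_on_id unzip_sel(6) inj_unzip N(2)] unfolding G_def by blast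
  obtain \<gamma>3 where \<gamma>3: "\<And>n. 0 < \<gamma>3 n" "decays (\<lambda>n. packing (G n) cw2 (\<lambda>(a, b, r). obs2 r) (\<gamma>3 n) (N2 n))"
    using packing_decays[where h=unzip and F="cw2" and \<iota>="id" and X="lv2" and H="\<lambda>(a, b, r). obs2 r" and \<iota>'="\<lambda>l. (map fst l, map snd l)" and Y="lo2",
      OF finJ packing(3) unzip_sel(2) inj_on_id unzip_sel(7) inj_unzip N(2)] unfolding G_def by blast
  have c1: "decays (\<lambda>n. covering (G n) (\<lambda>(a, b, r). (a, b)) (\<lambda>(a, b, r). eve r) (real (L1 n) * real (L2 n)))"
    unfolding G_def
  proof (rule covering_decays[where h=unzip and F="\<lambda>(a, b, r). (a, b)" and \<iota>="\<lambda>l. (map fst l, map snd l)" and X="lv12" and H="\<lambda>(a, b, r). eve r" and \<iota>'="id" and Y="lz",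
      OF finJ covering(3) unzip_sel(3) inj_unzip unzip_sel(4) inj_on_id])
    fix n show "exp (real n * (k + d1 + g)) / 64 \<le> real (L1 n) * real (L2 n)"
      using lb[OF L1[of n] L2[of n]] exp_ge_zero[of "real n * (k + d1 + g)"] by linarith
  qed
  have c2: "decays (\<lambda>n. covering (G n) cw1 (\<lambda>(a, b, r). eve r) (real (L1 n)))"
    unfolding G_def
    by (rule covering_decays[where h=unzip and F="cw1" and \<iota>="id" and X="lv1" and H="\<lambda>(a, b, r). eve r" and \<iota>'="id" and Y="lz",
      OF finJ covering(1) unzip_sel(1) inj_on_id unzip_sel(4) inj_on_id]) (rule order_trans[OF quarter(1) L1])
  have c3: "decays (\<lambda>n. covering (G n) cw2 (\<lambda>(a, b, r). eve r) (real (L2 n)))"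
    unfolding G_def
    by (rule covering_decays[where h=unzip and F="cw2" and \<iota>="id" and X="lv2" and H="\<lambda>(a, b, r). eve r" and \<iota>'="id" and Y="lz",
      OF finJ covering(2) unzip_sel(2) inj_on_id unzip_sel(4) inj_on_id]) (rule order_trans[OF quarter(1) L2])
  have c4: "decays (\<lambda>n. covering (G n) (\<lambda>(a, b, r). (a, b)) (\<lambda>(a, b, r). eve r) (real (N1 n) * real (L3 n)))"
    unfolding G_def
  proof (rule covering_decays[where h=unzip and F="\<lambda>(a, b, r). (a, b)" and \<iota>="\<lambda>l. (map fst l, map snd l)" and X="lv12" and H="\<lambda>(a, b, r). eve r" and \<iota>'="id" and Y="lz",
      OF finJ covering(5) unzip_sel(3) inj_unzip unzip_sel(4) inj_on_id])
    fix n show "exp (real n * (s1 + k + d1 + k + d2)) / 64 \<le> real (N1 n) * real (L3 n)"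
    proof -
      have eq: "s1 + (k + d1) + (k + d2) = s1 + k + d1 + k + d2" by simp
      have "exp (real n * (s1 + k + d1 + k + d2)) / (8 * 4) \<le> real (N1 n) * real (L3 n)"
        using lb[OF N1[of n] L3[of n]] unfolding eq by simp
      then show ?thesis using exp_ge_zero[of "real n * (s1 + k + d1 + k + d2)"] by linarith
    qed
  qed
  have "mean_dens J lv1 lz < s1 + (k + d1)" using covering(1) rates(1) by simp
  then have c5: "decays (\<lambda>n. covering (G n) cw1 (\<lambda>(a, b, r). eve r) (real (N1 n)))"
    unfolding G_def
    by (rule covering_decays[where h=unzip and F="cw1" and \<iota>="id" and X="lv1" and H="\<lambda>(a, b, r). eve r" and \<iota>'="id" and Y="lz",
      OF finJ _ unzip_sel(1) inj_on_id unzip_sel(4) inj_on_id]) (rule order_trans[OF quarter(2) N1])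
  have c6: "decays (\<lambda>n. covering (G n) cw2 (\<lambda>(a, b, r). eve r) (real (L3 n)))"
    unfolding G_def
    by (rule covering_decays[where h=unzip and F="cw2" and \<iota>="id" and X="lv2" and H="\<lambda>(a, b, r). eve r" and \<iota>'="id" and Y="lz",
      OF finJ covering(4) unzip_sel(2) inj_on_id unzip_sel(4) inj_on_id]) (rule order_trans[OF quarter(1) L3])
  define cov where "cov n = (covering (G n) (\<lambda>(a, b, r). (a, b)) (\<lambda>(a, b, r). eve r) (real (L1 n) * real (L2 n))
      + covering (G n) cw1 (\<lambda>(a, b, r). eve r) (real (L1 n)) + covering (G n) cw2 (\<lambda>(a, b, r). eve r) (real (L2 n)))
      + (covering (G n) (\<lambda>(a, b, r). (a, b)) (\<lambda>(a, b, r). eve r) (real (N1 n) * real (L3 n))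
      + covering (G n) cw1 (\<lambda>(a, b, r). eve r) (real (N1 n)) + covering (G n) cw2 (\<lambda>(a, b, r). eve r) (real (L3 n)))" for n
  have "decays cov" unfolding cov_def by (intro decays_add c1 c2 c3 c4 c5 c6)
  then obtain t where t: "\<And>n. 0 < t n" "decays (\<lambda>n. cov n / (2 * t n) + 4 * t n)" using decays_balance by blast
  define \<epsilon> where "\<epsilon> n = packing (G n) cw1 (\<lambda>(a, b, r). obs2 r) (\<gamma>1 n) (N1 n) + packing (G n) cw2 (\<lambda>(a, b, r). obs1 r) (\<gamma>2 n) (N2 n)
      + packing (G n) cw2 (\<lambda>(a, b, r). obs2 r) (\<gamma>3 n) (N2 n) + (cov n / (2 * t n) + 4 * t n)" for n
  have "decays \<epsilon>" unfolding \<epsilon>_def by (intro decays_add \<gamma>1(2) \<gamma>2(2) \<gamma>3(2) t(2))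
  moreover have "scode b W n (fl n s1) (fl n k) (fl n s2) (fl n k) (\<epsilon> n)" for n
  proof -
    have G: "joint (replicate_pmf n p1) (replicate_pmf n p2) (block_channel W n (block_input X1) (block_input X2)) = G n"
      unfolding G_def J_def by (rule joint_block_channel)
    have e: "\<epsilon> n = packing (G n) cw1 (\<lambda>(a, b, r). obs2 r) (\<gamma>1 n) (N1 n) + packing (G n) cw2 (\<lambda>(a, b, r). obs1 r) (\<gamma>2 n) (N2 n)
      + packing (G n) cw2 (\<lambda>(a, b, r). obs2 r) (\<gamma>3 n) (N2 n)
      + ((covering (G n) (\<lambda>(a, b, r). (a, b)) (\<lambda>(a, b, r). eve r) (real (L1 n) * real (L2 n))
      + covering (G n) cw1 (\<lambda>(a, b, r). eve r) (real (L1 n)) + covering (G n) cw2 (\<lambda>(a, b, r). eve r) (real (L2 n))) / (2 * t n) + 2 * t n)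
      + ((covering (G n) (\<lambda>(a, b, r). (a, b)) (\<lambda>(a, b, r). eve r) (real (N1 n) * real (L3 n))
      + covering (G n) cw1 (\<lambda>(a, b, r). eve r) (real (N1 n)) + covering (G n) cw2 (\<lambda>(a, b, r). eve r) (real (L3 n))) / (2 * t n) + 2 * t n)"
      unfolding \<epsilon>_def cov_def by (simp add: add_divide_distrib)
    show ?thesis
      unfolding e N1_def N2_def L1_def L2_def L3_def G[symmetric]
      by (rule random_code_mac) (use fb t \<gamma>1 \<gamma>2 \<gamma>3 fin finite_set_replicate_pmf finite_block_input in auto)
  qed
  ultimately show ?thesis by blast
qed

lemma random_code_rates_public:
  fixes W :: "('x1::finite,'x2::finite,'y1::finite,'y2::finite,'z::finite) channel"
    and X1 :: "nat \<Rightarrow> 'x1 pmf" and X2 :: "nat \<Rightarrow> 'x2 pmf"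
  assumes fin: "finite (set_pmf p1)" "finite (set_pmf p2)"
    and rates: "0 \<le> k" "0 \<le> s2" "0 \<le> d2"
  defines "J \<equiv> letter_law p1 p2 X1 X2 W"
  assumes packing: "k < mean_dens J lv1 lo2" "s2 + k + d2 < mean_dens J lv2 lo1" "s2 + k + d2 < mean_dens J lv2 lo2"
    and covering: "mean_dens J lv2 lv1z < d2"
  shows "\<exists>\<epsilon>. decays \<epsilon> \<and> (\<forall>n. scode True W n (fl n 0) (fl n k) (fl n s2) (fl n k) (\<epsilon> n))"
proof -
  have finJ: "finite (set_pmf J)" unfolding J_def by (rule finite_letter_law[OF fin])
  define G where "G n = map_pmf unzip (replicate_pmf n J)" for n
  define N1 where "N1 n = 1 * (fl n k * 1)" for n
  define N2 where "N2 n = fl n s2 * (fl n k * fl n d2)" for n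
  note fb = fl_bounds[OF rates(1)] fl_bounds[OF rates(2)] fl_bounds[OF rates(3)]
  have ub: "real a * real c \<le> exp (real n * (x + y))" if "real a \<le> exp (real n * x)" "real c \<le> exp (real n * y)" for a c n x y
    using mult_mono[OF that] by (simp add: exp_add[symmetric] algebra_simps)
  have N: "real (N1 n) \<le> exp (real n * k)" "real (N2 n) \<le> exp (real n * (s2 + k + d2))" for n
    using fb(2) ub[OF fb(5) ub[OF fb(2) fb(8), folded of_nat_mult]]
    unfolding N1_def N2_def by (simp_all add: add.assoc)
  obtain \<gamma>1 where \<gamma>1: "\<And>n. 0 < \<gamma>1 n" "decays (\<lambda>n. packing (G n) cw1 (\<lambda>(a, b, r). obs2 r) (\<gamma>1 n) (N1 n))"
    using packing_decays[where h=unzip and F="cw1" and \<iota>="id" and X="lv1" and H="\<lambda>(a, b, r). obs2 r" and \<iota>'="\<lambda>l. (map fst l, map snd l)" and Y="lo2",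
      OF finJ packing(1) unzip_sel(1) inj_on_id unzip_sel(7) inj_unzip N(1)] unfolding G_def by blast
  obtain \<gamma>2 where \<gamma>2: "\<And>n. 0 < \<gamma>2 n" "decays (\<lambda>n. packing (G n) cw2 (\<lambda>(a, b, r). obs1 r) (\<gamma>2 n) (N2 n))"
    using packing_decays[where h=unzip and F="cw2" and \<iota>="id" and X="lv2" and H="\<lambda>(a, b, r). obs1 r" and \<iota>'="\<lambda>l. (map fst l, map snd l)" and Y="lo1",
      OF finJ packing(2) unzip_sel(2) inj_on_id unzip_sel(6) inj_unzip N(2)] unfolding G_def by blast
  obtain \<gamma>3 where \<gamma>3: "\<And>n. 0 < \<gamma>3 n" "decays (\<lambda>n. packing (G n) cw2 (\<lambda>(a, b, r). obs2 r) (\<gamma>3 n) (N2 n))"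
    using packing_decays[where h=unzip and F="cw2" and \<iota>="id" and X="lv2" and H="\<lambda>(a, b, r). obs2 r" and \<iota>'="\<lambda>l. (map fst l, map snd l)" and Y="lo2",
      OF finJ packing(3) unzip_sel(2) inj_on_id unzip_sel(7) inj_unzip N(2)] unfolding G_def by blast
  define cov where "cov n = covering (G n) cw2 (\<lambda>(a, b, r). (a, eve r)) (real (fl n d2))" for n
  have "decays cov" unfolding G_def cov_def
  proof (rule covering_decays[where h=unzip and F="cw2" and \<iota>="id" and X="lv2" and H="\<lambda>(a, b, r). (a, eve r)" and \<iota>'="\<lambda>l. (map fst l, map snd l)" and Y="lv1z",
      OF finJ covering unzip_sel(2) inj_on_id unzip_sel(5) inj_unzip])
    fix n show "exp (real n * d2) / 64 \<le> real (fl n d2)"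
      using fb(9)[of n] exp_ge_zero[of "real n * d2"] by linarith
  qed
  then obtain t where t: "\<And>n. 0 < t n" "decays (\<lambda>n. cov n / (2 * t n) + 4 * t n)" using decays_balance by blast
  define \<epsilon> where "\<epsilon> n = packing (G n) cw1 (\<lambda>(a, b, r). obs2 r) (\<gamma>1 n) (N1 n) + packing (G n) cw2 (\<lambda>(a, b, r). obs1 r) (\<gamma>2 n) (N2 n)
      + packing (G n) cw2 (\<lambda>(a, b, r). obs2 r) (\<gamma>3 n) (N2 n) + (cov n / (2 * t n) + 4 * t n)" for n
  have "decays \<epsilon>" unfolding \<epsilon>_def by (intro decays_add \<gamma>1(2) \<gamma>2(2) \<gamma>3(2) t(2))
  moreover have "scode True W n (fl n 0) (fl n k) (fl n s2) (fl n k) (\<epsilon> n)" for n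
  proof -
    have G: "joint (replicate_pmf n p1) (replicate_pmf n p2) (block_channel W n (block_input X1) (block_input X2)) = G n"
      unfolding G_def J_def by (rule joint_block_channel)
    have fl0: "fl n 0 = 1" by (simp add: fl_def)
    have "scode True W n 1 (fl n k) (fl n s2) (fl n k)
      (packing (G n) cw1 (\<lambda>(a, b, r). obs2 r) (\<gamma>1 n) (N1 n) + packing (G n) cw2 (\<lambda>(a, b, r). obs1 r) (\<gamma>2 n) (N2 n)
      + packing (G n) cw2 (\<lambda>(a, b, r). obs2 r) (\<gamma>3 n) (N2 n) + (cov n / (2 * t n) + 2 * t n))"
      unfolding cov_def N1_def N2_def G[symmetric]
      by (rule random_code_public) (use fb t \<gamma>1 \<gamma>2 \<gamma>3 fin finite_set_replicate_pmf finite_block_input in auto)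
    then show ?thesis unfolding fl0 by (rule scode_mono) (use t(1)[of n] in \<open>simp add: \<epsilon>_def\<close>)
  qed
  ultimately show ?thesis by blast
qed

section \<open>Block Markov coding and time sharing\<close>

text \<open>Among m + 1 blocks only the first carries no encrypted part, which costs user 1 a rate
  of k / (m + 1). The number \<open>m\<close> is chosen for the given \<delta> and then kept while
  \<open>n\<close> grows, so the factor \<open>3 ^ m\<close> in the error is a constant.\<close>

lemma ach_block_markov:
  fixes W :: "('x1,'x2,'y1,'y2,'z) channel"
  assumes rates: "0 \<le> s1" "0 \<le> k" "0 \<le> s2" and dec: "decays \<epsilon>"
    and code: "\<And>n. scode b W n (fl n s1) (fl n k) (fl n s2) (fl n k) (\<epsilon> n)"
  shows "ach b W (s1 + k) s2"
  unfolding ach_def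
proof (intro allI impI)
  fix \<delta> :: real assume \<delta>: "0 < \<delta>"
  obtain m :: nat where m: "2 * k / \<delta> < real m" using reals_Archimedean2 by blast
  define p where "p = Suc m"
  have p: "0 < p" "k / real p \<le> \<delta> / 2"
  proof -
    show "0 < p" by (simp add: p_def)
    have "2 * k < \<delta> * real p" using m \<delta> by (simp add: p_def field_simps)
    then show "k / real p \<le> \<delta> / 2" using \<open>0 < p\<close> by (simp add: field_simps)
  qed
  \<comment> \<open>The total rounding loss: fewer than \<open>p\<close> leftover channel uses at
    the full rates, and 1 for each of the at most 2 p integer parts that enter a logarithm.\<close>
  define A where "A = real p * (s1 + k + s2) + 2 * real p"
  have "\<forall>\<^sub>F n in sequentially. (2 * 3 ^ m) * \<epsilon> (n div p) \<le> \<delta> / real n"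
    by (rule decays_tendsto[OF _ dec \<delta> p(1)]) simp
  moreover have "\<forall>\<^sub>F n in sequentially. A / real n < \<delta> / 2"
    using \<delta> by (intro order_tendstoD(2)[OF lim_const_over_n]) auto
  ultimately show "\<forall>\<^sub>F n in sequentially. \<exists>N1 N2. scode b W n N1 1 N2 1 (\<delta> / real n) \<and>
     \<bar>ln (real N1) / real n - (s1 + k)\<bar> \<le> \<delta> \<and> \<bar>ln (real N2) / real n - s2\<bar> \<le> \<delta>"
    using eventually_ge_at_top[of 1]
  proof eventually_elim
    case (elim n)
    define q where "q = n div p"
    define S where "S = fl q s1" define \<kappa> where "\<kappa> = fl q k" define T where "T = fl q s2"
    have n: "n = p * q + n mod p" "n mod p < p" using p unfolding q_def by auto
    have "scode b W (p * q) (S * (S * \<kappa>) ^ m) 1 (T ^ p) 1 (3 ^ m * \<epsilon> q)"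
      unfolding S_def \<kappa>_def T_def p_def by (rule scode_drop_key[OF scode_power[OF code]])
    \<comment> \<open>The remaining \<open>n mod p\<close> channel uses are filled by the trivial
      code. As the first component of the composition, the block code has its error doubled.\<close>
    from scode_seq[OF this scode_trivial[of b W "n mod p"]]
    have "scode b W n (S * (S * \<kappa>) ^ m) 1 (T ^ p) 1 (2 * (3 ^ m * \<epsilon> q) + 0)"
      using n(1) by simp
    then have sc: "scode b W n (S * (S * \<kappa>) ^ m) 1 (T ^ p) 1 (\<delta> / real n)"
      by (rule scode_mono) (use elim(1) in \<open>simp add: q_def\<close>)
    have pos: "0 < real S" "0 < real \<kappa>" "0 < real T"
      unfolding S_def \<kappa>_def T_def using fl_bounds(1) rates by auto
    have lnS: "ln (real S) \<le> real q * s1" "real q * s1 - 1 \<le> ln (real S)"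
      and lnk: "ln (real \<kappa>) \<le> real q * k" "real q * k - 1 \<le> ln (real \<kappa>)"
      and lnT: "ln (real T) \<le> real q * s2" "real q * s2 - 1 \<le> ln (real T)"
      unfolding S_def \<kappa>_def T_def using ln_fl_bounds rates by auto
    have ln1: "ln (real (S * (S * \<kappa>) ^ m)) = real p * ln (real S) + real m * ln (real \<kappa>)"
      using pos by (simp add: ln_mult ln_realpow p_def algebra_simps)
    have ln2: "ln (real (T ^ p)) = real p * ln (real T)" using pos by (simp add: ln_realpow)
    have rn: "1 \<le> real n" using elim(3) by simp
    have pq: "real p * real q \<le> real n" "real n - real p \<le> real p * real q"
    proof -
      have "real n = real p * real q + real (n mod p)" using n(1) by (metis of_nat_add of_nat_mult)
      then show "real p * real q \<le> real n" "real n - real p \<le> real p * real q" using n(2) by auto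
    qed
    have Ad: "A < \<delta> / 2 * real n" using elim(2) rn by (simp add: pos_divide_less_eq)
    have qk: "real q * k \<le> \<delta> / 2 * real n"
    proof -
      have "real q * k = real p * real q * (k / real p)" using p by simp
      also have "\<dots> \<le> real n * (\<delta> / 2)" using pq(1) p \<delta> rates by (intro mult_mono) auto
      finally show ?thesis by (simp add: mult.commute)
    qed
    have mult: "real p * real q * x \<le> real n * x" "(real n - real p) * x \<le> real p * real q * x" if "0 \<le> x" for x
      using pq that by (intro mult_right_mono; simp)+
    have u1: "ln (real (S * (S * \<kappa>) ^ m)) \<le> real n * (s1 + k)"
    proof -
      have "ln (real (S * (S * \<kappa>) ^ m)) \<le> real p * (real q * s1) + real m * (real q * k)"
        unfolding ln1 using lnS lnk by (intro add_mono mult_left_mono) auto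
      also have "\<dots> \<le> real p * (real q * s1) + real p * (real q * k)"
        using rates by (intro add_left_mono mult_right_mono) (auto simp: p_def)
      also have "\<dots> = real p * real q * (s1 + k)" by (simp add: algebra_simps)
      also have "\<dots> \<le> real n * (s1 + k)" using rates by (intro mult) auto
      finally show ?thesis .
    qed
    have l1: "real n * (s1 + k) - \<delta> * real n \<le> ln (real (S * (S * \<kappa>) ^ m))"
    proof -
      have "real p * (real q * s1 - 1) + real m * (real q * k - 1) \<le> ln (real (S * (S * \<kappa>) ^ m))"
        unfolding ln1 using lnS lnk by (intro add_mono mult_left_mono) auto
      moreover have "real p * (real q * s1 - 1) + real m * (real q * k - 1) = real p * real q * (s1 + k) - real q * k - (2 * real p - 1)"
        by (simp add: p_def algebra_simps)
      moreover have "(real n - real p) * (s1 + k) \<le> real p * real q * (s1 + k)" using rates by (intro mult) auto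
      moreover have "real p * (s1 + k) + 2 * real p \<le> A" unfolding A_def using rates by (simp add: algebra_simps)
      moreover have "(real n - real p) * (s1 + k) = real n * (s1 + k) - real p * (s1 + k)" by (simp add: algebra_simps)
      ultimately show ?thesis using Ad qk by linarith
    qed
    have u2: "ln (real (T ^ p)) \<le> real n * s2"
    proof -
      have "ln (real (T ^ p)) \<le> real p * (real q * s2)" unfolding ln2 using lnT by (intro mult_left_mono) auto
      also have "\<dots> \<le> real n * s2" using mult(1)[OF rates(3)] by simp
      finally show ?thesis .
    qed
    have l2: "real n * s2 - \<delta> * real n \<le> ln (real (T ^ p))"
    proof -
      have "real p * (real q * s2 - 1) \<le> ln (real (T ^ p))" unfolding ln2 using lnT by (intro mult_left_mono) auto
      moreover have "real p * (real q * s2 - 1) = real p * real q * s2 - real p" by (simp add: algebra_simps)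
      moreover have "(real n - real p) * s2 \<le> real p * real q * s2" using rates by (intro mult) auto
      moreover have "real p * s2 + real p \<le> A" unfolding A_def using rates by (simp add: algebra_simps)
      moreover have "(real n - real p) * s2 = real n * s2 - real p * s2" by (simp add: algebra_simps)
      moreover have "0 \<le> \<delta> * real n" using \<delta> by simp
      ultimately show ?thesis using Ad by linarith
    qed
    have near: "\<bar>x / real n - y\<bar> \<le> \<delta>" if "x \<le> real n * y" "real n * y - \<delta> * real n \<le> x" for x y
    proof -
      have "x / real n - y = (x - real n * y) / real n" using rn by (simp add: field_simps)
      moreover have "\<bar>x - real n * y\<bar> \<le> \<delta> * real n" using that \<delta> rn by (auto simp: abs_le_iff intro: order_trans)
      ultimately show ?thesis using rn by (simp add: pos_divide_le_eq)
    qed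
    show ?case
      by (intro exI[of _ "S * (S * \<kappa>) ^ m"] exI[of _ "T ^ p"] conjI sc near u1 l1 u2 l2)
  qed
qed

lemma ach_closed: "closed {(R1, R2). ach b W R1 R2}"
proof (rule closed_sequential_limits[THEN iffD2], intro allI impI, elim conjE)
  fix x l assume x: "\<forall>n. x n \<in> {(R1, R2). ach b W R1 R2}" and lim: "x \<longlonglongrightarrow> l"
  have "ach b W (fst l) (snd l)"
    unfolding ach_def
  proof (intro allI impI)
    fix \<delta> :: real assume \<delta>: "0 < \<delta>"
    obtain i where i: "dist (x i) l < \<delta> / 2" using lim \<delta> unfolding lim_sequentially by (meson half_gt_zero order_refl)
    have d: "\<bar>fst (x i) - fst l\<bar> \<le> \<delta> / 2" "\<bar>snd (x i) - snd l\<bar> \<le> \<delta> / 2"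
      using i dist_fst_le[of "x i" l] dist_snd_le[of "x i" l] by (auto simp: dist_real_def)
    have "ach b W (fst (x i)) (snd (x i))" using x by (auto simp: case_prod_unfold)
    then have "\<forall>\<^sub>F n in sequentially. \<exists>N1 N2. scode b W n N1 1 N2 1 (\<delta> / 2 / real n) \<and>
     \<bar>ln (real N1) / real n - fst (x i)\<bar> \<le> \<delta> / 2 \<and> \<bar>ln (real N2) / real n - snd (x i)\<bar> \<le> \<delta> / 2"
      unfolding ach_def using \<delta> half_gt_zero by blast
    then show "\<forall>\<^sub>F n in sequentially. \<exists>N1 N2. scode b W n N1 1 N2 1 (\<delta> / real n) \<and>
     \<bar>ln (real N1) / real n - fst l\<bar> \<le> \<delta> \<and> \<bar>ln (real N2) / real n - snd l\<bar> \<le> \<delta>"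
    proof eventually_elim
      case (elim n)
      then obtain N1 N2 where N: "scode b W n N1 1 N2 1 (\<delta> / 2 / real n)"
        "\<bar>ln (real N1) / real n - fst (x i)\<bar> \<le> \<delta> / 2" "\<bar>ln (real N2) / real n - snd (x i)\<bar> \<le> \<delta> / 2" by blast
      have "scode b W n N1 1 N2 1 (\<delta> / real n)"
        by (rule scode_mono[OF N(1)], rule divide_right_mono) (use \<delta> in auto)
      moreover have "\<bar>ln (real N1) / real n - fst l\<bar> \<le> \<delta>" "\<bar>ln (real N2) / real n - snd l\<bar> \<le> \<delta>"
        using N(2,3) d by linarith+
      ultimately show ?case by blast
    qed
  qed
  then show "l \<in> {(R1, R2). ach b W R1 R2}" by (simp add: case_prod_unfold)
qed

lemma ach_swap: "ach b W R1 R2 \<Longrightarrow> ach b (swap_channel W) R2 R1"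
  unfolding ach_def
proof (intro allI impI)
  fix \<delta> :: real assume ach: "\<forall>\<delta>>0. \<forall>\<^sub>F n in sequentially. \<exists>N1 N2. scode b W n N1 1 N2 1 (\<delta> / real n) \<and>
     \<bar>ln (real N1) / real n - R1\<bar> \<le> \<delta> \<and> \<bar>ln (real N2) / real n - R2\<bar> \<le> \<delta>" and "0 < \<delta>"
  then have "\<forall>\<^sub>F n in sequentially. \<exists>N1 N2. scode b W n N1 1 N2 1 (\<delta> / real n) \<and>
     \<bar>ln (real N1) / real n - R1\<bar> \<le> \<delta> \<and> \<bar>ln (real N2) / real n - R2\<bar> \<le> \<delta>" by blast
  then show "\<forall>\<^sub>F n in sequentially. \<exists>N1 N2. scode b (swap_channel W) n N1 1 N2 1 (\<delta> / real n) \<and>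
     \<bar>ln (real N1) / real n - R2\<bar> \<le> \<delta> \<and> \<bar>ln (real N2) / real n - R1\<bar> \<le> \<delta>"
    by eventually_elim (blast intro: scode_swap)
qed

lemma swap_channel_swap: "swap_channel (swap_channel W) = W"
  by (simp add: swap_channel_def fun_eq_iff map_pmf_comp case_prod_unfold)

lemma ach_True_False: "ach True W R1 R2 \<Longrightarrow> ach False W R1 R2"
  unfolding ach_def
proof (intro allI impI)
  fix \<delta> :: real assume ach: "\<forall>\<delta>>0. \<forall>\<^sub>F n in sequentially. \<exists>N1 N2. scode True W n N1 1 N2 1 (\<delta> / real n) \<and>
     \<bar>ln (real N1) / real n - R1\<bar> \<le> \<delta> \<and> \<bar>ln (real N2) / real n - R2\<bar> \<le> \<delta>" and "0 < \<delta>"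
  then have "\<forall>\<^sub>F n in sequentially. \<exists>N1 N2. scode True W n N1 1 N2 1 (\<delta> / real n) \<and>
     \<bar>ln (real N1) / real n - R1\<bar> \<le> \<delta> \<and> \<bar>ln (real N2) / real n - R2\<bar> \<le> \<delta>" by blast
  then show "\<forall>\<^sub>F n in sequentially. \<exists>N1 N2. scode False W n N1 1 N2 1 (\<delta> / real n) \<and>
     \<bar>ln (real N1) / real n - R1\<bar> \<le> \<delta> \<and> \<bar>ln (real N2) / real n - R2\<bar> \<le> \<delta>"
    by eventually_elim (blast intro: scode_individual)
qed

text \<open>Two codes are concatenated by \<open>scode_seq\<close> with a key of a single value, so
  the pad carries nothing and the message numbers simply multiply.\<close>

lemma ach_time_sharing:
  assumes A: "ach b W R1 R2" "ach b W R1' R2'" and l: "0 < l" "l < 1"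
  shows "ach b W (l * R1 + (1 - l) * R1') (l * R2 + (1 - l) * R2')"
  unfolding ach_def
proof (intro allI impI)
  fix \<delta> :: real assume \<delta>: "0 < \<delta>"
  \<comment> \<open>The first part eventually has length at least l n / 2 and the second at least (1
    - l) n, so each error is at most \<delta> / (3 n). The composition counts them twice and once,
    which gives \<delta> / n.\<close>
  define \<eta> where "\<eta> = \<delta> * min l (1 - l) / 6"
  have \<eta>: "0 < \<eta>" "6 * \<eta> \<le> \<delta> * l" "6 * \<eta> \<le> \<delta> * (1 - l)"
    unfolding \<eta>_def using \<delta> l by (auto simp: mult_le_cancel_left1 min_def)
  have \<eta>\<delta>: "6 * \<eta> \<le> \<delta>" using \<eta>(2) l \<delta> by (smt (verit) mult_le_cancel_left2)
  define n1 where "n1 n = nat \<lfloor>l * real n\<rfloor>" for n :: nat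
  define n2 where "n2 n = n - n1 n" for n
  have n1: "real (n1 n) \<le> l * real n" "l * real n - 1 \<le> real (n1 n)" for n
  proof -
    have "0 \<le> l * real n" using l by simp
    then show "real (n1 n) \<le> l * real n" "l * real n - 1 \<le> real (n1 n)" unfolding n1_def by linarith+
  qed
  have le: "n1 n \<le> n" for n
  proof -
    have "l * real n \<le> real n" using l by (simp add: mult_left_le_one_le)
    with n1(1)[of n] show ?thesis by linarith
  qed
  have n12: "n = n1 n + n2 n" for n using le unfolding n2_def by simp
  have n2: "(1 - l) * real n \<le> real (n2 n)" "real (n2 n) \<le> (1 - l) * real n + 1" for n
  proof -
    have "real n = real (n1 n) + real (n2 n)" using n12 by (metis of_nat_add)
    then show "(1 - l) * real n \<le> real (n2 n)" "real (n2 n) \<le> (1 - l) * real n + 1"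
      using n1[of n] by (simp_all add: algebra_simps)
  qed
  have lim: "filterlim n1 at_top sequentially" "filterlim n2 at_top sequentially"
  proof -
    have big: "filterlim g at_top sequentially" if g: "\<And>n. c * real n - 1 \<le> real (g n)" and c: "0 < c" for g :: "nat \<Rightarrow> nat" and c :: real
      unfolding filterlim_at_top
    proof
      fix Z
      have "\<forall>\<^sub>F n in sequentially. (real Z + 1) / c \<le> real n"
        using filterlim_real_sequentially unfolding filterlim_at_top by blast
      then show "\<forall>\<^sub>F n in sequentially. Z \<le> g n"
      proof eventually_elim
        case (elim n)
        then have "real Z + 1 \<le> c * real n" using c by (simp add: pos_divide_le_eq mult.commute)
        then show ?case using g[of n] by linarith
      qed
    qed
    show "filterlim n1 at_top sequentially" by (rule big[OF n1(2) l(1)])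
    show "filterlim n2 at_top sequentially"
    proof (rule big[of "1 - l"])
      show "(1 - l) * real n - 1 \<le> real (n2 n)" for n using n2(1)[of n] by linarith
    qed (use l in simp)
  qed
  have ev1: "\<forall>\<^sub>F n in sequentially. \<exists>N1 N2. scode b W (n1 n) N1 1 N2 1 (\<eta> / real (n1 n)) \<and>
     \<bar>ln (real N1) / real (n1 n) - R1\<bar> \<le> \<eta> \<and> \<bar>ln (real N2) / real (n1 n) - R2\<bar> \<le> \<eta>"
    by (rule eventually_compose_filterlim[OF _ lim(1)]) (use A(1) \<eta>(1) in \<open>auto simp: ach_def\<close>)
  have ev2: "\<forall>\<^sub>F n in sequentially. \<exists>N1 N2. scode b W (n2 n) N1 1 N2 1 (\<eta> / real (n2 n)) \<and>
     \<bar>ln (real N1) / real (n2 n) - R1'\<bar> \<le> \<eta> \<and> \<bar>ln (real N2) / real (n2 n) - R2'\<bar> \<le> \<eta>"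
    by (rule eventually_compose_filterlim[OF _ lim(2)]) (use A(2) \<eta>(1) in \<open>auto simp: ach_def\<close>)
  \<comment> \<open>Rounding changes each of the two lengths by at most 1, which shifts a
    log-cardinality by at most the absolute values of the rates.\<close>
  define B where "B = \<bar>R1\<bar> + \<bar>R2\<bar> + \<bar>R1'\<bar> + \<bar>R2'\<bar>"
  have ev3: "\<forall>\<^sub>F n in sequentially. B / real n < \<delta> / 2"
    using \<delta> by (intro order_tendstoD(2)[OF lim_const_over_n]) auto
  have ev4: "\<forall>\<^sub>F n in sequentially. 2 / l / real n < 1"
    by (intro order_tendstoD(2)[OF lim_const_over_n]) auto
  show "\<forall>\<^sub>F n in sequentially. \<exists>N1 N2. scode b W n N1 1 N2 1 (\<delta> / real n) \<and>
     \<bar>ln (real N1) / real n - (l * R1 + (1 - l) * R1')\<bar> \<le> \<delta> \<and> \<bar>ln (real N2) / real n - (l * R2 + (1 - l) * R2')\<bar> \<le> \<delta>"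
    using ev1 ev2 ev3 ev4 eventually_ge_at_top[of 1]
  proof eventually_elim
    case (elim n)
    from elim(1) obtain N1 N2 where N: "scode b W (n1 n) N1 1 N2 1 (\<eta> / real (n1 n))"
     "\<bar>ln (real N1) / real (n1 n) - R1\<bar> \<le> \<eta>" "\<bar>ln (real N2) / real (n1 n) - R2\<bar> \<le> \<eta>" by blast
    from elim(2) obtain N1' N2' where N': "scode b W (n2 n) N1' 1 N2' 1 (\<eta> / real (n2 n))"
     "\<bar>ln (real N1') / real (n2 n) - R1'\<bar> \<le> \<eta>" "\<bar>ln (real N2') / real (n2 n) - R2'\<bar> \<le> \<eta>" by blast
    have rn: "1 \<le> real n" using elim(5) by simp
    have "0 < l * real n" using l rn by simp
    then have ln2: "2 < l * real n" using elim(4) unfolding divide_divide_eq_left by (simp only: pos_divide_less_eq mult_1)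
    have pos: "l * real n / 2 \<le> real (n1 n)" "0 < real (n1 n)" using n1(2)[of n] ln2 by linarith+
    have pos': "(1 - l) * real n \<le> real (n2 n)" "0 < real (n2 n)"
    proof -
      have "0 < (1 - l) * real n" using l rn by simp
      then show "(1 - l) * real n \<le> real (n2 n)" "0 < real (n2 n)" using n2(1)[of n] by linarith+
    qed
    have e1: "\<eta> / real (n1 n) \<le> \<delta> / 3 / real n"
    proof -
      have "3 * \<eta> * real n \<le> \<delta> * l / 2 * real n" using \<eta>(2) rn by (intro mult_right_mono) auto
      also have "\<dots> = \<delta> * (l * real n / 2)" by simp
      also have "\<dots> \<le> \<delta> * real (n1 n)" using pos \<delta> by (intro mult_left_mono) auto
      finally show ?thesis using pos rn by (simp add: divide_simps mult.commute mult.left_commute)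
    qed
    have e2: "\<eta> / real (n2 n) \<le> \<delta> / 3 / real n"
    proof -
      have "3 * \<eta> * real n \<le> \<delta> * (1 - l) * real n" using \<eta> rn by (intro mult_right_mono) auto
      also have "\<dots> = \<delta> * ((1 - l) * real n)" by simp
      also have "\<dots> \<le> \<delta> * real (n2 n)" using pos' \<delta> by (intro mult_left_mono) auto
      finally show ?thesis using pos' rn by (simp add: divide_simps mult.commute mult.left_commute)
    qed
    have "scode b W (n1 n + n2 n) (N1 * (N1' * 1)) 1 (N2 * N2') 1 (2 * (\<eta> / real (n1 n)) + \<eta> / real (n2 n))"
      by (rule scode_seq[OF N(1) N'(1)])
    then have sc: "scode b W n (N1 * N1') 1 (N2 * N2') 1 (\<delta> / real n)"
      unfolding n12[symmetric] mult_1_right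
      by (rule scode_mono) (use e1 e2 in simp)
    have Npos: "0 < real N1" "0 < real N2" "0 < real N1'" "0 < real N2'"
      using scode_positive[OF N(1)] scode_positive[OF N'(1)] by auto
    have Bn: "B \<le> \<delta> / 2 * real n" using elim(3) rn by (simp add: pos_divide_less_eq less_imp_le)
    have rate: "\<bar>(a + a') / real n - (l * r + (1 - l) * r')\<bar> \<le> \<delta>"
      if a: "\<bar>a / real (n1 n) - r\<bar> \<le> \<eta>" "\<bar>a' / real (n2 n) - r'\<bar> \<le> \<eta>" "\<bar>r\<bar> + \<bar>r'\<bar> \<le> B" for a a' r r' :: real
    proof -
      have b1: "\<bar>a - real (n1 n) * r\<bar> \<le> \<eta> * real (n1 n)"
      proof -
        have "a - real (n1 n) * r = (a / real (n1 n) - r) * real (n1 n)" using pos by (simp add: field_simps)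
        then show ?thesis using a(1) pos by (simp add: abs_mult)
      qed
      have b2: "\<bar>a' - real (n2 n) * r'\<bar> \<le> \<eta> * real (n2 n)"
      proof -
        have "a' - real (n2 n) * r' = (a' / real (n2 n) - r') * real (n2 n)" using pos' by (simp add: field_simps)
        then show ?thesis using a(2) pos' by (simp add: abs_mult)
      qed
      have b3: "\<bar>real (n1 n) * r - l * real n * r\<bar> \<le> \<bar>r\<bar>"
      proof -
        have "\<bar>real (n1 n) - l * real n\<bar> \<le> 1" using n1[of n] by linarith
        then have "\<bar>real (n1 n) - l * real n\<bar> * \<bar>r\<bar> \<le> 1 * \<bar>r\<bar>" by (rule mult_right_mono) simp
        then show ?thesis by (simp add: abs_mult[symmetric] left_diff_distrib)
      qed
      have b4: "\<bar>real (n2 n) * r' - (1 - l) * real n * r'\<bar> \<le> \<bar>r'\<bar>"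
      proof -
        have "\<bar>real (n2 n) - (1 - l) * real n\<bar> \<le> 1" using n2[of n] by linarith
        then have "\<bar>real (n2 n) - (1 - l) * real n\<bar> * \<bar>r'\<bar> \<le> 1 * \<bar>r'\<bar>" by (rule mult_right_mono) simp
        then show ?thesis by (simp add: abs_mult[symmetric] left_diff_distrib)
      qed
      have sum: "\<eta> * real (n1 n) + \<eta> * real (n2 n) = \<eta> * real n"
        using n12[of n] by (metis distrib_left of_nat_add)
      have "\<eta> * real n \<le> \<delta> / 2 * real n" using \<eta>\<delta> rn \<delta> by (intro mult_right_mono) auto
      then have "\<bar>a + a' - (l * real n * r + (1 - l) * real n * r')\<bar> \<le> \<delta> * real n"
        using b1 b2 b3 b4 a(3) sum Bn by linarith
      moreover have "(a + a') / real n - (l * r + (1 - l) * r') = (a + a' - (l * real n * r + (1 - l) * real n * r')) / real n"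
        using rn by (simp add: field_simps)
      ultimately show ?thesis using rn by (simp add: pos_divide_le_eq)
    qed
    have "\<bar>ln (real (N1 * N1')) / real n - (l * R1 + (1 - l) * R1')\<bar> \<le> \<delta>"
      "\<bar>ln (real (N2 * N2')) / real n - (l * R2 + (1 - l) * R2')\<bar> \<le> \<delta>"
      using rate[OF N(2) N'(2)] rate[OF N(3) N'(3)] Npos unfolding B_def by (simp_all add: ln_mult)
    with sc show ?case by blast
  qed
qed

lemma ach_convex: "convex {(R1, R2). ach b W R1 R2}"
proof (rule convexI)
  fix x y :: "real \<times> real" and u v :: real
  assume x: "x \<in> {(R1, R2). ach b W R1 R2}" and y: "y \<in> {(R1, R2). ach b W R1 R2}" and uv: "0 \<le> u" "0 \<le> v" "u + v = 1"
  show "u *\<^sub>R x + v *\<^sub>R y \<in> {(R1, R2). ach b W R1 R2}"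
  proof (cases "u = 0 \<or> v = 0")
    case True
    then show ?thesis using x y uv by auto
  next
    case False
    have v: "v = 1 - u" using uv by simp
    have "ach b W (fst x) (snd x)" "ach b W (fst y) (snd y)" using x y by (auto simp: case_prod_unfold)
    from ach_time_sharing[OF this, of u] show ?thesis using uv False unfolding v by (simp add: case_prod_unfold)
  qed
qed

section \<open>Information inequalities\<close>

lemma mean_dens_commute: "mean_dens p X Y = mean_dens p Y X"
  unfolding mean_dens_def by (simp add: dens_commute[of p X Y])

lemma mean_dens_map: "mean_dens (map_pmf h p) X Y = mean_dens p (\<lambda>w. X (h w)) (\<lambda>w. Y (h w))"
  unfolding mean_dens_def by (simp add: dens_map_pmf o_def)

lemma mutual_info_mean_dens:
  fixes X :: "'w \<Rightarrow> 'a::countable" and Y :: "'w \<Rightarrow> 'b::countable"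
  shows "mutual_info p X Y = mean_dens p X Y"
  unfolding mean_dens_def by (rule mutual_info_dens)

lemma pmf_map_reindex:
  assumes "inj h" "\<And>w. X w = h (Y w)" "x = h y"
  shows "pmf (map_pmf X p) x = pmf (map_pmf Y p) y"
proof -
  have "map_pmf X p = map_pmf h (map_pmf Y p)" unfolding map_pmf_comp using assms(2) by (intro map_pmf_cong refl)
  then show ?thesis using pmf_map_inj'[OF assms(1)] assms(3) by simp
qed

text \<open>Both sides equal p(x,y,z) / (p(x) p(y) p(z)); on the left this uses that
  \<open>Y\<close> and \<open>Z\<close> are independent.\<close>

lemma dens_chain:
  assumes indep: "map_pmf (\<lambda>w. (Y w, Z w)) p = pair_pmf (map_pmf Y p) (map_pmf Z p)" and w: "w \<in> set_pmf p"
  shows "dens p X (\<lambda>w. (Y w, Z w)) w = dens p X Z w * dens p Y (\<lambda>w. (Z w, X w)) w"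
proof -
  have 1: "pmf (map_pmf (\<lambda>w. (Y w, (Z w, X w))) p) (Y w, (Z w, X w)) = pmf (map_pmf (\<lambda>w. (X w, (Y w, Z w))) p) (X w, (Y w, Z w))"
    by (rule pmf_map_reindex[where h="\<lambda>(x, (y, z)). (y, (z, x))"]) (auto simp: inj_def)
  have 2: "pmf (map_pmf (\<lambda>w. (Z w, X w)) p) (Z w, X w) = pmf (map_pmf (\<lambda>w. (X w, Z w)) p) (X w, Z w)"
    by (rule pmf_map_reindex[where h="\<lambda>(x, z). (z, x)"]) (auto simp: inj_def)
  have pos: "pmf (map_pmf (\<lambda>w. (X w, Z w)) p) (X w, Z w) \<noteq> 0"
    using w by (simp add: set_pmf_iff[symmetric])
  show ?thesis unfolding dens_def 1 2 indep using pos by (simp add: pmf_pair)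
qed

lemma E_ln_mult:
  assumes "finite (set_pmf p)" "\<And>w. w \<in> set_pmf p \<Longrightarrow> f w = g w * h w" "\<And>w. w \<in> set_pmf p \<Longrightarrow> 0 < g w"
     "\<And>w. w \<in> set_pmf p \<Longrightarrow> 0 < h w"
  shows "E p (\<lambda>w. ln (f w)) = E p (\<lambda>w. ln (g w)) + E p (\<lambda>w. ln (h w))"
proof -
  have "E p (\<lambda>w. ln (f w)) = E p (\<lambda>w. ln (g w) + ln (h w))"
    by (rule E_cong) (simp add: assms(2) ln_mult_pos assms(3,4))
  then show ?thesis by (simp add: E_add assms(1))
qed

lemma mean_dens_chain:
  assumes "finite (set_pmf p)" "map_pmf (\<lambda>w. (Y w, Z w)) p = pair_pmf (map_pmf Y p) (map_pmf Z p)"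
  shows "mean_dens p X (\<lambda>w. (Y w, Z w)) = mean_dens p X Z + mean_dens p Y (\<lambda>w. (Z w, X w))"
  unfolding mean_dens_def by (rule E_ln_mult[OF assms(1) dens_chain[OF assms(2)]]) (auto intro: dens_pos)

text \<open>For \<open>Y\<close> independent of \<open>Z\<close>, the information I(X;Y|Z) is the
  one between \<open>Y\<close> and the pair (Z, X). The receiver's own input can thus be counted as
  part of its observation, and the sender's codebook need not be conditioned on it.\<close>

lemma cond_mutual_info_mean_dens:
  fixes X :: "'w \<Rightarrow> 'a::countable" and Y :: "'w \<Rightarrow> 'b::countable" and Z :: "'w \<Rightarrow> 'c::countable"
  assumes "finite (set_pmf p)" "map_pmf (\<lambda>w. (Y w, Z w)) p = pair_pmf (map_pmf Y p) (map_pmf Z p)"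
  shows "cond_mutual_info p X Y Z = mean_dens p Y (\<lambda>w. (Z w, X w))"
  using mean_dens_chain[OF assms, of X] unfolding cond_mutual_info_dens mean_dens_def by simp

lemma sum_pmf_pair_le:
  assumes "finite S"
  shows "(\<Sum>v\<in>S. pmf (map_pmf (\<lambda>w. (V w, Z w)) p) (v, z)) \<le> pmf (map_pmf Z p) z"
proof -
  have "(\<Sum>v\<in>S. pmf (map_pmf (\<lambda>w. (V w, Z w)) p) (v, z)) = measure_pmf.prob (map_pmf (\<lambda>w. (V w, Z w)) p) (S \<times> {z})"
    using assms by (simp add: measure_measure_pmf_finite sum.cartesian_product' del: measure_map_pmf)
  also have "\<dots> \<le> measure_pmf.prob (map_pmf (\<lambda>w. (V w, Z w)) p) (snd -` {z})"
    by (rule measure_pmf.finite_measure_mono) auto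
  also have "\<dots> = pmf (map_pmf Z p) z" by (simp add: pmf_map vimage_def)
  finally show ?thesis .
qed

text \<open>Data processing along a Markov chain \<open>X - Y - Z\<close>, from \<open>ln u \<le> u - 1\<close> applied to the ratio of the two densities.\<close>

lemma mean_dens_markov:
  assumes fin: "finite (set_pmf p)"
    and markov: "\<And>w. w \<in> set_pmf p \<Longrightarrow> pmf (map_pmf (\<lambda>w. (X w, Y w, Z w)) p) (X w, Y w, Z w) * pmf (map_pmf Y p) (Y w) =
       pmf (map_pmf (\<lambda>w. (X w, Y w)) p) (X w, Y w) * pmf (map_pmf (\<lambda>w. (Y w, Z w)) p) (Y w, Z w)"
  shows "mean_dens p X Z \<le> mean_dens p X Y"
proof -
  define T where "T = (\<lambda>w. (X w, Y w, Z w))"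
  define P where "P = map_pmf T p"
  define pxy where "pxy x y = pmf (map_pmf (\<lambda>w. (X w, Y w)) p) (x, y)" for x y
  define pxz where "pxz x z = pmf (map_pmf (\<lambda>w. (X w, Z w)) p) (x, z)" for x z
  define pyz where "pyz y z = pmf (map_pmf (\<lambda>w. (Y w, Z w)) p) (y, z)" for y z
  define px where "px x = pmf (map_pmf X p) x" for x
  define py where "py y = pmf (map_pmf Y p) y" for y
  define pz where "pz z = pmf (map_pmf Z p) z" for z
  have pos: "0 < px (X w)" "0 < py (Y w)" "0 < pz (Z w)" "0 < pxy (X w) (Y w)" "0 < pxz (X w) (Z w)" "0 < pmf P (T w)"
    if "w \<in> set_pmf p" for w
    unfolding px_def py_def pz_def pxy_def pxz_def P_def using that by (auto intro!: pmf_positive simp: T_def)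
  define h where "h = (\<lambda>(x, y, z). pxz x z * py y / (pz z * pxy x y))"
  have ratio: "dens p X Z w / dens p X Y w = h (T w)" if "w \<in> set_pmf p" for w
    using pos[OF that] unfolding dens_def h_def T_def px_def py_def pz_def pxy_def pxz_def by (simp add: field_simps)
  have "mean_dens p X Z - mean_dens p X Y = E p (\<lambda>w. ln (dens p X Z w) - ln (dens p X Y w))"
    unfolding mean_dens_def by (simp add: E_diff fin)
  also have "\<dots> \<le> E p (\<lambda>w. h (T w) - 1)"
  proof (rule E_mono[OF fin])
    fix w assume w: "w \<in> set_pmf p"
    have d: "0 < dens p X Z w" "0 < dens p X Y w" using w by (auto intro: dens_pos)
    then have "ln (dens p X Z w) - ln (dens p X Y w) = ln (dens p X Z w / dens p X Y w)" by (simp add: ln_div)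
    also have "\<dots> \<le> dens p X Z w / dens p X Y w - 1" using d by (intro ln_le_minus_one) auto
    finally show "ln (dens p X Z w) - ln (dens p X Y w) \<le> h (T w) - 1" using ratio[OF w] by simp
  qed
  also have "\<dots> = E P h - 1" unfolding P_def by (simp add: E_diff fin)
  \<comment> \<open>By the Markov property each summand becomes p(x,z) p(y,z) / p(z). Enlarging the
    support to a product set decouples x from y, and what is left sums to at most the total mass of
    \<open>Z\<close>.\<close>
  also have "E P h \<le> 1"
  proof -
    define SX where "SX = X ` set_pmf p" define SY where "SY = Y ` set_pmf p" define SZ where "SZ = Z ` set_pmf p"
    have finS: "finite SX" "finite SY" "finite SZ" unfolding SX_def SY_def SZ_def using fin by auto
    have sub: "set_pmf P \<subseteq> SX \<times> SY \<times> SZ" unfolding P_def T_def SX_def SY_def SZ_def by auto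
    have "E P h = (\<Sum>t\<in>set_pmf P. h t * pmf P t)"
      by (rule integral_measure_pmf_real) (use fin in \<open>auto simp: P_def\<close>)
    also have "\<dots> \<le> (\<Sum>t\<in>set_pmf P. case t of (x, y, z) \<Rightarrow> pxz x z * pyz y z / pz z)"
    proof (rule sum_mono)
      fix t assume "t \<in> set_pmf P"
      then obtain w where w: "w \<in> set_pmf p" and t: "t = T w" unfolding P_def by auto
      have "pmf P (T w) * py (Y w) = pxy (X w) (Y w) * pyz (Y w) (Z w)"
        using markov[OF w] unfolding P_def T_def py_def pxy_def pyz_def .
      then show "h t * pmf P t \<le> (case t of (x, y, z) \<Rightarrow> pxz x z * pyz y z / pz z)"
        using pos[OF w] unfolding t h_def T_def by (simp add: field_simps)
    qed
    also have "\<dots> \<le> (\<Sum>t\<in>SX \<times> SY \<times> SZ. case t of (x, y, z) \<Rightarrow> pxz x z * pyz y z / pz z)"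
      using sub finS by (intro sum_mono2) (auto simp: pxz_def pyz_def pz_def)
    also have "\<dots> = (\<Sum>z\<in>SZ. (\<Sum>x\<in>SX. pxz x z) * (\<Sum>y\<in>SY. pyz y z) / pz z)"
    proof -
      have "(\<Sum>t\<in>SX \<times> SY \<times> SZ. case t of (x, y, z) \<Rightarrow> pxz x z * pyz y z / pz z) = (\<Sum>x\<in>SX. \<Sum>y\<in>SY. \<Sum>z\<in>SZ. pxz x z * pyz y z / pz z)"
        by (simp only: sum.cartesian_product)
      also have "\<dots> = (\<Sum>z\<in>SZ. \<Sum>x\<in>SX. \<Sum>y\<in>SY. pxz x z * pyz y z / pz z)"
        by (simp only: sum.swap[of _ SZ SX] sum.swap[of _ SZ SY])
      finally show ?thesis by (simp add: sum_product sum_divide_distrib)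
    qed
    also have "\<dots> \<le> (\<Sum>z\<in>SZ. pz z)"
    proof (rule sum_mono)
      fix z assume "z \<in> SZ"
      then have z: "0 < pz z" using pos unfolding SZ_def by auto
      have "(\<Sum>x\<in>SX. pxz x z) * (\<Sum>y\<in>SY. pyz y z) \<le> pz z * pz z"
        unfolding pxz_def pyz_def using finS z unfolding pz_def by (intro mult_mono sum_pmf_pair_le) (auto simp: sum_nonneg)
      then show "(\<Sum>x\<in>SX. pxz x z) * (\<Sum>y\<in>SY. pyz y z) / pz z \<le> pz z" using z by (simp add: pos_divide_le_eq)
    qed
    also have "\<dots> = 1" unfolding pz_def SZ_def using fin by (intro sum_pmf_eq_1) auto
    finally show ?thesis .
  qed
  finally show ?thesis by simp
qed

lemma mean_dens_function:
  assumes "finite (set_pmf p)" "\<And>w. Z w = f (Y w)"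
  shows "mean_dens p X Z \<le> mean_dens p X Y"
proof (rule mean_dens_markov[OF assms(1)])
  fix w
  have 1: "pmf (map_pmf (\<lambda>w. (X w, Y w, Z w)) p) (X w, Y w, Z w) = pmf (map_pmf (\<lambda>w. (X w, Y w)) p) (X w, Y w)"
    by (rule pmf_map_reindex[where h="\<lambda>(x, y). (x, y, f y)"]) (auto simp: inj_def assms(2))
  have 2: "pmf (map_pmf (\<lambda>w. (Y w, Z w)) p) (Y w, Z w) = pmf (map_pmf Y p) (Y w)"
    by (rule pmf_map_reindex[where h="\<lambda>y. (y, f y)"]) (auto simp: inj_def assms(2))
  show "pmf (map_pmf (\<lambda>w. (X w, Y w, Z w)) p) (X w, Y w, Z w) * pmf (map_pmf Y p) (Y w) =
       pmf (map_pmf (\<lambda>w. (X w, Y w)) p) (X w, Y w) * pmf (map_pmf (\<lambda>w. (Y w, Z w)) p) (Y w, Z w)"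
    unfolding 1 2 ..
qed

text \<open>A constant observation carries no information, and it is a function of every other
  observation.\<close>

lemma mean_dens_nonneg: "finite (set_pmf p) \<Longrightarrow> 0 \<le> mean_dens p X Y"
proof -
  assume fin: "finite (set_pmf p)"
  have "mean_dens p X (\<lambda>_. ()) = 0"
  proof -
    have "ln (dens p X (\<lambda>_. ()) w) = 0" if w: "w \<in> set_pmf p" for w
    proof -
      have "pmf (map_pmf (\<lambda>w. (X w, ())) p) (X w, ()) = pmf (map_pmf X p) (X w)"
        by (rule pmf_map_reindex[where h="\<lambda>x. (x, ())"]) (auto simp: inj_def)
      moreover have "pmf (map_pmf X p) (X w) \<noteq> 0" using w by (simp add: set_pmf_iff[symmetric])
      ultimately have "dens p X (\<lambda>_. ()) w = 1" unfolding dens_def by simp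
      then show ?thesis by simp
    qed
    then have "mean_dens p X (\<lambda>_. ()) = E p (\<lambda>_. 0)" unfolding mean_dens_def by (intro E_cong) auto
    then show ?thesis by simp
  qed
  then show ?thesis using mean_dens_function[OF fin, of "\<lambda>_. ()" "\<lambda>_. ()" Y X] by simp
qed

section \<open>The single-letter law\<close>

abbreviation lx1 where "lx1 \<equiv> (\<lambda>(v1, v2, x1, x2, y1, y2, z). x1)"
abbreviation lx2 where "lx2 \<equiv> (\<lambda>(v1, v2, x1, x2, y1, y2, z). x2)"

text \<open>The first two independences turn \<open>A1\<close> and \<open>A2\<close> into
  unconditional informations; the third gives the chain rule behind \<open>B12\<close>.\<close>

lemma letter_law_indep:
  fixes p1 p2 :: "nat pmf" and X1 :: "nat \<Rightarrow> 'x1 pmf" and X2 :: "nat \<Rightarrow> 'x2 pmf" and W :: "('x1,'x2,'y1,'y2,'z) channel"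
  defines "J \<equiv> letter_law p1 p2 X1 X2 W"
  shows "map_pmf (\<lambda>w. (lv1 w, lx2 w)) J = pair_pmf (map_pmf lv1 J) (map_pmf lx2 J)"
    and "map_pmf (\<lambda>w. (lv2 w, lx1 w)) J = pair_pmf (map_pmf lv2 J) (map_pmf lx1 J)"
    and "map_pmf (\<lambda>w. (lv2 w, lv1 w)) J = pair_pmf (map_pmf lv2 J) (map_pmf lv1 J)"
proof -
  have J: "map_pmf f J = bind_pmf p1 (\<lambda>a. bind_pmf p2 (\<lambda>b. bind_pmf (X1 a) (\<lambda>x1. bind_pmf (X2 b) (\<lambda>x2.
     map_pmf (\<lambda>(y1, y2, z). f (a, b, x1, x2, y1, y2, z)) (W x1 x2)))))" for f :: "_ \<Rightarrow> 'q"
    unfolding J_def letter_law_def by (simp add: map_bind_pmf map_pmf_comp case_prod_unfold)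
  have v1: "map_pmf lv1 J = p1" and v2: "map_pmf lv2 J = p2" and x1: "map_pmf lx1 J = bind_pmf p1 X1" and x2: "map_pmf lx2 J = bind_pmf p2 X2"
    unfolding J_def letter_law_def by (simp_all add: map_bind_pmf map_pmf_comp case_prod_unfold bind_return_pmf')
  show "map_pmf (\<lambda>w. (lv1 w, lx2 w)) J = pair_pmf (map_pmf lv1 J) (map_pmf lx2 J)"
    unfolding v1 x2 unfolding J_def letter_law_def pair_pmf_def by (simp add: map_bind_pmf map_pmf_comp case_prod_unfold bind_assoc_pmf)
  show "map_pmf (\<lambda>w. (lv2 w, lx1 w)) J = pair_pmf (map_pmf lv2 J) (map_pmf lx1 J)"
    unfolding v2 x1 unfolding J_def letter_law_def pair_pmf_def
    by (simp add: map_bind_pmf map_pmf_comp case_prod_unfold bind_assoc_pmf bind_commute_pmf[of p1 p2])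
  show "map_pmf (\<lambda>w. (lv2 w, lv1 w)) J = pair_pmf (map_pmf lv2 J) (map_pmf lv1 J)"
    unfolding v1 v2 unfolding J_def letter_law_def pair_pmf_def
    by (simp add: map_bind_pmf map_pmf_comp case_prod_unfold bind_assoc_pmf bind_commute_pmf[of p1 p2])
qed

text \<open>Given X2, the triple (X1, Y1, Y2) is generated by \<open>T\<close> without reference to
  V2, so V2, (X2, Y2), (X1, Y1) form a Markov chain. User 2 can therefore recover its own index at
  every rate at which user 1 can.\<close>

lemma letter_law_markov:
  fixes p1 p2 :: "nat pmf" and X1 :: "nat \<Rightarrow> 'x1 pmf" and X2 :: "nat \<Rightarrow> 'x2 pmf" and W :: "('x1,'x2,'y1,'y2,'z) channel"
  assumes fin: "finite (set_pmf (letter_law p1 p2 X1 X2 W))"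
  defines "J \<equiv> letter_law p1 p2 X1 X2 W"
  shows "mean_dens J lv2 lo1 \<le> mean_dens J lv2 lo2"
proof (rule mean_dens_markov)
  show "finite (set_pmf J)" unfolding J_def by (rule fin)
  define q where "q = bind_pmf p2 (\<lambda>b. map_pmf (Pair b) (X2 b))"
  define T where "T x2 = bind_pmf p1 (\<lambda>a. bind_pmf (X1 a) (\<lambda>x1. map_pmf (\<lambda>(y1, y2, z). (y2, (x1, y1))) (W x1 x2)))" for x2
  have law: "map_pmf (\<lambda>(a, b, x1, x2, y1, y2, z). ((b, x2), (y2, (x1, y1)))) J = bind_pmf q (\<lambda>c. map_pmf (Pair c) (T (snd c)))"
    unfolding J_def letter_law_def q_def T_def
    by (simp add: map_bind_pmf bind_map_pmf bind_assoc_pmf map_pmf_comp case_prod_unfold bind_commute_pmf[of p1 p2]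
        bind_commute_pmf[of "X1 a" "X2 b" for a b] bind_commute_pmf[of p1 "X2 b" for b])
  have law1: "map_pmf (\<lambda>(a, b, x1, x2, y1, y2, z). ((b, x2), y2)) J = bind_pmf q (\<lambda>c. map_pmf (Pair c) (map_pmf fst (T (snd c))))"
    using arg_cong[OF law, of "map_pmf (\<lambda>(c, (y, o1)). (c, y))"] by (simp add: map_pmf_comp map_bind_pmf case_prod_unfold)
  have law2: "map_pmf (\<lambda>(a, b, x1, x2, y1, y2, z). (x2, (y2, (x1, y1)))) J = bind_pmf (map_pmf snd q) (\<lambda>c. map_pmf (Pair c) (T c))"
    using arg_cong[OF law, of "map_pmf (\<lambda>((b, x), r). (x, r))"] by (simp add: map_pmf_comp map_bind_pmf bind_map_pmf case_prod_unfold)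
  have law3: "map_pmf lo2 J = bind_pmf (map_pmf snd q) (\<lambda>c. map_pmf (Pair c) (map_pmf fst (T c)))"
    using arg_cong[OF law, of "map_pmf (\<lambda>((b, x), (y, o1)). (x, y))"] by (simp add: map_pmf_comp map_bind_pmf bind_map_pmf case_prod_unfold)
  fix w assume "w \<in> set_pmf J"
  obtain a b x1 x2 y1 y2 z where w: "w = (a, b, x1, x2, y1, y2, z)" by (cases w)
  have 1: "pmf (map_pmf (\<lambda>w. (lv2 w, lo2 w, lo1 w)) J) (lv2 w, lo2 w, lo1 w) = pmf q (b, x2) * pmf (T x2) (y2, (x1, y1))"
  proof -
    have "pmf (map_pmf (\<lambda>w. (lv2 w, lo2 w, lo1 w)) J) (lv2 w, lo2 w, lo1 w) =
      pmf (map_pmf (\<lambda>(a, b, x1, x2, y1, y2, z). ((b, x2), (y2, (x1, y1)))) J) ((b, x2), (y2, (x1, y1)))"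
      by (rule pmf_map_reindex[where h="\<lambda>((b, x2), (y2, o1)). (b, (x2, y2), o1)"]) (auto simp: inj_def w)
    then show ?thesis unfolding law pmf_bind_Pair by simp
  qed
  have 2: "pmf (map_pmf (\<lambda>w. (lv2 w, lo2 w)) J) (lv2 w, lo2 w) = pmf q (b, x2) * pmf (map_pmf fst (T x2)) y2"
  proof -
    have "pmf (map_pmf (\<lambda>w. (lv2 w, lo2 w)) J) (lv2 w, lo2 w) =
      pmf (map_pmf (\<lambda>(a, b, x1, x2, y1, y2, z). ((b, x2), y2)) J) ((b, x2), y2)"
      by (rule pmf_map_reindex[where h="\<lambda>((b, x2), y2). (b, (x2, y2))"]) (auto simp: inj_def w)
    then show ?thesis unfolding law1 pmf_bind_Pair by simp
  qed
  have 3: "pmf (map_pmf (\<lambda>w. (lo2 w, lo1 w)) J) (lo2 w, lo1 w) = pmf (map_pmf snd q) x2 * pmf (T x2) (y2, (x1, y1))"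
  proof -
    have "pmf (map_pmf (\<lambda>w. (lo2 w, lo1 w)) J) (lo2 w, lo1 w) =
      pmf (map_pmf (\<lambda>(a, b, x1, x2, y1, y2, z). (x2, (y2, (x1, y1)))) J) (x2, (y2, (x1, y1)))"
      by (rule pmf_map_reindex[where h="\<lambda>(x2, (y2, o1)). ((x2, y2), o1)"]) (auto simp: inj_def w)
    then show ?thesis unfolding law2 pmf_bind_Pair .
  qed
  have 4: "pmf (map_pmf lo2 J) (lo2 w) = pmf (map_pmf snd q) x2 * pmf (map_pmf fst (T x2)) y2"
    unfolding law3 w by (simp add: pmf_bind_Pair)
  show "pmf (map_pmf (\<lambda>w. (lv2 w, lo2 w, lo1 w)) J) (lv2 w, lo2 w, lo1 w) * pmf (map_pmf lo2 J) (lo2 w) =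
       pmf (map_pmf (\<lambda>w. (lv2 w, lo2 w)) J) (lv2 w, lo2 w) * pmf (map_pmf (\<lambda>w. (lo2 w, lo1 w)) J) (lo2 w, lo1 w)"
    unfolding 1 2 3 4 by (simp only: ac_simps)
qed

text \<open>Independence of V1 and V2 removes the conditioning from the chain rule. The first two
  claims together yield \<open>B1 + B2 \<le> B12\<close>, on which the choice of the user who sends
  the key rests.\<close>

lemma leak_chain:
  fixes p1 p2 :: "nat pmf" and X1 :: "nat \<Rightarrow> 'x1 pmf" and X2 :: "nat \<Rightarrow> 'x2 pmf" and W :: "('x1,'x2,'y1,'y2,'z) channel"
  assumes fin: "finite (set_pmf (letter_law p1 p2 X1 X2 W))"
  defines "J \<equiv> letter_law p1 p2 X1 X2 W"
  shows "mean_dens J lv12 lz = mean_dens J lv1 lz + mean_dens J lv2 lv1z"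
    and "mean_dens J lv2 lz \<le> mean_dens J lv2 lv1z" and "0 \<le> mean_dens J lv1 lz" and "0 \<le> mean_dens J lv2 lz"
proof -
  have finJ: "finite (set_pmf J)" unfolding J_def by (rule fin)
  have "mean_dens J lz (\<lambda>w. (lv2 w, lv1 w)) = mean_dens J lz lv1 + mean_dens J lv2 (\<lambda>w. (lv1 w, lz w))"
    by (rule mean_dens_chain[OF finJ]) (unfold J_def, rule letter_law_indep)
  moreover have "(\<lambda>w. (lv1 w, lz w)) = lv1z" by (auto simp: fun_eq_iff)
  moreover have "mean_dens J lz (\<lambda>w. (lv2 w, lv1 w)) = mean_dens J lv12 lz"
  proof -
    have swap: "(\<lambda>w. (lv2 w, lv1 w)) = (\<lambda>w. prod.swap (lv12 w))" by (auto simp: fun_eq_iff)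
    have "dens J lz (\<lambda>w. (lv2 w, lv1 w)) w = dens J lv12 lz w" for w
      unfolding swap dens_commute[of J lv12] by (rule dens_inj_right[OF inj_swap])
    then show ?thesis unfolding mean_dens_def by presburger
  qed
  ultimately show "mean_dens J lv12 lz = mean_dens J lv1 lz + mean_dens J lv2 lv1z"
    by (metis mean_dens_commute)
  show "mean_dens J lv2 lz \<le> mean_dens J lv2 lv1z"
    by (rule mean_dens_function[OF finJ, where f=snd]) auto
  show "0 \<le> mean_dens J lv1 lz" "0 \<le> mean_dens J lv2 lz" by (rule mean_dens_nonneg[OF finJ])+
qed

section \<open>Achievability of the interior\<close>

context
  fixes p1 p2 :: "nat pmf" and X1 :: "nat \<Rightarrow> 'x1::finite pmf" and X2 :: "nat \<Rightarrow> 'x2::finite pmf"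
    and W :: "('x1,'x2,'y1::finite,'y2::finite,'z::finite) channel"
  assumes fin: "finite (set_pmf p1)" "finite (set_pmf p2)"
begin

private abbreviation "J \<equiv> letter_law p1 p2 X1 X2 W"
private abbreviation "a1 \<equiv> mean_dens J lv1 lo2"
private abbreviation "a2 \<equiv> mean_dens J lv2 lo1"
private abbreviation "b1 \<equiv> mean_dens J lv1 lz"
private abbreviation "b2 \<equiv> mean_dens J lv2 lz"
private abbreviation "b12 \<equiv> mean_dens J lv12 lz"

text \<open>Subtracting the chain rule for \<open>b12\<close>, the assumption
  \<open>a1 \<le> b1\<close> turns the sum-rate condition into R1 + R2 < a2 - I(V2;V1,Z). User 2
  thus has room for its message, for a key of rate \<open>R1\<close> that encrypts all of user 1's
  message, and for the randomness that covers given user 1's codeword.\<close>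

lemma ach_interior_public:
  assumes R: "0 < R1" "0 < R2" "R1 < a1" "R1 + R2 < a1 + a2 - b12" and le: "a1 \<le> b1"
  shows "ach True W R1 R2"
proof -
  have finJ: "finite (set_pmf J)" by (rule finite_letter_law[OF fin])
  note leak = leak_chain[OF finJ]
  define d2 where "d2 = (mean_dens J lv2 lv1z + (a2 - R1 - R2)) / 2"
  have d2: "mean_dens J lv2 lv1z < d2" "d2 < a2 - R1 - R2" unfolding d2_def using R le leak(1) by argo+
  obtain \<epsilon> where \<epsilon>: "decays \<epsilon>" "\<And>n. scode True W n (fl n 0) (fl n R1) (fl n R2) (fl n R1) (\<epsilon> n)"
    using random_code_rates_public[OF fin, of R1 R2 d2 X1 X2 W] R d2 leak(2-4) letter_law_markov[OF finJ] by fastforce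
  from ach_block_markov[OF _ _ _ \<epsilon>] R show ?thesis by simp
qed

text \<open>Local randomness will fill the total rates almost up to \<open>a1\<close> and
  \<open>a2\<close>. The lower bound on \<open>k\<close> then keeps slot plus local randomness of
  user 1 above \<open>b1\<close>, and the upper bound keeps the local randomness of user 2 above
  \<open>b2\<close>; \<open>k < R1\<close> leaves a private part of the message.\<close>

lemma key_rate_exists:
  assumes "0 < R1" "R1 < a1" "R2 < a2 - b2" "R1 + R2 < a1 + a2 - b1 - b2" "b1 < a1"
  obtains k where "0 < k" "R1 - a1 + b1 < k" "k < R1" "k < a2 - b2 - R2"
proof
  define k where "k = (max 0 (R1 - a1 + b1) + min R1 (a2 - b2 - R2)) / 2"
  show "0 < k" "R1 - a1 + b1 < k" "k < R1" "k < a2 - b2 - R2"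
    using assms unfolding k_def by argo+
qed

lemma ach_interior_joint:
  assumes R: "0 < R1" "0 < R2" "R1 < a1" "R1 + R2 < a1 + a2 - b12" "R2 < a2 - b2" and gt: "b1 < a1"
  shows "ach True W R1 R2"
proof -
  have finJ: "finite (set_pmf J)" by (rule finite_letter_law[OF fin])
  note leak = leak_chain[OF finJ]
  obtain k where k: "0 < k" "R1 - a1 + b1 < k" "k < R1" "k < a2 - b2 - R2"
    by (rule key_rate_exists[of R1 R2]) (use R gt leak in linarith)+
  \<comment> \<open>Local randomness fills the total rates up to \<open>a1 - \<eta>\<close> and
    \<open>a2 - \<eta>\<close>. The key rate cancels: k + d1 + d2 = a1 + a2 - R1 - R2 - 2 \<eta>,
    which stays above \<open>b12\<close>.\<close>
  define \<eta> where "\<eta> = min (min (a1 - b1 + k - R1) (a2 - b2 - R2 - k)) (min ((a1 + a2 - b12 - R1 - R2) / 2) (a1 - R1)) / 2"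
  have \<eta>: "0 < \<eta>" "\<eta> < a1 - b1 + k - R1" "\<eta> < a2 - b2 - R2 - k" "2 * \<eta> < a1 + a2 - b12 - R1 - R2" "\<eta> < a1 - R1"
    unfolding \<eta>_def using R k gt by argo+
  obtain \<epsilon> where \<epsilon>: "decays \<epsilon>" "\<And>n. scode True W n (fl n (R1 - k)) (fl n k) (fl n R2) (fl n k) (\<epsilon> n)"
    using random_code_rates[OF fin, of "R1 - k" k "a1 - \<eta> - R1" R2 "a2 - \<eta> - R2 - k" X1 X2 W True]
      R k \<eta> leak(2-4) letter_law_markov[OF finJ] by fastforce
  from ach_block_markov[OF _ _ _ \<epsilon>] R k show ?thesis by simp
qed

lemma ach_interior_individual:
  assumes R: "0 < R1" "0 < R2" "R1 < a1" "R1 < a1 + a2 - b12" "R2 < a1 + a2 - b12" "R2 < a2 - b2"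
      "R1 + R2 < a1 + a2 - b1 - b2" and gt: "b1 < a1"
  shows "ach False W R1 R2"
proof -
  have finJ: "finite (set_pmf J)" by (rule finite_letter_law[OF fin])
  note leak = leak_chain[OF finJ]
  obtain k where k: "0 < k" "R1 - a1 + b1 < k" "k < R1" "k < a2 - b2 - R2"
    by (rule key_rate_exists[of R1 R2]) (use R gt leak in linarith)+
  \<comment> \<open>For the key view the message of user 2 counts as randomness: k + d1 + s2 + d2 =
    a1 + a2 - R1 - 2 \<eta>. For the message view the sum is s1 + k + d1 + k + d2 = a1 + a2 - R2 - 2
    \<eta>. Each bound of a single rate by a1 + a2 - b12 thus belongs to one view.\<close>
  define \<eta> where "\<eta> = min (min (a1 - b1 + k - R1) (a2 - b2 - R2 - k))
     (min (min ((a1 + a2 - b12 - R1) / 2) ((a1 + a2 - b12 - R2) / 2)) (a1 - R1)) / 2"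
  have \<eta>: "0 < \<eta>" "\<eta> < a1 - b1 + k - R1" "\<eta> < a2 - b2 - R2 - k" "2 * \<eta> < a1 + a2 - b12 - R1" "2 * \<eta> < a1 + a2 - b12 - R2" "\<eta> < a1 - R1"
    unfolding \<eta>_def using R k gt by argo+
  obtain \<epsilon> where \<epsilon>: "decays \<epsilon>" "\<And>n. scode False W n (fl n (R1 - k)) (fl n k) (fl n R2) (fl n k) (\<epsilon> n)"
    using random_code_rates[OF fin, of "R1 - k" k "a1 - \<eta> - R1" R2 "a2 - \<eta> - R2 - k" X1 X2 W False]
      R k \<eta> leak(2-4) letter_law_markov[OF finJ] by fastforce
  from ach_block_markov[OF _ _ _ \<epsilon>] R k show ?thesis by simp
qed

end

lemma letter_law_swap:
  "letter_law p2 p1 X2 X1 (swap_channel W) = map_pmf (\<lambda>(v1, v2, x1, x2, y1, y2, z). (v2, v1, x2, x1, y2, y1, z)) (letter_law p1 p2 X1 X2 W)"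
  unfolding letter_law_def swap_channel_def
  by (simp add: map_bind_pmf map_pmf_comp case_prod_unfold bind_commute_pmf[of p2 p1] bind_commute_pmf[of "X2 b" "X1 a" for a b])

lemma mean_dens_swap:
  fixes p1 p2 :: "nat pmf" and X1 :: "nat \<Rightarrow> 'x1 pmf" and X2 :: "nat \<Rightarrow> 'x2 pmf" and W :: "('x1,'x2,'y1,'y2,'z) channel"
  defines "J \<equiv> letter_law p1 p2 X1 X2 W" and "J' \<equiv> letter_law p2 p1 X2 X1 (swap_channel W)"
  shows "mean_dens J' lv1 lo2 = mean_dens J lv2 lo1" "mean_dens J' lv2 lo1 = mean_dens J lv1 lo2"
    "mean_dens J' lv1 lz = mean_dens J lv2 lz" "mean_dens J' lv2 lz = mean_dens J lv1 lz" "mean_dens J' lv12 lz = mean_dens J lv12 lz"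
proof -
  show "mean_dens J' lv1 lo2 = mean_dens J lv2 lo1" "mean_dens J' lv2 lo1 = mean_dens J lv1 lo2"
    "mean_dens J' lv1 lz = mean_dens J lv2 lz" "mean_dens J' lv2 lz = mean_dens J lv1 lz"
    unfolding J'_def J_def letter_law_swap mean_dens_map by (simp_all add: case_prod_unfold)
  have "mean_dens J' lv12 lz = mean_dens J (\<lambda>w. prod.swap (lv12 w)) lz"
    unfolding J'_def J_def letter_law_swap mean_dens_map by (simp add: case_prod_unfold)
  then show "mean_dens J' lv12 lz = mean_dens J lv12 lz" unfolding mean_dens_def by (simp only: dens_inj_left[OF inj_swap])
qed

lemma product_inputs_letter_law:
  fixes W :: "('x1,'x2,'y1,'y2,'z) channel"
  assumes "P \<in> product_inputs"
  obtains p1 p2 X1 X2 where "finite (set_pmf p1)" "finite (set_pmf p2)" "joint_law W P = letter_law p1 p2 X1 X2 W"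
proof -
  obtain p1 p2 X1 X2 where fin: "finite (set_pmf p1)" "finite (set_pmf p2)"
    and P: "\<And>v1 v2 x1 x2. pmf P (v1, v2, x1, x2) = (pmf p1 v1 * pmf (X1 v1) x1) * (pmf p2 v2 * pmf (X2 v2) x2)"
    using assms unfolding product_inputs_def by blast
  have "P = bind_pmf p1 (\<lambda>a. map_pmf (Pair a) (bind_pmf p2 (\<lambda>b. map_pmf (Pair b) (pair_pmf (X1 a) (X2 b)))))"
  proof (rule pmf_eqI)
    fix w show "pmf P w = pmf (bind_pmf p1 (\<lambda>a. map_pmf (Pair a) (bind_pmf p2 (\<lambda>b. map_pmf (Pair b) (pair_pmf (X1 a) (X2 b)))))) w"
      by (cases w) (simp add: P pmf_bind_Pair pmf_pair)
  qed
  then have "joint_law W P = letter_law p1 p2 X1 X2 W"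
    unfolding joint_law_def letter_law_def
    by (simp add: bind_assoc_pmf bind_map_pmf pair_pmf_def bind_return_pmf)
  with fin show ?thesis by (rule that)
qed

lemma region_quantities:
  fixes p1 p2 :: "nat pmf" and X1 :: "nat \<Rightarrow> 'x1::finite pmf" and X2 :: "nat \<Rightarrow> 'x2::finite pmf"
    and W :: "('x1,'x2,'y1::finite,'y2::finite,'z::finite) channel"
  assumes fin: "finite (set_pmf p1)" "finite (set_pmf p2)" and law: "joint_law W P = letter_law p1 p2 X1 X2 W"
  defines "J \<equiv> letter_law p1 p2 X1 X2 W"
  shows "A1 W P = mean_dens J lv1 lo2" "A2 W P = mean_dens J lv2 lo1" "B1 W P = mean_dens J lv1 lz" "B2 W P = mean_dens J lv2 lz"
    "B12 W P = mean_dens J lv12 lz"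
proof -
  have finJ: "finite (set_pmf J)" unfolding J_def by (rule finite_letter_law[OF fin])
  have lo: "(\<lambda>w. (lx2 w, (\<lambda>(v1, v2, x1, x2, y1, y2, z). y2) w)) = lo2" "(\<lambda>w. (lx1 w, (\<lambda>(v1, v2, x1, x2, y1, y2, z). y1) w)) = lo1"
    by (auto simp: fun_eq_iff)
  show "A1 W P = mean_dens J lv1 lo2"
    unfolding A1_def law J_def[symmetric] lo(1)[symmetric]
    by (rule cond_mutual_info_mean_dens[OF finJ]) (unfold J_def, rule letter_law_indep)
  show "A2 W P = mean_dens J lv2 lo1"
    unfolding A2_def law J_def[symmetric] lo(2)[symmetric]
    by (rule cond_mutual_info_mean_dens[OF finJ]) (unfold J_def, rule letter_law_indep)
  show "B1 W P = mean_dens J lv1 lz" "B2 W P = mean_dens J lv2 lz" "B12 W P = mean_dens J lv12 lz"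
    unfolding B1_def B2_def B12_def law J_def[symmetric] mutual_info_mean_dens
    by (simp_all add: mean_dens_commute[of J lz])
qed

text \<open>One of the two orientations always works. If \<open>A1\<close> exceeds \<open>B1\<close>
  and \<open>A2\<close> exceeds \<open>B2\<close>, the sum rate is below (A1 - B1) + (A2 - B2), so
  some user has a rate below its own difference; that user has rate to spare and sends the
  key.\<close>

lemma ach_interior:
  fixes W :: "('x1::finite,'x2::finite,'y1::finite,'y2::finite,'z::finite) channel"
  assumes P: "P \<in> product_inputs" and R: "0 < R1" "0 < R2" "R1 < A1 W P" "R2 < A2 W P"
  shows "R1 + R2 < A1 W P + A2 W P - B12 W P \<Longrightarrow> ach True W R1 R2"
    and "R1 < A1 W P + A2 W P - B12 W P \<Longrightarrow> R2 < A1 W P + A2 W P - B12 W P \<Longrightarrow>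
      R1 + R2 < min (A1 W P - B1 W P) (A1 W P + A2 W P - B12 W P) + min (A2 W P - B2 W P) (A1 W P + A2 W P - B12 W P) \<Longrightarrow>
      ach False W R1 R2"
proof -
  obtain p1 p2 X1 X2 where fin: "finite (set_pmf p1)" "finite (set_pmf p2)" and law: "joint_law W P = letter_law p1 p2 X1 X2 W"
    by (rule product_inputs_letter_law[OF P, of W])
  have finJ: "finite (set_pmf (letter_law p1 p2 X1 X2 W))" by (rule finite_letter_law[OF fin])
  note q = region_quantities[OF fin law]
  note leak = leak_chain[OF finJ, folded q]
  have B: "B1 W P + B2 W P \<le> B12 W P" "0 \<le> B1 W P" "0 \<le> B2 W P" using leak by linarith+
  note forward = ach_interior_public[OF fin, where ?X1.0=X1 and ?X2.0=X2 and W=W, folded q]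
    ach_interior_joint[OF fin, where ?X1.0=X1 and ?X2.0=X2 and W=W, folded q]
    ach_interior_individual[OF fin, where ?X1.0=X1 and ?X2.0=X2 and W=W, folded q]
  note backward = ach_interior_public[OF fin(2,1), where ?X1.0=X2 and ?X2.0=X1 and W="swap_channel W", unfolded mean_dens_swap, folded q]
    ach_interior_joint[OF fin(2,1), where ?X1.0=X2 and ?X2.0=X1 and W="swap_channel W", unfolded mean_dens_swap, folded q]
    ach_interior_individual[OF fin(2,1), where ?X1.0=X2 and ?X2.0=X1 and W="swap_channel W", unfolded mean_dens_swap, folded q]
  have unswap: "ach b (swap_channel W) R2 R1 \<Longrightarrow> ach b W R1 R2" for b
    using ach_swap[of b "swap_channel W" R2 R1] by (simp add: swap_channel_swap)
  show joint: "ach True W R1 R2" if S: "R1 + R2 < A1 W P + A2 W P - B12 W P"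
  proof -
    consider "A1 W P \<le> B1 W P" | "A2 W P \<le> B2 W P" | "B1 W P < A1 W P" "R2 < A2 W P - B2 W P"
      | "B2 W P < A2 W P" "R1 < A1 W P - B1 W P" using S B by linarith
    then show ?thesis
    proof cases
      case 1 then show ?thesis using forward(1) R S by blast
    next
      case 2 then show ?thesis by (intro unswap backward(1)) (use R S in linarith)+
    next
      case 3 then show ?thesis using forward(2) R S by blast
    next
      case 4 then show ?thesis by (intro unswap backward(2)) (use R S in linarith)+
    qed
  qed
  show "ach False W R1 R2" if S: "R1 < A1 W P + A2 W P - B12 W P" "R2 < A1 W P + A2 W P - B12 W P"
      "R1 + R2 < min (A1 W P - B1 W P) (A1 W P + A2 W P - B12 W P) + min (A2 W P - B2 W P) (A1 W P + A2 W P - B12 W P)"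
  proof -
    consider "A1 W P \<le> B1 W P \<or> A2 W P \<le> B2 W P" | "B1 W P < A1 W P" "B2 W P < A2 W P" "R2 < A2 W P - B2 W P"
      | "B1 W P < A1 W P" "B2 W P < A2 W P" "R1 < A1 W P - B1 W P" using S by linarith
    then show ?thesis
    proof cases
      case 1
      \<comment> \<open>One of the two minima is at most 0 and the other is at most A1 + A2 - B12,
        so the sum-rate condition of joint secrecy holds.\<close>
      then have "R1 + R2 < A1 W P + A2 W P - B12 W P" using S(3) by linarith
      then show ?thesis by (rule ach_True_False[OF joint])
    next
      case 2 then show ?thesis by (intro forward(3)) (use R S in linarith)+
    next
      case 3 then show ?thesis by (intro unswap backward(3)) (use R S in linarith)+
    qed
  qed
qed

text \<open>Rates in the region are positive, so scaling by \<open>c < 1\<close> makes every upper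
  bound strict and \<open>ach_interior\<close> applies. Closedness of the achievable set recovers
  the point itself as \<open>c\<close> tends to 1.\<close>

lemma region_subset_ach:
  fixes W :: "('x1::finite,'x2::finite,'y1::finite,'y2::finite,'z::finite) channel"
  assumes P: "P \<in> product_inputs"
  shows "region_JA_of W P \<subseteq> {(R1, R2). ach True W R1 R2}" "region_IA_of W P \<subseteq> {(R1, R2). ach False W R1 R2}"
proof -
  have scale: "x \<in> {(R1, R2). ach b W R1 R2}"
    if inner: "\<And>c. 0 < c \<Longrightarrow> c < 1 \<Longrightarrow> ach b W (c * fst x) (c * snd x)" for x b
  proof -
    define c where "c n = 1 - 1 / real (n + 2)" for n :: nat
    have c: "0 < c n" "c n < 1" for n unfolding c_def by auto
    have "(\<lambda>n. 1 / real (n + 2)) \<longlonglongrightarrow> 0"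
      using LIMSEQ_ignore_initial_segment[OF lim_1_over_n, of 2] by simp
    then have "c \<longlonglongrightarrow> 1 - 0" unfolding c_def by (intro tendsto_diff tendsto_const)
    then have lim: "(\<lambda>n. c n *\<^sub>R x) \<longlonglongrightarrow> x" using tendsto_scaleR[of c 1 sequentially "\<lambda>_. x" x] by simp
    show ?thesis
      by (rule closed_sequentially[OF ach_closed _ lim]) (use inner c in \<open>simp add: case_prod_unfold\<close>)
  qed
  have less: "c * y < z" if "0 < c" "c < 1" "0 < y" "y \<le> z" for c y z :: real
    using that by (smt (verit) mult_less_cancel_right2)
  show "region_JA_of W P \<subseteq> {(R1, R2). ach True W R1 R2}"
  proof
    fix x assume "x \<in> region_JA_of W P"
    then have x: "0 < fst x" "0 < snd x" "fst x \<le> A1 W P" "snd x \<le> A2 W P" "fst x + snd x \<le> A1 W P + A2 W P - B12 W P"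
      by (auto simp: region_JA_of_def)
    show "x \<in> {(R1, R2). ach True W R1 R2}"
    proof (rule scale)
      fix c :: real assume c: "0 < c" "c < 1"
      show "ach True W (c * fst x) (c * snd x)"
        by (rule ach_interior(1)[OF P]) (use x c less[OF c] in \<open>simp_all add: distrib_left[symmetric]\<close>)
    qed
  qed
  show "region_IA_of W P \<subseteq> {(R1, R2). ach False W R1 R2}"
  proof
    fix x assume "x \<in> region_IA_of W P"
    then have x: "0 < fst x" "0 < snd x" "fst x \<le> A1 W P" "snd x \<le> A2 W P" "fst x \<le> A1 W P + A2 W P - B12 W P"
      "snd x \<le> A1 W P + A2 W P - B12 W P"
      "fst x + snd x \<le> min (A1 W P - B1 W P) (A1 W P + A2 W P - B12 W P) + min (A2 W P - B2 W P) (A1 W P + A2 W P - B12 W P)"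
      by (auto simp: region_IA_of_def)
    show "x \<in> {(R1, R2). ach False W R1 R2}"
    proof (rule scale)
      fix c :: real assume c: "0 < c" "c < 1"
      have "c * (fst x + snd x) < min (A1 W P - B1 W P) (A1 W P + A2 W P - B12 W P) + min (A2 W P - B2 W P) (A1 W P + A2 W P - B12 W P)"
        by (rule less[OF c _ x(7)]) (use x in simp)
      then show "ach False W (c * fst x) (c * snd x)"
        by (intro ach_interior(2)[OF P]) (use x c less[OF c] in \<open>simp_all add: distrib_left[symmetric]\<close>)
    qed
  qed
qed

theorem theorem1:
  fixes W :: "('x1::finite, 'x2::finite, 'y1::finite, 'y2::finite, 'z::finite) channel"
  shows "(\<forall>(R1, R2)\<in>region_JA W. achievable_joint W R1 R2) \<and>
         (\<forall>(R1, R2)\<in>region_IA W. achievable_individual W R1 R2)"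
proof -
  have "region_JA W \<subseteq> {(R1, R2). ach True W R1 R2}" "region_IA W \<subseteq> {(R1, R2). ach False W R1 R2}"
    unfolding region_JA_def region_IA_def
    by (intro closure_minimal hull_minimal ach_convex ach_closed UN_least region_subset_ach; assumption)+
  then show ?thesis
    using ach_achievable_joint ach_achievable_individual by fast
qed

end
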